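(* For each $p\in\mathbb{N}$, $\vec r=(r_1,\dots,r_p)\in\mathbb{N}^p_{\mathrm{ord}}$, $\vec a=(a_1,\dots,a_p)\in\mathbb{R}_+^p$, $\sigma\in\{0,1\}$, $T>0$, $x_0\in\mathbb{R}$ and $\delta\in(0,1)$, there exist Schwartz class solutions $u:\mathbb{R}\times[0,T)\to\mathbb{R}$ of the Boussinesq equation $u_{tt}=u_{xx}+(u^2)_{xx}+u_{xxxx}$ on $\mathbb{R}\times[0,T)$ such that $$u(x_0,t)\asymp \frac{\mathrm{LOG}\big(\tfrac{1}{T-t};\vec r,\vec a,\sigma\big)}{(T-t)^{\delta}}\quad\text{as } t\to T,$$ and $$|u(x,t)|\le C\,\frac{1+x^2}{(x-x_0)^2},\qquad x\in\mathbb{R}\setminus\{x_0\},\ t\in[0,T),$$ for some constant $C>0$. If $\delta\in(0,\tfrac12)$, then the last bound can be replaced by $$|u(x,t)|\le C\,\frac{1+|x|}{|x-x_0|},\qquad x\in\mathbb{R}\setminus\{x_0\},\ t\in[0,T).$$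
   Context: $\mathbb{N}=\{0,1,2,\dots\}$, $\mathbb{N}_{>0}=\{1,2,\dots\}$, $\mathbb{R}_+=[0,+\infty)$, and $\mathbb{N}^p_{\mathrm{ord}}=\{(r_1,\dots,r_p)\in(\mathbb{N}_{>0})^p: r_1<r_2<\dots<r_p\}$. For $r\in\mathbb{N}_{>0}$, $\log_r$ denotes the $r$-th iterate of the logarithm ($\log_1 s=\log s$, $\log_2 s=\log\log s$, etc.). Define $\mathrm{LOG}(s;\vec r,\vec a,\sigma)=(-1)^\sigma\prod_{j=1}^p(\log_{r_j}s)^{a_j}$, with the convention $\mathrm{LOG}\equiv(-1)^\sigma$ if $p=0$. For real functions $f,g$ defined for $t<T$ close to $T$, $f(t)\asymp g(t)$ as $t\to T$ means there exist $T_0\in(0,T)$ and $c_1,c_2>0$ with $c_1 g(t)\le f(t)\le c_2 g(t)$ for all $t\in[T_0,T)$. For $T\in(0,\infty]$, $u$ is a Schwartz class solution of the Boussinesq equation on $\mathbb{R}\times[0,T)$ if $u$ is a smooth real-valued solution of $u_{tt}=u_{xx}+(u^2)_{xx}+u_{xxxx}$ on $\mathbb{R}\times[0,T)$ and for each integer $N\ge1$ and each $\tau\in[0,T)$, $\sup_{x\in\mathbb{R},t\in[0,\tau]}\sum_{i=0}^N(1+|x|)^N|\partial_x^i u(x,t)|<\infty$. *)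

theory Defs
  imports "HOL-Analysis.Analysis"
begin

text \<open>Functions of (x,t) are modelled as maps real \<times> real \<Rightarrow> real; derivatives are
  taken within the (closed-at-t=0) domain S, so smoothness up to t = 0 is expressed.\<close>

definition pdx :: "(real \<times> real) set \<Rightarrow> (real \<times> real \<Rightarrow> real) \<Rightarrow> real \<times> real \<Rightarrow> real" where
  "pdx S g = (\<lambda>z. frechet_derivative g (at z within S) (1, 0))"

definition pdt :: "(real \<times> real) set \<Rightarrow> (real \<times> real \<Rightarrow> real) \<Rightarrow> real \<times> real \<Rightarrow> real" where
  "pdt S g = (\<lambda>z. frechet_derivative g (at z within S) (0, 1))"

definition smooth_on :: "(real \<times> real) set \<Rightarrow> (real \<times> real \<Rightarrow> real) \<Rightarrow> bool" where
  "smooth_on S f \<longleftrightarrow> (\<exists>F. f \<in> F \<and> (\<forall>g\<in>F. continuous_on S g \<and>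
      (\<exists>gx\<in>F. \<exists>gt\<in>F. \<forall>z\<in>S.
         (g has_derivative (\<lambda>(h, k). gx z * h + gt z * k)) (at z within S))))"

definition dom_T :: "real \<Rightarrow> (real \<times> real) set" where
  "dom_T T = UNIV \<times> {0..<T}"

definition schwartz_boussinesq_sol :: "real \<Rightarrow> (real \<times> real \<Rightarrow> real) \<Rightarrow> bool" where
  "schwartz_boussinesq_sol T u \<longleftrightarrow>
     smooth_on (dom_T T) u \<and>
     (\<forall>z\<in>dom_T T.
        pdt (dom_T T) (pdt (dom_T T) u) z =
          pdx (dom_T T) (pdx (dom_T T) u) z
        + pdx (dom_T T) (pdx (dom_T T) (\<lambda>w. (u w)\<^sup>2)) z
        + (pdx (dom_T T) ^^ 4) u z) \<and>
     (\<forall>N::nat. N \<ge> 1 \<longrightarrow> (\<forall>\<tau>. 0 \<le> \<tau> \<and> \<tau> < T \<longrightarrow>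
        (\<exists>B. \<forall>x t. 0 \<le> t \<and> t \<le> \<tau> \<longrightarrow>
           (\<Sum>i=0..N. (1 + \<bar>x\<bar>) ^ N * \<bar>((pdx (dom_T T) ^^ i) u) (x, t)\<bar>) \<le> B)))"

definition iter_log :: "nat \<Rightarrow> real \<Rightarrow> real" where
  "iter_log r s = (ln ^^ r) s"

definition LOG :: "real \<Rightarrow> nat \<Rightarrow> (nat \<Rightarrow> nat) \<Rightarrow> (nat \<Rightarrow> real) \<Rightarrow> nat \<Rightarrow> real" where
  "LOG s p r a \<sigma> = (-1) ^ \<sigma> * (\<Prod>j=1..p. (iter_log (r j) s) powr (a j))"

definition asymp_eq_at :: "(real \<Rightarrow> real) \<Rightarrow> (real \<Rightarrow> real) \<Rightarrow> real \<Rightarrow> bool" where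
  "asymp_eq_at f g T \<longleftrightarrow> (\<exists>T0 c1 c2. 0 < T0 \<and> T0 < T \<and> c1 > 0 \<and> c2 > 0 \<and>
      (\<forall>t. T0 \<le> t \<and> t < T \<longrightarrow> c1 * g t \<le> f t \<and> f t \<le> c2 * g t))"

end

theory Submission
  imports Defs "HOL-Complex_Analysis.Complex_Analysis"
begin

text \<open>
  After reversing time, \<open>tau = T - t\<close>, and moving \<open>x0\<close> to the origin, the solution is sought as
  \<open>v(x,tau) = \<integral> V(xi,tau) cos(xi x) dxi\<close> on \<open>0 < tau < L\<close> with \<open>L > T\<close>. For each frequency the equation is
  \<open>V'' = (xi^4 - xi^2) V - xi^2 (V * V)\<close>. High frequencies are unstable in one direction of time, so this is treated as
  a boundary value problem in \<open>tau\<close>: \<open>V = \<Phi> + \<integral> kk(xi,tau,s) (V * V)(xi,s) ds\<close> with a Green function \<open>kk\<close> and a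
  decaying linear solution \<open>\<Phi>\<close>. The low-frequency shape of \<open>\<Phi>\<close> is a superposition of Gaussians \<open>xi^2 exp(-y xi^2)\<close> with
  weight \<open>rho(y) = y^(1/2 - \<delta>) LOG(1/y)\<close>, which makes \<open>\<integral> \<Phi> dxi\<close> comparable to \<open>b(tau) = tau^(-\<delta>) LOG(1/tau)\<close>.

  A contraction in the norm \<open>|V| e^(tau|xi|) <= M b(tau)\<close> (supremum and \<open>L1\<close> in \<open>xi\<close>) produces \<open>V\<close>; the quadratic
  term is \<open>O(M^2) b\<close>, so for small \<open>M\<close> the value at the origin keeps the rate of \<open>\<Phi>\<close>. The analytic weight
  gives smoothness. Decay in \<open>x\<close> comes from finite differences of \<open>V\<close> in \<open>xi\<close>: the kernel is holomorphic on discs of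
  radius comparable to \<open>1 + |xi|\<close>, each difference gains powers of \<open>tau\<close>, and second differences (first ones, if
  \<open>\<delta> < 1/2\<close>) are bounded uniformly up to \<open>tau = 0\<close>.
\<close>

section \<open>The entire functions cosh and sinh of a square root\<close>

text \<open>The claim fixes \<open>u(x0,t)\<close> only up to constants, so the amplitude of \<Phi>
  may be taken small; this is why T is arbitrary although the fixed point is a small-data argument.
  The Duhamel integral of b^2 against a kernel of size min/max has size tau^(1-2\<beta>) and is
  absorbed by b once \<delta> < \<beta> < 1 and 2\<beta> - 1 <= \<delta>; the gap between \<beta>
  and \<delta> swallows the logarithms, which enter only through a Potter bound. The factor xi^2 in
  the Gaussians matters: the integral of xi^2 exp(-(y+tau) xi^2) is of order (y+tau)^(-3/2), so the
  weight y^(1/2-\<delta>) that produces tau^(-\<delta>) is integrable at 0 for every \<delta> < 1.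
  Differences in xi replace derivatives because they pass through the integral equation without any
  regularity of V in xi; they have a trivial a priori bound, which small M lets one iterate away.
  Since L > T, the initial time t = 0 is an interior value of tau, with two-sided derivatives. The
  weight e^(tau|xi|) survives the kernel, whose decay exp(-xi^2 |tau-s| / 2) beats
  e^(|tau-s||xi|).\<close>

declare csqrt.simps [simp del]

text \<open>\<open>cosh (sqrt v)\<close> and \<open>sinh (sqrt v) / sqrt v\<close> as power series, so that no branch of the square root enters.\<close>

definition ec :: "complex => complex" where
  "ec v = (\<Sum>n. v ^ n / fact (2 * n))"

definition es :: "complex => complex" where
  "es v = (\<Sum>n. v ^ n / fact (2 * n + 1))"

lemma ec_sums_sq: "(\<lambda>n. (x\<^sup>2) ^ n / fact (2 * n)) sums cosh x" for x :: complex
proof -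
  have m: "strict_mono (\<lambda>n::nat. 2 * n)" by (rule strict_monoI) simp
  have "(\<lambda>n. (if even (2*n) then x ^ (2*n) /\<^sub>R fact (2*n) else 0)) sums cosh x"
    using cosh_converges[of x]
    by (subst sums_mono_reindex[OF m, where f = "\<lambda>n. if even n then x ^ n /\<^sub>R fact n else 0"])
      (auto elim!: evenE)
  then show ?thesis
    by (simp add: scaleR_conv_of_real divide_inverse mult_ac flip: power_mult)
qed

lemma es_sums_sq: "(\<lambda>n. x * ((x\<^sup>2) ^ n / fact (2 * n + 1))) sums sinh x" for x :: complex
proof -
  have m: "strict_mono (\<lambda>n::nat. 2 * n + 1)" by (rule strict_monoI) simp
  have "(\<lambda>n. (if even (2*n+1) then 0 else x ^ (2*n+1) /\<^sub>R fact (2*n+1))) sums sinh x"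
    using sinh_converges[of x]
    by (subst sums_mono_reindex[OF m, where f = "\<lambda>n. if even n then 0 else x ^ n /\<^sub>R fact n"])
      (auto elim!: oddE)
  then show ?thesis
    by (simp add: scaleR_conv_of_real divide_inverse mult_ac del: fact_Suc flip: power_mult)
qed

lemma ec_sums: "(\<lambda>n. v ^ n / fact (2 * n)) sums ec v"
  using ec_sums_sq[of "csqrt v"] unfolding ec_def by (simp add: sums_iff)

lemma ec_sq: "ec (x\<^sup>2) = cosh x"
  using ec_sums_sq[of x] unfolding ec_def by (simp add: sums_iff)

lemma es_sums: "(\<lambda>n. v ^ n / fact (2 * n + 1)) sums es v"
proof (cases "v = 0")
  case True
  have "(\<lambda>n. (0::complex) ^ n / fact (2 * n + 1)) sums (\<Sum>n\<in>{0}. 0 ^ n / fact (2 * n + 1))"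
    by (rule sums_finite) auto
  then show ?thesis using True unfolding es_def by (simp add: sums_iff)
next
  case False
  then have "summable (\<lambda>n. csqrt v * (v ^ n / fact (2 * n + 1)))"
    using es_sums_sq[of "csqrt v"] by (simp add: sums_iff)
  then have "summable (\<lambda>n. v ^ n / fact (2 * n + 1))"
    using False by (subst (asm) summable_cmult_iff) auto
  then show ?thesis unfolding es_def by (simp add: sums_iff)
qed

lemma es_sq: "x * es (x\<^sup>2) = sinh x"
  using sums_mult[OF es_sums[of "x\<^sup>2"], of x] es_sums_sq[of x] by (rule sums_unique2)

lemma es_0 [simp]: "es 0 = 1"
proof -
  have "(\<lambda>n. (0::complex) ^ n / fact (2 * n + 1)) sums (\<Sum>n\<in>{0}. 0 ^ n / fact (2 * n + 1))"
    by (rule sums_finite) auto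
  then show ?thesis using es_sums[of 0] sums_unique2 by fastforce
qed

lemma entire_power_series:
  fixes a :: "nat => complex"
  assumes "\<And>w. (\<lambda>n. a n * w ^ n) sums f w"
  shows "f holomorphic_on A"
proof -
  have "f holomorphic_on ball 0 r" for r
    by (rule power_series_holomorphic[of _ _ a]) (use assms in simp)
  then have "f field_differentiable at x" for x
    using holomorphic_on_imp_differentiable_at[of f "ball 0 (norm x + 1)" x] by simp
  then show ?thesis by (simp add: holomorphic_on_def field_differentiable_at_within)
qed

lemma ec_holomorphic: "ec holomorphic_on A"
  by (rule entire_power_series[of "\<lambda>n. 1 / fact (2*n)"]) (use ec_sums in simp)

lemma es_holomorphic: "es holomorphic_on A"
  by (rule entire_power_series[of "\<lambda>n. 1 / fact (2*n+1)"]) (use es_sums in simp)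

lemma ec_of_real: "ec (of_real v) \<in> \<real>"
proof -
  have "(\<lambda>n. complex_of_real (v ^ n / fact (2 * n))) sums ec (of_real v)" using ec_sums[of "of_real v"] by simp
  moreover from this have "summable (\<lambda>n. v ^ n / fact (2 * n))"
    by (simp add: sums_iff summable_of_real_iff del: of_real_power of_real_divide)
  ultimately show ?thesis
    by (metis Reals_of_real sums_of_real_iff sums_unique suminf_of_real sums_iff)
qed

lemma es_of_real: "es (of_real v) \<in> \<real>"
proof -
  have "(\<lambda>n. complex_of_real (v ^ n / fact (2 * n + 1))) sums es (of_real v)" using es_sums[of "of_real v"] by simp
  moreover from this have "summable (\<lambda>n. v ^ n / fact (2 * n + 1))"
    by (simp add: sums_iff summable_of_real_iff del: of_real_power of_real_divide of_real_mult)
  ultimately show ?thesis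
    by (metis Reals_of_real sums_of_real_iff sums_unique suminf_of_real sums_iff)
qed

text \<open>Fundamental solutions of f'' = w f with data (1,0) and (0,1) at t = 0, namely cosh(t
  sqrt w) and sinh(t sqrt w) / sqrt w. They are entire in w; the principal root enters only
  identities and bounds, never the definition, so its branch cut does no harm.\<close>

definition CC :: "complex => real => complex" where
  "CC w t = ec (w * (of_real t)\<^sup>2)"

definition SS :: "complex => real => complex" where
  "SS w t = of_real t * es (w * (of_real t)\<^sup>2)"

lemma CC_cosh: "CC w t = cosh (csqrt w * of_real t)"
  using ec_sq[of "csqrt w * of_real t"] by (simp add: CC_def power_mult_distrib)

lemma SS_sinh: "csqrt w * SS w t = sinh (csqrt w * of_real t)"
  using es_sq[of "csqrt w * of_real t"] by (simp add: SS_def power_mult_distrib mult_ac)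

lemma SS_0 [simp]: "SS w 0 = 0" by (simp add: SS_def)
lemma CC_0 [simp]: "CC w 0 = 1" by (simp add: CC_cosh)

lemma CC_deriv: "(CC w has_vector_derivative w * SS w t) (at t within A)"
proof -
  define x where "x = csqrt w"
  have "((\<lambda>z. cosh (x * z)) has_field_derivative sinh (x * of_real t) * x) (at (of_real t))"
    by (auto intro!: derivative_eq_intros)
  then have "((\<lambda>t. cosh (x * of_real t)) has_vector_derivative (sinh (x * of_real t) * x)) (at t within A)"
    using has_vector_derivative_real_field by blast
  moreover have "CC w = (\<lambda>t. cosh (x * of_real t))" by (simp add: x_def CC_cosh fun_eq_iff)
  moreover have "sinh (x * of_real t) * x = w * SS w t"
  proof -
    have "sinh (x * of_real t) * x = x * x * SS w t" by (simp add: x_def SS_sinh[symmetric])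
    also have "x * x = w" by (simp add: x_def flip: power2_eq_square)
    finally show ?thesis .
  qed
  ultimately show ?thesis by simp
qed

lemma SS_deriv: "(SS w has_vector_derivative CC w t) (at t within A)"
proof (cases "w = 0")
  case True
  have "(of_real has_vector_derivative 1) (at t within A)" by (auto intro!: derivative_eq_intros has_vector_derivative_of_real)
  moreover have "SS 0 = of_real" by (simp add: SS_def fun_eq_iff)
  ultimately show ?thesis using True by (simp add: CC_cosh)
next
  case False
  define x where "x = csqrt w"
  have x: "x \<noteq> 0" using False by (simp add: x_def)
  have "((\<lambda>z. sinh (x * z) / x) has_field_derivative cosh (x * of_real t)) (at (of_real t))"
    using x by (auto intro!: derivative_eq_intros)
  then have "((\<lambda>t. sinh (x * of_real t) / x) has_vector_derivative cosh (x * of_real t)) (at t within A)"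
    using has_vector_derivative_real_field by blast
  moreover have "SS w = (\<lambda>t. sinh (x * of_real t) / x)"
    using x by (auto simp: fun_eq_iff x_def SS_sinh[symmetric])
  moreover have "cosh (x * of_real t) = CC w t" by (simp add: CC_cosh x_def)
  ultimately show ?thesis by simp
qed

lemma CC_add: "CC w (s + t) = CC w s * CC w t + w * SS w s * SS w t"
proof -
  have "csqrt w * SS w s * (csqrt w * SS w t) = w * SS w s * SS w t"
    by (metis (no_types, opaque_lifting) ab_semigroup_mult_class.mult_ac(1) mult.left_commute power2_csqrt power2_eq_square)
  then show ?thesis unfolding SS_sinh by (simp add: CC_cosh distrib_left cosh_add)
qed

lemma CC_uminus: "CC w (- t) = CC w t" by (simp add: CC_def)
lemma SS_uminus: "SS w (- t) = - SS w t" by (simp add: SS_def)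

lemma norm_cosh_le: "norm (cosh z) <= exp \<bar>Re z\<bar>" for z :: complex
proof -
  have "norm (cosh z) <= (norm (exp z) + norm (exp (-z))) / 2"
    unfolding cosh_field_def using norm_triangle_ineq[of "exp z" "exp (-z)"] by simp
  also have "\<dots> <= exp \<bar>Re z\<bar>"
  proof -
    have "exp (Re z) <= exp \<bar>Re z\<bar>" "exp (- Re z) <= exp \<bar>Re z\<bar>" unfolding exp_le_cancel_iff by auto
    then show ?thesis unfolding norm_exp_eq_Re uminus_complex.sel by argo
  qed
  finally show ?thesis .
qed

lemma norm_sinh_le: "norm (sinh z) <= exp \<bar>Re z\<bar>" for z :: complex
proof -
  have "norm (sinh z) <= (norm (exp z) + norm (exp (-z))) / 2"
    unfolding sinh_field_def using norm_triangle_ineq4[of "exp z" "exp (-z)"] by simp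
  also have "\<dots> <= exp \<bar>Re z\<bar>"
  proof -
    have "exp (Re z) <= exp \<bar>Re z\<bar>" "exp (- Re z) <= exp \<bar>Re z\<bar>" unfolding exp_le_cancel_iff by auto
    then show ?thesis unfolding norm_exp_eq_Re uminus_complex.sel by argo
  qed
  finally show ?thesis .
qed

lemma Re_csqrt_nonneg: "0 <= Re (csqrt w)"
  using csqrt_principal[of w] by linarith

lemma norm_CC_le: "0 <= t ==> norm (CC w t) <= exp (Re (csqrt w) * t)"
  using norm_cosh_le[of "csqrt w * of_real t"] Re_csqrt_nonneg[of w]
  by (simp add: CC_cosh abs_mult)

lemma norm_SS_le1: "0 <= t ==> norm (csqrt w) * norm (SS w t) <= exp (Re (csqrt w) * t)"
  using norm_sinh_le[of "csqrt w * of_real t"] Re_csqrt_nonneg[of w]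
  unfolding norm_mult[symmetric] SS_sinh by (simp add: abs_mult)

text \<open>Mean value inequality from \<open>SS w 0 = 0\<close> with derivative
  \<open>CC w\<close>. Unlike the preceding bound it survives w = 0, and it supplies the vanishing
  at time 0 that makes the kernel small there.\<close>

lemma norm_SS_le2:
  assumes "0 <= t" shows "norm (SS w t) <= t * exp (Re (csqrt w) * t)"
proof -
  have "norm (SS w t - SS w 0) <= exp (Re (csqrt w) * t) * norm (t - 0)"
  proof (rule differentiable_bound[where S = "{0..t}" and f' = "\<lambda>s h. h *\<^sub>R CC w s"])
    fix s assume s: "s \<in> {0..t}"
    show "(SS w has_derivative (\<lambda>h. h *\<^sub>R CC w s)) (at s within {0..t})"
      using SS_deriv unfolding has_vector_derivative_def .
    have "norm (CC w s) <= exp (Re (csqrt w) * t)"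
      using norm_CC_le[of s w] s Re_csqrt_nonneg[of w]
      by (meson atLeastAtMost_iff exp_le_cancel_iff mult_left_mono order_trans)
    then show "onorm (\<lambda>h. h *\<^sub>R CC w s) <= exp (Re (csqrt w) * t)"
      by (intro onorm_bound) (auto simp: mult.commute[of "exp _"] intro!: mult_left_mono)
  qed (use assms in auto)
  then show ?thesis using assms by (simp add: mult.commute)
qed

section \<open>The symbol of the linear equation on complex discs\<close>

definition wz :: "complex => complex" where
  "wz z = z ^ 4 - z ^ 2"

text \<open>Scaling z = xi (1 + u) turns a disc of radius proportional to |xi| into a fixed small
  disc in u, so that the large-frequency estimates become numerical ones.\<close>

lemma one_plus_small:
  fixes u :: complex
  assumes "norm u <= 1/20"
  shows "norm ((1 + u)^4 - 1) <= 1/4" "norm ((1+u)^2) <= 9/8" "Re ((1+u)^2) >= 1/2"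
proof -
  have e: "(1 + u)^4 - 1 = u * (4 + 6 * u + 4 * u^2 + u^3)" by (simp add: power4_eq_xxxx power3_eq_cube power2_eq_square algebra_simps)
  have n2: "norm u ^ 2 <= (1/20)^2" "norm u ^ 3 <= (1/20)^3"
    by (intro power_mono assms norm_ge_zero)+
  have "norm (4 + 6 * u + 4 * u^2 + u^3) <= norm (4 + 6 * u + 4 * u^2) + norm (u^3)" by (rule norm_triangle_ineq)
  also have "norm (4 + 6 * u + 4 * u^2) <= norm (4 + 6*u) + norm (4 * u^2)" by (rule norm_triangle_ineq)
  also have "norm (4 + 6*u) <= norm (4::complex) + norm (6*u)" by (rule norm_triangle_ineq)
  finally have "norm (4 + 6 * u + 4 * u^2 + u^3) <= 5"
    using n2 assms by (simp add: norm_mult norm_power power_divide)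
  then have "norm u * norm (4 + 6 * u + 4 * u^2 + u^3) <= 1/20 * 5"
    by (intro mult_mono assms) auto
  then show "norm ((1 + u)^4 - 1) <= 1/4" unfolding e norm_mult by simp
  have e2: "(1+u)^2 - 1 = u * (2 + u)" by (simp add: power2_eq_square algebra_simps)
  have "norm (2 + u) <= 2 + norm u" using norm_triangle_ineq[of 2 u] by simp
  then have "norm u * norm (2 + u) <= 1/20 * (2+1/20)" using assms by (intro mult_mono) auto
  then have d: "norm ((1+u)^2 - 1) <= 1/8" unfolding e2 norm_mult by simp
  have "norm ((1+u)^2) <= norm ((1+u)^2 - 1) + norm (1::complex)" using norm_triangle_ineq[of "(1+u)^2 - 1" 1] by simp
  then show "norm ((1+u)^2) <= 9/8" using d by simp
  have "\<bar>Re ((1+u)^2 - 1)\<bar> <= 1/8" using abs_Re_le_cmod d order_trans by blast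
  then show "Re ((1+u)^2) >= 1/2" unfolding minus_complex.sel one_complex.sel by linarith
qed

text \<open>For |xi| >= 4 the quartic term dominates: \<open>wz z\<close> stays within xi^4/2 of
  xi^4, so its real part is at least xi^4/2. As Re(a^2) = (Re a)^2 - (Im a)^2, the principal root
  has real part at least xi^2/2.\<close>

lemma disc_large:
  fixes xi :: real and z :: complex
  assumes z: "norm (z - of_real xi) <= 1/40 * (1 + \<bar>xi\<bar>)" and hxi: "\<bar>xi\<bar> >= 4"
  shows "Re (csqrt (wz z)) >= xi^2 / 2" "norm z ^ 2 <= 9/8 * xi^2" "Re (z^2) >= xi^2 / 2"
    "norm (csqrt (wz z)) >= xi^2 / 2"
proof -
  define u where "u = (z - of_real xi) / of_real xi"
  have x0: "xi \<noteq> 0" using hxi by auto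
  have zu: "z = of_real xi * (1 + u)" using x0 by (simp add: u_def field_simps)
  have "norm (z - of_real xi) <= 1/20 * \<bar>xi\<bar>" using z hxi by argo
  then have u: "norm u <= 1/20" using x0 by (simp add: u_def norm_divide field_simps)
  note o = one_plus_small[OF u]
  have z2: "z^2 = of_real (xi^2) * (1+u)^2" by (simp add: zu power_mult_distrib)
  have "norm (z^2) = xi^2 * norm ((1+u)^2)" unfolding z2 norm_mult by (simp add: norm_power)
  also have "\<dots> <= xi^2 * (9/8)" by (intro mult_left_mono o) auto
  finally show n2: "norm z ^ 2 <= 9/8 * xi^2" by (simp add: norm_power)
  have "Re (z^2) = xi^2 * Re ((1+u)^2)" unfolding z2 by simp
  also have "\<dots> >= xi^2 * (1/2)" by (intro mult_left_mono o) auto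
  finally show "Re (z^2) >= xi^2 / 2" by simp
  have x2: "xi^2 >= 16" using power_mono[OF hxi, of 2] by simp
  have z4: "z^4 = of_real (xi^4) * (1+u)^4" by (simp add: zu power_mult_distrib del: distrib_left_numeral)
  have "wz z - of_real (xi^4) = of_real (xi^4) * ((1+u)^4 - 1) - z^2"
    unfolding wz_def z4 by (simp add: right_diff_distrib)
  then have "norm (wz z - of_real (xi^4)) <= norm (of_real (xi^4) * ((1+u)^4 - 1)) + norm (z^2)"
    by (metis norm_triangle_ineq4)
  also have "\<dots> <= xi^4 * (1/4) + 9/8 * xi^2"
  proof (intro add_mono)
    show "norm (of_real (xi^4) * ((1+u)^4 - 1)) <= xi^4 * (1/4)"
      unfolding norm_mult using mult_left_mono[OF o(1), of "xi^4"] by (simp add: norm_power)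
    show "norm (z^2) <= 9/8 * xi^2" using n2 by (simp add: norm_power)
  qed
  also have "9/8 * xi^2 <= xi^4 * (1/4)"
  proof -
    have "xi^4 = xi^2 * xi^2" by (simp add: power4_eq_xxxx power2_eq_square)
    moreover have "xi^2 * xi^2 >= 16 * xi^2" using x2 by (intro mult_right_mono) auto
    ultimately show ?thesis using zero_le_power2[of xi] by linarith
  qed
  finally have d: "norm (wz z - of_real (xi^4)) <= xi^4 / 2" by simp
  have "\<bar>Re (wz z - of_real (xi^4))\<bar> <= xi^4/2" using abs_Re_le_cmod d order_trans by blast
  then have rw: "Re (wz z) >= xi^4/2" unfolding minus_complex.sel Re_complex_of_real abs_le_iff by argo
  define a where "a = csqrt (wz z)"
  have "a^2 = wz z" by (simp add: a_def)
  then have "Re (wz z) = (Re a)^2 - (Im a)^2" by (metis Re_power2)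
  then have "(Re a)^2 >= xi^4/2" using rw zero_le_power2[of "Im a"] by linarith
  moreover have "(xi^2/2)^2 <= xi^4/2" by (simp add: power_divide flip: power_mult)
  ultimately have "(xi^2/2)^2 <= (Re a)^2" by linarith
  then show g: "Re (csqrt (wz z)) >= xi^2 / 2"
    using Re_csqrt_nonneg power2_le_imp_le unfolding a_def by blast
  then show "norm (csqrt (wz z)) >= xi^2 / 2" using complex_Re_le_cmod order_trans by blast
qed

lemma disc_small:
  fixes xi :: real and z :: complex
  assumes z: "norm (z - of_real xi) <= 1/40 * (1 + \<bar>xi\<bar>)" and hxi: "\<bar>xi\<bar> <= R" and R: "R >= 1"
  shows "norm z <= 2 * R"
  using z hxi R norm_triangle_ineq[of "z - of_real xi" "of_real xi"] by simp

text \<open>The additive losses pay for |xi| < 4: there |z| <= 8, so Re(z^2) >= -64, while xi^2/2 <=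
  8; hence 8 and 72 = 64 + 8. Over a bounded time they cost only constant factors.\<close>

lemma disc_bounds:
  fixes xi :: real and z :: complex
  assumes z: "norm (z - of_real xi) <= 1/40 * (1 + \<bar>xi\<bar>)"
  shows "Re (csqrt (wz z)) >= xi^2 / 2 - 8" "norm z ^ 2 <= 64 * (1 + xi^2)" "Re (z^2) >= xi^2 / 2 - 72"
proof -
  have "Re (csqrt (wz z)) >= xi^2 / 2 - 8 \<and> norm z ^ 2 <= 64 * (1 + xi^2) \<and> Re (z^2) >= xi^2 / 2 - 72"
  proof (cases "\<bar>xi\<bar> >= 4")
    case True
    show ?thesis using disc_large[OF z True] zero_le_power2[of xi] by argo
  next
    case False
    then have n: "norm z <= 8" using disc_small[OF z, of 4] by simp
    have n2: "norm z ^ 2 <= 8 ^ 2" using n by (intro power_mono) auto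
    have x2: "xi^2 <= 16" using False power_mono[of "\<bar>xi\<bar>" 4 2] by simp
    have "\<bar>Re (z^2)\<bar> <= norm z ^ 2" using abs_Re_le_cmod[of "z^2"] by (simp add: norm_power)
    moreover have "8 ^ 2 = (64::real)" by simp
    ultimately show ?thesis using n2 x2 Re_csqrt_nonneg[of "wz z"] zero_le_power2[of xi] unfolding abs_le_iff by argo
  qed
  then show "Re (csqrt (wz z)) >= xi^2 / 2 - 8" "norm z ^ 2 <= 64 * (1 + xi^2)" "Re (z^2) >= xi^2 / 2 - 72" by auto
qed

section \<open>Finite differences and the Green function\<close>

definition fd :: "'a => ('a::ab_group_add => 'b::ab_group_add) => 'a => 'b" where
  "fd h f = (\<lambda>x. f (x + h) - f x)"

text \<open>Cauchy's estimate on discs of radius up to R/4 bounds f' by 4G/R on the ball of radius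
  3R/4, which contains the segment from z to z + h.\<close>

lemma fd_holomorphic_bound:
  fixes f :: "complex => complex" and h R G :: real
  assumes f: "f holomorphic_on ball z0 R" and G: "\<And>z. z \<in> ball z0 R ==> norm (f z) <= G"
    and h: "0 <= h" "h <= R / 4" and R: "R > 0" and z: "z \<in> ball z0 (R/2)"
  shows "norm (fd (of_real h) f z) <= 4 * h / R * G"
proof -
  define B where "B = ball z0 (3*R/4)"
  have zB: "z \<in> B" using z R by (simp add: B_def)
  have zhB: "z + of_real h \<in> B"
  proof -
    have "dist z0 (z + of_real h) <= dist z0 z + dist z (z + of_real h)" by (rule dist_triangle)
    also have "dist z (z + of_real h) = h" using h by (simp add: dist_norm)
    finally show ?thesis using z h R by (simp add: B_def)
  qed
  have sub: "cball w (R/5) \<subseteq> ball z0 R" if w: "w \<in> B" for w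
  proof
    fix x assume "x \<in> cball w (R/5)"
    then show "x \<in> ball z0 R" using w dist_triangle[of z0 x w] R by (simp add: B_def)
  qed
  have sub4: "ball w (R/4) \<subseteq> ball z0 R" if w: "w \<in> B" for w
  proof
    fix x assume "x \<in> ball w (R/4)"
    then show "x \<in> ball z0 R" using w dist_triangle[of z0 x w] R by (simp add: B_def)
  qed
  have d: "norm (deriv f w) <= G / (R/4)" if w: "w \<in> B" for w
  proof -
    have bd: "norm (deriv f w) <= G / \<rho>" if r: "0 < \<rho>" "\<rho> < R/4" for \<rho>
    proof -
      have c: "cball w \<rho> \<subseteq> ball w (R/4)" using r by auto
      have "norm ((deriv ^^ 1) f w) <= fact 1 * G / \<rho> ^ 1"
      proof (rule Cauchy_inequality)
        show "f holomorphic_on ball w \<rho>"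
          using f sub4[OF w] c by (meson ball_subset_cball holomorphic_on_subset subset_trans)
        show "continuous_on (cball w \<rho>) f"
          using f sub4[OF w] c by (meson holomorphic_on_imp_continuous_on holomorphic_on_subset subset_trans)
        show "0 < \<rho>" by fact
        fix x assume "norm (w - x) = \<rho>"
        then have "x \<in> cball w \<rho>" by (simp add: dist_norm)
        then show "norm (f x) <= G" using G sub4[OF w] c by blast
      qed
      then show ?thesis by simp
    qed
    have "((\<lambda>\<rho>. G / \<rho>) \<longlongrightarrow> G / (R/4)) (at_left (R/4))"
      using R by (intro tendsto_intros) auto
    moreover have "eventually (\<lambda>\<rho>. norm (deriv f w) <= G / \<rho>) (at_left (R/4))"
    proof -
      have "eventually (\<lambda>\<rho>. \<rho> \<in> {0<..<R/4}) (at_left (R/4))"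
        using R by (intro eventually_at_leftI[of 0]) auto
      then show ?thesis by eventually_elim (use bd in auto)
    qed
    ultimately show ?thesis by (intro tendsto_lowerbound[of _ _ "at_left (R/4)"]) auto
  qed
  have "norm (f (z + of_real h) - f z) <= (G / (R/4)) * norm (z + of_real h - z)"
  proof (rule field_differentiable_bound[of B f "deriv f"])
    show "convex B" by (simp add: B_def)
    fix w assume w: "w \<in> B"
    have "f holomorphic_on ball z0 R" by fact
    moreover have "w \<in> ball z0 R" using w R by (simp add: B_def)
    ultimately show "(f has_field_derivative deriv f w) (at w within B)"
      by (meson has_field_derivative_at_within holomorphic_derivI open_ball)
    show "norm (deriv f w) <= G / (R/4)" using d w by blast
  qed (use zB zhB in auto)
  then show ?thesis using h by (simp add: fd_def mult_ac)
qed

text \<open>Each difference gains h/R and halves the disc, which is why h <= R/8^n is required. C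
  depends on n alone; this uniformity in f, R and G is what the kernel estimates use.\<close>

lemma fd_iter_holomorphic_bound:
  "\<exists>C>0. \<forall>f z0 R G h. f holomorphic_on ball z0 R --> (\<forall>z\<in>ball z0 R. norm (f z) <= G) -->
     0 <= h --> R > 0 --> h <= R / 8 ^ n -->
     norm (((fd (of_real h)) ^^ n) f (z0::complex)) <= C * (h / R) ^ n * (G::real)"
proof (induction n)
  case 0
  show ?case by (intro exI[of _ 1]) auto
next
  case (Suc n)
  then obtain C where C: "C > 0" and IH: "\<And>f z0 R G h. f holomorphic_on ball z0 R ==> (\<And>z. z\<in>ball z0 R ==> norm (f z) <= G) ==>
     0 <= h ==> R > 0 ==> h <= R / 8 ^ n ==>
     norm (((fd (of_real h)) ^^ n) f (z0::complex)) <= C * (h / R) ^ n * (G::real)" by meson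
  show ?case
  \<comment> \<open>4 comes from the single difference; 2^n from applying the induction hypothesis
    on the half disc, where h/R doubles.\<close>
  proof (intro exI[of _ "C * 2 ^ n * 4"] conjI allI impI)
    show "C * 2 ^ n * 4 > 0" using C by simp
    fix f and z0 :: complex and R G h :: real
    assume f: "f holomorphic_on ball z0 R" and G: "\<forall>z\<in>ball z0 R. norm (f z) <= G"
      and h: "0 <= h" and R: "R > 0" and hR: "h <= R / 8 ^ Suc n"
    have hR2: "h <= R / 2 / 8 ^ n"
      using hR R by (simp add: field_simps)
    also have "\<dots> <= R / 2 / 1" using R by (intro divide_left_mono) auto
    finally have hR4: "h <= R / 4" using hR R
    proof -
      have "R / 8 ^ Suc n <= R / 8 ^ 1" using R by (intro divide_left_mono power_increasing) auto
      then show ?thesis using hR R by simp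
    qed
    define g where "g = fd (of_real h) f"
    have "norm (((fd (of_real h)) ^^ n) g z0) <= C * (h / (R/2)) ^ n * (4 * h / R * G)"
    proof (rule IH)
      show "g holomorphic_on ball z0 (R/2)"
        unfolding g_def fd_def
      proof (intro holomorphic_intros)
        show "f holomorphic_on ball z0 (R/2)" using f R by (auto intro: holomorphic_on_subset)
        have "(f \<circ> (\<lambda>z. z + of_real h)) holomorphic_on ball z0 (R/2)"
        proof (rule holomorphic_on_compose_gen[OF _ f])
          show "(\<lambda>z. z + of_real h) holomorphic_on ball z0 (R/2)" by (intro holomorphic_intros)
          show "(\<lambda>z. z + of_real h) ` ball z0 (R/2) \<subseteq> ball z0 R"
          proof clarify
            fix z assume z: "z \<in> ball z0 (R/2)"
            have "dist z0 (z + of_real h) <= dist z0 z + dist z (z + of_real h)" by (rule dist_triangle)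
            also have "dist z (z + of_real h) = h" using h by (simp add: dist_norm)
            finally show "z + of_real h \<in> ball z0 R" using z hR4 R by simp
          qed
        qed
        then show "(\<lambda>z. f (z + of_real h)) holomorphic_on ball z0 (R/2)" by (simp add: o_def)
      qed
      show "norm (g z) <= 4 * h / R * G" if "z \<in> ball z0 (R/2)" for z
        unfolding g_def by (rule fd_holomorphic_bound[OF f]) (use G h hR4 R that in auto)
    qed (use h R hR2 in auto)
    moreover have "((fd (of_real h)) ^^ Suc n) f = ((fd (of_real h)) ^^ n) g"
      by (simp add: g_def funpow_Suc_right del: funpow.simps)
    moreover have "C * (h / (R/2)) ^ n * (4 * h / R * G) = C * 2 ^ n * 4 * (h / R) ^ Suc n * G"
    proof -
      have "h / (R/2) = 2 * (h / R)" by simp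
      then show ?thesis by (simp only: power_mult_distrib power_Suc) simp
    qed
    ultimately show "norm (((fd (of_real h)) ^^ Suc n) f z0) <= C * 2 ^ n * 4 * (h / R) ^ Suc n * G"
      by metis
  qed
qed

lemma fd_iter_Re:
  "(fd h ^^ n) (\<lambda>x. Re (f (of_real x))) x = Re (((fd (of_real h)) ^^ n) f (of_real x))"
proof (induction n arbitrary: f)
  case (Suc n)
  have "fd h (\<lambda>x. Re (f (of_real x))) = (\<lambda>x. Re (fd (of_real h) f (of_real x)))"
    by (simp add: fd_def)
  then show ?case using Suc[of "fd (of_real h) f"] by (simp add: funpow_Suc_right del: funpow.simps)
qed simp

lemma cosh_i_real: "cosh (\<i> * complex_of_real x) = of_real (cos x)"
  by (simp add: cosh_field_def cos_exp_eq flip: cos_of_real)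

lemma cosh_of_real_complex: "cosh (complex_of_real x) = of_real (cosh x)"
  by (simp add: cosh_field_def flip: exp_of_real)

text \<open>On real w the function is a cosh or a cosine, hence real and at least -1; adding 2 then
  keeps the denominator \<open>DD\<close> away from zero on the real axis.\<close>

lemma CC_real_ge: "CC (of_real w) t \<in> \<real>" "Re (CC (of_real w) t) >= -1"
proof -
  show "CC (of_real w) t \<in> \<real>"
    unfolding CC_def using ec_of_real[of "w * t^2"] by simp
  show "Re (CC (of_real w) t) >= -1"
  proof (cases "w >= 0")
    case True
    then have "CC (of_real w) t = of_real (cosh (sqrt w * t))"
      by (simp add: CC_cosh csqrt_of_real_nonneg cosh_of_real_complex flip: of_real_mult)
    then show ?thesis using cosh_real_ge_1[of "sqrt w * t"] by simp
  next
    case False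
    then have "CC (of_real w) t = cosh (\<i> * of_real (sqrt (- w) * t))"
      by (simp add: CC_cosh csqrt_of_real_nonpos mult.assoc)
    then have "CC (of_real w) t = of_real (cos (sqrt (- w) * t))" unfolding cosh_i_real .
    then show ?thesis by simp
  qed
qed

lemma SS_real: "SS (of_real w) t \<in> \<real>"
  unfolding SS_def using es_of_real[of "w * t^2"] by simp

lemma wz_of_real: "wz (of_real x) = of_real (x^4 - x^2)" by (simp add: wz_def)

section \<open>The linear problem on a finite time interval\<close>

locale time_interval =
  fixes L :: real
  assumes L: "L > 0"
begin

text \<open>The naive choice \<open>sinh (q (L - t)) / sinh (q L)\<close>, with \<open>q\<close> the root of the symbol, fails for \<open>\<bar>xi\<bar> < 1\<close>, where
  \<open>q\<close> is imaginary and the denominator may vanish; \<open>DD\<close> is at least 1 on the real line.\<close>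

definition DD :: "complex => complex" where
  "DD z = CC (wz z) (2 * L) + 2"

text \<open>Solution of f'' = wz z f with value 1 at t = 0. Reflecting at 2 * L rather than L keeps
  the growing part \<open>2 * CC (wz z) t\<close> below the size of the decaying part as long as t
  <= L, so the whole decays like exp(-Re q t) there, q being the root of the symbol.\<close>

definition EE :: "complex => real => complex" where
  "EE z t = (CC (wz z) (2 * L - t) + 2 * CC (wz z) t) / DD z"

lemma DD_real: "DD (of_real x) \<in> \<real>" "Re (DD (of_real x)) >= 1"
  unfolding DD_def wz_of_real using CC_real_ge[of "x^4 - x^2" "2*L"] by auto

lemma EE_real: "EE (of_real x) t \<in> \<real>"
  unfolding EE_def using DD_real[of x] CC_real_ge[of "x^4 - x^2"] by (auto simp: wz_of_real)

lemma DD_holomorphic: "DD holomorphic_on A"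
proof -
  have "(ec \<circ> (\<lambda>z. (z^4 - z^2) * (of_real (2*L))\<^sup>2)) holomorphic_on A"
    by (intro holomorphic_on_compose holomorphic_intros ec_holomorphic)
  then have "(\<lambda>z. (ec \<circ> (\<lambda>z. (z^4 - z^2) * (of_real (2*L))\<^sup>2)) z + 2) holomorphic_on A"
    by (intro holomorphic_intros)
  then show ?thesis by (simp add: DD_def[abs_def] CC_def wz_def o_def)
qed

text \<open>If the exponent is large, the growing exponential in cosh dominates everything else.
  Otherwise xi is bounded, and uniform continuity on a compact disc transports the bound
  \<open>DD >= 1\<close> from the real axis to a thin neighbourhood.\<close>

lemma DD_lower:
  "\<exists>r c. 0 < r \<and> r <= 1/40 \<and> 0 < c \<and> (\<forall>xi z. norm (z - of_real xi) <= r * (1 + \<bar>xi\<bar>) -->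
     c * exp (2 * L * Re (csqrt (wz z))) <= norm (DD z))"
proof -
  \<comment> \<open>Beyond R1 one has xi^2 >= 256/L, so 2 L a >= 256 and the exponential exceeds 16;
    the compactness case thus has |xi| <= R1.\<close>
  define R1 where "R1 = 16 + 16 / L"
  have R1: "R1 >= 1" "R1 > 0" using L by (auto simp: R1_def add_pos_pos)
  have "uniformly_continuous_on (cball 0 (2 * R1)) DD"
    by (intro compact_uniformly_continuous holomorphic_on_imp_continuous_on DD_holomorphic) auto
  then obtain d where d: "d > 0" "\<And>x y. x \<in> cball 0 (2*R1) ==> y \<in> cball 0 (2*R1) ==> dist y x < d ==> dist (DD y) (DD x) < 1/2"
    unfolding uniformly_continuous_on_def by (meson half_gt_zero zero_less_one)
  define r where "r = min (1/40) (d / (2 * (1 + R1)))"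
  have r: "0 < r" "r <= 1/40" unfolding r_def using d R1 by simp (rule min.cobounded1)
  \<comment> \<open>In the bounded case exp(2 L a) < 16 and |DD z| >= 1/2 = 16/32; in the other case
    |DD z| >= (exp(2 L a) - 5)/2 is ample.\<close>
  define c :: real where "c = 1/32"
  have "c * exp (2 * L * Re (csqrt (wz z))) <= norm (DD z)"
    if z: "norm (z - of_real xi) <= r * (1 + \<bar>xi\<bar>)" for xi z
  proof -
    define a where "a = Re (csqrt (wz z))"
    have z40: "norm (z - of_real xi) <= 1/40 * (1 + \<bar>xi\<bar>)"
      using z r by (meson abs_ge_zero add_nonneg_nonneg mult_right_mono order_trans zero_le_one)
    have a0: "a >= 0" by (simp add: a_def Re_csqrt_nonneg)
    show ?thesis
    proof (cases "exp (2 * L * a) >= 16")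
      case True
      have e: "exp (- (2*L*a)) <= 1" using a0 L by simp
      have cs: "norm (exp x - exp (- x)) <= norm (exp x + exp (-x)) + 2 * norm (exp (-x))" for x :: complex
        using norm_triangle_ineq4[of "exp x + exp (-x)" "2 * exp (-x)"] by (simp add: norm_mult)
      define x where "x = csqrt (wz z) * of_real (2*L)"
      have rx: "Re x = 2 * L * a" by (simp add: x_def a_def)
      have "norm (exp x) <= norm (exp x + exp (-x)) + norm (exp (-x))"
        using norm_triangle_ineq4[of "exp x + exp (-x)" "exp (-x)"] by simp
      then have "exp (2*L*a) <= norm (exp x + exp (-x)) + exp (- (2*L*a))"
        unfolding norm_exp_eq_Re uminus_complex.sel rx .
      moreover have "norm (exp x + exp (-x)) = 2 * norm (cosh x)"
        unfolding cosh_field_def by (simp add: norm_divide)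
      ultimately have "exp (2*L*a) <= 2 * norm (cosh x) + 1"
        using e by linarith
      moreover have "norm (cosh x) <= norm (DD z) + 2"
        using norm_triangle_ineq4[of "cosh x + 2" 2] unfolding DD_def CC_cosh x_def by simp
      ultimately have "exp (2*L*a) <= 2 * norm (DD z) + 5" by linarith
      then show ?thesis using True unfolding c_def a_def by linarith
    next
      case False
      have xs: "\<bar>xi\<bar> <= R1"
      proof (rule ccontr)
        assume "\<not> \<bar>xi\<bar> <= R1"
        then have big: "\<bar>xi\<bar> > 16 + 16/L" by (simp add: R1_def)
        have "16 / L > 0" using L by simp
        then have b1: "\<bar>xi\<bar> > 16" "\<bar>xi\<bar> > 16 / L" using big by linarith+
        have "xi^2 = \<bar>xi\<bar> * \<bar>xi\<bar>" by (simp add: power2_eq_square)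
        also have "\<dots> >= 16 * (16/L)" using b1 L by (intro mult_mono) auto
        finally have "xi^2 >= 256 / L" by simp
        moreover have "a >= xi^2/2" unfolding a_def using disc_large(1)[OF z40] b1 by simp
        ultimately have "a >= 128 / L" by simp
        then have "2 * L * a >= 256" using L by (simp add: field_simps)
        then have "exp (2*L*a) >= 1 + 256" using exp_ge_add_one_self[of "2*L*a"] by linarith
        then show False using False by simp
      qed
      have "dist (DD z) (DD (of_real xi)) < 1/2"
      proof (rule d(2))
        show "of_real xi \<in> cball (0::complex) (2*R1)" using xs R1 by simp
        show "z \<in> cball 0 (2*R1)" using disc_small[OF z40 xs R1(1)] by simp
        have "r * (1 + \<bar>xi\<bar>) <= d / (2 * (1 + R1)) * (1 + R1)"
          using xs r d R1 by (intro mult_mono) (auto simp: r_def)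
        also have "\<dots> = d / 2" using R1 by (simp add: field_simps)
        finally show "dist z (of_real xi) < d" using z d by (simp add: dist_norm)
      qed
      moreover have "norm (DD (of_real xi)) >= 1" using DD_real[of xi] complex_Re_le_cmod order_trans by blast
      moreover have "norm (DD (of_real xi)) <= norm (DD z) + dist (DD z) (DD (of_real xi))"
        by (metis add.commute dist_commute dist_norm norm_triangle_sub)
      ultimately have "norm (DD z) >= 1/2" by linarith
      then show ?thesis using False unfolding c_def a_def by simp
    qed
  qed
  then show ?thesis using r by (intro exI[of _ r] exI[of _ c]) (auto simp: c_def)
qed

text \<open>For t <= L the numerator is at most 3 exp(a (2L - t)), and \<open>DD_lower\<close>
  divides by exp(2 L a) up to a constant.\<close>

lemma EE_disc:
  "\<exists>r C. 0 < r \<and> r <= 1/40 \<and> 0 < C \<and> (\<forall>xi z. norm (z - of_real xi) <= r * (1 + \<bar>xi\<bar>) -->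
     DD z \<noteq> 0 \<and> (\<forall>t. 0 <= t \<and> t <= L --> norm (EE z t) <= C * exp (- Re (csqrt (wz z)) * t)))"
proof -
  obtain r c where rc: "0 < r" "r <= 1/40" "0 < c"
    and low0: "\<forall>xi z. norm (z - of_real xi) <= r * (1 + \<bar>xi\<bar>) -->
     c * exp (2 * L * Re (csqrt (wz z))) <= norm (DD z)" using DD_lower by - (elim exE conjE, rule that)
  note low = low0[rule_format]
  have "DD z \<noteq> 0 \<and> (\<forall>t. 0 <= t \<and> t <= L --> norm (EE z t) <= (3 / c) * exp (- Re (csqrt (wz z)) * t))"
    if z: "norm (z - of_real xi) <= r * (1 + \<bar>xi\<bar>)" for xi z
  proof (intro conjI allI impI)
    define a where "a = Re (csqrt (wz z))"
    have a0: "a >= 0" by (simp add: a_def Re_csqrt_nonneg)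
    have D: "norm (DD z) >= c * exp (2 * L * a)" using low[OF z] by (simp add: a_def)
    have D0: "c * exp (2*L*a) > 0" using rc by simp
    then show "DD z \<noteq> 0" using D by auto
    fix t assume t: "0 <= t \<and> t <= L"
    have "norm (CC (wz z) (2 * L - t) + 2 * CC (wz z) t) <= norm (CC (wz z) (2 * L - t)) + 2 * norm (CC (wz z) t)"
      by (metis norm_mult norm_numeral norm_triangle_ineq)
    also have "norm (CC (wz z) (2*L-t)) <= exp (a * (2*L-t))" using norm_CC_le t by (simp add: a_def)
    also have "norm (CC (wz z) t) <= exp (a * t)" using norm_CC_le t by (simp add: a_def)
    also have "exp (a * t) <= exp (a * (2*L - t))" using t a0 by (simp add: mult_left_mono)
    finally have n: "norm (CC (wz z) (2 * L - t) + 2 * CC (wz z) t) <= 3 * exp (a * (2*L - t))" by simp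
    have "norm (EE z t) <= 3 * exp (a * (2*L - t)) / (c * exp (2*L*a))"
      unfolding EE_def norm_divide using n D D0 by (intro frac_le) auto
    also have "\<dots> = (3 / c) * exp (- a * t)"
    proof -
      have "exp (a * (2*L - t)) = exp (2*L*a) * exp (- a * t)"
        by (simp add: algebra_simps flip: exp_add)
      then show ?thesis using rc by simp
    qed
    finally show "norm (EE z t) <= (3 / c) * exp (- Re (csqrt (wz z)) * t)" by (simp add: a_def)
  qed
  then show ?thesis using rc by (intro exI[of _ r] exI[of _ "3/c"]) auto
qed

text \<open>The kernel continued to complex frequency; m and M stand for the smaller and the larger
  of the two times, so that only a holomorphic dependence on z remains.\<close>

definition KK :: "real => real => complex => complex" where
  "KK m M z = z\<^sup>2 * SS (wz z) m * EE z M"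

text \<open>The bound 1 reflects that z^2 divided by the root of the symbol is bounded for |xi| >= 4
  (and everything is bounded for smaller xi on a finite time interval); the bound (1 + xi^2) m is
  the vanishing of \<open>SS\<close> at time 0. The numerical constant is a crude common
  one.\<close>

lemma SS_disc:
  fixes z :: complex
  assumes z: "norm (z - of_real xi) <= 1/40 * (1 + \<bar>xi\<bar>)" and m: "0 <= m" "m <= L"
  shows "norm (z^2 * SS (wz z) m) <= (2048 + 1024 * L) * min 1 ((1 + xi\<^sup>2) * m) * exp (Re (csqrt (wz z)) * m)"
proof -
  define e where "e = exp (Re (csqrt (wz z)) * m)"
  have e: "e > 0" by (simp add: e_def)
  have s2: "norm (SS (wz z) m) <= m * e" unfolding e_def by (rule norm_SS_le2[OF m(1)])
  have A: "norm (z^2 * SS (wz z) m) <= 64 * ((1 + xi\<^sup>2) * m) * e"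
  proof -
    have "norm (z^2 * SS (wz z) m) <= (64 * (1 + xi^2)) * (m * e)"
      unfolding norm_mult norm_power using s2 disc_bounds(2)[OF z] e m by (intro mult_mono) auto
    then show ?thesis by (simp add: mult_ac)
  qed
  have B: "norm (z^2 * SS (wz z) m) <= (2048 + 1024 * L) * e"
  proof (cases "\<bar>xi\<bar> >= 4")
    case True
    note d = disc_large[OF z True]
    have x2: "xi^2 > 0" using True by auto
    have "xi^2 / 2 * norm (SS (wz z) m) <= norm (csqrt (wz z)) * norm (SS (wz z) m)"
      using d(4) by (intro mult_right_mono) auto
    also have "\<dots> <= e" unfolding e_def by (rule norm_SS_le1[OF m(1)])
    finally have "norm (SS (wz z) m) <= e * 2 / xi^2" using x2 by (simp add: field_simps)
    then have "norm (z^2 * SS (wz z) m) <= (9/8 * xi^2) * (e * 2 / xi^2)"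
      unfolding norm_mult norm_power using d(2) x2 by (intro mult_mono) auto
    also have "\<dots> = 9/4 * e" using x2 by simp
    also have "\<dots> <= (2048 + 1024 * L) * e" using e L by (intro mult_right_mono) auto
    finally show ?thesis .
  next
    case False
    have "norm (z^2) <= 64"
      using disc_small[OF z, of 4] False power_mono[of "norm z" 8 2] by (simp add: norm_power)
    then have "norm (z^2 * SS (wz z) m) <= 64 * (m * e)"
      unfolding norm_mult using s2 by (intro mult_mono) auto
    also have "\<dots> <= 64 * (L * e)" using m e by (intro mult_left_mono mult_right_mono) auto
    also have "\<dots> <= (2048 + 1024 * L) * e" using e L by (simp add: algebra_simps)
    finally show ?thesis .
  qed
  have "norm (z^2 * SS (wz z) m) <= (2048 + 1024 * L) * ((1 + xi\<^sup>2) * m) * e"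
  proof -
    have "64 * ((1 + xi\<^sup>2) * m) * e <= (2048 + 1024 * L) * ((1 + xi\<^sup>2) * m) * e"
      using m e L by (intro mult_right_mono) auto
    then show ?thesis using A by linarith
  qed
  then show ?thesis using B e unfolding e_def[symmetric] min_def by auto
qed

text \<open>Through Cauchy's formula, bounds on discs of radius comparable to \<open>1 + \<bar>xi\<bar>\<close> become bounds for finite differences.\<close>

lemma kernel_disc:
  "\<exists>r C. 0 < r \<and> 0 < C \<and> (\<forall>xi m M. 0 <= m \<and> m <= M \<and> M <= L -->
     KK m M holomorphic_on ball (of_real xi) (r * (1 + \<bar>xi\<bar>)) \<and>
     (\<forall>z\<in>ball (complex_of_real xi) (r * (1 + \<bar>xi\<bar>)).
        norm (KK m M z) <= C * min 1 ((1 + xi\<^sup>2) * m) * exp (- (xi\<^sup>2 * (M - m) / 2)))) \<and>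
   (\<forall>xi y t. 0 <= y \<and> y <= 1 \<and> 0 <= t \<and> t <= L -->
     (\<lambda>z. z\<^sup>2 * exp (- of_real y * z\<^sup>2) * EE z t) holomorphic_on ball (of_real xi) (r * (1 + \<bar>xi\<bar>)) \<and>
     (\<forall>z\<in>ball (complex_of_real xi) (r * (1 + \<bar>xi\<bar>)).
        norm (z\<^sup>2 * exp (- of_real y * z\<^sup>2) * EE z t) <= C * (1 + xi\<^sup>2) * exp (- (xi\<^sup>2 * (y + t) / 2)))) \<and>
   (\<forall>xi t. 0 <= t \<and> t <= L --> norm (EE (of_real xi) t) <= C * exp (- (xi\<^sup>2 * t / 2)))"
proof -
  obtain r C where rC: "0 < r" "r <= 1/40" "0 < C"
    and E0: "\<forall>xi z. norm (z - of_real xi) <= r * (1 + \<bar>xi\<bar>) -->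
     DD z \<noteq> 0 \<and> (\<forall>t. 0 <= t \<and> t <= L --> norm (EE z t) <= C * exp (- Re (csqrt (wz z)) * t))"
    using EE_disc by - (elim exE conjE, rule that)
  note E1 = E0[THEN spec, THEN spec, THEN mp]
  have E_nz: "DD z \<noteq> 0" if "norm (z - of_real xi) <= r * (1 + \<bar>xi\<bar>)" for xi z
    using E1[OF that] by (rule conjunct1)
  have E_bd: "norm (EE z t) <= C * exp (- Re (csqrt (wz z)) * t)"
    if "norm (z - of_real xi) <= r * (1 + \<bar>xi\<bar>)" "0 <= t" "t <= L" for xi z t
    by (rule E1[OF that(1), THEN conjunct2, THEN spec, THEN mp, OF conjI[OF that(2,3)]])
  define C2 where "C2 = (2048 + 1024 * L) * C * exp (8 * L)"
  define C3 where "C3 = 64 * C * exp 72 * exp (8 * L)"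
  define C4 where "C4 = C * exp (8 * L)"
  define C1 where "C1 = C2 + C3 + C4"
  have C0: "C2 > 0" "C3 > 0" "C4 > 0" using rC L by (auto simp: C2_def C3_def C4_def)
  have d40: "norm (z - complex_of_real xi) <= 1/40 * (1 + \<bar>xi\<bar>)" if "norm (z - of_real xi) <= r * (1 + \<bar>xi\<bar>)" for z xi
    using that rC by (meson abs_ge_zero add_nonneg_nonneg mult_right_mono order_trans zero_le_one)
  have CCh: "(\<lambda>z. CC (wz z) s) holomorphic_on A" for s A
  proof -
    have "(ec \<circ> (\<lambda>z. (z^4 - z^2) * (of_real s)\<^sup>2)) holomorphic_on A"
      by (intro holomorphic_on_compose holomorphic_intros ec_holomorphic)
    then show ?thesis by (simp add: CC_def[abs_def] wz_def o_def)
  qed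
  have SSh: "(\<lambda>z. SS (wz z) s) holomorphic_on A" for s A
  proof -
    have "(es \<circ> (\<lambda>z. (z^4 - z^2) * (of_real s)\<^sup>2)) holomorphic_on A"
      by (intro holomorphic_on_compose holomorphic_intros es_holomorphic)
    then have "(\<lambda>z. of_real s * (es \<circ> (\<lambda>z. (z^4 - z^2) * (of_real s)\<^sup>2)) z) holomorphic_on A"
      by (intro holomorphic_intros)
    then show ?thesis by (simp add: SS_def[abs_def] wz_def o_def)
  qed
  have EEh: "(\<lambda>z. EE z s) holomorphic_on ball (of_real xi) (r * (1 + \<bar>xi\<bar>))" for s xi
    unfolding EE_def using E_nz[of _ xi]
    by (intro holomorphic_intros CCh DD_holomorphic) (auto simp: dist_norm norm_minus_commute)
  show ?thesis
  proof (rule exI[of _ r], rule exI[of _ C1], intro conjI allI impI ballI)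
    show "0 < r" "0 < C1" using rC C0 by (auto simp: C1_def)
    fix xi m M :: real and z :: complex assume mM: "0 <= m \<and> m <= M \<and> M <= L"
    show "KK m M holomorphic_on ball (of_real xi) (r * (1 + \<bar>xi\<bar>))"
      unfolding KK_def by (intro holomorphic_intros EEh SSh)
    assume "z \<in> ball (of_real xi) (r * (1 + \<bar>xi\<bar>))"
    then have z: "norm (z - of_real xi) <= r * (1 + \<bar>xi\<bar>)" by (auto simp: dist_norm norm_minus_commute)
    define a where "a = Re (csqrt (wz z))"
    define q where "q = min 1 ((1 + xi\<^sup>2) * m)"
    have q: "q >= 0" using mM by (auto simp: q_def)
    have "norm (KK m M z) <= ((2048 + 1024 * L) * q * exp (a * m)) * (C * exp (- a * M))"
      unfolding KK_def norm_mult[of "_ * _" "EE z M"] a_def q_def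
      using SS_disc[OF d40[OF z], of m] E_bd[OF z, of M] mM q rC L
      by (intro mult_mono) (auto simp: q_def)
    also have "\<dots> = (2048 + 1024 * L) * C * q * exp (- (a * (M - m)))"
      by (simp add: right_diff_distrib exp_diff exp_minus field_simps)
    also have "\<dots> <= (2048 + 1024 * L) * C * q * (exp (8 * L) * exp (- (xi\<^sup>2 * (M - m) / 2)))"
    proof (intro mult_left_mono)
      \<comment> \<open>The real part of the root exceeds xi^2/2 up to the constant 8; multiplied by
        M - m <= L, this loss becomes the factor \<open>exp (8 * L)\<close>.\<close>
      have "(xi^2/2 - 8) * (M - m) <= a * (M - m)"
        using disc_bounds(1)[OF d40[OF z]] mM by (intro mult_right_mono) (auto simp: a_def)
      then have "- (a * (M - m)) <= 8 * (M - m) + - (xi\<^sup>2 * (M - m) / 2)" by (simp add: algebra_simps)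
      also have "\<dots> <= 8 * L + - (xi\<^sup>2 * (M - m) / 2)" using mM by simp
      finally show "exp (- (a * (M - m))) <= exp (8 * L) * exp (- (xi\<^sup>2 * (M - m) / 2))"
        by (simp flip: exp_add)
      show "0 <= (2048 + 1024 * L) * C * q" using q rC L by simp
    qed
    also have "\<dots> = C2 * (q * exp (- (xi\<^sup>2 * (M - m) / 2)))" by (simp add: C2_def)
    also have "\<dots> <= C1 * (q * exp (- (xi\<^sup>2 * (M - m) / 2)))"
      using C0 q by (intro mult_right_mono) (auto simp: C1_def)
    finally show "norm (KK m M z) <= C1 * min 1 ((1 + xi\<^sup>2) * m) * exp (- (xi\<^sup>2 * (M - m) / 2))"
      by (simp add: q_def mult.assoc)
  next
    fix xi y t :: real and z :: complex assume yt: "0 <= y \<and> y <= 1 \<and> 0 <= t \<and> t <= L"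
    show "(\<lambda>z. z\<^sup>2 * exp (- of_real y * z\<^sup>2) * EE z t) holomorphic_on ball (of_real xi) (r * (1 + \<bar>xi\<bar>))"
      by (intro holomorphic_intros EEh)
    assume "z \<in> ball (of_real xi) (r * (1 + \<bar>xi\<bar>))"
    then have z: "norm (z - of_real xi) <= r * (1 + \<bar>xi\<bar>)" by (auto simp: dist_norm norm_minus_commute)
    note db = disc_bounds[OF d40[OF z]]
    define a where "a = Re (csqrt (wz z))"
    have e1: "norm (exp (- of_real y * z\<^sup>2)) <= exp 72 * exp (- (xi^2 * y / 2))"
    proof -
      have "(xi^2/2 - 72) * y <= Re (z^2) * y" using db(3) yt by (intro mult_right_mono) auto
      then have "- (Re (z^2) * y) <= 72 * y + - (xi^2 * y / 2)" by (simp add: algebra_simps)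
      also have "\<dots> <= 72 + - (xi^2 * y / 2)" using yt by simp
      finally show ?thesis by (simp add: mult.commute flip: exp_add)
    qed
    have e2: "norm (EE z t) <= C * (exp (8 * L) * exp (- (xi^2 * t / 2)))"
    proof -
      have "(xi^2/2 - 8) * t <= a * t" using db(1) yt by (intro mult_right_mono) (auto simp: a_def)
      then have "- (a * t) <= 8 * t + - (xi^2 * t / 2)" by (simp add: algebra_simps)
      also have "\<dots> <= 8 * L + - (xi^2 * t / 2)" using yt by simp
      finally have "exp (- a * t) <= exp (8 * L) * exp (- (xi^2 * t / 2))" by (simp flip: exp_add)
      then have "C * exp (- a * t) <= C * (exp (8 * L) * exp (- (xi^2 * t / 2)))" using rC by simp
      moreover have "norm (EE z t) <= C * exp (- a * t)" using E_bd[OF z] yt by (simp add: a_def)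
      ultimately show ?thesis by linarith
    qed
    have "norm (z\<^sup>2 * exp (- of_real y * z\<^sup>2) * EE z t) <=
       (64 * (1 + xi^2)) * (exp 72 * exp (- (xi^2 * y / 2))) * (C * (exp (8 * L) * exp (- (xi^2 * t / 2))))"
      unfolding norm_mult using db(2) e1 e2 by (intro mult_mono) (auto simp: norm_power)
    also have "\<dots> = C3 * ((1 + xi\<^sup>2) * exp (- (xi\<^sup>2 * (y + t) / 2)))"
    proof -
      have "exp (- (xi\<^sup>2 * (y + t) / 2)) = exp (- (xi^2 * y / 2)) * exp (- (xi^2 * t / 2))"
        by (simp add: algebra_simps add_divide_distrib flip: exp_add)
      then show ?thesis by (simp add: C3_def mult_ac)
    qed
    also have "\<dots> <= C1 * ((1 + xi\<^sup>2) * exp (- (xi\<^sup>2 * (y + t) / 2)))"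
      using C0 by (intro mult_right_mono) (auto simp: C1_def)
    finally show "norm (z\<^sup>2 * exp (- of_real y * z\<^sup>2) * EE z t) <= C1 * (1 + xi\<^sup>2) * exp (- (xi\<^sup>2 * (y + t) / 2))"
      by (simp add: mult.assoc)
  next
    fix xi t :: real assume t: "0 <= t \<and> t <= L"
    have z: "norm (of_real xi - of_real xi :: complex) <= r * (1 + \<bar>xi\<bar>)" using rC by simp
    define a where "a = Re (csqrt (wz (of_real xi)))"
    have "(xi^2/2 - 8) * t <= a * t" using disc_bounds(1)[OF d40[OF z]] t by (intro mult_right_mono) (auto simp: a_def)
    then have "- (a * t) <= 8 * t + - (xi^2 * t / 2)" by (simp add: algebra_simps)
    also have "\<dots> <= 8 * L + - (xi^2 * t / 2)" using t by simp
    finally have "exp (- a * t) <= exp (8 * L) * exp (- (xi^2 * t / 2))" by (simp flip: exp_add)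
    then have "C * exp (- a * t) <= C * (exp (8 * L) * exp (- (xi^2 * t / 2)))" using rC by simp
    moreover have "norm (EE (of_real xi) t) <= C * exp (- a * t)" using E_bd[OF z] t by (simp add: a_def)
    ultimately have "norm (EE (of_real xi) t) <= C4 * exp (- (xi^2 * t / 2))" by (simp add: C4_def mult.assoc)
    also have "\<dots> <= C1 * exp (- (xi^2 * t / 2))" using C0 by (intro mult_right_mono) (auto simp: C1_def)
    finally show "norm (EE (of_real xi) t) <= C1 * exp (- (xi\<^sup>2 * t / 2))" .
  qed
qed

end

lemma x_exp_le: "x * exp (- (a * x)) <= 1 / a" if "a > 0" for a x :: real
proof -
  have "a * x <= exp (a * x)" using exp_ge_add_one_self[of "a*x"] by linarith
  then have "a * x * exp (- (a*x)) <= exp (a*x) * exp (-(a*x))" by (intro mult_right_mono) auto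
  also have "\<dots> = 1" by (simp flip: exp_add)
  finally show ?thesis using that by (simp add: field_simps)
qed

section \<open>The real kernel, its weighted bounds and its differences\<close>

context time_interval
begin

definition EEr :: "real => real => real" where "EEr xi t = Re (EE (of_real xi) t)"
definition SSr :: "real => real => real" where "SSr xi t = Re (SS (wz (of_real xi)) t)"

lemma EE_EEr: "EE (of_real xi) t = of_real (EEr xi t)"
  using EE_real[of xi t] by (simp add: EEr_def)

lemma SS_SSr: "SS (wz (of_real xi)) t = of_real (SSr xi t)"
  using SS_real[of "xi^4 - xi^2" t] by (simp add: SSr_def wz_of_real del: of_real_diff of_real_power)

text \<open>Product form of a Green function: the solution vanishing at 0, taken at the smaller
  time, times the decaying solution at the larger time. The factor xi^2 comes from the nonlinearity.
  No Wronskian appears in a denominator because it equals 1.\<close>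

definition kk :: "real => real => real => real" where
  "kk xi tau s = xi\<^sup>2 * SSr xi (min tau s) * EEr xi (max tau s)"

text \<open>One Gaussian of the superposition, evolved by the linear equation up to time t.\<close>

definition pro :: "real => real => real => real" where
  "pro y t xi = xi\<^sup>2 * exp (- (y * xi\<^sup>2)) * EEr xi t"

lemma kk_KK: "kk xi tau s = Re (KK (min tau s) (max tau s) (of_real xi))"
  by (simp add: kk_def KK_def EE_EEr SS_SSr flip: of_real_power of_real_mult)

lemma pro_Re: "pro y t xi = Re ((of_real xi)\<^sup>2 * exp (- of_real y * (of_real xi)\<^sup>2) * EE (of_real xi) t)"
  by (simp add: pro_def EE_EEr exp_of_real flip: of_real_power of_real_mult of_real_minus)

text \<open>The discs of \<open>kernel_disc\<close> have radius r (1 + |xi|), so every difference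
  gains h / (1 + |xi|) with no loss in the Gaussian factors. This is the only place where complex
  frequencies are converted into real differences.\<close>

lemma kernel_profile_diff:
  "\<exists>C h0. 0 < C \<and> 0 < h0 \<and> (\<forall>h xi. 0 < h \<and> h <= h0 -->
     (\<forall>tau s. 0 <= tau \<and> tau <= L \<and> 0 <= s \<and> s <= L -->
       \<bar>(fd h ^^ n) (\<lambda>xi. kk xi tau s) xi\<bar> <= C * (h / (1 + \<bar>xi\<bar>)) ^ n *
         (min 1 ((1 + xi\<^sup>2) * min tau s) * exp (- (xi\<^sup>2 * (max tau s - min tau s) / 2)))) \<and>
     (\<forall>y t. 0 <= y \<and> y <= 1 \<and> 0 <= t \<and> t <= L -->
       \<bar>(fd h ^^ n) (pro y t) xi\<bar> <= C * (h / (1 + \<bar>xi\<bar>)) ^ n *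
         ((1 + xi\<^sup>2) * exp (- (xi\<^sup>2 * (y + t) / 2)))))"
proof -
  obtain r C where rC: "0 < r" "0 < C"
   and K: "\<forall>xi m M. 0 <= m \<and> m <= M \<and> M <= L -->
     KK m M holomorphic_on ball (of_real xi) (r * (1 + \<bar>xi\<bar>)) \<and>
     (\<forall>z\<in>ball (complex_of_real xi) (r * (1 + \<bar>xi\<bar>)).
        norm (KK m M z) <= C * min 1 ((1 + xi\<^sup>2) * m) * exp (- (xi\<^sup>2 * (M - m) / 2)))"
   and P: "\<forall>xi y t. 0 <= y \<and> y <= 1 \<and> 0 <= t \<and> t <= L -->
     (\<lambda>z. z\<^sup>2 * exp (- of_real y * z\<^sup>2) * EE z t) holomorphic_on ball (of_real xi) (r * (1 + \<bar>xi\<bar>)) \<and>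
     (\<forall>z\<in>ball (complex_of_real xi) (r * (1 + \<bar>xi\<bar>)).
        norm (z\<^sup>2 * exp (- of_real y * z\<^sup>2) * EE z t) <= C * (1 + xi\<^sup>2) * exp (- (xi\<^sup>2 * (y + t) / 2)))"
    using kernel_disc by - (elim exE conjE, rule that)
  note K3 = K[THEN spec, THEN spec, THEN spec, THEN mp]
  note P3 = P[THEN spec, THEN spec, THEN spec, THEN mp]
  have hK: "KK m M holomorphic_on ball (of_real xi) (r * (1 + \<bar>xi\<bar>))"
   if "0 <= m" "m <= M" "M <= L" for m M xi
    by (rule K3[THEN conjunct1]) (use that in simp)
  have bK: "norm (KK m M z) <= C * min 1 ((1 + xi\<^sup>2) * m) * exp (- (xi\<^sup>2 * (M - m) / 2))"
   if "0 <= m" "m <= M" "M <= L" and z: "z\<in>ball (of_real xi) (r * (1 + \<bar>xi\<bar>))" for m M xi z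
    by (rule K3[THEN conjunct2, THEN bspec, OF _ z]) (use that in simp)
  have hP: "(\<lambda>z. z\<^sup>2 * exp (- of_real y * z\<^sup>2) * EE z t) holomorphic_on ball (of_real xi) (r * (1 + \<bar>xi\<bar>))"
   if "0 <= y" "y <= 1" "0 <= t" "t <= L" for y t xi
    by (rule P3[THEN conjunct1]) (use that in simp)
  have bP: "norm (z\<^sup>2 * exp (- of_real y * z\<^sup>2) * EE z t) <= C * (1 + xi\<^sup>2) * exp (- (xi\<^sup>2 * (y + t) / 2))"
   if "0 <= y" "y <= 1" "0 <= t" "t <= L" and z: "z\<in>ball (of_real xi) (r * (1 + \<bar>xi\<bar>))" for y t xi z
    by (rule P3[THEN conjunct2, THEN bspec, OF _ z]) (use that in simp)
  obtain D where D: "D > 0" and fdb0: "\<forall>f z0 R G h. f holomorphic_on ball z0 R --> (\<forall>z\<in>ball z0 R. norm (f z) <= G) -->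
     0 <= h --> R > 0 --> h <= R / 8 ^ n -->
     norm (((fd (of_real h)) ^^ n) f (z0::complex)) <= D * (h / R) ^ n * (G::real)"
    using fd_iter_holomorphic_bound[of n] by - (elim exE conjE, rule that)
  note fdb = fdb0[rule_format]
  \<comment> \<open>The admissible step for the smallest disc, the one at xi = 0; it then serves all
    xi.\<close>
  define h0 where "h0 = r / 8 ^ n"
  have step: "\<bar>(fd h ^^ n) (\<lambda>x. Re (f (of_real x))) xi\<bar> <= (D * C / r ^ n) * (h / (1 + \<bar>xi\<bar>)) ^ n * G"
    if f: "f holomorphic_on ball (of_real xi) (r * (1 + \<bar>xi\<bar>))"
      and G: "\<And>z. z \<in> ball (of_real xi) (r * (1 + \<bar>xi\<bar>)) ==> norm (f z) <= C * G" and h: "0 < h" "h <= h0"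
    for f h xi G
  proof -
    have "\<bar>(fd h ^^ n) (\<lambda>x. Re (f (of_real x))) xi\<bar> <= norm (((fd (of_real h)) ^^ n) f (of_real xi))"
      unfolding fd_iter_Re by (rule abs_Re_le_cmod)
    also have "\<dots> <= D * (h / (r * (1 + \<bar>xi\<bar>))) ^ n * (C * G)"
    proof (rule fdb[OF f])
      have "h0 <= r * (1 + \<bar>xi\<bar>) / 8 ^ n" unfolding h0_def using rC by (intro divide_right_mono) auto
      then show "h <= r * (1 + \<bar>xi\<bar>) / 8 ^ n" using h by linarith
      show "0 < r * (1 + \<bar>xi\<bar>)" using rC by (simp add: add_pos_nonneg)
    qed (use G h in auto)
    also have "\<dots> = (D * C / r ^ n) * (h / (1 + \<bar>xi\<bar>)) ^ n * G"
      by (simp add: power_divide power_mult_distrib)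
    finally show ?thesis .
  qed
  show ?thesis
  proof (rule exI[of _ "D * C / r ^ n"], rule exI[of _ h0], intro conjI allI impI)
    show "0 < D * C / r ^ n" "0 < h0" using D rC by (auto simp: h0_def)
    fix h xi :: real assume h: "0 < h \<and> h <= h0"
    { fix tau s :: real assume ts: "0 <= tau \<and> tau <= L \<and> 0 <= s \<and> s <= L"
      show "\<bar>(fd h ^^ n) (\<lambda>xi. kk xi tau s) xi\<bar> <= D * C / r ^ n * (h / (1 + \<bar>xi\<bar>)) ^ n *
         (min 1 ((1 + xi\<^sup>2) * min tau s) * exp (- (xi\<^sup>2 * (max tau s - min tau s) / 2)))"
        unfolding kk_KK
        by (rule step[OF hK]) (use h ts bK[of "min tau s" "max tau s" _ xi] in \<open>auto simp: mult.assoc simp del: min_def\<close>) }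
    { fix y t :: real assume ts: "0 <= y \<and> y <= 1 \<and> 0 <= t \<and> t <= L"
      show "\<bar>(fd h ^^ n) (pro y t) xi\<bar> <= D * C / r ^ n * (h / (1 + \<bar>xi\<bar>)) ^ n *
         ((1 + xi\<^sup>2) * exp (- (xi\<^sup>2 * (y + t) / 2)))"
        unfolding pro_Re[abs_def]
        by (rule step[OF hP]) (use h ts bP[of y t _ xi] in \<open>auto simp: mult.assoc\<close>) }
  qed
qed

lemma kk_diff_basic:
  obtains C h0 where "0 < C" "0 < h0" "\<And>h xi tau s. 0 < h ==> h <= h0 ==> 0 <= tau ==> tau <= L ==> 0 <= s ==> s <= L ==>
       \<bar>(fd h ^^ n) (\<lambda>xi. kk xi tau s) xi\<bar> <= C * (h / (1 + \<bar>xi\<bar>)) ^ n *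
         (min 1 ((1 + xi\<^sup>2) * min tau s) * exp (- (xi\<^sup>2 * (max tau s - min tau s) / 2)))"
  using kernel_profile_diff[of n]
proof (atomize_elim, elim exE conjE)
  fix C h0 :: real
  assume C: "0 < C" "0 < h0" and a: "\<forall>h xi. 0 < h \<and> h <= h0 -->
     (\<forall>tau s. 0 <= tau \<and> tau <= L \<and> 0 <= s \<and> s <= L -->
       \<bar>(fd h ^^ n) (\<lambda>xi. kk xi tau s) xi\<bar> <= C * (h / (1 + \<bar>xi\<bar>)) ^ n *
         (min 1 ((1 + xi\<^sup>2) * min tau s) * exp (- (xi\<^sup>2 * (max tau s - min tau s) / 2)))) \<and>
     (\<forall>y t. 0 <= y \<and> y <= 1 \<and> 0 <= t \<and> t <= L -->
       \<bar>(fd h ^^ n) (pro y t) xi\<bar> <= C * (h / (1 + \<bar>xi\<bar>)) ^ n *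
         ((1 + xi\<^sup>2) * exp (- (xi\<^sup>2 * (y + t) / 2))))"
  show "\<exists>C h0. 0 < C \<and> 0 < h0 \<and> (\<forall>h xi tau s. 0 < h --> h <= h0 --> 0 <= tau --> tau <= L --> 0 <= s --> s <= L -->
       \<bar>(fd h ^^ n) (\<lambda>xi. kk xi tau s) xi\<bar> <= C * (h / (1 + \<bar>xi\<bar>)) ^ n *
         (min 1 ((1 + xi\<^sup>2) * min tau s) * exp (- (xi\<^sup>2 * (max tau s - min tau s) / 2))))"
  proof (rule exI[of _ C], rule exI[of _ h0], intro conjI C allI impI)
    note a1 = a[THEN spec, THEN spec, THEN mp, THEN conjunct1, THEN spec, THEN spec, THEN mp]
    fix h xi tau s assume "0 < h" "h <= h0" "0 <= tau" "tau <= L" "0 <= s" "s <= L"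
    then show "\<bar>(fd h ^^ n) (\<lambda>xi. kk xi tau s) xi\<bar> <= C * (h / (1 + \<bar>xi\<bar>)) ^ n *
         (min 1 ((1 + xi\<^sup>2) * min tau s) * exp (- (xi\<^sup>2 * (max tau s - min tau s) / 2)))"
      by (intro a1 conjI)
  qed
qed

text \<open>Either m and M are comparable and the ratio is bounded below, or M - m >= M/2 and the
  Gaussian trades the factor 1 + xi^2 for a multiple of 1 + 1/M.\<close>

lemma kernel_ratio_bound:
  assumes m: "0 < m" "m <= M" "M <= L"
  shows "min 1 ((1 + xi\<^sup>2) * m) * exp (- (xi\<^sup>2 * (M - m) / 4)) <= (L + 10) * (m / M)"
proof (cases "M <= 2 * m")
  case True
  have "min 1 ((1 + xi\<^sup>2) * m) * exp (- (xi\<^sup>2 * (M - m) / 4)) <= 1 * 1"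
    using m by (intro mult_mono) auto
  also have "1 * 1 <= 10 * (m / M)" using True m by (simp add: field_simps)
  also have "\<dots> <= (L + 10) * (m / M)" using m L by (intro mult_right_mono) auto
  finally show ?thesis .
next
  case False
  have M: "M > 0" using m by simp
  have "xi^2 * (M / 2) <= xi\<^sup>2 * (M - m)" using False by (intro mult_left_mono) auto
  then have e: "exp (- (xi\<^sup>2 * (M - m) / 4)) <= exp (- (M / 8 * xi\<^sup>2))" by (simp add: mult.commute)
  have "min 1 ((1 + xi\<^sup>2) * m) * exp (- (xi\<^sup>2 * (M - m) / 4)) <= ((1 + xi\<^sup>2) * m) * exp (- (M / 8 * xi\<^sup>2))"
    using m e by (intro mult_mono) auto
  also have "\<dots> = m * (exp (- (M / 8 * xi\<^sup>2)) + xi\<^sup>2 * exp (- (M / 8 * xi\<^sup>2)))" by (simp add: algebra_simps)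
  also have "\<dots> <= m * (1 + 8 / M)"
    using m x_exp_le[of "M/8" "xi^2"] M by (intro mult_left_mono add_mono) auto
  also have "\<dots> = (M + 8) * (m / M)" using M by (simp add: field_simps)
  also have "\<dots> <= (L + 10) * (m / M)" using m by (intro mult_right_mono) auto
  finally show ?thesis .
qed

text \<open>Since |xi| <= xi^2/4 + 1, half of the Gaussian exponent absorbs the exponential; the
  remainder is at most exp L.\<close>

lemma exp_weight: "exp (- (xi\<^sup>2 * d / 2)) * exp (e * \<bar>xi\<bar>) <= exp L * exp (- (xi\<^sup>2 * d / 4))"
  if "0 <= d" "d <= L" "\<bar>e\<bar> <= d" for d e xi :: real
proof -
  have "(\<bar>xi\<bar>/2 - 1)^2 >= 0" by simp
  then have "\<bar>xi\<bar> <= xi\<^sup>2 / 4 + 1" unfolding power2_diff power_divide power2_abs by simp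
  then have "d * \<bar>xi\<bar> <= d * (xi\<^sup>2 / 4 + 1)" using that by (intro mult_left_mono) auto
  moreover have "e * \<bar>xi\<bar> <= d * \<bar>xi\<bar>" using that by (intro mult_right_mono) auto
  ultimately have "- (xi\<^sup>2 * d / 2) + e * \<bar>xi\<bar> <= L + - (xi\<^sup>2 * d / 4)" using that by (simp add: algebra_simps)
  then show ?thesis by (simp flip: exp_add)
qed

text \<open>Moving the analytic weight from time s to time tau keeps the min/max bound. The weight
  may grow or shrink on the way, since s can lie on either side of tau, and the kernel decays in
  both directions.\<close>

lemma kk_weighted:
  "\<exists>C>0. \<forall>xi tau s. 0 < tau \<and> tau < L \<and> 0 < s \<and> s < L -->
     \<bar>kk xi tau s\<bar> * exp ((tau - s) * \<bar>xi\<bar>) <= C * (min tau s / max tau s)"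
proof -
  obtain C h0 where C: "0 < C" "0 < h0" and b: "\<And>h xi tau s. 0 < h ==> h <= h0 ==> 0 <= tau ==> tau <= L ==> 0 <= s ==> s <= L ==>
       \<bar>(fd h ^^ 0) (\<lambda>xi. kk xi tau s) xi\<bar> <= C * (h / (1 + \<bar>xi\<bar>)) ^ 0 *
         (min 1 ((1 + xi\<^sup>2) * min tau s) * exp (- (xi\<^sup>2 * (max tau s - min tau s) / 2)))"
    by (rule kk_diff_basic, rule that)
  have "\<bar>kk xi tau s\<bar> * exp ((tau - s) * \<bar>xi\<bar>) <= (C * exp L * (L + 10)) * (min tau s / max tau s)"
    if "0 < tau \<and> tau < L \<and> 0 < s \<and> s < L" for xi tau s
  proof -
    define m M q where "m = min tau s" and "M = max tau s" and "q = min 1 ((1 + xi\<^sup>2) * m)"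
    have mM: "0 < m" "m <= M" "M <= L" "\<bar>tau - s\<bar> <= M - m" using that by (auto simp: m_def M_def)
    have q: "q >= 0" using mM by (simp add: q_def)
    have "\<bar>kk xi tau s\<bar> * exp ((tau - s) * \<bar>xi\<bar>) <= (C * (q * exp (- (xi\<^sup>2 * (M - m) / 2)))) * exp ((tau - s) * \<bar>xi\<bar>)"
      using b[of h0 tau s xi] that C by (intro mult_right_mono) (auto simp: q_def m_def M_def)
    also have "\<dots> = C * q * (exp (- (xi\<^sup>2 * (M - m) / 2)) * exp ((tau - s) * \<bar>xi\<bar>))" by simp
    also have "\<dots> <= C * q * (exp L * exp (- (xi\<^sup>2 * (M - m) / 4)))"
      using exp_weight[of "M - m" "tau - s" xi] mM q C by (intro mult_left_mono) auto
    also have "\<dots> = C * exp L * (q * exp (- (xi\<^sup>2 * (M - m) / 4)))" by simp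
    also have "\<dots> <= C * exp L * ((L + 10) * (m / M))"
      using kernel_ratio_bound[OF mM(1-3), of xi] C by (intro mult_left_mono) (auto simp: q_def)
    finally show ?thesis by (simp add: m_def M_def mult.assoc)
  qed
  then show ?thesis using C L by (intro exI[of _ "C * exp L * (L + 10)"]) auto
qed

text \<open>Three gains from differencing the kernel: none, half and all of the singular factor \<open>1 / max tau s\<close>.\<close>

lemma kk_diff:
  "\<exists>C h0. 0 < C \<and> 0 < h0 \<and> (\<forall>h xi tau s. 0 < h \<and> h <= h0 \<and> 0 < tau \<and> tau < L \<and> 0 < s \<and> s < L -->
     \<bar>(fd h ^^ n) (\<lambda>xi. kk xi tau s) xi\<bar> <= C * h ^ n * (min tau s / max tau s) \<and>
     (n = 1 --> \<bar>(fd h ^^ n) (\<lambda>xi. kk xi tau s) xi\<bar> <= C * h ^ n * (min tau s / sqrt (max tau s))) \<and>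
     (n = 2 --> \<bar>(fd h ^^ n) (\<lambda>xi. kk xi tau s) xi\<bar> <= C * h ^ n * min tau s))"
proof -
  obtain C h0 where C: "0 < C" "0 < h0" and b: "\<And>h xi tau s. 0 < h ==> h <= h0 ==> 0 <= tau ==> tau <= L ==> 0 <= s ==> s <= L ==>
       \<bar>(fd h ^^ n) (\<lambda>xi. kk xi tau s) xi\<bar> <= C * (h / (1 + \<bar>xi\<bar>)) ^ n *
         (min 1 ((1 + xi\<^sup>2) * min tau s) * exp (- (xi\<^sup>2 * (max tau s - min tau s) / 2)))"
    by (rule kk_diff_basic, rule that)
  define C1 where "C1 = C * (L + 10)"
  have C1: "C1 > 0" "C <= C1" using C L by (auto simp: C1_def)
  show ?thesis
  proof (rule exI[of _ C1], rule exI[of _ h0], intro conjI allI impI)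
    show "0 < C1" "0 < h0" using C1 C by auto
    fix h xi tau s assume a: "0 < h \<and> h <= h0 \<and> 0 < tau \<and> tau < L \<and> 0 < s \<and> s < L"
    define m M q where "m = min tau s" and "M = max tau s" and "q = min 1 ((1 + xi\<^sup>2) * m) * exp (- (xi\<^sup>2 * (M - m) / 2))"
    have mM: "0 < m" "m <= M" "M <= L" using a by (auto simp: m_def M_def)
    have q0: "q >= 0" using mM by (simp add: q_def)
    have B: "\<bar>(fd h ^^ n) (\<lambda>xi. kk xi tau s) xi\<bar> <= C * (h / (1 + \<bar>xi\<bar>)) ^ n * q"
      using b[of h tau s xi] a by (simp add: m_def M_def q_def)
    have q1: "q <= (L + 10) * (m / M)"
    proof -
      have "q <= min 1 ((1 + xi\<^sup>2) * m) * exp (- (xi\<^sup>2 * (M - m) / 4))"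
        unfolding q_def using mM by (intro mult_left_mono) auto
      then show ?thesis using kernel_ratio_bound[OF mM, of xi] by linarith
    qed
    have q2: "q <= (1 + \<bar>xi\<bar>)^2 * m"
    proof -
      have "q <= ((1 + xi\<^sup>2) * m) * 1" unfolding q_def using mM by (intro mult_mono) auto
      also have "\<dots> <= (1 + \<bar>xi\<bar>)^2 * m" using mM by (auto simp: power2_sum intro!: mult_right_mono)
      finally show ?thesis .
    qed
    have x1: "1 + \<bar>xi\<bar> >= 1" by simp
    show "\<bar>(fd h ^^ n) (\<lambda>xi. kk xi tau s) xi\<bar> <= C1 * h ^ n * (min tau s / max tau s)"
    proof -
      have "(h / (1 + \<bar>xi\<bar>)) ^ n <= h ^ n" using a x1 by (intro power_mono) (auto simp: divide_le_eq_1 field_simps)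
      then have "C * (h / (1 + \<bar>xi\<bar>)) ^ n * q <= C * h ^ n * ((L + 10) * (m / M))"
        using q1 q0 C a by (intro mult_mono) auto
      then show ?thesis using B by (simp add: C1_def m_def M_def mult_ac)
    qed
    show "\<bar>(fd h ^^ n) (\<lambda>xi. kk xi tau s) xi\<bar> <= C1 * h ^ n * min tau s" if n: "n = 2"
    proof -
      have "C * (h / (1 + \<bar>xi\<bar>)) ^ n * q <= C * (h / (1 + \<bar>xi\<bar>)) ^ n * ((1 + \<bar>xi\<bar>)^2 * m)"
        using q2 C a by (intro mult_left_mono) auto
      also have "\<dots> = C * h ^ n * m" using n by (simp add: power_divide)
      also have "\<dots> <= C1 * h ^ n * m" using C1 mM a by (intro mult_right_mono) auto
      finally show ?thesis using B by (simp add: m_def)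
    qed
    show "\<bar>(fd h ^^ n) (\<lambda>xi. kk xi tau s) xi\<bar> <= C1 * h ^ n * (min tau s / sqrt (max tau s))" if n: "n = 1"
    proof -
      \<comment> \<open>For one difference q is bounded by the geometric mean of q1 and q2: it costs
        a single factor 1 + |xi|, which the gain h / (1 + |xi|) cancels, and leaves only half of the
        singularity in M.\<close>
      have "q * q <= ((L + 10) * (m / M)) * ((1 + \<bar>xi\<bar>)^2 * m)"
        using q1 q2 q0 mM L by (intro mult_mono) auto
      also have "\<dots> = (L + 10) * ((1 + \<bar>xi\<bar>) * (m / sqrt M))^2"
        using mM by (simp add: power_mult_distrib power_divide power2_eq_square)
      also have "\<dots> <= (L + 10)^2 * ((1 + \<bar>xi\<bar>) * (m / sqrt M))^2"
      proof (intro mult_right_mono zero_le_power2)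
        have "1 * (L + 10) <= (L + 10) * (L + 10)" using L by (intro mult_right_mono) auto
        then show "L + 10 <= (L + 10)^2" by (simp add: power2_eq_square)
      qed
      finally have "q^2 <= ((L + 10) * ((1 + \<bar>xi\<bar>) * (m / sqrt M)))^2"
        unfolding power_mult_distrib power2_eq_square[of q] .
      then have "q <= (L + 10) * ((1 + \<bar>xi\<bar>) * (m / sqrt M))"
        by (rule power2_le_imp_le) (use L mM in \<open>simp add: add_nonneg_nonneg\<close>)
      then have "C * (h / (1 + \<bar>xi\<bar>)) ^ n * q <= C * (h / (1 + \<bar>xi\<bar>)) ^ n * ((L + 10) * ((1 + \<bar>xi\<bar>) * (m / sqrt M)))"
        using C a by (intro mult_left_mono) auto
      also have "\<dots> = C1 * h ^ n * (m / sqrt M)"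
      proof -
        have "1 + \<bar>xi\<bar> \<noteq> 0" using x1 by linarith
        then show ?thesis unfolding n C1_def by simp
      qed
      finally show ?thesis using B by (simp add: m_def M_def)
    qed
  qed
qed

end

section \<open>Integrals depending on parameters\<close>

lemma continuous_on_integral_dominated:
  fixes f :: "'a::metric_space => 'b => real"
  assumes dom: "\<And>x. x \<in> X ==> \<exists>e>0. \<exists>g. integrable M g \<and> (\<forall>y\<in>X. dist y x < e --> (\<forall>l. \<bar>f y l\<bar> <= g l))"
    and meas: "\<And>x. x \<in> X ==> f x \<in> borel_measurable M"
    and cont: "\<And>l. continuous_on X (\<lambda>x. f x l)"
  shows "continuous_on X (\<lambda>x. \<integral>l. f x l \<partial>M)"
proof (rule continuous_on_sequentiallyI)
  fix u :: "nat => 'a" and a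
  assume u: "\<forall>n. u n \<in> X" and a: "a \<in> X" and lim: "u \<longlonglongrightarrow> a"
  obtain e g where e: "e > 0" "integrable M g" "\<And>y l. y \<in> X ==> dist y a < e ==> \<bar>f y l\<bar> <= g l"
    using dom[OF a] by blast
  obtain N where N: "\<And>n. n >= N ==> dist (u n) a < e"
    using lim e(1) unfolding lim_sequentially by blast
  have "(\<lambda>n. \<integral>l. f (u (n + N)) l \<partial>M) \<longlonglongrightarrow> (\<integral>l. f a l \<partial>M)"
  proof (rule integral_dominated_convergence[where w = g])
    show "AE l in M. (\<lambda>n. f (u (n + N)) l) \<longlonglongrightarrow> f a l"
    proof (intro AE_I2)
      fix l
      have "(\<lambda>n. f (u n) l) \<longlonglongrightarrow> f a l"
        using continuous_on_tendsto_compose[OF cont lim a] u by simp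
      then show "(\<lambda>n. f (u (n + N)) l) \<longlonglongrightarrow> f a l" by (rule LIMSEQ_ignore_initial_segment)
    qed
  qed (use meas u a e N in auto)
  then show "(\<lambda>n. \<integral>l. f (u n) l \<partial>M) \<longlonglongrightarrow> (\<integral>l. f a l \<partial>M)"
    by (rule LIMSEQ_offset)
qed

text \<open>The mean value inequality makes the integrand Lipschitz with constant
  \<open>g l\<close>, so the error quotient is dominated by \<open>2 * g l\<close>, and dominated
  convergence along sequences applies.\<close>

lemma has_derivative_integral_dominated:
  fixes f :: "'a::real_normed_vector => 'b => real"
  assumes e: "e > 0"
    and der: "\<And>y l. dist y z < e ==> ((\<lambda>y. f y l) has_derivative D y l) (at y)"
    and bd: "\<And>y l v. dist y z < e ==> \<bar>D y l v\<bar> <= g l * norm v"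
    and g: "integrable M g" and g0: "\<And>l. 0 <= g l"
    and f: "\<And>y. dist y z < e ==> integrable M (f y)"
    and meas: "\<And>v. (\<lambda>l. D z l v) \<in> borel_measurable M"
  shows "((\<lambda>y. \<integral>l. f y l \<partial>M) has_derivative (\<lambda>v. \<integral>l. D z l v \<partial>M)) (at z)"
proof -
  have dz: "dist z z < e" using e by simp
  have Dint: "integrable M (\<lambda>l. D z l v)" for v
    by (rule Bochner_Integration.integrable_bound[of M "\<lambda>l. g l * norm v"])
      (use g meas in \<open>auto intro!: AE_I2 order_trans[OF bd[OF dz] abs_ge_self]\<close>)
  have lin: "linear (D z l)" for l using der[OF dz] has_derivative_linear by blast
  have lip: "\<bar>f y l - f z l\<bar> <= g l * norm (y - z)" if y: "dist y z < e" for y l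
  proof -
    have "norm (f y l - f z l) <= g l * norm (y - z)"
    proof (rule differentiable_bound[of "ball z e" "\<lambda>y. f y l" "\<lambda>y. D y l"])
      fix x assume "x \<in> ball z e"
      then have x: "dist x z < e" by (simp add: dist_commute)
      show "((\<lambda>y. f y l) has_derivative D x l) (at x within ball z e)"
        using der[OF x] has_derivative_at_withinI by blast
      show "onorm (D x l) <= g l"
        by (rule onorm_bound) (use bd[OF x] g0 in auto)
    qed (use y e in \<open>auto simp: dist_commute\<close>)
    then show ?thesis by simp
  qed
  show ?thesis
    unfolding has_derivative_at
  proof (intro conjI)
    show "bounded_linear (\<lambda>v. \<integral>l. D z l v \<partial>M)"
    proof (rule bounded_linear_intro)
      fix v w show "(\<integral>l. D z l (v + w) \<partial>M) = (\<integral>l. D z l v \<partial>M) + (\<integral>l. D z l w \<partial>M)"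
        using Dint by (simp add: linear_add[OF lin])
    next
      fix r v show "(\<integral>l. D z l (r *\<^sub>R v) \<partial>M) = r *\<^sub>R (\<integral>l. D z l v \<partial>M)"
        by (simp add: linear_cmul[OF lin])
    next
      fix v
      have "norm (\<integral>l. D z l v \<partial>M) <= (\<integral>l. \<bar>D z l v\<bar> \<partial>M)" by simp
      also have "\<dots> <= (\<integral>l. g l * norm v \<partial>M)"
        by (rule integral_mono) (use Dint g bd[OF dz] in auto)
      finally show "norm (\<integral>l. D z l v \<partial>M) <= norm v * (\<integral>l. g l \<partial>M)" by (simp add: mult.commute)
    qed
    show "(\<lambda>h. norm ((\<integral>l. f (z + h) l \<partial>M) - (\<integral>l. f z l \<partial>M) - (\<integral>l. D z l h \<partial>M)) / norm h) \<midarrow>0\<rightarrow> 0"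
      unfolding tendsto_at_iff_sequentially
    proof (intro allI impI)
      fix X :: "nat => 'a"
      assume X: "\<forall>i. X i \<in> UNIV - {0}" and lim: "X \<longlonglongrightarrow> 0"
      obtain N where N: "\<And>n. n >= N ==> dist (X n) 0 < e"
        using lim e unfolding lim_sequentially by blast
      define q where "q n l = (f (z + X (n+N)) l - f z l - D z l (X (n+N))) / norm (X (n+N))" for n l
      have Xn: "dist (z + X (n + N)) z < e" for n using N[of "n+N"] by (simp add: dist_norm)
      have X0: "X n \<noteq> 0" for n using X by auto
      have "(\<lambda>n. \<integral>l. q n l \<partial>M) \<longlonglongrightarrow> (\<integral>l. 0 \<partial>M)"
      proof (rule integral_dominated_convergence[where w = "\<lambda>l. 2 * g l"])
        show "AE l in M. (\<lambda>n. q n l) \<longlonglongrightarrow> 0"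
        proof (intro AE_I2)
          fix l
          have "(\<lambda>h. norm (f (z + h) l - f z l - D z l h) / norm h) \<midarrow>0\<rightarrow> 0"
            using der[OF dz] unfolding has_derivative_at by blast
          then have "(\<lambda>n. norm (f (z + X n) l - f z l - D z l (X n)) / norm (X n)) \<longlonglongrightarrow> 0"
            unfolding tendsto_at_iff_sequentially using X lim by (auto simp: o_def)
          then have "(\<lambda>n. norm (f (z + X (n+N)) l - f z l - D z l (X (n+N))) / norm (X (n+N))) \<longlonglongrightarrow> 0"
            by (rule LIMSEQ_ignore_initial_segment)
          then have "(\<lambda>n. \<bar>q n l\<bar>) \<longlonglongrightarrow> 0" by (simp add: q_def abs_divide)
          then show "(\<lambda>n. q n l) \<longlonglongrightarrow> 0" by (rule tendsto_rabs_zero_cancel)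
        qed
        show "AE l in M. norm (q n l) <= 2 * g l" for n
        proof (intro AE_I2)
          fix l
          have "\<bar>f (z + X (n+N)) l - f z l - D z l (X (n+N))\<bar> <= \<bar>f (z + X (n+N)) l - f z l\<bar> + \<bar>D z l (X (n+N))\<bar>"
            by (rule abs_triangle_ineq4)
          also have "\<dots> <= g l * norm (X (n+N)) + g l * norm (X (n+N))"
            using lip[OF Xn, of n l] bd[OF dz, of l "X (n+N)"] by (intro add_mono) auto
          finally have "\<bar>f (z + X (n+N)) l - f z l - D z l (X (n+N))\<bar> <= (2 * g l) * norm (X (n+N))" by simp
          then show "norm (q n l) <= 2 * g l"
            using X0[of "n+N"] by (simp add: q_def pos_divide_le_eq)
        qed
        have "f (z + X (n+N)) \<in> borel_measurable M" "f z \<in> borel_measurable M" for n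
          using f[OF Xn] f[OF dz] by auto
        then show "q n \<in> borel_measurable M" for n
          unfolding q_def using meas by (intro borel_measurable_divide borel_measurable_diff) auto
      qed (use g in auto)
      moreover have "(\<integral>l. q n l \<partial>M) = ((\<integral>l. f (z + X (n+N)) l \<partial>M) - (\<integral>l. f z l \<partial>M) - (\<integral>l. D z l (X (n+N)) \<partial>M)) / norm (X (n+N))" for n
        unfolding q_def using f[OF Xn, of n] f[OF dz] Dint by simp
      ultimately have "(\<lambda>n. ((\<integral>l. f (z + X (n+N)) l \<partial>M) - (\<integral>l. f z l \<partial>M) - (\<integral>l. D z l (X (n+N)) \<partial>M)) / norm (X (n+N))) \<longlonglongrightarrow> 0"
        by simp
      from tendsto_rabs_zero[OF this]
      have "(\<lambda>n. norm ((\<integral>l. f (z + X (n+N)) l \<partial>M) - (\<integral>l. f z l \<partial>M) - (\<integral>l. D z l (X (n+N)) \<partial>M)) / norm (X (n+N))) \<longlonglongrightarrow> 0"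
        by (simp add: abs_divide)
      from LIMSEQ_offset[OF this]
      show "((\<lambda>h. norm ((\<integral>l. f (z + h) l \<partial>M) - (\<integral>l. f z l \<partial>M) - (\<integral>l. D z l h \<partial>M)) / norm h) \<circ> X) \<longlonglongrightarrow> 0"
        by (simp add: o_def)
    qed
  qed
qed

lemma deriv_integral_upper:
  fixes f :: "real => real"
  assumes x: "a < x" "x < b" and c: "continuous_on {a<..<b} f" and i: "set_integrable lborel {a<..<b} f"
  shows "((\<lambda>t. LINT s:{a<..<t}|lborel. f s) has_real_derivative f x) (at x)"
proof -
  \<comment> \<open>The integrand may be singular at both end points; the fundamental theorem is
    applied on the compact interval [c, d] and the integral over (a, c) is carried along as a
    constant.\<close>
  define c d where "c = (a + x) / 2" and "d = (x + b) / 2"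
  have cd: "a < c" "c < x" "x < d" "d < b" using x by (auto simp: c_def d_def)
  have cont: "continuous_on {c..d} f" using c cd by (auto intro: continuous_on_subset)
  have "((\<lambda>u. LBINT y=c..u. f y) has_vector_derivative f x) (at x within {c..d})"
    by (rule interval_integral_FTC2[OF _ _ cont]) (use cd in auto)
  then have "((\<lambda>u. LBINT y=c..u. f y) has_vector_derivative f x) (at x)"
    using cd by (simp add: at_within_Icc_at)
  then have "((\<lambda>u. (LINT s:{a<..<c}|lborel. f s) + (LBINT y=c..u. f y)) has_real_derivative f x) (at x)"
    unfolding has_real_derivative_iff_has_vector_derivative by (auto intro!: derivative_eq_intros)
  then show ?thesis
  proof (rule has_field_derivative_transform_within_open[where S = "{c<..<d}"])
    fix t assume t: "t \<in> {c<..<d}"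
    have "interval_lebesgue_integrable lborel (ereal a) (ereal t) f"
      using t cd unfolding interval_lebesgue_integrable_def
      by (auto intro: set_integrable_subset[OF i])
    then have "(LBINT y=a..c. f y) + (LBINT y=c..t. f y) = (LBINT y=a..t. f y)"
      using t cd by (intro interval_integral_sum) (simp add: min_def max_def)
    then show "(LINT s:{a<..<c}|lborel. f s) + (LBINT y=c..t. f y) = (LINT s:{a<..<t}|lborel. f s)"
      using t cd by (simp add: interval_lebesgue_integral_def)
  qed (use cd in auto)
qed

lemma deriv_integral_lower:
  fixes f :: "real => real"
  assumes x: "a < x" "x < b" and c: "continuous_on {a<..<b} f" and i: "set_integrable lborel {a<..<b} f"
  shows "((\<lambda>t. LINT s:{t<..<b}|lborel. f s) has_real_derivative - f x) (at x)"
proof -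
  have "((\<lambda>t. (LINT s:{a<..<b}|lborel. f s) - (LINT s:{a<..<t}|lborel. f s)) has_real_derivative - f x) (at x)"
    using deriv_integral_upper[OF assms] by (auto intro!: derivative_eq_intros)
  then show ?thesis
  proof (rule has_field_derivative_transform_within_open[where S = "{a<..<b}"])
    fix t assume t: "t \<in> {a<..<b}"
    have "interval_lebesgue_integrable lborel (ereal a) (ereal b) f"
      using t unfolding interval_lebesgue_integrable_def
      by (auto intro: set_integrable_subset[OF i])
    then have "(LBINT y=a..t. f y) + (LBINT y=t..b. f y) = (LBINT y=a..b. f y)"
      using t by (intro interval_integral_sum) (simp add: min_def max_def)
    then show "(LINT s:{a<..<b}|lborel. f s) - (LINT s:{a<..<t}|lborel. f s) = (LINT s:{t<..<b}|lborel. f s)"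
      using t by (simp add: interval_lebesgue_integral_def)
  qed (use x in auto)
qed

section \<open>The propagators as real functions of frequency and time\<close>

context time_interval
begin

definition ww :: "real => real" where "ww xi = xi^4 - xi^2"
definition CCr :: "real => real => real" where "CCr xi t = Re (CC (wz (of_real xi)) t)"
definition DDr :: "real => real" where "DDr xi = CCr xi (2 * L) + 2"
definition EEd :: "real => real => real" where
  "EEd xi t = ww xi * (2 * SSr xi t - SSr xi (2 * L - t)) / DDr xi"

lemma CC_CCr: "CC (wz (of_real xi)) t = of_real (CCr xi t)"
  using CC_real_ge[of "xi^4 - xi^2" t] by (simp add: CCr_def wz_of_real del: of_real_diff of_real_power)

lemma DDr_pos: "DDr xi >= 1"
proof -
  have "DD (of_real xi) = of_real (DDr xi)" unfolding DD_def CC_CCr DDr_def by simp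
  then show ?thesis using DD_real(2)[of xi] by (simp only: Re_complex_of_real)
qed

lemma EEr_eq: "EEr xi t = (CCr xi (2 * L - t) + 2 * CCr xi t) / DDr xi"
proof -
  have "EE (of_real xi) t = of_real ((CCr xi (2 * L - t) + 2 * CCr xi t) / DDr xi)"
    unfolding EE_def DD_def CC_CCr DDr_def by simp
  then show ?thesis by (simp only: EEr_def Re_complex_of_real)
qed

lemma SSr_deriv: "(SSr xi has_real_derivative CCr xi t) (at t)"
  using bounded_linear.has_vector_derivative[OF bounded_linear_Re SS_deriv]
  unfolding has_real_derivative_iff_has_vector_derivative SSr_def[abs_def] CCr_def .

lemma CCr_deriv: "(CCr xi has_real_derivative ww xi * SSr xi t) (at t)"
proof -
  have "((\<lambda>t. Re (CC (wz (of_real xi)) t)) has_vector_derivative Re (wz (of_real xi) * SS (wz (of_real xi)) t)) (at t)"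
    by (rule bounded_linear.has_vector_derivative[OF bounded_linear_Re CC_deriv])
  moreover have "Re (wz (of_real xi) * SS (wz (of_real xi)) t) = ww xi * SSr xi t"
    unfolding SS_SSr by (simp add: wz_of_real ww_def flip: of_real_mult of_real_power of_real_diff)
  ultimately show ?thesis
    unfolding has_real_derivative_iff_has_vector_derivative CCr_def[abs_def] by simp
qed

lemma EEr_deriv: "(EEr xi has_real_derivative EEd xi t) (at t)"
proof -
  have "((\<lambda>t. CCr xi (2 * L - t)) has_real_derivative ww xi * SSr xi (2 * L - t) * (0 - 1)) (at t)"
    by (rule DERIV_chain2[OF CCr_deriv]) (intro derivative_intros)
  from DERIV_cdivide[OF DERIV_add[OF this DERIV_cmult[OF CCr_deriv[of xi t], of 2]], of "DDr xi"]
  show ?thesis unfolding EEr_eq[abs_def] EEd_def by (simp add: algebra_simps)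
qed

lemma EEd_deriv: "(EEd xi has_real_derivative ww xi * EEr xi t) (at t)"
proof -
  have "((\<lambda>t. SSr xi (2 * L - t)) has_real_derivative CCr xi (2 * L - t) * (0 - 1)) (at t)"
    by (rule DERIV_chain2[OF SSr_deriv]) (intro derivative_intros)
  from DERIV_cdivide[OF DERIV_cmult[OF DERIV_diff[OF DERIV_cmult[OF SSr_deriv[of xi t], of 2] this], of "ww xi"], of "DDr xi"]
  show ?thesis unfolding EEd_def[abs_def] EEr_eq by (simp add: algebra_simps)
qed

text \<open>The addition formula rewrites \<open>CCr xi (2 * L)\<close> in \<open>DDr\<close>
  through 2 * L - t and t, and the Pythagorean identity clears the rest; the two sides differ only
  by the factor \<open>DDr\<close>.\<close>

lemma wronskian: "EEr xi t * CCr xi t - EEd xi t * SSr xi t = 1"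
proof -
  have add: "CCr xi (s + t) = CCr xi s * CCr xi t + ww xi * SSr xi s * SSr xi t" for s t
  proof -
    have "of_real (CCr xi (s + t)) = (of_real (CCr xi s * CCr xi t + ww xi * SSr xi s * SSr xi t) :: complex)"
      using CC_add[of "wz (of_real xi)" s t] unfolding CC_CCr SS_SSr by (simp add: ww_def wz_def)
    then show ?thesis by (simp only: of_real_eq_iff)
  qed
  have sq: "CCr xi t * CCr xi t - ww xi * SSr xi t * SSr xi t = 1"
    using add[of t "-t"] by (simp add: CCr_def SSr_def CC_uminus SS_uminus)
  have a2: "CCr xi (2 * L) = CCr xi (2 * L - t) * CCr xi t + ww xi * SSr xi (2 * L - t) * SSr xi t"
    using add[of "2 * L - t" t] by simp
  have "(EEr xi t * CCr xi t - EEd xi t * SSr xi t) * DDr xi =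
     (CCr xi (2 * L - t) + 2 * CCr xi t) * CCr xi t - ww xi * (2 * SSr xi t - SSr xi (2 * L - t)) * SSr xi t"
    using DDr_pos[of xi] unfolding EEr_eq EEd_def by (simp add: left_diff_distrib)
  also have "\<dots> = DDr xi"
    unfolding DDr_def a2 using sq by (simp add: algebra_simps)
  finally show ?thesis using DDr_pos[of xi] by simp
qed

lemma CCr_cont: "continuous_on UNIV (\<lambda>p. CCr (fst p) (snd p))"
proof -
  have "continuous_on UNIV (\<lambda>p. ec (wz (of_real (fst p)) * (of_real (snd p))\<^sup>2))"
    by (rule continuous_on_compose2[OF holomorphic_on_imp_continuous_on[OF ec_holomorphic[of UNIV]]])
      (auto simp: wz_def intro!: continuous_intros)
  then show ?thesis unfolding CCr_def CC_def by (intro continuous_intros)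
qed

lemma SSr_cont: "continuous_on UNIV (\<lambda>p. SSr (fst p) (snd p))"
proof -
  have "continuous_on UNIV (\<lambda>p. es (wz (of_real (fst p)) * (of_real (snd p))\<^sup>2))"
    by (rule continuous_on_compose2[OF holomorphic_on_imp_continuous_on[OF es_holomorphic[of UNIV]]])
      (auto simp: wz_def intro!: continuous_intros)
  then show ?thesis unfolding SSr_def SS_def by (intro continuous_intros)
qed

lemma CCr_cont' [continuous_intros]: "continuous_on A f ==> continuous_on A g ==> continuous_on A (\<lambda>x. CCr (f x) (g x))"
  using continuous_on_compose2[OF CCr_cont, of A "\<lambda>x. (f x, g x)"] by (simp add: continuous_on_Pair)

lemma SSr_cont' [continuous_intros]: "continuous_on A f ==> continuous_on A g ==> continuous_on A (\<lambda>x. SSr (f x) (g x))"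
  using continuous_on_compose2[OF SSr_cont, of A "\<lambda>x. (f x, g x)"] by (simp add: continuous_on_Pair)

lemma EEr_cont' [continuous_intros]:
  assumes "continuous_on A f" "continuous_on A g"
  shows "continuous_on A (\<lambda>x. EEr (f x) (g x))"
proof -
  have "DDr x \<noteq> 0" for x using DDr_pos[of x] by linarith
  then show ?thesis using assms unfolding EEr_eq unfolding DDr_def by (intro continuous_intros) auto
qed

lemma kk_cont' [continuous_intros]:
  "continuous_on A f ==> continuous_on A g ==> continuous_on A h ==> continuous_on A (\<lambda>x. kk (f x) (g x) (h x))"
  unfolding kk_def by (intro continuous_intros)

lemma kk_measurable [measurable (raw)]:
  assumes "f \<in> borel_measurable M" "g \<in> borel_measurable M" "h \<in> borel_measurable M"
  shows "(\<lambda>x. kk (f x) (g x) (h x)) \<in> borel_measurable M"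
proof -
  have "(\<lambda>p::real\<times>real\<times>real. kk (fst p) (fst (snd p)) (snd (snd p))) \<in> borel_measurable borel"
    by (intro borel_measurable_continuous_onI continuous_intros)
  then have k: "(\<lambda>p::real\<times>real\<times>real. kk (fst p) (fst (snd p)) (snd (snd p))) \<in> borel_measurable (borel \<Otimes>\<^sub>M (borel \<Otimes>\<^sub>M borel))"
    by (simp add: borel_prod)
  have m: "(\<lambda>x. (f x, g x, h x)) \<in> M \<rightarrow>\<^sub>M borel \<Otimes>\<^sub>M (borel \<Otimes>\<^sub>M borel)"
    using assms by measurable
  show ?thesis using measurable_compose[OF m k] by simp
qed

lemma EEr_measurable [measurable (raw)]:
  assumes "f \<in> borel_measurable M" "g \<in> borel_measurable M"
  shows "(\<lambda>x. EEr (f x) (g x)) \<in> borel_measurable M"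
proof -
  have "(\<lambda>p::real\<times>real. EEr (fst p) (snd p)) \<in> borel_measurable borel"
    by (intro borel_measurable_continuous_onI continuous_intros)
  then have k: "(\<lambda>p::real\<times>real. EEr (fst p) (snd p)) \<in> borel_measurable (borel \<Otimes>\<^sub>M borel)"
    by (simp add: borel_prod)
  have m: "(\<lambda>x. (f x, g x)) \<in> M \<rightarrow>\<^sub>M borel \<Otimes>\<^sub>M borel"
    using assms by measurable
  show ?thesis using measurable_compose[OF m k] by simp
qed

lemma EEr_0 [simp]: "EEr xi 0 = 1"
proof -
  have "CCr xi 0 = 1" by (simp add: CCr_def)
  then have "EEr xi 0 = DDr xi / DDr xi" by (simp add: EEr_eq DDr_def)
  then show ?thesis using DDr_pos[of xi] by simp
qed

lemma EEr_even: "EEr (- xi) t = EEr xi t"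
proof -
  have w: "wz (of_real (- xi)) = wz (of_real xi)" by (simp add: wz_def)
  show ?thesis unfolding EEr_def EE_def DD_def w ..
qed

lemma kk_even: "kk (- xi) tau s = kk xi tau s"
proof -
  have w: "wz (of_real (- xi)) = wz (of_real xi)" by (simp add: wz_def)
  have "SSr (- xi) t = SSr xi t" for t unfolding SSr_def w ..
  then show ?thesis by (simp add: kk_def EEr_even)
qed

end

context time_interval
begin

text \<open>\<open>kk\<close> is the Green function of \<open>d\<^sup>2/dtau\<^sup>2 - ww xi\<close>, up to the factor \<open>- xi\<^sup>2\<close>.\<close>

lemma green_ode:
  fixes F :: "real => real" and xi :: real
  assumes F: "continuous_on {0<..<L} F" and int: "integrable lborel (\<lambda>s. indicator {0<..<L} s * (s * F s))"
  defines "I \<equiv> \<lambda>tau. \<integral>s. indicator {0<..<L} s * (kk xi tau s * F s) \<partial>lborel"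
  shows "\<exists>I'. \<forall>tau\<in>{0<..<L}. (I has_real_derivative I' tau) (at tau) \<and>
     (I' has_real_derivative ww xi * I tau - xi\<^sup>2 * F tau) (at tau)"
proof -
  \<comment> \<open>Variation of constants: in the first derivative the boundary terms of P and Q
    cancel, in the second they combine to the Wronskian times \<open>- F tau\<close>.\<close>
  define P where "P tau = (LINT s:{0<..<tau}|lborel. SSr xi s * F s)" for tau
  define Q where "Q tau = (LINT s:{tau<..<L}|lborel. EEr xi s * F s)" for tau
  define I' where "I' tau = xi\<^sup>2 * (EEd xi tau * P tau + CCr xi tau * Q tau)" for tau
  have Fm: "(\<lambda>s. indicator {0<..<L} s * F s) \<in> borel_measurable lborel"
    using borel_measurable_continuous_on_indicator[OF _ F] by simp
  have cont: "continuous_on {0<..<L} (\<lambda>s. SSr xi s * F s)" "continuous_on {0<..<L} (\<lambda>s. EEr xi s * F s)"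
    by (intro continuous_intros F)+
  \<comment> \<open>\<open>SSr xi s\<close> vanishes linearly at 0, so the assumed integrability of
    s F(s) suffices although F itself may fail to be integrable there.\<close>
  have iP: "set_integrable lborel {0<..<L} (\<lambda>s. SSr xi s * F s)"
  proof -
    define K where "K = exp (Re (csqrt (wz (of_real xi))) * L)"
    have S: "\<bar>SSr xi s\<bar> <= s * K" if "0 < s" "s < L" for s
    proof -
      have "\<bar>SSr xi s\<bar> <= norm (SS (wz (of_real xi)) s)" unfolding SSr_def by (rule abs_Re_le_cmod)
      also have "\<dots> <= s * exp (Re (csqrt (wz (of_real xi))) * s)" using that by (intro norm_SS_le2) auto
      also have "\<dots> <= s * K" unfolding K_def using that Re_csqrt_nonneg
        by (intro mult_left_mono) (auto intro: mult_left_mono)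
      finally show ?thesis .
    qed
    have "integrable lborel (\<lambda>s. SSr xi s * (indicator {0<..<L} s * F s))"
    proof (rule Bochner_Integration.integrable_bound[of _ "\<lambda>s. K * (indicator {0<..<L} s * (s * F s))"])
      show "integrable lborel (\<lambda>s. K * (indicator {0<..<L} s * (s * F s)))" using int by simp
      have "SSr xi \<in> borel_measurable borel"
        by (intro borel_measurable_continuous_onI continuous_intros)
      then show "(\<lambda>s. SSr xi s * (indicator {0<..<L} s * F s)) \<in> borel_measurable lborel"
        by (intro borel_measurable_times[OF _ Fm]) simp
      have "\<bar>SSr xi s * F s\<bar> <= \<bar>K * (s * F s)\<bar>" if "0 < s" "s < L" for s
      proof -
        have "\<bar>SSr xi s\<bar> * \<bar>F s\<bar> <= (s * K) * \<bar>F s\<bar>" using S[OF that] by (intro mult_right_mono) auto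
        then show ?thesis using that by (simp add: abs_mult K_def mult_ac)
      qed
      then show "AE s in lborel. norm (SSr xi s * (indicator {0<..<L} s * F s)) <= norm (K * (indicator {0<..<L} s * (s * F s)))"
        by (intro AE_I2) (auto simp: indicator_def)
    qed
    then show ?thesis unfolding set_integrable_def by (simp add: mult_ac)
  qed
  \<comment> \<open>\<open>EEr\<close> does not vanish at 0, hence the cut-off c; Q is only formed
    for tau > 0.\<close>
  have iQ: "set_integrable lborel {c<..<L} (\<lambda>s. EEr xi s * F s)" if c: "0 < c" for c
  proof -
    have "bounded (EEr xi ` {0..L})"
      by (intro compact_imp_bounded compact_continuous_image continuous_intros) auto
    then obtain K where "\<forall>s\<in>{0..L}. \<bar>EEr xi s\<bar> <= K" unfolding bounded_iff by auto
    then have K: "\<And>s. s \<in> {0..L} ==> \<bar>EEr xi s\<bar> <= K" by blast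
    have "integrable lborel (\<lambda>s. EEr xi s * (indicator {c<..<L} s * (indicator {0<..<L} s * F s)))"
    proof (rule Bochner_Integration.integrable_bound[of _ "\<lambda>s. (K / c) * (indicator {0<..<L} s * (s * F s))"])
      show "integrable lborel (\<lambda>s. (K / c) * (indicator {0<..<L} s * (s * F s)))" using int by simp
      have "EEr xi \<in> borel_measurable borel"
        by (intro borel_measurable_continuous_onI continuous_intros)
      then show "(\<lambda>s. EEr xi s * (indicator {c<..<L} s * (indicator {0<..<L} s * F s))) \<in> borel_measurable lborel"
        by (intro borel_measurable_times[OF _ borel_measurable_times[OF _ Fm]]) simp_all
      have "\<bar>EEr xi s * F s\<bar> <= \<bar>(K / c) * (s * F s)\<bar>" if "c < s" "s < L" for s
      proof -
        have K0: "K >= 0" using K[of 0] L by auto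
        have "K * c <= K * s" using that K0 by (intro mult_left_mono) auto
        then have "K <= K / c * s" using c by (simp add: field_simps)
        then have "\<bar>EEr xi s\<bar> <= K / c * s" using K[of s] that c by auto
        then have "\<bar>EEr xi s\<bar> * \<bar>F s\<bar> <= (K / c * s) * \<bar>F s\<bar>" by (intro mult_right_mono) auto
        then show ?thesis using that c K0 by (simp add: abs_mult mult_ac)
      qed
      then show "AE s in lborel. norm (EEr xi s * (indicator {c<..<L} s * (indicator {0<..<L} s * F s))) <= norm ((K / c) * (indicator {0<..<L} s * (s * F s)))"
        using c by (intro AE_I2) (auto simp: indicator_def)
    qed
    moreover have "(\<lambda>s. EEr xi s * (indicator {c<..<L} s * (indicator {0<..<L} s * F s))) = (\<lambda>s. indicator {c<..<L} s *\<^sub>R (EEr xi s * F s))"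
      using c by (auto simp: fun_eq_iff indicator_def)
    ultimately show ?thesis unfolding set_integrable_def by simp
  qed
  have P': "(P has_real_derivative SSr xi tau * F tau) (at tau)" if "tau \<in> {0<..<L}" for tau
    unfolding P_def by (rule deriv_integral_upper[OF _ _ cont(1) iP]) (use that in auto)
  have Q': "(Q has_real_derivative - (EEr xi tau * F tau)) (at tau)" if "tau \<in> {0<..<L}" for tau
    unfolding Q_def
    by (rule deriv_integral_lower[of "tau/2", OF _ _ continuous_on_subset[OF cont(2)] iQ]) (use that in auto)
  have I: "I tau = xi\<^sup>2 * (EEr xi tau * P tau + SSr xi tau * Q tau)" if t: "tau \<in> {0<..<L}" for tau
  proof -
    have "I tau = (\<integral>s. xi\<^sup>2 * EEr xi tau * (indicator {0<..<tau} s *\<^sub>R (SSr xi s * F s)) +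
        xi\<^sup>2 * SSr xi tau * (indicator {tau<..<L} s *\<^sub>R (EEr xi s * F s)) \<partial>lborel)"
      unfolding I_def
    proof (rule integral_cong_AE)
      show "(\<lambda>s. indicator {0<..<L} s * (kk xi tau s * F s)) \<in> borel_measurable lborel"
      proof -
        have "(\<lambda>s. kk xi tau s * (indicator {0<..<L} s * F s)) \<in> borel_measurable lborel"
          using Fm by measurable
        then show ?thesis by (simp add: mult_ac)
      qed
      have "set_integrable lborel {0<..<tau} (\<lambda>s. SSr xi s * F s)"
        using iP by (rule set_integrable_subset) (use t in auto)
      then show "(\<lambda>s. xi\<^sup>2 * EEr xi tau * (indicator {0<..<tau} s *\<^sub>R (SSr xi s * F s)) +
        xi\<^sup>2 * SSr xi tau * (indicator {tau<..<L} s *\<^sub>R (EEr xi s * F s))) \<in> borel_measurable lborel"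
        using iQ[of tau] t unfolding set_integrable_def
        by (intro borel_measurable_add borel_measurable_times borel_measurable_const borel_measurable_integrable) auto
      have "AE s in lborel. s \<noteq> tau" by (rule AE_lborel_singleton)
      then show "AE s in lborel. indicator {0<..<L} s * (kk xi tau s * F s) = xi\<^sup>2 * EEr xi tau * (indicator {0<..<tau} s *\<^sub>R (SSr xi s * F s)) +
        xi\<^sup>2 * SSr xi tau * (indicator {tau<..<L} s *\<^sub>R (EEr xi s * F s))"
        by eventually_elim (use t in \<open>auto simp: indicator_def kk_def\<close>)
    qed
    also have "\<dots> = xi\<^sup>2 * EEr xi tau * P tau + xi\<^sup>2 * SSr xi tau * Q tau"
    proof -
      have "set_integrable lborel {0<..<tau} (\<lambda>s. SSr xi s * F s)"
        using iP by (rule set_integrable_subset) (use t in auto)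
      then show ?thesis
        using iQ[of tau] t unfolding P_def Q_def set_integrable_def set_lebesgue_integral_def
        by (subst Bochner_Integration.integral_add) auto
    qed
    finally show ?thesis by (simp add: algebra_simps)
  qed
  have "(I has_real_derivative I' tau) (at tau) \<and> (I' has_real_derivative ww xi * I tau - xi\<^sup>2 * F tau) (at tau)"
    if t: "tau \<in> {0<..<L}" for tau
  proof
    have "((\<lambda>tau. xi\<^sup>2 * (EEr xi tau * P tau + SSr xi tau * Q tau)) has_real_derivative I' tau) (at tau)"
      unfolding I'_def
      by (auto intro!: derivative_eq_intros EEr_deriv SSr_deriv P'[OF t] Q'[OF t] simp: algebra_simps)
    then show "(I has_real_derivative I' tau) (at tau)"
      by (rule has_field_derivative_transform_within_open[where S = "{0<..<L}"]) (use t I in auto)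
    have "(I' has_real_derivative xi\<^sup>2 * ((ww xi * EEr xi tau * P tau + SSr xi tau * F tau * EEd xi tau) +
        (ww xi * SSr xi tau * Q tau + - (EEr xi tau * F tau) * CCr xi tau))) (at tau)"
      unfolding I'_def[abs_def]
      by (intro DERIV_cmult DERIV_add DERIV_mult EEd_deriv CCr_deriv P'[OF t] Q'[OF t])
    moreover have "xi\<^sup>2 * ((ww xi * EEr xi tau * P tau + SSr xi tau * F tau * EEd xi tau) +
        (ww xi * SSr xi tau * Q tau + - (EEr xi tau * F tau) * CCr xi tau)) =
        ww xi * (xi\<^sup>2 * (EEr xi tau * P tau + SSr xi tau * Q tau)) - xi\<^sup>2 * F tau * (EEr xi tau * CCr xi tau - EEd xi tau * SSr xi tau)"
      by (simp add: algebra_simps)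
    ultimately show "(I' has_real_derivative ww xi * I tau - xi\<^sup>2 * F tau) (at tau)"
      by (simp add: I[OF t] wronskian)
  qed
  then show ?thesis by blast
qed

end

section \<open>Weighted integrals and the fixed point\<close>

lemma nn_integral_powr_from_0:
  assumes "a > -1" "c >= 0"
  shows "(\<integral>\<^sup>+x. ennreal (x powr a) * indicator {0..c} x \<partial>lborel) = ennreal (c powr (a + 1) / (a + 1))"
  by (rule nn_integral_has_integral_lebesgue'[OF _ has_integral_powr_from_0[OF assms]]) auto

lemma nn_integral_powr_to_inf:
  assumes "a < -1" "c > 0"
  shows "(\<integral>\<^sup>+x. ennreal (x powr a) * indicator {c..} x \<partial>lborel) = ennreal (- (c powr (a + 1)) / (a + 1))"
  by (rule nn_integral_has_integral_lebesgue'[OF _ has_integral_powr_to_inf[OF assms]]) auto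

lemma nn_integral_inverse_square: "(\<integral>\<^sup>+x. ennreal (1 / (1 + x\<^sup>2)) \<partial>lborel) <= ennreal pi"
proof -
  define f where "f = (\<lambda>x::real. 1 / (1 + x\<^sup>2))"
  have m [measurable]: "f \<in> borel_measurable borel" unfolding f_def by measurable
  have h: "(\<integral>\<^sup>+x. ennreal (f x) * indicator {0..} x \<partial>lborel) = ennreal (pi / 2 - arctan 0)"
  proof (rule nn_integral_FTC_atLeast[OF m])
    show "(arctan has_real_derivative f x) (at x)" for x
      unfolding f_def using DERIV_arctan[of x] by (simp add: divide_inverse)
    show "0 <= f x" for x by (simp add: f_def)
    show "(arctan \<longlongrightarrow> pi/2) at_top" by (rule tendsto_arctan_at_top)
  qed
  have r: "(\<integral>\<^sup>+x. ennreal (f x) * indicator {..0} x \<partial>lborel) = (\<integral>\<^sup>+x. ennreal (f x) * indicator {0..} x \<partial>lborel)"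
    by (subst nn_integral_real_affine[where c = "-1" and t = 0]) (auto simp: f_def indicator_def)
  have "(\<integral>\<^sup>+x. ennreal (f x) \<partial>lborel) <= (\<integral>\<^sup>+x. ennreal (f x) * indicator {0..} x + ennreal (f x) * indicator {..0} x \<partial>lborel)"
    by (intro nn_integral_mono) (auto simp: indicator_def)
  also have "\<dots> = ennreal (pi / 2) + ennreal (pi / 2)"
    using h r by (subst nn_integral_add) auto
  also have "\<dots> = ennreal pi" by (simp flip: ennreal_plus)
  finally show ?thesis by (simp add: f_def)
qed

lemma integrable_inverse_square: "integrable lborel (\<lambda>x::real. 1 / (1 + x\<^sup>2))"
proof (rule integrableI_nonneg)
  show "(\<integral>\<^sup>+x. ennreal (1 / (1 + x\<^sup>2)) \<partial>lborel) < \<infinity>"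
    using nn_integral_inverse_square by (rule le_less_trans) simp
qed (auto simp: add_nonneg_nonneg)

lemma poly_exp_bound:
  fixes a :: real
  assumes a: "a > 0"
  shows "\<exists>C>0. \<forall>x. (1 + \<bar>x\<bar>) ^ n * exp (- (a * \<bar>x\<bar>)) <= C * (1 / (1 + x\<^sup>2))"
proof -
  define m where "m = n + 2"
  \<comment> \<open>From y <= (m/a) exp(a y / m) raised to the power m, with y = 1 + |x|; the two
    powers beyond n pay for the factor 1 + x^2.\<close>
  define C where "C = (real m / a) ^ m * exp a"
  have "(1 + \<bar>x\<bar>) ^ n * exp (- (a * \<bar>x\<bar>)) <= C * (1 / (1 + x\<^sup>2))" for x :: real
  proof -
    define y where "y = 1 + \<bar>x\<bar>"
    have y: "y >= 1" by (simp add: y_def)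
    have m0: "real m > 0" by (simp add: m_def)
    have "a * y / real m <= exp (a * y / real m)" using exp_ge_add_one_self[of "a * y / real m"] by linarith
    then have "(a * y / real m) ^ m <= exp (a * y / real m) ^ m" using a y by (intro power_mono) auto
    also have "\<dots> = exp (a * y)" using m0 by (simp flip: exp_of_nat_mult)
    finally have "(real m / a) ^ m * (a * y / real m) ^ m <= (real m / a) ^ m * exp (a * y)"
      using a by (intro mult_left_mono) auto
    also have "(real m / a) ^ m * (a * y / real m) ^ m = y ^ m"
      using a m0 by (simp flip: power_mult_distrib)
    finally have ym: "y ^ m <= C * exp (a * \<bar>x\<bar>)" by (simp add: C_def y_def distrib_left exp_add mult_ac)
    have "1 + x\<^sup>2 <= y ^ 2" by (simp add: y_def power2_sum)
    then have "(y ^ n * exp (- (a * \<bar>x\<bar>))) * (1 + x\<^sup>2) <= (y ^ n * exp (- (a * \<bar>x\<bar>))) * y ^ 2"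
      using y by (intro mult_left_mono) auto
    also have "\<dots> = y ^ m * exp (- (a * \<bar>x\<bar>))" by (simp add: m_def power_add power2_eq_square)
    also have "\<dots> <= C * exp (a * \<bar>x\<bar>) * exp (- (a * \<bar>x\<bar>))" using ym by (intro mult_right_mono) auto
    also have "\<dots> = C" by (simp add: exp_minus)
    finally have "(y ^ n * exp (- (a * \<bar>x\<bar>))) * (1 + x\<^sup>2) <= C" .
    then show ?thesis using add_pos_nonneg[of 1 "x^2"] by (simp add: y_def pos_le_divide_eq)
  qed
  moreover have "C > 0" using a by (simp add: C_def m_def)
  ultimately show ?thesis by blast
qed

lemma integrable_exp_abs: "a > 0 ==> integrable lborel (\<lambda>x::real. (1 + \<bar>x\<bar>) ^ n * exp (- (a * \<bar>x\<bar>)))"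
proof -
  assume a: "a > 0"
  obtain C where C: "C > 0" "\<And>x. (1 + \<bar>x\<bar>) ^ n * exp (- (a * \<bar>x\<bar>)) <= C * (1 / (1 + x\<^sup>2))"
    using poly_exp_bound[OF a, of n] by auto
  show ?thesis
  proof (rule Bochner_Integration.integrable_bound[of _ "\<lambda>x. C * (1 / (1 + x\<^sup>2))"])
    show "integrable lborel (\<lambda>x. C * (1 / (1 + x\<^sup>2)))"
      by (rule integrable_mult_right[OF integrable_inverse_square])
    show "AE x in lborel. norm ((1 + \<bar>x\<bar>) ^ n * exp (- (a * \<bar>x\<bar>))) <= norm (C * (1 / (1 + x\<^sup>2)))"
      using C by (intro AE_I2) (auto simp: abs_mult intro: order_trans[OF _ abs_ge_self])
  qed measurable
qed

lemma ennreal_abs_integral_le: "ennreal \<bar>\<integral>x. f x \<partial>M\<bar> <= (\<integral>\<^sup>+x. ennreal \<bar>f x\<bar> \<partial>M)" for f :: "'a => real"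
proof (cases "integrable M f")
  case True then show ?thesis using integral_norm_bound_ennreal[OF True] by simp
next
  case False then show ?thesis by (simp add: not_integrable_integral_eq)
qed

lemma nn_integral_translate:
  fixes f :: "real => ennreal"
  assumes [measurable]: "f \<in> borel_measurable borel"
  shows "(\<integral>\<^sup>+x. f (x + t) \<partial>lborel) = (\<integral>\<^sup>+x. f x \<partial>lborel)"
  using nn_integral_real_affine[of f 1 t] by (simp add: add.commute)

lemma nn_integral_convolution:
  fixes f g :: "real => ennreal"
  assumes [measurable]: "f \<in> borel_measurable borel" "g \<in> borel_measurable borel"
  shows "(\<integral>\<^sup>+x. (\<integral>\<^sup>+l. f (x - l) * g l \<partial>lborel) \<partial>lborel) = (\<integral>\<^sup>+x. f x \<partial>lborel) * (\<integral>\<^sup>+x. g x \<partial>lborel)"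
proof -
  have "(\<integral>\<^sup>+x. (\<integral>\<^sup>+l. f (x - l) * g l \<partial>lborel) \<partial>lborel) = (\<integral>\<^sup>+l. (\<integral>\<^sup>+x. f (x - l) * g l \<partial>lborel) \<partial>lborel)"
    by (rule lborel_pair.Fubini') measurable
  also have "\<dots> = (\<integral>\<^sup>+l. (\<integral>\<^sup>+x. f x \<partial>lborel) * g l \<partial>lborel)"
  proof (intro nn_integral_cong)
    fix l
    have "(\<integral>\<^sup>+x. f (x - l) * g l \<partial>lborel) = (\<integral>\<^sup>+x. f (x + (- l)) \<partial>lborel) * g l"
      by (subst nn_integral_multc) auto
    then show "(\<integral>\<^sup>+x. f (x - l) * g l \<partial>lborel) = (\<integral>\<^sup>+x. f x \<partial>lborel) * g l"
      by (subst (asm) nn_integral_translate) auto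
  qed
  also have "\<dots> = (\<integral>\<^sup>+x. f x \<partial>lborel) * (\<integral>\<^sup>+x. g x \<partial>lborel)"
    by (rule nn_integral_cmult) measurable
  finally show ?thesis .
qed

text \<open>Splitting at s = tau: the lower part converges at 0 because g < 2, the upper part
  extended to infinity converges because g + e > 1, and both scale like tau^(2-e-g). The exponent e
  is the power of the singular factor 1 / max left in the kernel.\<close>

lemma kappa_integral:
  fixes e g tau :: real
  assumes t: "0 < tau" and g: "1 - e < g" "g < 2"
  shows "(\<integral>\<^sup>+s. indicator {0<..<L} s * ennreal (min tau s * max tau s powr (- e) * s powr (- g)) \<partial>lborel)
     <= ennreal ((1 / (2 - g) + 1 / (g + e - 1)) * tau powr (2 - e - g))"
proof -
  have "(\<integral>\<^sup>+s. indicator {0<..<L} s * ennreal (min tau s * max tau s powr (- e) * s powr (- g)) \<partial>lborel) <=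
     (\<integral>\<^sup>+s. ennreal (tau powr (- e)) * (ennreal (s powr (1 - g)) * indicator {0..tau} s) +
         ennreal tau * (ennreal (s powr (- e - g)) * indicator {tau..} s) \<partial>lborel)"
  proof (intro nn_integral_mono)
    fix s :: real
    show "indicator {0<..<L} s * ennreal (min tau s * max tau s powr (- e) * s powr (- g)) <=
      ennreal (tau powr (- e)) * (ennreal (s powr (1 - g)) * indicator {0..tau} s) +
         ennreal tau * (ennreal (s powr (- e - g)) * indicator {tau..} s)"
    proof (cases "0 < s \<and> s < L")
      case False then show ?thesis by (auto simp: indicator_def)
    next
      case True
      show ?thesis
      proof (cases "s < tau")
        case True
        then have "s * s powr (- g) = s powr (1 - g)" using \<open>0 < s \<and> s < L\<close>
          by (simp add: powr_diff powr_minus field_simps)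
        then have "min tau s * max tau s powr (- e) * s powr (- g) = tau powr (- e) * s powr (1 - g)"
          using True by (simp add: mult_ac)
        then have "indicator {0<..<L} s * ennreal (min tau s * max tau s powr (- e) * s powr (- g)) = ennreal (tau powr (- e)) * (ennreal (s powr (1 - g)) * indicator {0..tau} s)"
          using True \<open>0 < s \<and> s < L\<close> t by (simp only: ennreal_mult' powr_ge_zero) simp
        then show ?thesis by simp
      next
        case False
        have "s powr (- e) * s powr (- g) = s powr (- e - g)" by (simp flip: powr_add)
        then have q: "min tau s * max tau s powr (- e) * s powr (- g) = tau * s powr (- e - g)"
          using False by (simp add: mult_ac)
        have "indicator {0<..<L} s * ennreal (min tau s * max tau s powr (- e) * s powr (- g)) = ennreal tau * (ennreal (s powr (- e - g)) * indicator {tau..} s)"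
          unfolding q using False \<open>0 < s \<and> s < L\<close> t by (simp add: ennreal_mult)
        then show ?thesis by simp
      qed
    qed
  qed
  also have "\<dots> = ennreal (tau powr (- e)) * ennreal (tau powr (1 - g + 1) / (1 - g + 1)) +
       ennreal tau * ennreal (- (tau powr (- e - g + 1)) / (- e - g + 1))"
  proof -
    have a: "(\<integral>\<^sup>+s. ennreal (s powr (1 - g)) * indicator {0..tau} s \<partial>lborel) = ennreal (tau powr (1 - g + 1) / (1 - g + 1))"
      by (rule nn_integral_powr_from_0) (use t g in auto)
    have b: "(\<integral>\<^sup>+s. ennreal (s powr (- e - g)) * indicator {tau..} s \<partial>lborel) = ennreal (- (tau powr (- e - g + 1)) / (- e - g + 1))"
      by (rule nn_integral_powr_to_inf) (use t g in auto)
    show ?thesis unfolding a[symmetric] b[symmetric]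
      by (subst nn_integral_add) (auto simp: nn_integral_cmult)
  qed
  also have "\<dots> = ennreal ((1 / (2 - g) + 1 / (g + e - 1)) * tau powr (2 - e - g))"
  proof -
    have 1: "tau powr (- e) * (tau powr (1 - g + 1) / (1 - g + 1)) = 1 / (2 - g) * tau powr (2 - e - g)"
      by (simp flip: powr_add) (simp add: algebra_simps)
    have t1: "tau * tau powr (- e - g + 1) = tau powr (2 - e - g)"
      using t powr_add[of tau 1 "- e - g + 1"] by (simp add: algebra_simps)
    have "- (tau powr (- e - g + 1)) / (- e - g + 1) = tau powr (- e - g + 1) / (g + e - 1)"
    proof -
      have n: "- e - g + 1 = - (g + e - 1)" by simp
      show ?thesis unfolding n by (simp only: minus_divide_divide)
    qed
    then have 2: "tau * (- (tau powr (- e - g + 1)) / (- e - g + 1)) = 1 / (g + e - 1) * tau powr (2 - e - g)"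
      using t1 by simp
    have "ennreal (tau powr (- e)) * ennreal (tau powr (1 - g + 1) / (1 - g + 1)) = ennreal (1 / (2 - g) * tau powr (2 - e - g))"
      using 1 by (metis ennreal_mult' powr_ge_zero)
    moreover have "ennreal tau * ennreal (- (tau powr (- e - g + 1)) / (- e - g + 1)) = ennreal (1 / (g + e - 1) * tau powr (2 - e - g))"
      using 2 t by (metis ennreal_mult' less_imp_le)
    ultimately show ?thesis using g by (simp add: distrib_right flip: ennreal_plus)
  qed
  finally show ?thesis .
qed

text \<open>Nothing but power bounds on the weight is retained. The exponent \<beta> of the upper
  bound is a little larger than the true rate, so as to include logarithms; the lower bound
  s^(1-2\<beta>) is the size of the kernel integral of b^2, and says that the nonlinearity is no
  more singular than b.\<close>

locale blowup_weight = time_interval +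
  fixes b :: "real => real" and \<beta> c0 Cb :: real
  assumes beta: "0 < \<beta>" "\<beta> < 1" and c0: "0 < c0"
    and b_meas [measurable]: "b \<in> borel_measurable borel"
    and b_upper: "\<And>s. 0 < s ==> s < L ==> b s <= Cb * s powr (- \<beta>)"
    and b_lower: "\<And>s. 0 < s ==> s < L ==> c0 * s powr (1 - 2 * \<beta>) <= b s"
begin

lemma b_pos: "0 < s ==> s < L ==> 0 < b s"
proof -
  assume s: "0 < s" "s < L"
  have "0 < c0 * s powr (1 - 2 * \<beta>)" using c0 s by (intro mult_pos_pos) auto
  then show ?thesis using b_lower[OF s] by linarith
qed

lemma Cb_pos: "0 < Cb"
proof -
  have "0 < b (L/2)" using L by (intro b_pos) auto
  also have "\<dots> <= Cb * (L/2) powr (- \<beta>)" using L by (intro b_upper) auto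
  finally show ?thesis using L by (simp add: zero_less_mult_iff)
qed

lemma b_local_bound:
  assumes a: "0 < a"
  shows "\<exists>K>0. \<forall>s. a <= s \<and> s < L --> b s <= K"
proof (intro exI conjI allI impI)
  show "Cb * a powr (- \<beta>) > 0" using Cb_pos a by simp
  fix s assume s: "a <= s \<and> s < L"
  have "b s <= Cb * s powr (- \<beta>)" using s a by (intro b_upper) auto
  also have "\<dots> <= Cb * a powr (- \<beta>)"
    using s a Cb_pos beta by (intro mult_left_mono powr_mono2') auto
  finally show "b s <= Cb * a powr (- \<beta>)" .
qed

text \<open>Evenness makes the Fourier integral a real cosine integral. Extension by zero outside
  the time interval lets all time integrals run over the whole line and gives joint
  measurability.\<close>

definition adm :: "(real \<times> real => real) => bool" where
  "adm V \<longleftrightarrow> continuous_on (UNIV \<times> {0<..<L}) V \<and> (\<forall>xi s. s \<notin> {0<..<L} --> V (xi, s) = 0) \<and>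
     (\<forall>xi s. V (- xi, s) = V (xi, s))"

text \<open>The sup and L1 parts together are stable under convolution, since L1 times sup is sup
  and L1 times L1 is L1; the exponential weight is submultiplicative. One function of s bounds
  both.\<close>

definition bnd :: "(real \<times> real => real) => (real => real) => bool" where
  "bnd V g \<longleftrightarrow> (\<forall>s\<in>{0<..<L}. (\<forall>xi. \<bar>V (xi, s)\<bar> * exp (s * \<bar>xi\<bar>) <= g s) \<and>
     (\<integral>\<^sup>+xi. ennreal (\<bar>V (xi, s)\<bar> * exp (s * \<bar>xi\<bar>)) \<partial>lborel) <= ennreal (g s))"

definition conv :: "(real \<times> real => real) => (real \<times> real => real) => real \<times> real => real" where
  "conv V W = (\<lambda>(xi, s). \<integral>l. V (xi - l, s) * W (l, s) \<partial>lborel)"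

text \<open>The integral over all s is really one over {0<..<L}, where admissible F live; the
  explicit 0 makes the result admissible again.\<close>

definition duh :: "(real \<times> real => real) => real \<times> real => real" where
  "duh F = (\<lambda>(xi, tau). if tau \<in> {0<..<L} then \<integral>s. kk xi tau s * F (xi, s) \<partial>lborel else 0)"

lemma admD:
  assumes "adm V"
  shows "continuous_on (UNIV \<times> {0<..<L}) V" "s \<notin> {0<..<L} ==> V (xi, s) = 0" "V (- xi, s) = V (xi, s)"
proof -
  note a = assms[unfolded adm_def]
  show "continuous_on (UNIV \<times> {0<..<L}) V" by (rule a[THEN conjunct1])
  show "s \<notin> {0<..<L} ==> V (xi, s) = 0" using a[THEN conjunct2, THEN conjunct1] by simp
  show "V (- xi, s) = V (xi, s)" using a[THEN conjunct2, THEN conjunct2] by simp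
qed

lemma bndD:
  assumes "bnd V g" "0 < s" "s < L"
  shows "\<bar>V (xi, s)\<bar> * exp (s * \<bar>xi\<bar>) <= g s" "\<bar>V (xi, s)\<bar> <= g s * exp (- (s * \<bar>xi\<bar>))"
    "(\<integral>\<^sup>+xi. ennreal (\<bar>V (xi, s)\<bar> * exp (s * \<bar>xi\<bar>)) \<partial>lborel) <= ennreal (g s)"
    "(\<integral>\<^sup>+xi. ennreal \<bar>V (xi, s)\<bar> \<partial>lborel) <= ennreal (g s)" "0 <= g s"
proof -
  show 1: "\<bar>V (xi, s)\<bar> * exp (s * \<bar>xi\<bar>) <= g s" for xi using assms unfolding bnd_def by auto
  then have "\<bar>V (xi, s)\<bar> * exp (s * \<bar>xi\<bar>) * exp (- (s * \<bar>xi\<bar>)) <= g s * exp (- (s * \<bar>xi\<bar>))"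
    by (intro mult_right_mono) auto
  then show "\<bar>V (xi, s)\<bar> <= g s * exp (- (s * \<bar>xi\<bar>))" by (simp add: mult.assoc flip: exp_add)
  show 2: "(\<integral>\<^sup>+xi. ennreal (\<bar>V (xi, s)\<bar> * exp (s * \<bar>xi\<bar>)) \<partial>lborel) <= ennreal (g s)"
    using assms unfolding bnd_def by auto
  have "(\<integral>\<^sup>+xi. ennreal \<bar>V (xi, s)\<bar> \<partial>lborel) <= (\<integral>\<^sup>+xi. ennreal (\<bar>V (xi, s)\<bar> * exp (s * \<bar>xi\<bar>)) \<partial>lborel)"
  proof (intro nn_integral_mono ennreal_leI)
    fix xi :: real
    have "\<bar>V (xi, s)\<bar> * 1 <= \<bar>V (xi, s)\<bar> * exp (s * \<bar>xi\<bar>)" using assms by (intro mult_left_mono) auto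
    then show "\<bar>V (xi, s)\<bar> <= \<bar>V (xi, s)\<bar> * exp (s * \<bar>xi\<bar>)" by simp
  qed
  then show "(\<integral>\<^sup>+xi. ennreal \<bar>V (xi, s)\<bar> \<partial>lborel) <= ennreal (g s)" using 2 by (rule order_trans)
  show "0 <= g s" using 1[of 0] by (smt (verit) abs_ge_zero exp_gt_zero mult_nonneg_nonneg)
qed

lemma adm_measurable:
  assumes "adm V" shows "V \<in> borel_measurable (borel \<Otimes>\<^sub>M borel)"
proof -
  have "(\<lambda>p. indicator (UNIV \<times> {0<..<L}) p *\<^sub>R V p) \<in> borel_measurable borel"
    by (rule borel_measurable_continuous_on_indicator[OF _ admD(1)[OF assms]])
      (intro borel_open open_Times; simp)
  moreover have "(\<lambda>p. indicator (UNIV \<times> {0<..<L}) p *\<^sub>R V p) = V"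
  proof
    fix p :: "real \<times> real"
    show "indicator (UNIV \<times> {0<..<L}) p *\<^sub>R V p = V p"
      using admD(2)[OF assms] by (cases p) (auto simp: indicator_def)
  qed
  ultimately show ?thesis by (simp add: borel_prod)
qed

lemma adm_section:
  assumes "adm V"
  shows "(\<lambda>xi. V (xi, s)) \<in> borel_measurable borel" "(\<lambda>s. V (xi, s)) \<in> borel_measurable borel"
proof -
  have 1: "(\<lambda>xi. (xi, s)) \<in> borel \<rightarrow>\<^sub>M borel \<Otimes>\<^sub>M borel" and 2: "(\<lambda>s. (xi, s)) \<in> borel \<rightarrow>\<^sub>M borel \<Otimes>\<^sub>M borel"
    by measurable
  show "(\<lambda>xi. V (xi, s)) \<in> borel_measurable borel" by (rule measurable_compose[OF 1 adm_measurable[OF assms]])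
  show "(\<lambda>s. V (xi, s)) \<in> borel_measurable borel" by (rule measurable_compose[OF 2 adm_measurable[OF assms]])
qed

lemma weight_triangle: "0 <= s ==> exp (s * \<bar>xi\<bar>) <= exp (s * \<bar>xi - l\<bar>) * exp (s * \<bar>l\<bar>)" for s xi l :: real
proof -
  assume s: "0 <= s"
  have "\<bar>xi\<bar> <= \<bar>xi - l\<bar> + \<bar>l\<bar>" by linarith
  then have "s * \<bar>xi\<bar> <= s * (\<bar>xi - l\<bar> + \<bar>l\<bar>)" using s by (intro mult_left_mono) auto
  then show ?thesis by (simp add: distrib_left flip: exp_add)
qed

lemma conv_integrable:
  assumes V: "adm V" and W: "adm W" and bV: "bnd V g" and bW: "bnd W k" and s: "0 < s" "s < L"
  shows "integrable lborel (\<lambda>l. V (xi - l, s) * W (l, s))"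
proof (rule Bochner_Integration.integrable_bound[of _ "\<lambda>l. g s * k s * ((1 + \<bar>l\<bar>) ^ 0 * exp (- (s * \<bar>l\<bar>)))"])
  show "integrable lborel (\<lambda>l. g s * k s * ((1 + \<bar>l\<bar>) ^ 0 * exp (- (s * \<bar>l\<bar>))))"
    by (rule integrable_mult_right[OF integrable_exp_abs[OF s(1)]])
  have "(\<lambda>l. V (xi - l, s)) \<in> borel_measurable borel"
    using measurable_compose[OF _ adm_section(1)[OF V], of "\<lambda>l. xi - l"] by simp
  then show "(\<lambda>l. V (xi - l, s) * W (l, s)) \<in> borel_measurable lborel"
    using adm_section(1)[OF W] by simp
  have "\<bar>V (xi - l, s) * W (l, s)\<bar> <= g s * k s * exp (- (s * \<bar>l\<bar>))" for l
  proof -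
    have "\<bar>V (xi - l, s)\<bar> <= g s * exp (- (s * \<bar>xi - l\<bar>))" by (rule bndD(2)[OF bV s])
    also have "\<dots> <= g s * 1" using s bndD(5)[OF bV s] by (intro mult_left_mono) auto
    finally have "\<bar>V (xi - l, s)\<bar> * \<bar>W (l, s)\<bar> <= (g s) * (k s * exp (- (s * \<bar>l\<bar>)))"
      using bndD(2)[OF bW s, of l] bndD(5)[OF bV s] by (intro mult_mono) auto
    then show ?thesis by (simp add: abs_mult mult.assoc)
  qed
  then show "AE l in lborel. norm (V (xi - l, s) * W (l, s)) <= norm (g s * k s * ((1 + \<bar>l\<bar>) ^ 0 * exp (- (s * \<bar>l\<bar>))))"
    by (intro AE_I2) (auto intro: order_trans[OF _ abs_ge_self])
qed

text \<open>Young's inequality for the weighted functions, by \<open>weight_triangle\<close>: one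
  pointwise majorant, a convolution, yields both parts of the norm.\<close>

lemma conv_bnd:
  assumes V: "adm V" and W: "adm W" and bV: "bnd V g" and bW: "bnd W k"
  shows "bnd (conv V W) (\<lambda>s. g s * k s)"
  unfolding bnd_def
proof (intro ballI conjI allI)
  fix s assume "s \<in> {0<..<L}"
  then have s: "0 < s" "s < L" by auto
  define v where "v xi = ennreal (\<bar>V (xi, s)\<bar> * exp (s * \<bar>xi\<bar>))" for xi
  define w where "w xi = ennreal (\<bar>W (xi, s)\<bar> * exp (s * \<bar>xi\<bar>))" for xi
  have [measurable]: "v \<in> borel_measurable borel" "w \<in> borel_measurable borel"
    unfolding v_def w_def using adm_section(1)[OF V] adm_section(1)[OF W] by measurable
  have g0: "0 <= g s" "0 <= k s" using bndD(5)[OF bV s] bndD(5)[OF bW s] by auto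
  have pt: "ennreal (\<bar>conv V W (xi, s)\<bar> * exp (s * \<bar>xi\<bar>)) <= (\<integral>\<^sup>+l. v (xi - l) * w l \<partial>lborel)" for xi
  proof -
    have "ennreal (\<bar>conv V W (xi, s)\<bar> * exp (s * \<bar>xi\<bar>)) = ennreal \<bar>\<integral>l. (V (xi - l, s) * W (l, s)) * exp (s * \<bar>xi\<bar>) \<partial>lborel\<bar>"
      by (simp add: conv_def abs_mult)
    also have "\<dots> <= (\<integral>\<^sup>+l. ennreal \<bar>(V (xi - l, s) * W (l, s)) * exp (s * \<bar>xi\<bar>)\<bar> \<partial>lborel)"
      by (rule ennreal_abs_integral_le)
    also have "\<dots> <= (\<integral>\<^sup>+l. v (xi - l) * w l \<partial>lborel)"
    proof (intro nn_integral_mono)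
      fix l
      have "\<bar>(V (xi - l, s) * W (l, s)) * exp (s * \<bar>xi\<bar>)\<bar> = \<bar>V (xi - l, s)\<bar> * \<bar>W (l, s)\<bar> * exp (s * \<bar>xi\<bar>)"
        by (simp add: abs_mult)
      also have "\<dots> <= \<bar>V (xi - l, s)\<bar> * \<bar>W (l, s)\<bar> * (exp (s * \<bar>xi - l\<bar>) * exp (s * \<bar>l\<bar>))"
        using weight_triangle[of s xi l] s by (intro mult_left_mono) auto
      also have "\<dots> = (\<bar>V (xi - l, s)\<bar> * exp (s * \<bar>xi - l\<bar>)) * (\<bar>W (l, s)\<bar> * exp (s * \<bar>l\<bar>))" by simp
      finally show "ennreal \<bar>(V (xi - l, s) * W (l, s)) * exp (s * \<bar>xi\<bar>)\<bar> <= v (xi - l) * w l"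
        unfolding v_def w_def by (subst ennreal_mult[symmetric]) (auto intro!: ennreal_leI)
    qed
    finally show ?thesis .
  qed
  show "\<bar>conv V W (xi, s)\<bar> * exp (s * \<bar>xi\<bar>) <= g s * k s" for xi
  proof -
    have "(\<integral>\<^sup>+l. v (xi - l) * w l \<partial>lborel) <= (\<integral>\<^sup>+l. ennreal (g s) * w l \<partial>lborel)"
      unfolding v_def by (intro nn_integral_mono mult_right_mono ennreal_leI bndD(1)[OF bV s]) auto
    also have "\<dots> = ennreal (g s) * (\<integral>\<^sup>+l. w l \<partial>lborel)" by (rule nn_integral_cmult) measurable
    also have "\<dots> <= ennreal (g s) * ennreal (k s)"
      unfolding w_def by (intro mult_left_mono bndD(3)[OF bW s]) auto
    finally have "ennreal (\<bar>conv V W (xi, s)\<bar> * exp (s * \<bar>xi\<bar>)) <= ennreal (g s * k s)"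
      using pt[of xi] g0 by (simp add: ennreal_mult)
    then show ?thesis using g0 by (simp add: ennreal_le_iff)
  qed
  have "(\<integral>\<^sup>+xi. ennreal (\<bar>conv V W (xi, s)\<bar> * exp (s * \<bar>xi\<bar>)) \<partial>lborel) <= (\<integral>\<^sup>+xi. (\<integral>\<^sup>+l. v (xi - l) * w l \<partial>lborel) \<partial>lborel)"
    by (intro nn_integral_mono pt)
  also have "\<dots> = (\<integral>\<^sup>+xi. v xi \<partial>lborel) * (\<integral>\<^sup>+xi. w xi \<partial>lborel)"
    by (rule nn_integral_convolution) measurable
  also have "\<dots> <= ennreal (g s) * ennreal (k s)"
    unfolding v_def w_def by (intro mult_mono bndD(3)[OF bV s] bndD(3)[OF bW s]) auto
  finally show "(\<integral>\<^sup>+xi. ennreal (\<bar>conv V W (xi, s)\<bar> * exp (s * \<bar>xi\<bar>)) \<partial>lborel) <= ennreal (g s * k s)"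
    using g0 by (simp add: ennreal_mult)
qed

lemma conv_adm:
  assumes V: "adm V" and W: "adm W" and bV: "bnd V (\<lambda>s. M1 * b s)" and bW: "bnd W (\<lambda>s. M2 * b s)"
  shows "adm (conv V W)"
  unfolding adm_def
proof (intro conjI allI impI)
  show "conv V W (xi, s) = 0" if "s \<notin> {0<..<L}" for xi s
    using admD(2)[OF V that] by (simp add: conv_def)
  show "conv V W (- xi, s) = conv V W (xi, s)" for xi s
  proof -
    have "(\<integral>l. V (- xi - l, s) * W (l, s) \<partial>lborel) = (\<integral>l. V (- xi + l, s) * W (- l, s) \<partial>lborel)"
      using lborel_integral_real_affine[of "-1" "\<lambda>l. V (- xi - l, s) * W (l, s)" 0] by simp
    also have "\<dots> = (\<integral>l. V (xi - l, s) * W (l, s) \<partial>lborel)"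
      using admD(3)[OF V, of "xi - _" s] by (simp add: admD(3)[OF W])
    finally show ?thesis by (simp add: conv_def)
  qed
  have "continuous_on (UNIV \<times> {0<..<L}) (\<lambda>p. \<integral>l. V (fst p - l, snd p) * W (l, snd p) \<partial>lborel)"
  proof (rule continuous_on_integral_dominated)
    fix p :: "real \<times> real" assume p: "p \<in> UNIV \<times> {0<..<L}"
    then have s: "0 < snd p" "snd p < L" by auto
    show "(\<lambda>l. V (fst p - l, snd p) * W (l, snd p)) \<in> borel_measurable lborel"
      using conv_integrable[OF V W bV bW s, of "fst p"] by auto
    define a where "a = snd p / 2"
    have a: "a > 0" using s by (simp add: a_def)
    obtain K where K: "K > 0" "\<And>s. a <= s ==> s < L ==> b s <= K" using b_local_bound[OF a] by blast
    have M0: "0 <= M1" "0 <= M2"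
      using bndD(5)[OF bV s] bndD(5)[OF bW s] b_pos[OF s] by (auto simp: zero_le_mult_iff)
    show "\<exists>e>0. \<exists>g. integrable lborel g \<and> (\<forall>y\<in>UNIV \<times> {0<..<L}. dist y p < e --> (\<forall>l. \<bar>V (fst y - l, snd y) * W (l, snd y)\<bar> <= g l))"
    proof (intro exI conjI ballI impI allI)
      show "a > 0" by fact
      show "integrable lborel (\<lambda>l. (M1 * K) * (M2 * K) * ((1 + \<bar>l\<bar>) ^ 0 * exp (- (a * \<bar>l\<bar>))))"
        by (rule integrable_mult_right[OF integrable_exp_abs[OF a]])
      fix y :: "real \<times> real" and l :: real
      assume y: "y \<in> UNIV \<times> {0<..<L}" "dist y p < a"
      have "\<bar>snd y - snd p\<bar> <= dist y p" using dist_snd_le[of y p] by (simp add: dist_real_def)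
      then have t: "a <= snd y" "0 < snd y" "snd y < L" using y a by (auto simp: a_def)
      have bK: "b (snd y) <= K" using K t by auto
      have b0: "0 < b (snd y)" using b_pos t by auto
      have "\<bar>V (fst y - l, snd y)\<bar> <= M1 * b (snd y) * exp (- (snd y * \<bar>fst y - l\<bar>))" by (rule bndD(2)[OF bV t(2,3)])
      also have "\<dots> <= M1 * K * 1" using t M0 bK b0 K by (intro mult_mono) auto
      finally have 1: "\<bar>V (fst y - l, snd y)\<bar> <= M1 * K" by simp
      have "\<bar>W (l, snd y)\<bar> <= M2 * b (snd y) * exp (- (snd y * \<bar>l\<bar>))" by (rule bndD(2)[OF bW t(2,3)])
      also have "\<dots> <= M2 * K * exp (- (a * \<bar>l\<bar>))" using t M0 bK b0 K by (intro mult_mono) (auto intro: mult_right_mono)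
      finally have 2: "\<bar>W (l, snd y)\<bar> <= M2 * K * exp (- (a * \<bar>l\<bar>))" .
      have "\<bar>V (fst y - l, snd y)\<bar> * \<bar>W (l, snd y)\<bar> <= (M1 * K) * (M2 * K * exp (- (a * \<bar>l\<bar>)))"
        using 1 2 M0 K by (intro mult_mono) auto
      then show "\<bar>V (fst y - l, snd y) * W (l, snd y)\<bar> <= (M1 * K) * (M2 * K) * ((1 + \<bar>l\<bar>) ^ 0 * exp (- (a * \<bar>l\<bar>)))"
        by (simp add: abs_mult mult_ac)
    qed
  next
    fix l :: real
    show "continuous_on (UNIV \<times> {0<..<L}) (\<lambda>p. V (fst p - l, snd p) * W (l, snd p))"
      by (intro continuous_on_mult continuous_on_compose2[OF admD(1)[OF V]] continuous_on_compose2[OF admD(1)[OF W]])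
        (auto intro!: continuous_intros)
  qed
  then show "continuous_on (UNIV \<times> {0<..<L}) (conv V W)"
    by (simp add: conv_def case_prod_unfold)
qed

lemma kernel_const: "\<exists>C>0. \<forall>xi tau s. 0 < tau \<and> tau < L \<and> 0 < s \<and> s < L -->
     \<bar>kk xi tau s\<bar> * exp ((tau - s) * \<bar>xi\<bar>) <= C * (min tau s / max tau s) \<and> \<bar>kk xi tau s\<bar> <= C * (min tau s / max tau s)"
proof -
  obtain C1 where C1: "C1 > 0" "\<forall>xi tau s. 0 < tau \<and> tau < L \<and> 0 < s \<and> s < L -->
     \<bar>kk xi tau s\<bar> * exp ((tau - s) * \<bar>xi\<bar>) <= C1 * (min tau s / max tau s)"
    using kk_weighted by blast
  obtain C2 h0 where C2: "C2 > 0" "h0 > 0" and k: "\<forall>h xi tau s. 0 < h \<and> h <= h0 \<and> 0 < tau \<and> tau < L \<and> 0 < s \<and> s < L -->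
     \<bar>(fd h ^^ 0) (\<lambda>xi. kk xi tau s) xi\<bar> <= C2 * h ^ 0 * (min tau s / max tau s) \<and>
     (0 = (1::nat) --> \<bar>(fd h ^^ 0) (\<lambda>xi. kk xi tau s) xi\<bar> <= C2 * h ^ 0 * (min tau s / sqrt (max tau s))) \<and>
     (0 = (2::nat) --> \<bar>(fd h ^^ 0) (\<lambda>xi. kk xi tau s) xi\<bar> <= C2 * h ^ 0 * min tau s)"
    using kk_diff[of 0] by - (elim exE conjE, rule that)
  show ?thesis
  proof (rule exI[of _ "C1 + C2"], intro conjI allI impI)
    show "0 < C1 + C2" using C1 C2 by simp
    fix xi tau s :: real assume t: "0 < tau \<and> tau < L \<and> 0 < s \<and> s < L"
    have r: "0 <= min tau s / max tau s" using t by auto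
    have "C1 * (min tau s / max tau s) <= (C1 + C2) * (min tau s / max tau s)"
      by (rule mult_right_mono[OF _ r]) (use C2 in simp)
    moreover have "C2 * (min tau s / max tau s) <= (C1 + C2) * (min tau s / max tau s)"
      by (rule mult_right_mono[OF _ r]) (use C1 in simp)
    moreover have "\<bar>kk xi tau s\<bar> <= C2 * (min tau s / max tau s)"
      using k[THEN spec, THEN spec, THEN spec, THEN spec, THEN mp, THEN conjunct1, of h0 tau s xi] C2(2) t by simp
    moreover have "\<bar>kk xi tau s\<bar> * exp ((tau - s) * \<bar>xi\<bar>) <= C1 * (min tau s / max tau s)" using C1(2) t by blast
    ultimately show "\<bar>kk xi tau s\<bar> * exp ((tau - s) * \<bar>xi\<bar>) <= (C1 + C2) * (min tau s / max tau s)" "\<bar>kk xi tau s\<bar> <= (C1 + C2) * (min tau s / max tau s)"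
      by linarith+
  qed
qed

text \<open>Chosen once and for all, so that the smallness conditions on the data can be written
  with the explicit constants \<open>Cq\<close> and \<open>Kp\<close>.\<close>

definition Ck :: real where
  "Ck = (SOME C. C > 0 \<and> (\<forall>xi tau s. 0 < tau \<and> tau < L \<and> 0 < s \<and> s < L -->
     \<bar>kk xi tau s\<bar> * exp ((tau - s) * \<bar>xi\<bar>) <= C * (min tau s / max tau s) \<and> \<bar>kk xi tau s\<bar> <= C * (min tau s / max tau s)))"

lemma Ck: "Ck > 0"
  "0 < tau ==> tau < L ==> 0 < s ==> s < L ==> \<bar>kk xi tau s\<bar> * exp ((tau - s) * \<bar>xi\<bar>) <= Ck * (min tau s / max tau s)"
  "0 < tau ==> tau < L ==> 0 < s ==> s < L ==> \<bar>kk xi tau s\<bar> <= Ck * (min tau s / max tau s)"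
proof -
  have c: "Ck > 0 \<and> (\<forall>xi tau s. 0 < tau \<and> tau < L \<and> 0 < s \<and> s < L -->
     \<bar>kk xi tau s\<bar> * exp ((tau - s) * \<bar>xi\<bar>) <= Ck * (min tau s / max tau s) \<and> \<bar>kk xi tau s\<bar> <= Ck * (min tau s / max tau s))"
    unfolding Ck_def using someI_ex[OF kernel_const] .
  show "Ck > 0" by (rule c[THEN conjunct1])
  note c2 = c[THEN conjunct2, THEN spec, THEN spec, THEN spec, THEN mp]
  show "0 < tau ==> tau < L ==> 0 < s ==> s < L ==> \<bar>kk xi tau s\<bar> * exp ((tau - s) * \<bar>xi\<bar>) <= Ck * (min tau s / max tau s)"
    by (rule c2[THEN conjunct1]) simp
  show "0 < tau ==> tau < L ==> 0 < s ==> s < L ==> \<bar>kk xi tau s\<bar> <= Ck * (min tau s / max tau s)"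
    by (rule c2[THEN conjunct2]) simp
qed

text \<open>Bound for the quadratic map: \<open>kappa_integral\<close> with e = 1 and g = 2 *
  \<beta> gives the bracket, \<open>Cb^2\<close> comes from the upper bound on b^2, and 1/c0
  converts tau^(1-2\<beta>) back into b.\<close>

definition Cq :: real where
  "Cq = Ck * (Cb\<^sup>2 * (1 / (2 - 2 * \<beta>) + 1 / (2 * \<beta>)) / c0)"

lemma Cq_pos: "Cq > 0"
proof -
  have "1 / (2 - 2 * \<beta>) + 1 / (2 * \<beta>) > 0" using beta by (simp add: add_pos_pos)
  then show ?thesis unfolding Cq_def using Ck(1) Cb_pos c0 by simp
qed

text \<open>This closes the contraction: squaring the weight and integrating against the kernel
  returns at most a multiple of the weight itself.\<close>

lemma kernel_weight_integral:
  assumes t: "0 < tau" "tau < L"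
  shows "(\<integral>\<^sup>+s. indicator {0<..<L} s * ennreal (Ck * (min tau s / max tau s) * (b s)\<^sup>2) \<partial>lborel) <= ennreal (Cq * b tau)"
proof -
  have "(\<integral>\<^sup>+s. indicator {0<..<L} s * ennreal (Ck * (min tau s / max tau s) * (b s)\<^sup>2) \<partial>lborel) <=
    (\<integral>\<^sup>+s. ennreal (Ck * Cb\<^sup>2) * (indicator {0<..<L} s * ennreal (min tau s * max tau s powr (- 1) * s powr (- (2 * \<beta>)))) \<partial>lborel)"
  proof (intro nn_integral_mono)
    fix s :: real
    show "indicator {0<..<L} s * ennreal (Ck * (min tau s / max tau s) * (b s)\<^sup>2) <=
      ennreal (Ck * Cb\<^sup>2) * (indicator {0<..<L} s * ennreal (min tau s * max tau s powr (- 1) * s powr (- (2 * \<beta>))))"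
    proof (cases "0 < s \<and> s < L")
      case True
      have "(b s)\<^sup>2 <= (Cb * s powr (- \<beta>))\<^sup>2"
        using b_upper[of s] b_pos[of s] True by (intro power_mono) auto
      also have "\<dots> = Cb\<^sup>2 * s powr (- (2 * \<beta>))"
        by (simp add: power_mult_distrib power2_eq_square flip: powr_add)
      finally have "Ck * (min tau s / max tau s) * (b s)\<^sup>2 <= Ck * (min tau s / max tau s) * (Cb\<^sup>2 * s powr (- (2 * \<beta>)))"
        using t True Ck(1) by (intro mult_left_mono) auto
      also have "\<dots> = (Ck * Cb\<^sup>2) * (min tau s * max tau s powr (- 1) * s powr (- (2 * \<beta>)))"
      proof -
        have "max tau s powr (- 1) = 1 / max tau s" using t True powr_neg_one[of "max tau s"] by simp
        then show ?thesis by simp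
      qed
      finally show ?thesis using True t Ck(1) by (simp add: ennreal_mult[symmetric] ennreal_leI)
    qed simp
  qed
  also have "\<dots> = ennreal (Ck * Cb\<^sup>2) * (\<integral>\<^sup>+s. indicator {0<..<L} s * ennreal (min tau s * max tau s powr (- 1) * s powr (- (2 * \<beta>))) \<partial>lborel)"
    by (rule nn_integral_cmult) measurable
  also have "\<dots> <= ennreal (Ck * Cb\<^sup>2) * ennreal ((1 / (2 - 2 * \<beta>) + 1 / (2 * \<beta> + 1 - 1)) * tau powr (2 - 1 - 2 * \<beta>))"
    by (rule mult_left_mono[OF kappa_integral]) (use t beta in auto)
  also have "\<dots> = ennreal (Ck * Cb\<^sup>2 * ((1 / (2 - 2 * \<beta>) + 1 / (2 * \<beta>)) * tau powr (1 - 2 * \<beta>)))"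
    using Ck(1) beta by (subst ennreal_mult[symmetric]) auto
  also have "\<dots> <= ennreal (Cq * b tau)"
  proof (rule ennreal_leI)
    have "tau powr (1 - 2 * \<beta>) <= b tau / c0" using b_lower[OF t] c0 by (simp add: pos_le_divide_eq mult.commute)
    then have "Ck * Cb\<^sup>2 * ((1 / (2 - 2 * \<beta>) + 1 / (2 * \<beta>)) * tau powr (1 - 2 * \<beta>)) <=
      Ck * Cb\<^sup>2 * ((1 / (2 - 2 * \<beta>) + 1 / (2 * \<beta>)) * (b tau / c0))"
      using Ck(1) beta by (intro mult_left_mono) auto
    also have "\<dots> = Cq * b tau" by (simp add: Cq_def)
    finally show "Ck * Cb\<^sup>2 * ((1 / (2 - 2 * \<beta>) + 1 / (2 * \<beta>)) * tau powr (1 - 2 * \<beta>)) <= Cq * b tau" .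
  qed
  finally show ?thesis .
qed

end

section \<open>The Duhamel operator and the contraction\<close>

context blowup_weight
begin

text \<open>s b(s)^2 is at most a multiple of s^(1-2\<beta>), and 1 - 2 \<beta> > -1. This is the
  majorant behind every Duhamel integral at positive tau; b^2 alone may fail to be
  integrable.\<close>

lemma integrable_s_b2: "integrable lborel (\<lambda>s. indicator {0<..<L} s * (s * (b s)\<^sup>2))"
proof (rule integrableI_bounded)
  show "(\<lambda>s. indicator {0<..<L} s * (s * (b s)\<^sup>2)) \<in> borel_measurable lborel" by measurable
  have "(\<integral>\<^sup>+s. ennreal (norm (indicator {0<..<L} s * (s * (b s)\<^sup>2))) \<partial>lborel) <=
     (\<integral>\<^sup>+s. ennreal (Cb\<^sup>2) * (ennreal (s powr (1 - 2 * \<beta>)) * indicator {0..L} s) \<partial>lborel)"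
  proof (intro nn_integral_mono)
    fix s :: real
    show "ennreal (norm (indicator {0<..<L} s * (s * (b s)\<^sup>2))) <= ennreal (Cb\<^sup>2) * (ennreal (s powr (1 - 2 * \<beta>)) * indicator {0..L} s)"
    proof (cases "0 < s \<and> s < L")
      case True
      have "(b s)\<^sup>2 <= (Cb * s powr (- \<beta>))\<^sup>2"
        using b_upper[of s] b_pos[of s] True by (intro power_mono) auto
      also have "\<dots> = Cb\<^sup>2 * s powr (- (2 * \<beta>))"
        by (simp add: power_mult_distrib power2_eq_square flip: powr_add)
      finally have "s * (b s)\<^sup>2 <= s * (Cb\<^sup>2 * s powr (- (2 * \<beta>)))" using True by (intro mult_left_mono) auto
      also have "\<dots> = Cb\<^sup>2 * s powr (1 - 2 * \<beta>)"
        using True by (simp add: powr_diff powr_minus field_simps)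
      finally show ?thesis using True by (simp add: abs_mult ennreal_mult[symmetric] ennreal_leI)
    qed (auto simp: indicator_def)
  qed
  also have "\<dots> = ennreal (Cb\<^sup>2) * ennreal (L powr (1 - 2 * \<beta> + 1) / (1 - 2 * \<beta> + 1))"
    using beta L by (subst nn_integral_cmult, measurable, subst nn_integral_powr_from_0) auto
  also have "\<dots> < \<infinity>" by (simp add: ennreal_mult_less_top)
  finally show "(\<integral>\<^sup>+s. ennreal (norm (indicator {0<..<L} s * (s * (b s)\<^sup>2))) \<partial>lborel) < \<infinity>" .
qed

lemma kk_F_bound:
  assumes F: "adm F" and t: "0 < tau" "tau < L"
  shows "\<bar>kk xi tau s * F (xi, s)\<bar> * exp (tau * \<bar>xi\<bar>) <= indicator {0<..<L} s * (Ck * (min tau s / max tau s) * (\<bar>F (xi, s)\<bar> * exp (s * \<bar>xi\<bar>)))"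
proof (cases "s \<in> {0<..<L}")
  case True
  have "exp (tau * \<bar>xi\<bar>) = exp ((tau - s) * \<bar>xi\<bar>) * exp (s * \<bar>xi\<bar>)"
    by (simp add: left_diff_distrib flip: exp_add)
  then have "\<bar>kk xi tau s * F (xi, s)\<bar> * exp (tau * \<bar>xi\<bar>) = (\<bar>kk xi tau s\<bar> * exp ((tau - s) * \<bar>xi\<bar>)) * (\<bar>F (xi, s)\<bar> * exp (s * \<bar>xi\<bar>))"
    by (simp add: abs_mult)
  also have "\<dots> <= (Ck * (min tau s / max tau s)) * (\<bar>F (xi, s)\<bar> * exp (s * \<bar>xi\<bar>))"
    using Ck(2)[of tau s xi] True t by (intro mult_right_mono) auto
  finally show ?thesis using True by simp
next
  case False
  then show ?thesis using admD(2)[OF F] by simp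
qed

lemma kk_F_measurable:
  assumes F: "adm F"
  shows "(\<lambda>s. kk xi tau s * F (xi, s)) \<in> borel_measurable borel"
  using adm_section(2)[OF F] by (intro borel_measurable_times kk_measurable) auto

text \<open>With tau >= a the ratio min/max is at most s/a, so a single majorant serves all xi and
  all such tau; continuity of \<open>duh F\<close> rests on this uniformity.\<close>

lemma kk_F_integrable:
  assumes F: "adm F" and bF: "bnd F (\<lambda>s. M * (b s)\<^sup>2)" and M: "0 <= M" and t: "0 < a" "a <= tau" "tau < L"
  shows "integrable lborel (\<lambda>s. kk xi tau s * F (xi, s))"
    "\<bar>kk xi tau s * F (xi, s)\<bar> <= Ck * M / a * (indicator {0<..<L} s * (s * (b s)\<^sup>2))"
proof -
  have 1: "\<bar>kk xi tau s * F (xi, s)\<bar> <= Ck * M / a * (indicator {0<..<L} s * (s * (b s)\<^sup>2))" for s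
  proof (cases "s \<in> {0<..<L}")
    case True
    have "\<bar>kk xi tau s * F (xi, s)\<bar> * 1 <= \<bar>kk xi tau s * F (xi, s)\<bar> * exp (tau * \<bar>xi\<bar>)"
      using t by (intro mult_left_mono) auto
    also have "\<dots> <= Ck * (min tau s / max tau s) * (\<bar>F (xi, s)\<bar> * exp (s * \<bar>xi\<bar>))"
      using kk_F_bound[OF F, of tau xi s] t True by simp
    also have "\<dots> <= Ck * (s / a) * (M * (b s)\<^sup>2)"
    proof (rule mult_mono)
      have "min tau s / max tau s <= s / a" using t True by (intro frac_le) auto
      then show "Ck * (min tau s / max tau s) <= Ck * (s / a)" using Ck(1) by (intro mult_left_mono) auto
      show "\<bar>F (xi, s)\<bar> * exp (s * \<bar>xi\<bar>) <= M * (b s)\<^sup>2" using bndD(1)[OF bF] True by auto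
    qed (use t True M Ck(1) in auto)
    finally show ?thesis using True by (simp add: mult_ac)
  next
    case False
    then show ?thesis using admD(2)[OF F] by simp
  qed
  show "\<bar>kk xi tau s * F (xi, s)\<bar> <= Ck * M / a * (indicator {0<..<L} s * (s * (b s)\<^sup>2))" by (rule 1)
  show "integrable lborel (\<lambda>s. kk xi tau s * F (xi, s))"
  proof (rule Bochner_Integration.integrable_bound)
    show "integrable lborel (\<lambda>s. Ck * M / a * (indicator {0<..<L} s * (s * (b s)\<^sup>2)))"
      by (rule integrable_mult_right[OF integrable_s_b2])
    show "AE s in lborel. norm (kk xi tau s * F (xi, s)) <= norm (Ck * M / a * (indicator {0<..<L} s * (s * (b s)\<^sup>2)))"
      by (intro AE_I2, unfold real_norm_def) (rule order_trans[OF 1 abs_ge_self])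
    show "(\<lambda>s. kk xi tau s * F (xi, s)) \<in> borel_measurable lborel" using kk_F_measurable[OF F] by simp
  qed
qed

text \<open>At each s both norms of F are at most M b(s)^2. For the sup part this is inserted
  pointwise, for the L1 part after Tonelli; both reduce to the scalar integral of
  \<open>kernel_weight_integral\<close>.\<close>

lemma duh_bnd:
  assumes F: "adm F" and bF: "bnd F (\<lambda>s. M * (b s)\<^sup>2)" and M: "0 <= M"
  shows "bnd (duh F) (\<lambda>s. M * Cq * b s)"
  unfolding bnd_def
proof (intro ballI conjI allI)
  fix tau assume "tau \<in> {0<..<L}"
  then have t: "0 < tau" "tau < L" by auto
  define R where "R s = indicator {0<..<L} s * (Ck * (min tau s / max tau s))" for s :: real
  have Rm [measurable]: "R \<in> borel_measurable borel" unfolding R_def by measurable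
  have R0: "R s >= 0" for s using t Ck(1) by (auto simp: R_def indicator_def)
  have Fm [measurable]: "F \<in> borel_measurable (borel \<Otimes>\<^sub>M borel)" by (rule adm_measurable[OF F])
  have pt: "ennreal (\<bar>duh F (xi, tau)\<bar> * exp (tau * \<bar>xi\<bar>)) <= (\<integral>\<^sup>+s. ennreal (R s) * ennreal (\<bar>F (xi, s)\<bar> * exp (s * \<bar>xi\<bar>)) \<partial>lborel)" for xi
  proof -
    have "ennreal (\<bar>duh F (xi, tau)\<bar> * exp (tau * \<bar>xi\<bar>)) = ennreal \<bar>\<integral>s. kk xi tau s * F (xi, s) * exp (tau * \<bar>xi\<bar>) \<partial>lborel\<bar>"
      using t by (simp add: duh_def abs_mult)
    also have "\<dots> <= (\<integral>\<^sup>+s. ennreal \<bar>kk xi tau s * F (xi, s) * exp (tau * \<bar>xi\<bar>)\<bar> \<partial>lborel)"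
      by (rule ennreal_abs_integral_le)
    also have "\<dots> <= (\<integral>\<^sup>+s. ennreal (R s) * ennreal (\<bar>F (xi, s)\<bar> * exp (s * \<bar>xi\<bar>)) \<partial>lborel)"
    proof (intro nn_integral_mono)
      fix s
      have "\<bar>kk xi tau s * F (xi, s) * exp (tau * \<bar>xi\<bar>)\<bar> <= R s * (\<bar>F (xi, s)\<bar> * exp (s * \<bar>xi\<bar>))"
        using kk_F_bound[OF F t, of xi s] by (simp add: R_def abs_mult mult.assoc)
      then show "ennreal \<bar>kk xi tau s * F (xi, s) * exp (tau * \<bar>xi\<bar>)\<bar> <= ennreal (R s) * ennreal (\<bar>F (xi, s)\<bar> * exp (s * \<bar>xi\<bar>))"
        using R0 by (subst ennreal_mult[symmetric]) (auto intro!: ennreal_leI)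
    qed
    finally show ?thesis .
  qed
  have tot: "(\<integral>\<^sup>+s. ennreal (R s) * ennreal (M * (b s)\<^sup>2) \<partial>lborel) <= ennreal (M * Cq * b tau)"
  proof -
    have "(\<integral>\<^sup>+s. ennreal (R s) * ennreal (M * (b s)\<^sup>2) \<partial>lborel) = (\<integral>\<^sup>+s. ennreal M * (indicator {0<..<L} s * ennreal (Ck * (min tau s / max tau s) * (b s)\<^sup>2)) \<partial>lborel)"
    proof (intro nn_integral_cong)
      fix s
      show "ennreal (R s) * ennreal (M * (b s)\<^sup>2) = ennreal M * (indicator {0<..<L} s * ennreal (Ck * (min tau s / max tau s) * (b s)\<^sup>2))"
      proof (cases "s \<in> {0<..<L}")
        case True
        have "ennreal (R s) * ennreal (M * (b s)\<^sup>2) = ennreal (R s * (M * (b s)\<^sup>2))"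
          using R0 M by (subst ennreal_mult) auto
        also have "R s * (M * (b s)\<^sup>2) = M * (Ck * (min tau s / max tau s) * (b s)\<^sup>2)" using True by (simp add: R_def)
        also have "ennreal \<dots> = ennreal M * ennreal (Ck * (min tau s / max tau s) * (b s)\<^sup>2)"
          using M t True Ck(1) by (subst ennreal_mult) auto
        finally show ?thesis using True by simp
      qed (simp add: R_def)
    qed
    also have "\<dots> = ennreal M * (\<integral>\<^sup>+s. indicator {0<..<L} s * ennreal (Ck * (min tau s / max tau s) * (b s)\<^sup>2) \<partial>lborel)"
      by (rule nn_integral_cmult) measurable
    also have "\<dots> <= ennreal M * ennreal (Cq * b tau)" by (intro mult_left_mono kernel_weight_integral t) auto
    also have "\<dots> = ennreal (M * Cq * b tau)"
      using M Cq_pos b_pos[OF t] by (subst ennreal_mult[symmetric]) (auto simp: mult.assoc)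
    finally show ?thesis .
  qed
  have r0: "0 <= M * Cq * b tau" using M Cq_pos b_pos[OF t] by simp
  show "\<bar>duh F (xi, tau)\<bar> * exp (tau * \<bar>xi\<bar>) <= M * Cq * b tau" for xi
  proof -
    have "(\<integral>\<^sup>+s. ennreal (R s) * ennreal (\<bar>F (xi, s)\<bar> * exp (s * \<bar>xi\<bar>)) \<partial>lborel) <= (\<integral>\<^sup>+s. ennreal (R s) * ennreal (M * (b s)\<^sup>2) \<partial>lborel)"
    proof (intro nn_integral_mono)
      fix s
      show "ennreal (R s) * ennreal (\<bar>F (xi, s)\<bar> * exp (s * \<bar>xi\<bar>)) <= ennreal (R s) * ennreal (M * (b s)\<^sup>2)"
      proof (cases "s \<in> {0<..<L}")
        case True
        then show ?thesis using bndD(1)[OF bF, of s xi] by (intro mult_left_mono ennreal_leI) auto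
      qed (simp add: R_def)
    qed
    then have "ennreal (\<bar>duh F (xi, tau)\<bar> * exp (tau * \<bar>xi\<bar>)) <= ennreal (M * Cq * b tau)"
      using pt[of xi] tot by (meson order_trans)
    then show ?thesis using r0 by (simp add: ennreal_le_iff)
  qed
  have "(\<integral>\<^sup>+xi. ennreal (\<bar>duh F (xi, tau)\<bar> * exp (tau * \<bar>xi\<bar>)) \<partial>lborel) <=
     (\<integral>\<^sup>+xi. (\<integral>\<^sup>+s. ennreal (R s) * ennreal (\<bar>F (xi, s)\<bar> * exp (s * \<bar>xi\<bar>)) \<partial>lborel) \<partial>lborel)"
    by (intro nn_integral_mono pt)
  also have "\<dots> = (\<integral>\<^sup>+s. (\<integral>\<^sup>+xi. ennreal (R s) * ennreal (\<bar>F (xi, s)\<bar> * exp (s * \<bar>xi\<bar>)) \<partial>lborel) \<partial>lborel)"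
    by (rule lborel_pair.Fubini') measurable
  also have "\<dots> = (\<integral>\<^sup>+s. ennreal (R s) * (\<integral>\<^sup>+xi. ennreal (\<bar>F (xi, s)\<bar> * exp (s * \<bar>xi\<bar>)) \<partial>lborel) \<partial>lborel)"
    by (intro nn_integral_cong nn_integral_cmult) measurable
  also have "\<dots> <= (\<integral>\<^sup>+s. ennreal (R s) * ennreal (M * (b s)\<^sup>2) \<partial>lborel)"
  proof (intro nn_integral_mono)
    fix s
    show "ennreal (R s) * (\<integral>\<^sup>+xi. ennreal (\<bar>F (xi, s)\<bar> * exp (s * \<bar>xi\<bar>)) \<partial>lborel) <= ennreal (R s) * ennreal (M * (b s)\<^sup>2)"
    proof (cases "s \<in> {0<..<L}")
      case True
      then show ?thesis using bndD(3)[OF bF, of s] by (intro mult_left_mono) auto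
    qed (simp add: R_def)
  qed
  also note tot
  finally show "(\<integral>\<^sup>+xi. ennreal (\<bar>duh F (xi, tau)\<bar> * exp (tau * \<bar>xi\<bar>)) \<partial>lborel) <= ennreal (M * Cq * b tau)" .
qed

lemma duh_adm:
  assumes F: "adm F" and bF: "bnd F (\<lambda>s. M * (b s)\<^sup>2)" and M: "0 <= M"
  shows "adm (duh F)"
  unfolding adm_def
proof (intro conjI allI impI)
  show "duh F (xi, s) = 0" if "s \<notin> {0<..<L}" for xi s using that by (auto simp: duh_def)
  show "duh F (- xi, s) = duh F (xi, s)" for xi s
    by (simp add: duh_def kk_even admD(3)[OF F])
  have "continuous_on (UNIV \<times> {0<..<L}) (\<lambda>p. \<integral>s. kk (fst p) (snd p) s * F (fst p, s) \<partial>lborel)"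
  proof (rule continuous_on_integral_dominated)
    fix p :: "real \<times> real" assume p: "p \<in> UNIV \<times> {0<..<L}"
    show "(\<lambda>s. kk (fst p) (snd p) s * F (fst p, s)) \<in> borel_measurable lborel"
      using kk_F_measurable[OF F] by simp
    define a where "a = snd p / 2"
    have a: "a > 0" using p by (auto simp: a_def)
    show "\<exists>e>0. \<exists>g. integrable lborel g \<and> (\<forall>y\<in>UNIV \<times> {0<..<L}. dist y p < e --> (\<forall>s. \<bar>kk (fst y) (snd y) s * F (fst y, s)\<bar> <= g s))"
    proof (intro exI conjI ballI impI allI)
      show "a > 0" by fact
      show "integrable lborel (\<lambda>s. Ck * M / a * (indicator {0<..<L} s * (s * (b s)\<^sup>2)))"
        by (rule integrable_mult_right[OF integrable_s_b2])
      fix y :: "real \<times> real" and s :: real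
      assume y: "y \<in> UNIV \<times> {0<..<L}" "dist y p < a"
      have "\<bar>snd y - snd p\<bar> <= dist y p" using dist_snd_le[of y p] by (simp add: dist_real_def)
      then have t: "a <= snd y" "snd y < L" using y a by (auto simp: a_def)
      show "\<bar>kk (fst y) (snd y) s * F (fst y, s)\<bar> <= Ck * M / a * (indicator {0<..<L} s * (s * (b s)\<^sup>2))"
        by (rule kk_F_integrable(2)[OF F bF M a t])
    qed
  next
    fix s :: real
    show "continuous_on (UNIV \<times> {0<..<L}) (\<lambda>p. kk (fst p) (snd p) s * F (fst p, s))"
    proof (cases "s \<in> {0<..<L}")
      case True
      show ?thesis
        by (intro continuous_on_mult kk_cont' continuous_on_compose2[OF admD(1)[OF F]])
          (use True in \<open>auto intro!: continuous_intros\<close>)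
    next
      case False
      then show ?thesis using admD(2)[OF F] by simp
    qed
  qed
  then show "continuous_on (UNIV \<times> {0<..<L}) (duh F)"
    by (rule continuous_on_eq) (auto simp: duh_def)
qed

lemma adm_add: "adm V ==> adm W ==> adm (\<lambda>p. V p + W p)"
  and adm_diff: "adm V ==> adm W ==> adm (\<lambda>p. V p - W p)"
  and adm_0: "adm (\<lambda>p. 0)"
  unfolding adm_def by (auto intro!: continuous_intros)

lemma bnd_add:
  assumes V: "adm V" and W: "adm W" and bV: "bnd V g" and bW: "bnd W k"
  shows "bnd (\<lambda>p. V p + W p) (\<lambda>s. g s + k s)" "bnd (\<lambda>p. V p - W p) (\<lambda>s. g s + k s)"
proof -
  have *: "bnd U (\<lambda>s. g s + k s)" if U: "\<And>p. \<bar>U p\<bar> <= \<bar>V p\<bar> + \<bar>W p\<bar>" for U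
    unfolding bnd_def
  proof (intro ballI conjI allI)
    fix s assume "s \<in> {0<..<L}"
    then have s: "0 < s" "s < L" by auto
    have pt: "\<bar>U (xi, s)\<bar> * exp (s * \<bar>xi\<bar>) <= \<bar>V (xi, s)\<bar> * exp (s * \<bar>xi\<bar>) + \<bar>W (xi, s)\<bar> * exp (s * \<bar>xi\<bar>)" for xi
      using mult_right_mono[OF U[of "(xi, s)"], of "exp (s * \<bar>xi\<bar>)"] by (simp add: distrib_right)
    show "\<bar>U (xi, s)\<bar> * exp (s * \<bar>xi\<bar>) <= g s + k s" for xi
      using pt[of xi] bndD(1)[OF bV s, of xi] bndD(1)[OF bW s, of xi] by linarith
    have [measurable]: "(\<lambda>xi. V (xi, s)) \<in> borel_measurable borel" "(\<lambda>xi. W (xi, s)) \<in> borel_measurable borel"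
      by (rule adm_section[OF V] adm_section[OF W])+
    have "(\<integral>\<^sup>+xi. ennreal (\<bar>U (xi, s)\<bar> * exp (s * \<bar>xi\<bar>)) \<partial>lborel) <=
      (\<integral>\<^sup>+xi. ennreal (\<bar>V (xi, s)\<bar> * exp (s * \<bar>xi\<bar>)) + ennreal (\<bar>W (xi, s)\<bar> * exp (s * \<bar>xi\<bar>)) \<partial>lborel)"
      using pt by (intro nn_integral_mono) (simp add: ennreal_leI flip: ennreal_plus)
    also have "\<dots> = (\<integral>\<^sup>+xi. ennreal (\<bar>V (xi, s)\<bar> * exp (s * \<bar>xi\<bar>)) \<partial>lborel) + (\<integral>\<^sup>+xi. ennreal (\<bar>W (xi, s)\<bar> * exp (s * \<bar>xi\<bar>)) \<partial>lborel)"
      by (rule nn_integral_add) measurable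
    also have "\<dots> <= ennreal (g s) + ennreal (k s)" by (intro add_mono bndD(3)[OF bV s] bndD(3)[OF bW s])
    also have "\<dots> = ennreal (g s + k s)" using bndD(5)[OF bV s] bndD(5)[OF bW s] by (simp add: ennreal_plus)
    finally show "(\<integral>\<^sup>+xi. ennreal (\<bar>U (xi, s)\<bar> * exp (s * \<bar>xi\<bar>)) \<partial>lborel) <= ennreal (g s + k s)" .
  qed
  show "bnd (\<lambda>p. V p + W p) (\<lambda>s. g s + k s)" by (rule *) (rule abs_triangle_ineq)
  show "bnd (\<lambda>p. V p - W p) (\<lambda>s. g s + k s)" by (rule *) (rule abs_triangle_ineq4)
qed

lemma bnd_cong: "bnd V g ==> (\<And>s. 0 < s ==> s < L ==> g s <= k s) ==> bnd V k"
proof -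
  assume V: "bnd V g" and gk: "\<And>s. 0 < s ==> s < L ==> g s <= k s"
  show "bnd V k" unfolding bnd_def
  proof (intro ballI conjI allI)
    fix s assume "s \<in> {0<..<L}"
    then have s: "0 < s" "s < L" by auto
    show "\<bar>V (xi, s)\<bar> * exp (s * \<bar>xi\<bar>) <= k s" for xi
      using bndD(1)[OF V s, of xi] gk[OF s] by linarith
    show "(\<integral>\<^sup>+xi. ennreal (\<bar>V (xi, s)\<bar> * exp (s * \<bar>xi\<bar>)) \<partial>lborel) <= ennreal (k s)"
      using bndD(3)[OF V s] ennreal_leI[OF gk[OF s]] by (rule order_trans)
  qed
qed

lemma conv_bnd_b:
  assumes "adm V" "adm W" "bnd V (\<lambda>s. M1 * b s)" "bnd W (\<lambda>s. M2 * b s)"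
  shows "bnd (conv V W) (\<lambda>s. M1 * M2 * (b s)\<^sup>2)"
  using conv_bnd[OF assms] by (simp add: power2_eq_square mult_ac)

definition TT :: "(real \<times> real => real) => (real \<times> real => real) => real \<times> real => real" where
  "TT \<Phi> V = (\<lambda>p. \<Phi> p + duh (conv V V) p)"

lemma TT_adm_bnd:
  assumes P: "adm \<Phi>" "bnd \<Phi> (\<lambda>s. \<epsilon> * b s)" and V: "adm V" "bnd V (\<lambda>s. M * b s)"
  shows "adm (TT \<Phi> V)" "bnd (TT \<Phi> V) (\<lambda>s. (\<epsilon> + M\<^sup>2 * Cq) * b s)"
proof -
  note c = conv_adm[OF V(1) V(1) V(2) V(2)] conv_bnd_b[OF V(1) V(1) V(2) V(2)]
  have M: "0 <= M * M" by simp
  note d = duh_adm[OF c M] duh_bnd[OF c M]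
  show "adm (TT \<Phi> V)" unfolding TT_def by (intro adm_add P d)
  show "bnd (TT \<Phi> V) (\<lambda>s. (\<epsilon> + M\<^sup>2 * Cq) * b s)"
    unfolding TT_def using bnd_add(1)[OF P(1) d(1) P(2) d(2)] by (simp add: distrib_right power2_eq_square)
qed

lemma TT_lipschitz:
  assumes V: "adm V" "bnd V (\<lambda>s. M * b s)" and W: "adm W" "bnd W (\<lambda>s. M * b s)"
    and D: "bnd (\<lambda>p. V p - W p) (\<lambda>s. d * b s)" and M: "0 <= M" "0 <= d"
  shows "bnd (\<lambda>p. TT \<Phi> V p - TT \<Phi> W p) (\<lambda>s. 2 * M * d * Cq * b s)"
proof -
  define U where "U = (\<lambda>p. V p - W p)"
  have U: "adm U" "bnd U (\<lambda>s. d * b s)" using adm_diff[OF V(1) W(1)] D by (auto simp: U_def)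
  note c1 = conv_adm[OF U(1) V(1) U(2) V(2)] conv_bnd_b[OF U(1) V(1) U(2) V(2)]
  note c2 = conv_adm[OF W(1) U(1) W(2) U(2)] conv_bnd_b[OF W(1) U(1) W(2) U(2)]
  note cV = conv_adm[OF V(1) V(1) V(2) V(2)] conv_bnd_b[OF V(1) V(1) V(2) V(2)]
  note cW = conv_adm[OF W(1) W(1) W(2) W(2)] conv_bnd_b[OF W(1) W(1) W(2) W(2)]
  have nn: "0 <= d * M" "0 <= M * d" "0 <= M * M" using M by auto
  note d1 = duh_adm[OF c1 nn(1)] duh_bnd[OF c1 nn(1)]
  note d2 = duh_adm[OF c2 nn(2)] duh_bnd[OF c2 nn(2)]
  \<comment> \<open>V*V - W*W = (V-W)*V + W*(V-W); the splitting keeps the order of the factors, so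
    commutativity of the convolution is not invoked.\<close>
  have cs: "conv V V (xi, s) - conv W W (xi, s) = conv U V (xi, s) + conv W U (xi, s)" for xi s
  proof (cases "s \<in> {0<..<L}")
    case True
    then have s: "0 < s" "s < L" by auto
    note i = conv_integrable[OF V(1) V(1) V(2) V(2) s, of xi] conv_integrable[OF W(1) W(1) W(2) W(2) s, of xi]
      conv_integrable[OF U(1) V(1) U(2) V(2) s, of xi] conv_integrable[OF W(1) U(1) W(2) U(2) s, of xi]
    show ?thesis unfolding conv_def using i
      by (simp add: U_def algebra_simps flip: Bochner_Integration.integral_diff Bochner_Integration.integral_add)
  next
    case False
    then show ?thesis using admD(2)[OF V(1)] admD(2)[OF W(1)] by (simp add: conv_def U_def)
  qed
  have ds: "duh (conv V V) p - duh (conv W W) p = duh (conv U V) p + duh (conv W U) p" for p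
  proof (cases p)
    case (Pair xi tau)
    show ?thesis
    proof (cases "tau \<in> {0<..<L}")
      case True
      then have t: "0 < tau" "tau <= tau" "tau < L" by auto
      note i = kk_F_integrable(1)[OF cV nn(3) t, of xi] kk_F_integrable(1)[OF cW nn(3) t, of xi]
        kk_F_integrable(1)[OF c1 nn(1) t, of xi] kk_F_integrable(1)[OF c2 nn(2) t, of xi]
      have "(\<integral>s. kk xi tau s * conv V V (xi, s) \<partial>lborel) - (\<integral>s. kk xi tau s * conv W W (xi, s) \<partial>lborel) =
         (\<integral>s. kk xi tau s * (conv V V (xi, s) - conv W W (xi, s)) \<partial>lborel)"
        using i by (simp add: right_diff_distrib)
      also have "\<dots> = (\<integral>s. kk xi tau s * conv U V (xi, s) \<partial>lborel) + (\<integral>s. kk xi tau s * conv W U (xi, s) \<partial>lborel)"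
        unfolding cs using i by (simp add: distrib_left)
      finally show ?thesis using True by (simp add: duh_def Pair)
    qed (auto simp: duh_def Pair)
  qed
  have "(\<lambda>p. TT \<Phi> V p - TT \<Phi> W p) = (\<lambda>p. duh (conv U V) p + duh (conv W U) p)"
    using ds by (simp add: TT_def fun_eq_iff)
  then show ?thesis
    using bnd_add(1)[OF d1(1) d2(1) d1(2) d2(2)] by (simp add: mult_ac)
qed

text \<open>Completeness of the weighted space in the form the iteration uses: a geometrically
  decreasing series, summing to the factor 2.\<close>

lemma bnd_suminf:
  assumes D: "\<And>n. adm (D n)" "\<And>n. bnd (D n) (\<lambda>s. c * (1/2) ^ n * b s)" and c: "0 <= c"
  shows "0 < s ==> s < L ==> summable (\<lambda>n. D n (xi, s))"
    "bnd (\<lambda>p. \<Sum>n. D n p) (\<lambda>s. 2 * c * b s)"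
proof -
  have bd: "\<bar>D n (xi, s)\<bar> * exp (s * \<bar>xi\<bar>) <= c * b s * (1/2)^n" if "0 < s" "s < L" for n xi s
    using bndD(1)[OF D(2) that, of n xi] by (simp add: mult_ac)
  have sg: "summable (\<lambda>n. c * b s * (1/2::real)^n)" for s by (intro summable_mult summable_geometric) simp
  have sumg: "(\<Sum>n. c * b s * (1/2)^n) = 2 * c * b s" for s
    using suminf_mult[of "\<lambda>n. (1/2::real)^n" "c * b s"] suminf_geometric[of "1/2::real"] by (simp add: summable_geometric)
  have sa: "summable (\<lambda>n. \<bar>D n (xi, s)\<bar> * exp (s * \<bar>xi\<bar>))" if "0 < s" "s < L" for xi s
    using sg[of s] by (rule summable_comparison_test') (use bd[OF that] in auto)
  have sn: "summable (\<lambda>n. \<bar>D n (xi, s)\<bar>)" if "0 < s" "s < L" for xi s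
    using summable_mult2[OF sa[OF that], of xi "exp (- (s * \<bar>xi\<bar>))"] by (simp add: mult.assoc flip: exp_add)
  show sm: "summable (\<lambda>n. D n (xi, s))" if "0 < s" "s < L" for xi s
    by (rule summable_rabs_cancel[OF sn[OF that]])
  show "bnd (\<lambda>p. \<Sum>n. D n p) (\<lambda>s. 2 * c * b s)"
    unfolding bnd_def
  proof (intro ballI conjI allI)
    fix s assume "s \<in> {0<..<L}"
    then have s: "0 < s" "s < L" by auto
    have b0: "0 < b s" by (rule b_pos[OF s])
    have pt: "\<bar>\<Sum>n. D n (xi, s)\<bar> * exp (s * \<bar>xi\<bar>) <= (\<Sum>n. \<bar>D n (xi, s)\<bar> * exp (s * \<bar>xi\<bar>))" for xi
      using mult_right_mono[OF summable_rabs[OF sn[OF s, of xi]], of "exp (s * \<bar>xi\<bar>)"]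
      by (simp add: suminf_mult2[OF sn[OF s, of xi]])
    show "\<bar>\<Sum>n. D n (xi, s)\<bar> * exp (s * \<bar>xi\<bar>) <= 2 * c * b s" for xi
    proof -
      have "(\<Sum>n. \<bar>D n (xi, s)\<bar> * exp (s * \<bar>xi\<bar>)) <= (\<Sum>n. c * b s * (1/2)^n)"
        by (rule suminf_le[OF bd[OF s] sa[OF s] sg])
      then show ?thesis using pt[of xi] unfolding sumg by linarith
    qed
    have [measurable]: "(\<lambda>xi. D n (xi, s)) \<in> borel_measurable borel" for n by (rule adm_section[OF D(1)])
    have "(\<integral>\<^sup>+xi. ennreal (\<bar>\<Sum>n. D n (xi, s)\<bar> * exp (s * \<bar>xi\<bar>)) \<partial>lborel) <=
       (\<integral>\<^sup>+xi. (\<Sum>n. ennreal (\<bar>D n (xi, s)\<bar> * exp (s * \<bar>xi\<bar>))) \<partial>lborel)"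
    proof (intro nn_integral_mono)
      fix xi
      have "(\<Sum>n. ennreal (\<bar>D n (xi, s)\<bar> * exp (s * \<bar>xi\<bar>))) = ennreal (\<Sum>n. \<bar>D n (xi, s)\<bar> * exp (s * \<bar>xi\<bar>))"
        by (rule suminf_ennreal2[OF _ sa[OF s]]) simp
      then show "ennreal (\<bar>\<Sum>n. D n (xi, s)\<bar> * exp (s * \<bar>xi\<bar>)) <= (\<Sum>n. ennreal (\<bar>D n (xi, s)\<bar> * exp (s * \<bar>xi\<bar>)))"
        using pt[of xi] by (simp only: ennreal_leI)
    qed
    also have "\<dots> = (\<Sum>n. \<integral>\<^sup>+xi. ennreal (\<bar>D n (xi, s)\<bar> * exp (s * \<bar>xi\<bar>)) \<partial>lborel)"
      by (rule nn_integral_suminf) measurable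
    also have "\<dots> <= (\<Sum>n. ennreal (c * b s * (1/2)^n))"
    proof (rule suminf_le)
      fix n show "(\<integral>\<^sup>+xi. ennreal (\<bar>D n (xi, s)\<bar> * exp (s * \<bar>xi\<bar>)) \<partial>lborel) <= ennreal (c * b s * (1/2)^n)"
        using bndD(3)[OF D(2) s, of n] by (simp add: mult_ac)
    qed auto
    also have "\<dots> = ennreal (2 * c * b s)"
    proof -
      have "(\<Sum>n. ennreal (c * b s * (1/2)^n)) = ennreal (\<Sum>n. c * b s * (1/2)^n)"
        by (rule suminf_ennreal2[OF _ sg]) (use c b0 in \<open>simp add: less_imp_le\<close>)
      then show ?thesis unfolding sumg .
    qed
    finally show "(\<integral>\<^sup>+xi. ennreal (\<bar>\<Sum>n. D n (xi, s)\<bar> * exp (s * \<bar>xi\<bar>)) \<partial>lborel) <= ennreal (2 * c * b s)" .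
  qed
qed

text \<open>b is unbounded at 0, so the Weierstrass test gives uniform convergence only for s > a;
  continuity is local, and a > 0 is arbitrary.\<close>

lemma adm_suminf:
  assumes D: "\<And>n. adm (D n)" "\<And>n. bnd (D n) (\<lambda>s. c * (1/2) ^ n * b s)" and c: "0 <= c"
  shows "adm (\<lambda>p. \<Sum>n. D n p)"
  unfolding adm_def
proof (intro conjI allI impI)
  show "(\<Sum>n. D n (xi, s)) = 0" if "s \<notin> {0<..<L}" for xi s using admD(2)[OF D(1) that] by simp
  show "(\<Sum>n. D n (- xi, s)) = (\<Sum>n. D n (xi, s))" for xi s by (simp add: admD(3)[OF D(1)])
  have loc: "continuous_on (UNIV \<times> {a<..<L}) (\<lambda>p. \<Sum>n. D n p)" if a: "0 < a" for a
  proof -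
    obtain K where K: "K > 0" "\<And>s. a <= s ==> s < L ==> b s <= K" using b_local_bound[OF a] by blast
    have "uniform_limit (UNIV \<times> {a<..<L}) (\<lambda>n p. \<Sum>i<n. D i p) (\<lambda>p. \<Sum>i. D i p) sequentially"
    proof (rule Weierstrass_m_test)
      show "summable (\<lambda>n. c * K * (1/2::real) ^ n)" by (intro summable_mult summable_geometric) simp
      fix n and p :: "real \<times> real" assume p: "p \<in> UNIV \<times> {a<..<L}"
      then have s: "0 < snd p" "snd p < L" "a <= snd p" using a by auto
      have "\<bar>D n (fst p, snd p)\<bar> <= c * (1/2)^n * b (snd p) * exp (- (snd p * \<bar>fst p\<bar>))" by (rule bndD(2)[OF D(2) s(1,2)])
      also have "\<dots> <= c * (1/2)^n * K * 1"
        using c K s b_pos[OF s(1,2)] by (intro mult_mono) auto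
      finally show "norm (D n p) <= c * K * (1/2) ^ n" by (simp add: mult_ac)
    qed
    then show ?thesis
    proof (rule uniform_limit_theorem[rotated])
      have "continuous_on (UNIV \<times> {a<..<L}) (\<lambda>p. \<Sum>i<n. D i p)" for n
        by (intro continuous_on_sum continuous_on_subset[OF admD(1)[OF D(1)]]) (use a in auto)
      then show "\<forall>\<^sub>F n in sequentially. continuous_on (UNIV \<times> {a<..<L}) (\<lambda>p. \<Sum>i<n. D i p)" by simp
    qed simp
  qed
  show "continuous_on (UNIV \<times> {0<..<L}) (\<lambda>p. \<Sum>n. D n p)"
  proof (rule continuous_at_imp_continuous_on, intro ballI)
    fix p :: "real \<times> real" assume p: "p \<in> UNIV \<times> {0<..<L}"
    have "open (UNIV \<times> {snd p / 2<..<L} :: (real \<times> real) set)" by (intro open_Times) auto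
    moreover have "p \<in> UNIV \<times> {snd p / 2<..<L}" using p by (cases p) auto
    moreover have "continuous_on (UNIV \<times> {snd p / 2<..<L}) (\<lambda>p. \<Sum>n. D n p)" using p by (intro loc) auto
    ultimately show "isCont (\<lambda>p. \<Sum>n. D n p) p" using continuous_on_eq_continuous_at by blast
  qed
qed

text \<open>Picard iteration from 0. The condition 8 \<epsilon> Cq <= 1 gives (2\<epsilon>)^2 Cq <=
  \<epsilon>/2, so the ball of size 2\<epsilon> is preserved, and the Lipschitz constant 4
  \<epsilon> Cq is at most 1/2.\<close>

theorem fixed_point:
  assumes P: "adm \<Phi>" "bnd \<Phi> (\<lambda>s. \<epsilon> * b s)" and e: "0 <= \<epsilon>" "8 * \<epsilon> * Cq <= 1"
  shows "\<exists>V. adm V \<and> bnd V (\<lambda>s. 2 * \<epsilon> * b s) \<and> (\<forall>xi s. 0 < s \<and> s < L --> V (xi, s) = \<Phi> (xi, s) + duh (conv V V) (xi, s))"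
proof -
  define X where "X n = (TT \<Phi> ^^ n) (\<lambda>_. 0)" for n
  have XS: "X (Suc n) = TT \<Phi> (X n)" for n by (simp add: X_def)
  have e4: "\<epsilon> + (2 * \<epsilon>)\<^sup>2 * Cq <= 2 * \<epsilon>"
  proof -
    have "\<epsilon> * (8 * \<epsilon> * Cq) <= \<epsilon> * 1" using e by (intro mult_left_mono) auto
    then have "(2 * \<epsilon>)\<^sup>2 * Cq <= \<epsilon> / 2" by (simp add: power2_eq_square mult_ac)
    then show ?thesis using e by linarith
  qed
  have X: "adm (X n) \<and> bnd (X n) (\<lambda>s. 2 * \<epsilon> * b s)" for n
  proof (induction n)
    case 0
    have "bnd (\<lambda>_. 0) (\<lambda>s. 2 * \<epsilon> * b s)" unfolding bnd_def using e by (auto intro!: mult_nonneg_nonneg less_imp_le[OF b_pos])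
    then show ?case using adm_0 by (simp add: X_def)
  next
    case (Suc n)
    have A: "bnd (X (Suc n)) (\<lambda>s. (\<epsilon> + (2 * \<epsilon>)\<^sup>2 * Cq) * b s)" "adm (X (Suc n))"
      unfolding XS by (rule TT_adm_bnd[OF P]; use Suc in blast)+
    moreover have "bnd (X (Suc n)) (\<lambda>s. 2 * \<epsilon> * b s)"
      by (intro bnd_cong[OF A(1)] mult_right_mono[OF e4 less_imp_le[OF b_pos]])
    ultimately show ?case by simp
  qed
  then have Xa: "adm (X n)" and Xb: "bnd (X n) (\<lambda>s. 2 * \<epsilon> * b s)" for n by auto
  define D where "D n = (\<lambda>p. X (Suc n) p - X n p)" for n
  have Da: "adm (D n)" for n unfolding D_def by (intro adm_diff Xa)
  have Db: "bnd (D n) (\<lambda>s. 2 * \<epsilon> * (1/2)^n * b s)" for n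
  proof (induction n)
    case 0
    have "D 0 = X 1" by (simp add: D_def X_def)
    then show ?case using Xb[of 1] by simp
  next
    case (Suc n)
    have A: "bnd (\<lambda>p. TT \<Phi> (X (Suc n)) p - TT \<Phi> (X n) p) (\<lambda>s. 2 * (2 * \<epsilon>) * (2 * \<epsilon> * (1/2)^n) * Cq * b s)"
      by (rule TT_lipschitz[OF Xa Xb Xa Xb]) (use Suc e in \<open>auto simp: D_def\<close>)
    have B: "2 * (2 * \<epsilon>) * (2 * \<epsilon> * (1/2)^n) * Cq <= 2 * \<epsilon> * (1/2)^Suc n"
    proof -
      have "(\<epsilon> * (1/2)^n) * (8 * \<epsilon> * Cq) <= (\<epsilon> * (1/2)^n) * 1" using e by (intro mult_left_mono) auto
      then show ?thesis by (simp add: mult_ac)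
    qed
    have "bnd (\<lambda>p. TT \<Phi> (X (Suc n)) p - TT \<Phi> (X n) p) (\<lambda>s. 2 * \<epsilon> * (1/2)^Suc n * b s)"
      by (intro bnd_cong[OF A] mult_right_mono[OF B less_imp_le[OF b_pos]])
    then show ?case by (simp only: D_def XS)
  qed
  define V where "V = (\<lambda>p. \<Sum>n. D n p)"
  have e2: "0 <= 2 * \<epsilon>" using e by simp
  have Va: "adm V" unfolding V_def by (rule adm_suminf[OF Da Db e2])
  have tail: "bnd (\<lambda>p. V p - X n p) (\<lambda>s. 4 * \<epsilon> * (1/2)^n * b s)" for n
  proof -
    have "bnd (\<lambda>p. \<Sum>k. D (k + n) p) (\<lambda>s. 2 * (2 * \<epsilon> * (1/2)^n) * b s)"
      by (rule bnd_suminf(2)) (use Da Db[of "_ + n"] e in \<open>auto simp: power_add mult_ac\<close>)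
    then have 1: "bnd (\<lambda>p. \<Sum>k. D (k + n) p) (\<lambda>s. 4 * \<epsilon> * (1/2)^n * b s)" by (simp add: mult_ac)
    have 2: "(\<Sum>k. D (k + n) (xi, s)) = V (xi, s) - X n (xi, s)" if "s \<in> {0<..<L}" for xi s
    proof -
      have "summable (\<lambda>n. D n (xi, s))" by (rule bnd_suminf(1)[OF Da Db e2]) (use that in auto)
      then have "(\<Sum>k. D (k + n) (xi, s)) = V (xi, s) - (\<Sum>k<n. D k (xi, s))"
        unfolding V_def by (rule suminf_minus_initial_segment)
      also have "(\<Sum>k<n. D k (xi, s)) = X n (xi, s)"
        unfolding D_def by (subst sum_lessThan_telescope) (simp add: X_def)
      finally show ?thesis .
    qed
    show ?thesis using 1 unfolding bnd_def by (simp add: 2)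
  qed
  have Vb: "bnd V (\<lambda>s. 2 * (2 * \<epsilon>) * b s)" unfolding V_def by (rule bnd_suminf(2)[OF Da Db e2])
  \<comment> \<open>Both V and \<open>TT \<Phi> V\<close> are compared with the iterate
    \<open>X (Suc n)\<close>. The series so far bounds V only by 4 \<epsilon> b, which is why the
    Lipschitz estimate is used with the doubled radius.\<close>
  have small: "\<bar>V (xi, s) - TT \<Phi> V (xi, s)\<bar> <= (4 * \<epsilon> * b s + 32 * \<epsilon>\<^sup>2 * Cq * b s) * (1/2)^n" if s: "0 < s" "s < L" for xi s n
  proof -
    have "bnd (X n) (\<lambda>s. 2 * (2 * \<epsilon>) * b s)"
      using Xb[of n] by (rule bnd_cong) (use e in \<open>auto intro!: mult_nonneg_nonneg less_imp_le[OF b_pos]\<close>)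
    then have "bnd (\<lambda>p. TT \<Phi> V p - TT \<Phi> (X n) p) (\<lambda>s. 2 * (2 * (2 * \<epsilon>)) * (4 * \<epsilon> * (1/2)^n) * Cq * b s)"
      by (intro TT_lipschitz[OF Va Vb Xa _ tail]) (use e in auto)
    from bndD(2)[OF this s, of xi]
    have "\<bar>TT \<Phi> V (xi, s) - TT \<Phi> (X n) (xi, s)\<bar> <= 32 * \<epsilon>\<^sup>2 * (1/2)^n * Cq * b s * exp (- (s * \<bar>xi\<bar>))"
      by (simp add: power2_eq_square mult_ac)
    also have "\<dots> <= 32 * \<epsilon>\<^sup>2 * (1/2)^n * Cq * b s * 1"
      using s Cq_pos b_pos[OF s] by (intro mult_left_mono) auto
    finally have 1: "\<bar>TT \<Phi> V (xi, s) - TT \<Phi> (X n) (xi, s)\<bar> <= 32 * \<epsilon>\<^sup>2 * (1/2)^n * Cq * b s" by simp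
    have "\<bar>V (xi, s) - X (Suc n) (xi, s)\<bar> <= 4 * \<epsilon> * (1/2)^Suc n * b s * exp (- (s * \<bar>xi\<bar>))"
      by (rule bndD(2)[OF tail s])
    also have "\<dots> <= 4 * \<epsilon> * (1/2)^n * b s * 1"
      using s e b_pos[OF s] by (intro mult_mono) auto
    finally have 2: "\<bar>V (xi, s) - TT \<Phi> (X n) (xi, s)\<bar> <= 4 * \<epsilon> * (1/2)^n * b s" by (simp add: XS)
    show ?thesis using 1 2 by (simp add: algebra_simps)
  qed
  have fixp: "V (xi, s) = \<Phi> (xi, s) + duh (conv V V) (xi, s)" if s: "0 < s" "s < L" for xi s
  proof -
    have "(\<lambda>n. (4 * \<epsilon> * b s + 32 * \<epsilon>\<^sup>2 * Cq * b s) * (1/2)^n) \<longlonglongrightarrow> (4 * \<epsilon> * b s + 32 * \<epsilon>\<^sup>2 * Cq * b s) * 0"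
      by (intro tendsto_intros LIMSEQ_power_zero) simp
    then have "\<bar>V (xi, s) - TT \<Phi> V (xi, s)\<bar> <= 0"
      using small[OF s, of xi] by (intro LIMSEQ_le_const) auto
    then show ?thesis by (simp add: TT_def)
  qed
  \<comment> \<open>The bound 2 \<epsilon> b of the iterates passes to the limit: V is
    \<open>X n\<close> plus a tail tending to 0.\<close>
  have "bnd V (\<lambda>s. 2 * \<epsilon> * b s)"
    unfolding bnd_def
  proof (intro ballI conjI allI)
    fix s assume "s \<in> {0<..<L}"
    then have s: "0 < s" "s < L" by auto
    have Vm: "(\<lambda>xi. V (xi, s)) \<in> borel_measurable borel" by (rule adm_section[OF Va])
    have q: "bnd V (\<lambda>s. (2 * \<epsilon> + 4 * \<epsilon> * (1/2)^n) * b s)" for n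
      using bnd_add(1)[OF Xa adm_diff[OF Va Xa] Xb tail, of n n] by (simp add: distrib_right)
    have lim: "(\<lambda>n. (2 * \<epsilon> + 4 * \<epsilon> * (1/2)^n) * b s) \<longlonglongrightarrow> (2 * \<epsilon> + 4 * \<epsilon> * 0) * b s"
      by (intro tendsto_intros LIMSEQ_power_zero) simp
    show "\<bar>V (xi, s)\<bar> * exp (s * \<bar>xi\<bar>) <= 2 * \<epsilon> * b s" for xi
      using lim bndD(1)[OF q s, of xi] by (intro LIMSEQ_le_const) auto
    have "(\<lambda>n. ennreal ((2 * \<epsilon> + 4 * \<epsilon> * (1/2)^n) * b s)) \<longlonglongrightarrow> ennreal (2 * \<epsilon> * b s)"
      using tendsto_ennrealI[OF lim] by simp
    then show "(\<integral>\<^sup>+xi. ennreal (\<bar>V (xi, s)\<bar> * exp (s * \<bar>xi\<bar>)) \<partial>lborel) <= ennreal (2 * \<epsilon> * b s)"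
      using bndD(3)[OF q s] by (intro LIMSEQ_le_const) auto
  qed
  then show ?thesis using Va fixp by blast
qed

end

section \<open>Fourier integrals and the differential equation\<close>

text \<open>The i-th derivative of the cosine, so that \<open>JJ W i\<close> is the i-th
  x-derivative of the cosine integral \<open>JJ W 0\<close>.\<close>

definition cs :: "nat => real => real" where
  "cs i \<theta> = cos (\<theta> + real i * (pi / 2))"

lemma cs_deriv: "(cs i has_real_derivative cs (Suc i) \<theta>) (at \<theta>)"
proof -
  have "cs (Suc i) \<theta> = - sin (\<theta> + real i * (pi / 2))"
  proof -
    have e: "\<theta> + real (Suc i) * (pi / 2) = (\<theta> + real i * (pi / 2)) + pi / 2" by (simp add: distrib_right)
    have "cos (y + pi / 2) = - sin y" for y :: real by (simp add: cos_add)
    then show ?thesis unfolding cs_def e .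
  qed
  then show ?thesis unfolding cs_def[abs_def] by (auto intro!: derivative_eq_intros)
qed

lemma cs_0: "cs 0 \<theta> = cos \<theta>" by (simp add: cs_def)

lemma cs_2: "cs (i + 2) \<theta> = - cs i \<theta>"
proof -
  have e: "\<theta> + real (i + 2) * (pi / 2) = (\<theta> + real i * (pi / 2)) + pi" by (simp add: distrib_right)
  show ?thesis unfolding cs_def e by (rule cos_periodic_pi)
qed

lemma abs_cs_le: "\<bar>cs i \<theta>\<bar> <= 1" by (simp add: cs_def)

lemma cs_measurable [measurable]: "cs i \<in> borel_measurable borel"
  unfolding cs_def[abs_def] by measurable

context time_interval
begin

text \<open>What differentiation under the integral requires: exponential decay, locally uniform in
  time, up to a polynomial. The polynomial is there because the symbol and x-derivatives multiply by
  powers of xi.\<close>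

definition tame :: "(real \<times> real => real) => bool" where
  "tame W \<longleftrightarrow> (\<forall>tau\<in>{0<..<L}. (\<lambda>xi. W (xi, tau)) \<in> borel_measurable borel) \<and>
     (\<forall>a c. 0 < a --> a <= c --> c < L --> (\<exists>C n. 0 <= C \<and> (\<forall>tau\<in>{a..c}. \<forall>xi. \<bar>W (xi, tau)\<bar> <= C * ((1 + \<bar>xi\<bar>) ^ n * exp (- (a * \<bar>xi\<bar>))))))"

definition JJ :: "(real \<times> real => real) => nat => real \<times> real => real" where
  "JJ W i = (\<lambda>(x, tau). \<integral>xi. W (xi, tau) * xi ^ i * cs i (xi * x) \<partial>lborel)"

lemma tameD:
  assumes "tame W"
  shows "0 < tau ==> tau < L ==> (\<lambda>xi. W (xi, tau)) \<in> borel_measurable borel"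
    "0 < a ==> a <= c ==> c < L ==> (\<exists>C n. 0 <= C \<and> (\<forall>tau\<in>{a..c}. \<forall>xi. \<bar>W (xi, tau)\<bar> <= C * ((1 + \<bar>xi\<bar>) ^ n * exp (- (a * \<bar>xi\<bar>)))))"
proof -
  note t = assms[unfolded tame_def]
  show "0 < tau ==> tau < L ==> (\<lambda>xi. W (xi, tau)) \<in> borel_measurable borel"
    using t[THEN conjunct1] by simp
  show "0 < a ==> a <= c ==> c < L ==> (\<exists>C n. 0 <= C \<and> (\<forall>tau\<in>{a..c}. \<forall>xi. \<bar>W (xi, tau)\<bar> <= C * ((1 + \<bar>xi\<bar>) ^ n * exp (- (a * \<bar>xi\<bar>)))))"
    by (rule t[THEN conjunct2, THEN spec, THEN spec, THEN mp, THEN mp, THEN mp])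
qed

lemma JJ_term_measurable:
  assumes "tame W" "0 < tau" "tau < L"
  shows "(\<lambda>xi. W (xi, tau) * xi ^ i * cs j (xi * x)) \<in> borel_measurable borel"
proof -
  have [measurable]: "(\<lambda>xi. W (xi, tau)) \<in> borel_measurable borel" by (rule tameD(1)[OF assms])
  show ?thesis by measurable
qed

lemma JJ_term_bound:
  fixes C :: real
  assumes "\<bar>w\<bar> <= C * ((1 + \<bar>xi\<bar>) ^ n * e)" "0 <= C" "0 <= e"
  shows "\<bar>w * xi ^ i * cs j \<theta>\<bar> <= C * ((1 + \<bar>xi\<bar>) ^ (n + i) * e)"
proof -
  have "\<bar>w * xi ^ i * cs j \<theta>\<bar> <= (C * ((1 + \<bar>xi\<bar>) ^ n * e)) * (1 + \<bar>xi\<bar>) ^ i * 1"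
    unfolding abs_mult power_abs
    using assms abs_cs_le[of j \<theta>] by (intro mult_mono power_mono) auto
  then show ?thesis by (simp add: power_add mult_ac)
qed

lemma JJ_integrable:
  assumes W: "tame W" and t: "0 < tau" "tau < L"
  shows "integrable lborel (\<lambda>xi. W (xi, tau) * xi ^ i * cs j (xi * x))"
proof -
  obtain C n where C: "0 <= C" "\<And>xi. \<bar>W (xi, tau)\<bar> <= C * ((1 + \<bar>xi\<bar>) ^ n * exp (- (tau * \<bar>xi\<bar>)))"
    using tameD(2)[OF W t(1) order_refl t(2)] by auto
  show ?thesis
  proof (rule Bochner_Integration.integrable_bound)
    show "integrable lborel (\<lambda>xi. C * ((1 + \<bar>xi\<bar>) ^ (n + i) * exp (- (tau * \<bar>xi\<bar>))))"
      by (rule integrable_mult_right[OF integrable_exp_abs[OF t(1)]])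
    show "(\<lambda>xi. W (xi, tau) * xi ^ i * cs j (xi * x)) \<in> borel_measurable lborel"
      using JJ_term_measurable[OF W t] by simp
    show "AE xi in lborel. norm (W (xi, tau) * xi ^ i * cs j (xi * x)) <= norm (C * ((1 + \<bar>xi\<bar>) ^ (n + i) * exp (- (tau * \<bar>xi\<bar>))))"
      by (intro AE_I2, unfold real_norm_def, rule order_trans[OF JJ_term_bound[OF C(2) C(1)] abs_ge_self]) simp
  qed
qed

lemma JJ_x_deriv:
  assumes W: "tame W" and t: "0 < tau" "tau < L"
  shows "((\<lambda>x. JJ W i (x, tau)) has_real_derivative JJ W (Suc i) (x, tau)) (at x)"
proof -
  obtain C n where C: "0 <= C" "\<And>xi. \<bar>W (xi, tau)\<bar> <= C * ((1 + \<bar>xi\<bar>) ^ n * exp (- (tau * \<bar>xi\<bar>)))"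
    using tameD(2)[OF W t(1) order_refl t(2)] by auto
  have "((\<lambda>x. \<integral>xi. W (xi, tau) * xi ^ i * cs i (xi * x) \<partial>lborel) has_derivative
      (\<lambda>h. \<integral>xi. W (xi, tau) * xi ^ Suc i * cs (Suc i) (xi * x) * h \<partial>lborel)) (at x)"
  proof (rule has_derivative_integral_dominated[where e = 1 and g = "\<lambda>xi. C * ((1 + \<bar>xi\<bar>) ^ (n + Suc i) * exp (- (tau * \<bar>xi\<bar>)))"])
    fix y xi h :: real
    have "((\<lambda>x. cs i (xi * x)) has_real_derivative cs (Suc i) (xi * y) * xi) (at y)"
      by (rule DERIV_chain2[OF cs_deriv]) (auto intro!: derivative_eq_intros)
    show "((\<lambda>x. W (xi, tau) * xi ^ i * cs i (xi * x)) has_derivative (\<lambda>h. W (xi, tau) * xi ^ Suc i * cs (Suc i) (xi * y) * h)) (at y)"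
      by (rule has_derivative_eq_rhs[OF DERIV_cmult[OF \<open>((\<lambda>x. cs i (xi * x)) has_real_derivative cs (Suc i) (xi * y) * xi) (at y)\<close>, of "W (xi, tau) * xi ^ i", unfolded has_field_derivative_def]])
        (simp add: fun_eq_iff mult_ac)
    have "\<bar>W (xi, tau) * xi ^ Suc i * cs (Suc i) (xi * y)\<bar> * \<bar>h\<bar> <= C * ((1 + \<bar>xi\<bar>) ^ (n + Suc i) * exp (- (tau * \<bar>xi\<bar>))) * \<bar>h\<bar>"
      by (intro mult_right_mono JJ_term_bound C) auto
    then show "\<bar>W (xi, tau) * xi ^ Suc i * cs (Suc i) (xi * y) * h\<bar> <= C * ((1 + \<bar>xi\<bar>) ^ (n + Suc i) * exp (- (tau * \<bar>xi\<bar>))) * norm h"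
      by (simp only: abs_mult real_norm_def)
  next
    show "integrable lborel (\<lambda>xi. C * ((1 + \<bar>xi\<bar>) ^ (n + Suc i) * exp (- (tau * \<bar>xi\<bar>))))"
      by (rule integrable_mult_right[OF integrable_exp_abs[OF t(1)]])
    show "integrable lborel (\<lambda>xi. W (xi, tau) * xi ^ i * cs i (xi * y))" for y by (rule JJ_integrable[OF W t])
    show "(\<lambda>xi. W (xi, tau) * xi ^ Suc i * cs (Suc i) (xi * x) * h) \<in> borel_measurable lborel" for h
      using JJ_term_measurable[OF W t, of "Suc i" "Suc i" x] by simp
  qed (use C in auto)
  moreover have "(\<lambda>h. \<integral>xi. W (xi, tau) * xi ^ Suc i * cs (Suc i) (xi * x) * h \<partial>lborel) = (\<lambda>h. JJ W (Suc i) (x, tau) * h)"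
    by (simp add: JJ_def fun_eq_iff)
  ultimately show ?thesis by (simp add: has_field_derivative_def JJ_def)
qed

lemma JJ_has_derivative:
  assumes W: "tame W" and W': "tame W'"
    and d: "\<And>xi tau. 0 < tau ==> tau < L ==> ((\<lambda>tau. W (xi, tau)) has_real_derivative W' (xi, tau)) (at tau)"
    and t: "0 < tau" "tau < L"
  shows "(JJ W i has_derivative (\<lambda>(h, k). JJ W (Suc i) (x, tau) * h + JJ W' i (x, tau) * k)) (at (x, tau))"
proof -
  define a c where "a = tau / 2" and "c = (tau + L) / 2"
  have ac: "0 < a" "a < tau" "tau < c" "c < L" "a <= c" using t by (auto simp: a_def c_def)
  define e where "e = min (tau - a) (c - tau)"
  have e: "e > 0" using ac by (simp add: e_def)
  obtain C n where C: "0 <= C" "\<And>tau xi. tau \<in> {a..c} ==> \<bar>W (xi, tau)\<bar> <= C * ((1 + \<bar>xi\<bar>) ^ n * exp (- (a * \<bar>xi\<bar>)))"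
    using tameD(2)[OF W ac(1) ac(5) ac(4)] by blast
  obtain C' n' where C': "0 <= C'" "\<And>tau xi. tau \<in> {a..c} ==> \<bar>W' (xi, tau)\<bar> <= C' * ((1 + \<bar>xi\<bar>) ^ n' * exp (- (a * \<bar>xi\<bar>)))"
    using tameD(2)[OF W' ac(1) ac(5) ac(4)] by blast
  define g where "g xi = C * ((1 + \<bar>xi\<bar>) ^ (n + Suc i) * exp (- (a * \<bar>xi\<bar>))) + C' * ((1 + \<bar>xi\<bar>) ^ (n' + i) * exp (- (a * \<bar>xi\<bar>)))" for xi
  define D where "D y xi v = W (xi, snd y) * xi ^ Suc i * cs (Suc i) (xi * fst y) * fst v + W' (xi, snd y) * xi ^ i * cs i (xi * fst y) * snd v" for y v :: "real \<times> real" and xi :: real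
  have rng: "snd y \<in> {a..c}" "0 < snd y" "snd y < L" if "dist y (x, tau) < e" for y :: "real \<times> real"
  proof -
    have "\<bar>snd y - tau\<bar> <= dist y (x, tau)" using dist_snd_le[of y "(x, tau)"] by (simp add: dist_real_def)
    then have "\<bar>snd y - tau\<bar> < e" using that by linarith
    then show "snd y \<in> {a..c}" by (auto simp: e_def)
    then show "0 < snd y" "snd y < L" using ac by auto
  qed
  have "((\<lambda>y. \<integral>xi. W (xi, snd y) * xi ^ i * cs i (xi * fst y) \<partial>lborel) has_derivative
      (\<lambda>v. \<integral>xi. D (x, tau) xi v \<partial>lborel)) (at (x, tau))"
  proof (rule has_derivative_integral_dominated[where e = e and g = g])
    fix y v :: "real \<times> real" and xi :: real
    assume y: "dist y (x, tau) < e"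
    have x1: "((\<lambda>y. cs i (xi * fst y)) has_derivative (\<lambda>v. cs (Suc i) (xi * fst y) * (xi * fst v))) (at y)"
    proof (rule has_derivative_compose[of "\<lambda>y. xi * fst y" "\<lambda>v. xi * fst v" _ _ "cs i" "\<lambda>h. cs (Suc i) (xi * fst y) * h"])
      show "((\<lambda>y. xi * fst y) has_derivative (\<lambda>v. xi * fst v)) (at y)"
        by (auto intro!: derivative_eq_intros)
      show "(cs i has_derivative (\<lambda>h. cs (Suc i) (xi * fst y) * h)) (at (xi * fst y))"
        using cs_deriv by (simp add: has_field_derivative_def)
    qed
    have x2: "((\<lambda>y. W (xi, snd y)) has_derivative (\<lambda>v. W' (xi, snd y) * snd v)) (at y)"
    proof (rule has_derivative_compose[of snd "\<lambda>v. snd v" _ _ "\<lambda>tau. W (xi, tau)" "\<lambda>h. W' (xi, snd y) * h"])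
      show "(snd has_derivative (\<lambda>v. snd v)) (at y)" by (auto intro!: derivative_eq_intros)
      show "((\<lambda>tau. W (xi, tau)) has_derivative (\<lambda>h. W' (xi, snd y) * h)) (at (snd y))"
        using d[OF rng(2,3)[OF y], of xi] by (simp add: has_field_derivative_def)
    qed
    show "((\<lambda>y. W (xi, snd y) * xi ^ i * cs i (xi * fst y)) has_derivative D y xi) (at y)"
      unfolding D_def
      by (rule derivative_eq_intros x1 x2 refl)+ (simp add: fun_eq_iff algebra_simps)
    have n1: "\<bar>fst v\<bar> <= norm v" "\<bar>snd v\<bar> <= norm v"
      using norm_fst_le[of "fst v" "snd v"] norm_snd_le[of "snd v" "fst v"] by simp_all
    have "\<bar>D y xi v\<bar> <= \<bar>W (xi, snd y) * xi ^ Suc i * cs (Suc i) (xi * fst y)\<bar> * \<bar>fst v\<bar> + \<bar>W' (xi, snd y) * xi ^ i * cs i (xi * fst y)\<bar> * \<bar>snd v\<bar>"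
      unfolding D_def by (rule order_trans[OF abs_triangle_ineq]) (simp only: abs_mult order_refl)
    also have "\<dots> <= (C * ((1 + \<bar>xi\<bar>) ^ (n + Suc i) * exp (- (a * \<bar>xi\<bar>)))) * norm v + (C' * ((1 + \<bar>xi\<bar>) ^ (n' + i) * exp (- (a * \<bar>xi\<bar>)))) * norm v"
      by (intro add_mono mult_mono JJ_term_bound C C' rng(1)[OF y] n1) (use C C' in auto)
    also have "\<dots> = g xi * norm v" by (simp add: g_def distrib_right)
    finally show "\<bar>D y xi v\<bar> <= g xi * norm v" .
  next
    show "integrable lborel g" unfolding g_def
      by (intro Bochner_Integration.integrable_add integrable_mult_right integrable_exp_abs ac)
    show "0 <= g xi" for xi using C C' by (simp add: g_def)
    show "integrable lborel (\<lambda>xi. W (xi, snd y) * xi ^ i * cs i (xi * fst y))" if "dist y (x, tau) < e" for y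
      by (rule JJ_integrable[OF W rng(2,3)[OF that]])
    show "(\<lambda>xi. D (x, tau) xi v) \<in> borel_measurable lborel" for v
    proof -
      have [measurable]: "(\<lambda>xi. W (xi, tau)) \<in> borel_measurable borel" "(\<lambda>xi. W' (xi, tau)) \<in> borel_measurable borel"
        using tameD(1)[OF W t] tameD(1)[OF W' t] by auto
      show ?thesis unfolding D_def snd_conv fst_conv by measurable
    qed
  qed (rule e)
  moreover have "(\<lambda>v. \<integral>xi. D (x, tau) xi v \<partial>lborel) = (\<lambda>(h, k). JJ W (Suc i) (x, tau) * h + JJ W' i (x, tau) * k)"
  proof
    fix v :: "real \<times> real"
    show "(\<integral>xi. D (x, tau) xi v \<partial>lborel) = (case v of (h, k) => JJ W (Suc i) (x, tau) * h + JJ W' i (x, tau) * k)"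
      using JJ_integrable[OF W t, of "Suc i" "Suc i" x] JJ_integrable[OF W' t, of i i x]
      by (cases v) (simp add: D_def JJ_def)
  qed
  moreover have "(\<lambda>y. \<integral>xi. W (xi, snd y) * xi ^ i * cs i (xi * fst y) \<partial>lborel) = JJ W i"
    by (simp add: JJ_def fun_eq_iff)
  ultimately show ?thesis by simp
qed

end

context blowup_weight
begin

lemma tame_bnd:
  assumes W: "adm W" and bW: "bnd W g" and g: "\<And>a. 0 < a ==> \<exists>K. \<forall>s. a <= s \<and> s < L --> g s <= K"
  shows "tame W"
  unfolding tame_def
proof (intro conjI ballI allI impI)
  show "(\<lambda>xi. W (xi, tau)) \<in> borel_measurable borel" for tau by (rule adm_section[OF W])
  fix a c :: real assume ac: "0 < a" "a <= c" "c < L"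
  obtain K where K: "\<And>s. a <= s ==> s < L ==> g s <= K" using g[OF ac(1)] by blast
  show "\<exists>C n. 0 <= C \<and> (\<forall>tau\<in>{a..c}. \<forall>xi. \<bar>W (xi, tau)\<bar> <= C * ((1 + \<bar>xi\<bar>) ^ n * exp (- (a * \<bar>xi\<bar>))))"
  proof (intro exI[of _ "K"] exI[of _ "0::nat"] conjI ballI allI)
    show "0 <= K" using bndD(5)[OF bW, of a] K[of a] ac by auto
    fix tau xi assume t: "tau \<in> {a..c}"
    have "\<bar>W (xi, tau)\<bar> <= g tau * exp (- (tau * \<bar>xi\<bar>))" using t ac by (intro bndD(2)[OF bW]) auto
    also have "\<dots> <= K * exp (- (a * \<bar>xi\<bar>))"
      using t ac K[of tau] bndD(5)[OF bW, of tau] by (intro mult_mono) (auto intro: mult_right_mono)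
    finally show "\<bar>W (xi, tau)\<bar> <= K * ((1 + \<bar>xi\<bar>) ^ 0 * exp (- (a * \<bar>xi\<bar>)))" by simp
  qed
qed

lemma tame_b: "adm W ==> bnd W (\<lambda>s. M * b s) ==> tame W"
proof -
  assume W: "adm W" "bnd W (\<lambda>s. M * b s)"
  show "tame W"
  proof (rule tame_bnd[OF W])
    fix a :: real assume a: "0 < a"
    obtain K where K: "\<And>s. a <= s ==> s < L ==> b s <= K" using b_local_bound[OF a] by blast
    have "M * b s <= \<bar>M\<bar> * K" if "a <= s \<and> s < L" for s
    proof -
      have "M * b s <= \<bar>M\<bar> * b s" using b_pos[of s] that a by (intro mult_right_mono) auto
      also have "\<dots> <= \<bar>M\<bar> * K" using K that by (intro mult_left_mono) auto
      finally show ?thesis .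
    qed
    then show "\<exists>K. \<forall>s. a <= s \<and> s < L --> M * b s <= K" by blast
  qed
qed

lemma tame_b2: "adm W ==> bnd W (\<lambda>s. M * (b s)\<^sup>2) ==> tame W"
proof -
  assume W: "adm W" "bnd W (\<lambda>s. M * (b s)\<^sup>2)"
  show "tame W"
  proof (rule tame_bnd[OF W])
    fix a :: real assume a: "0 < a"
    obtain K where K: "\<And>s. a <= s ==> s < L ==> b s <= K" using b_local_bound[OF a] by blast
    have "M * (b s)\<^sup>2 <= \<bar>M\<bar> * K\<^sup>2" if "a <= s \<and> s < L" for s
    proof -
      have "M * (b s)\<^sup>2 <= \<bar>M\<bar> * (b s)\<^sup>2" by (intro mult_right_mono) auto
      also have "\<dots> <= \<bar>M\<bar> * K\<^sup>2" using K that b_pos[of s] a by (intro mult_left_mono power_mono) auto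
      finally show ?thesis .
    qed
    then show "\<exists>K. \<forall>s. a <= s \<and> s < L --> M * (b s)\<^sup>2 <= K" by blast
  qed
qed

text \<open>The cosine integral equals the Fourier transform because the sine integral of an even
  function vanishes; Fubini and the addition formula then give the square of u.\<close>

lemma JJ_conv:
  assumes V: "adm V" and bV: "bnd V (\<lambda>s. M * b s)" and t: "0 < tau" "tau < L"
  shows "JJ (conv V V) 0 (x, tau) = (JJ V 0 (x, tau))\<^sup>2"
proof -
  define f where "f xi = V (xi, tau)" for xi
  have fm [measurable]: "f \<in> borel_measurable borel" unfolding f_def by (rule adm_section[OF V])
  have even: "f (- xi) = f xi" for xi by (simp add: f_def admD(3)[OF V])
  note tV = tame_b[OF V bV]
  have ic: "integrable lborel (\<lambda>xi. f xi * cos (xi * x))" and isn: "integrable lborel (\<lambda>xi. f xi * sin (xi * x))"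
  proof -
    show "integrable lborel (\<lambda>xi. f xi * cos (xi * x))"
      using JJ_integrable[OF tV t, of 0 0 x] by (simp add: f_def cs_0)
    have "cs 3 \<theta> = sin \<theta>" for \<theta>
      unfolding cs_def using cos_3over2_pi sin_3over2_pi by (simp add: cos_add mult.commute)
    then show "integrable lborel (\<lambda>xi. f xi * sin (xi * x))"
      using JJ_integrable[OF tV t, of 0 3 x] by (simp add: f_def)
  qed
  have s0: "(\<integral>xi. f xi * sin (xi * x) \<partial>lborel) = 0"
  proof -
    have "(\<integral>xi. f xi * sin (xi * x) \<partial>lborel) = (\<integral>xi. f (- xi) * sin (- xi * x) \<partial>lborel)"
      using lborel_integral_real_affine[of "-1" "\<lambda>xi. f xi * sin (xi * x)" 0] by simp
    then show ?thesis by (simp add: even)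
  qed
  define u where "u = (\<integral>xi. f xi * cos (xi * x) \<partial>lborel)"
  have uJ: "JJ V 0 (x, tau) = u" by (simp add: JJ_def u_def f_def cs_0)
  have fin: "(\<integral>\<^sup>+xi. ennreal \<bar>f xi\<bar> \<partial>lborel) < \<infinity>"
    using bndD(4)[OF bV t] unfolding f_def by (rule le_less_trans) simp
  have int: "integrable (lborel \<Otimes>\<^sub>M lborel) (\<lambda>(xi, l). f (xi - l) * f l * cos (xi * x))"
  proof (rule integrableI_bounded)
    show "(\<lambda>(xi, l). f (xi - l) * f l * cos (xi * x)) \<in> borel_measurable (lborel \<Otimes>\<^sub>M lborel)" by measurable
    have "(\<integral>\<^sup>+p. ennreal (norm (case p of (xi, l) => f (xi - l) * f l * cos (xi * x))) \<partial>(lborel \<Otimes>\<^sub>M lborel)) =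
      (\<integral>\<^sup>+xi. \<integral>\<^sup>+l. ennreal \<bar>f (xi - l) * f l * cos (xi * x)\<bar> \<partial>lborel \<partial>lborel)"
      by (subst lborel.nn_integral_fst[symmetric]) auto
    also have "\<dots> <= (\<integral>\<^sup>+xi. \<integral>\<^sup>+l. ennreal \<bar>f (xi - l)\<bar> * ennreal \<bar>f l\<bar> \<partial>lborel \<partial>lborel)"
    proof (intro nn_integral_mono)
      fix xi l :: real
      have "\<bar>f (xi - l) * f l * cos (xi * x)\<bar> <= \<bar>f (xi - l)\<bar> * \<bar>f l\<bar> * 1"
        unfolding abs_mult by (intro mult_left_mono) auto
      then show "ennreal \<bar>f (xi - l) * f l * cos (xi * x)\<bar> <= ennreal \<bar>f (xi - l)\<bar> * ennreal \<bar>f l\<bar>"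
        by (subst ennreal_mult[symmetric]) (auto intro: ennreal_leI)
    qed
    also have "\<dots> = (\<integral>\<^sup>+xi. ennreal \<bar>f xi\<bar> \<partial>lborel) * (\<integral>\<^sup>+xi. ennreal \<bar>f xi\<bar> \<partial>lborel)"
      by (rule nn_integral_convolution) measurable
    also have "\<dots> < \<infinity>" using fin by (simp add: ennreal_mult_less_top)
    finally show "(\<integral>\<^sup>+p. ennreal (norm (case p of (xi, l) => f (xi - l) * f l * cos (xi * x))) \<partial>(lborel \<Otimes>\<^sub>M lborel)) < \<infinity>" .
  qed
  have "JJ (conv V V) 0 (x, tau) = (\<integral>xi. (\<integral>l. f (xi - l) * f l * cos (xi * x) \<partial>lborel) \<partial>lborel)"
    by (simp add: JJ_def conv_def f_def cs_0)
  also have "\<dots> = (\<integral>l. (\<integral>xi. f (xi - l) * f l * cos (xi * x) \<partial>lborel) \<partial>lborel)"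
    using lborel_pair.Fubini_integral[OF int] by simp
  also have "\<dots> = (\<integral>l. u * (f l * cos (l * x)) \<partial>lborel)"
  proof (intro Bochner_Integration.integral_cong refl)
    fix l
    have "(\<integral>xi. f (xi - l) * f l * cos (xi * x) \<partial>lborel) = (\<integral>xi. f xi * f l * cos ((l + xi) * x) \<partial>lborel)"
      using lborel_integral_real_affine[of 1 "\<lambda>xi. f (xi - l) * f l * cos (xi * x)" l] by simp
    also have "\<dots> = (\<integral>xi. (f l * cos (l * x)) * (f xi * cos (xi * x)) - (f l * sin (l * x)) * (f xi * sin (xi * x)) \<partial>lborel)"
      by (simp add: distrib_right cos_add algebra_simps)
    also have "\<dots> = (f l * cos (l * x)) * u - (f l * sin (l * x)) * 0"
      unfolding u_def s0[symmetric] using ic isn by simp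
    finally show "(\<integral>xi. f (xi - l) * f l * cos (xi * x) \<partial>lborel) = u * (f l * cos (l * x))" by simp
  qed
  also have "\<dots> = u * u" unfolding u_def by simp
  finally show ?thesis unfolding uJ power2_eq_square .
qed

end

context time_interval
begin

lemma tame_mult:
  assumes W: "tame W" and p: "p \<in> borel_measurable borel" "\<And>xi. \<bar>p xi\<bar> <= (1 + \<bar>xi\<bar>) ^ k"
  shows "tame (\<lambda>(xi, tau). p xi * W (xi, tau))"
  unfolding tame_def
proof (intro conjI ballI allI impI)
  show "(\<lambda>xi. case (xi, tau) of (xi, tau) => p xi * W (xi, tau)) \<in> borel_measurable borel" if "tau \<in> {0<..<L}" for tau
    using tameD(1)[OF W, of tau] p(1) that by simp
  fix a c :: real assume ac: "0 < a" "a <= c" "c < L"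
  obtain C n where C: "0 <= C" "\<forall>tau\<in>{a..c}. \<forall>xi. \<bar>W (xi, tau)\<bar> <= C * ((1 + \<bar>xi\<bar>) ^ n * exp (- (a * \<bar>xi\<bar>)))"
    using tameD(2)[OF W ac] by blast
  show "\<exists>C n. 0 <= C \<and> (\<forall>tau\<in>{a..c}. \<forall>xi. \<bar>case (xi, tau) of (xi, tau) => p xi * W (xi, tau)\<bar> <= C * ((1 + \<bar>xi\<bar>) ^ n * exp (- (a * \<bar>xi\<bar>))))"
  proof (intro exI[of _ C] exI[of _ "k + n"] conjI ballI allI C(1))
    fix tau xi :: real assume t: "tau \<in> {a..c}"
    have "\<bar>p xi\<bar> * \<bar>W (xi, tau)\<bar> <= (1 + \<bar>xi\<bar>) ^ k * (C * ((1 + \<bar>xi\<bar>) ^ n * exp (- (a * \<bar>xi\<bar>))))"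
      using C(2) t by (intro mult_mono p(2)) auto
    then show "\<bar>case (xi, tau) of (xi, tau) => p xi * W (xi, tau)\<bar> <= C * ((1 + \<bar>xi\<bar>) ^ (k + n) * exp (- (a * \<bar>xi\<bar>)))"
      by (simp add: abs_mult power_add mult_ac)
  qed
qed

lemma tame_diff:
  assumes W: "tame W" and W': "tame W'"
  shows "tame (\<lambda>z. W z - W' z)"
  unfolding tame_def
proof (intro conjI ballI allI impI)
  show "(\<lambda>xi. W (xi, tau) - W' (xi, tau)) \<in> borel_measurable borel" if "tau \<in> {0<..<L}" for tau
    using tameD(1)[OF W, of tau] tameD(1)[OF W', of tau] that by simp
  fix a c :: real assume ac: "0 < a" "a <= c" "c < L"
  obtain C n where C: "0 <= C" "\<forall>tau\<in>{a..c}. \<forall>xi. \<bar>W (xi, tau)\<bar> <= C * ((1 + \<bar>xi\<bar>) ^ n * exp (- (a * \<bar>xi\<bar>)))"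
    using tameD(2)[OF W ac] by blast
  obtain C' n' where C': "0 <= C'" "\<forall>tau\<in>{a..c}. \<forall>xi. \<bar>W' (xi, tau)\<bar> <= C' * ((1 + \<bar>xi\<bar>) ^ n' * exp (- (a * \<bar>xi\<bar>)))"
    using tameD(2)[OF W' ac] by blast
  show "\<exists>C n. 0 <= C \<and> (\<forall>tau\<in>{a..c}. \<forall>xi. \<bar>W (xi, tau) - W' (xi, tau)\<bar> <= C * ((1 + \<bar>xi\<bar>) ^ n * exp (- (a * \<bar>xi\<bar>))))"
  proof (rule exI[of _ "C + C'"], rule exI[of _ "n + n'"], intro conjI ballI allI)
    show "0 <= C + C'" using C C' by simp
    fix tau xi :: real assume t: "tau \<in> {a..c}"
    have p1: "(1 + \<bar>xi\<bar>) ^ n <= (1 + \<bar>xi\<bar>) ^ (n + n')" by (rule power_increasing) auto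
    have p2: "(1 + \<bar>xi\<bar>) ^ n' <= (1 + \<bar>xi\<bar>) ^ (n + n')" by (rule power_increasing) auto
    note p = p1 p2
    have "\<bar>W (xi, tau) - W' (xi, tau)\<bar> <= \<bar>W (xi, tau)\<bar> + \<bar>W' (xi, tau)\<bar>" by (rule abs_triangle_ineq4)
    also have "\<dots> <= C * ((1 + \<bar>xi\<bar>) ^ n * exp (- (a * \<bar>xi\<bar>))) + C' * ((1 + \<bar>xi\<bar>) ^ n' * exp (- (a * \<bar>xi\<bar>)))"
      using C(2) C'(2) t by (intro add_mono) auto
    also have "\<dots> <= C * ((1 + \<bar>xi\<bar>) ^ (n + n') * exp (- (a * \<bar>xi\<bar>))) + C' * ((1 + \<bar>xi\<bar>) ^ (n + n') * exp (- (a * \<bar>xi\<bar>)))"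
      using C(1) C'(1) p by (intro add_mono mult_left_mono mult_right_mono) auto
    finally show "\<bar>W (xi, tau) - W' (xi, tau)\<bar> <= (C + C') * ((1 + \<bar>xi\<bar>) ^ (n + n') * exp (- (a * \<bar>xi\<bar>)))"
      by (simp add: distrib_right)
  qed
qed

text \<open>W and W'' control W': the mean value theorem gives a time z where W' is a difference
  quotient of W, and W'' bounds the change from z. This spares estimating the differentiated Duhamel
  integral. Measurability comes from limits of difference quotients.\<close>

lemma tame_antiderivative:
  assumes W: "tame W" and W'': "tame W''"
    and d1: "\<And>xi tau. 0 < tau ==> tau < L ==> ((\<lambda>tau. W (xi, tau)) has_real_derivative W' (xi, tau)) (at tau)"
    and d2: "\<And>xi tau. 0 < tau ==> tau < L ==> ((\<lambda>tau. W' (xi, tau)) has_real_derivative W'' (xi, tau)) (at tau)"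
  shows "tame W'"
  unfolding tame_def
proof (intro conjI ballI allI impI)
  fix tau assume "tau \<in> {0<..<L}"
  then have t: "0 < tau" "tau < L" by auto
  define q where "q n = (L - tau) / real (n + 2)" for n :: nat
  have q0: "q n > 0" "q n < L - tau" for n using t by (auto simp: q_def divide_less_eq)
  have ql: "q \<longlonglongrightarrow> 0"
    unfolding q_def using LIMSEQ_ignore_initial_segment[OF lim_const_over_n, of "L - tau" 2] by simp
  show "(\<lambda>xi. W' (xi, tau)) \<in> borel_measurable borel"
  proof (rule borel_measurable_LIMSEQ_real)
    fix xi
    have "((\<lambda>h. (W (xi, tau + h) - W (xi, tau)) / h) \<longlongrightarrow> W' (xi, tau)) (at 0)"
      using d1[OF t, of xi] by (simp add: DERIV_def)
    moreover have "filterlim q (at 0) sequentially"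
    proof (rule filterlim_atI[OF ql])
      have "q n \<noteq> 0" for n using q0(1)[of n] by linarith
      then show "\<forall>\<^sub>F n in sequentially. q n \<noteq> 0" by simp
    qed
    ultimately show "(\<lambda>n. (W (xi, tau + q n) - W (xi, tau)) / q n) \<longlonglongrightarrow> W' (xi, tau)"
      by (rule filterlim_compose)
  next
    fix n
    have "(\<lambda>xi. W (xi, tau + q n)) \<in> borel_measurable borel" "(\<lambda>xi. W (xi, tau)) \<in> borel_measurable borel"
      using q0[of n] t by (auto intro!: tameD(1)[OF W])
    then show "(\<lambda>xi. (W (xi, tau + q n) - W (xi, tau)) / q n) \<in> borel_measurable borel" by measurable
  qed
next
  fix a c0 :: real assume ac0: "0 < a" "a <= c0" "c0 < L"
  \<comment> \<open>Strictly beyond c0, so that a < c even if a = c0 and the mean value theorem has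
    room.\<close>
  define c where "c = (c0 + L) / 2"
  have ac: "0 < a" "a < c" "a <= c" "c < L" "c0 <= c" using ac0 by (auto simp: c_def)
  obtain C n where C: "0 <= C" "\<forall>tau\<in>{a..c}. \<forall>xi. \<bar>W (xi, tau)\<bar> <= C * ((1 + \<bar>xi\<bar>) ^ n * exp (- (a * \<bar>xi\<bar>)))"
    using tameD(2)[OF W ac(1,3,4)] by blast
  obtain C' n' where C': "0 <= C'" "\<forall>tau\<in>{a..c}. \<forall>xi. \<bar>W'' (xi, tau)\<bar> <= C' * ((1 + \<bar>xi\<bar>) ^ n' * exp (- (a * \<bar>xi\<bar>)))"
    using tameD(2)[OF W'' ac(1,3,4)] by blast
  define K where "K = 2 * C / (c - a) + (c - a) * C'"
  show "\<exists>C n. 0 <= C \<and> (\<forall>tau\<in>{a..c0}. \<forall>xi. \<bar>W' (xi, tau)\<bar> <= C * ((1 + \<bar>xi\<bar>) ^ n * exp (- (a * \<bar>xi\<bar>))))"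
  proof (rule exI[of _ K], rule exI[of _ "n + n'"], intro conjI ballI allI)
    show "0 <= K" using C(1) C'(1) ac by (simp add: K_def)
    fix tau xi :: real assume t: "tau \<in> {a..c0}"
    define E where "E k = (1 + \<bar>xi\<bar>) ^ k * exp (- (a * \<bar>xi\<bar>))" for k
    have E: "E n <= E (n + n')" "E n' <= E (n + n')" "0 <= E k" for k
      unfolding E_def by (auto intro!: mult_right_mono power_increasing)
    obtain z where z: "a < z" "z < c" "W (xi, c) - W (xi, a) = (c - a) * W' (xi, z)"
    proof -
      have "\<exists>z. a < z \<and> z < c \<and> W (xi, c) - W (xi, a) = (c - a) * W' (xi, z)"
        by (rule MVT2[OF ac(2)]) (use ac in \<open>auto intro!: d1\<close>)
      then show ?thesis using that by blast
    qed
    have 1: "\<bar>W' (xi, z)\<bar> <= 2 * C / (c - a) * E (n + n')"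
    proof -
      have "\<bar>(c - a) * W' (xi, z)\<bar> <= \<bar>W (xi, c)\<bar> + \<bar>W (xi, a)\<bar>" unfolding z(3)[symmetric] by (rule abs_triangle_ineq4)
      also have "\<dots> <= C * E n + C * E n" unfolding E_def using C(2) ac by (intro add_mono) auto
      also have "\<dots> <= 2 * C * E (n + n')" using mult_left_mono[OF E(1) C(1)] by simp
      finally have "(c - a) * \<bar>W' (xi, z)\<bar> <= 2 * C * E (n + n')" using ac by (simp add: abs_mult)
      then show ?thesis using ac by (simp add: field_simps)
    qed
    have 2: "\<bar>W' (xi, tau) - W' (xi, z)\<bar> <= (c - a) * C' * E (n + n')"
    proof -
      have "norm (W' (xi, tau) - W' (xi, z)) <= (C' * E n') * norm (tau - z)"
      proof (rule field_differentiable_bound[of "{a..c}" "\<lambda>t. W' (xi, t)" "\<lambda>t. W'' (xi, t)"])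
        fix x assume x: "x \<in> {a..c}"
        show "((\<lambda>t. W' (xi, t)) has_field_derivative W'' (xi, x)) (at x within {a..c})"
          using x ac by (intro has_field_derivative_at_within[OF d2]) auto
        show "norm (W'' (xi, x)) <= C' * E n'" using C'(2) x by (simp add: E_def)
      qed (use t z ac in auto)
      also have "\<dots> <= (C' * E (n + n')) * (c - a)"
        using t z ac E C' by (intro mult_mono mult_left_mono) auto
      finally show ?thesis by (simp add: mult_ac)
    qed
    have "\<bar>W' (xi, tau)\<bar> <= \<bar>W' (xi, tau) - W' (xi, z)\<bar> + \<bar>W' (xi, z)\<bar>" by linarith
    also have "\<dots> <= K * E (n + n')" using 1 2 by (simp add: K_def distrib_right)
    finally show "\<bar>W' (xi, tau)\<bar> <= K * ((1 + \<bar>xi\<bar>) ^ (n + n') * exp (- (a * \<bar>xi\<bar>)))" by (simp add: E_def)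
  qed
qed

end

section \<open>From the fixed point to the partial differential equation\<close>

locale boussinesq_fourier = blowup_weight +
  fixes V :: "real \<times> real => real" and A :: "real => real" and M :: real
  assumes V_adm: "adm V" and V_bnd: "bnd V (\<lambda>s. M * b s)"
    and V_eq: "\<And>xi s. 0 < s ==> s < L ==> V (xi, s) = A xi * EEr xi s + duh (conv V V) (xi, s)"
begin

definition FF :: "real \<times> real => real" where "FF = conv V V"
definition Vt :: "real \<times> real => real" where "Vt = (\<lambda>(xi, tau). deriv (\<lambda>tau. V (xi, tau)) tau)"
definition Vtt :: "real \<times> real => real" where "Vtt = (\<lambda>(xi, tau). ww xi * V (xi, tau) - xi\<^sup>2 * FF (xi, tau))"

lemma FF_adm: "adm FF" and FF_bnd: "bnd FF (\<lambda>s. M * M * (b s)\<^sup>2)"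
  unfolding FF_def using conv_adm[OF V_adm V_adm V_bnd V_bnd] conv_bnd_b[OF V_adm V_adm V_bnd V_bnd] by auto

text \<open>\<open>Vtt\<close> is defined as the right-hand side of the equation at frequency xi.
  That it is the derivative of \<open>Vt\<close> follows from \<open>green_ode\<close> for the
  Duhamel part and from \<open>EEd_deriv\<close> for the linear part.\<close>

lemma V_ode:
  shows "0 < tau ==> tau < L ==> ((\<lambda>tau. V (xi, tau)) has_real_derivative Vt (xi, tau)) (at tau)"
    and "0 < tau ==> tau < L ==> ((\<lambda>tau. Vt (xi, tau)) has_real_derivative Vtt (xi, tau)) (at tau)"
proof -
  define F where "F s = FF (xi, s)" for s
  have cF: "continuous_on {0<..<L} F"
    unfolding F_def by (rule continuous_on_compose2[OF admD(1)[OF FF_adm]]) (auto intro!: continuous_intros)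
  have iF: "integrable lborel (\<lambda>s. indicator {0<..<L} s * (s * F s))"
  proof (rule Bochner_Integration.integrable_bound)
    show "integrable lborel (\<lambda>s. M * M * (indicator {0<..<L} s * (s * (b s)\<^sup>2)))"
      by (rule integrable_mult_right[OF integrable_s_b2])
    have "F \<in> borel_measurable borel" unfolding F_def by (rule adm_section[OF FF_adm])
    then show "(\<lambda>s. indicator {0<..<L} s * (s * F s)) \<in> borel_measurable lborel" by measurable
    show "AE s in lborel. norm (indicator {0<..<L} s * (s * F s)) <= norm (M * M * (indicator {0<..<L} s * (s * (b s)\<^sup>2)))"
    proof (intro AE_I2)
      fix s
      show "norm (indicator {0<..<L} s * (s * F s)) <= norm (M * M * (indicator {0<..<L} s * (s * (b s)\<^sup>2)))"
      proof (cases "0 < s \<and> s < L")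
        case True
        then have s: "0 < s" "s < L" by auto
        have "\<bar>F s\<bar> <= M * M * (b s)\<^sup>2 * exp (- (s * \<bar>xi\<bar>))" unfolding F_def by (rule bndD(2)[OF FF_bnd s])
        also have "\<dots> <= M * M * (b s)\<^sup>2 * 1" using s by (intro mult_left_mono) auto
        finally have "s * \<bar>F s\<bar> <= s * (M * M * (b s)\<^sup>2)" using s by (intro mult_left_mono) auto
        then show ?thesis using s by (simp add: abs_mult mult_ac)
      qed (auto simp: indicator_def)
    qed
  qed
  define I where "I tau = (\<integral>s. indicator {0<..<L} s * (kk xi tau s * F s) \<partial>lborel)" for tau
  obtain I' where I': "\<And>tau. tau \<in> {0<..<L} ==> (I has_real_derivative I' tau) (at tau)"
     "\<And>tau. tau \<in> {0<..<L} ==> (I' has_real_derivative ww xi * I tau - xi\<^sup>2 * F tau) (at tau)"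
    using green_ode[OF cF iF, of xi] unfolding I_def[abs_def] by blast
  have ID: "duh (conv V V) (xi, tau) = I tau" if "tau \<in> {0<..<L}" for tau
  proof -
    have e: "indicator {0<..<L} s * (kk xi tau s * F s) = kk xi tau s * FF (xi, s)" for s
      using admD(2)[OF FF_adm, of s xi] by (cases "s \<in> {0<..<L}") (auto simp: F_def)
    have "I tau = (\<integral>s. kk xi tau s * FF (xi, s) \<partial>lborel)" unfolding I_def e ..
    then show ?thesis using that by (simp add: duh_def FF_def)
  qed
  define G where "G tau = A xi * EEd xi tau + I' tau" for tau
  have d: "((\<lambda>tau. V (xi, tau)) has_real_derivative G tau) (at tau)" if t: "tau \<in> {0<..<L}" for tau
  proof -
    have "((\<lambda>tau. A xi * EEr xi tau + I tau) has_real_derivative G tau) (at tau)"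
      unfolding G_def by (intro DERIV_add DERIV_cmult EEr_deriv I'(1) t)
    then show ?thesis
      by (rule has_field_derivative_transform_within_open[where S = "{0<..<L}"]) (use t V_eq ID in auto)
  qed
  have VG: "Vt (xi, tau) = G tau" if "tau \<in> {0<..<L}" for tau
    using DERIV_imp_deriv[OF d[OF that]] by (simp add: Vt_def)
  show "((\<lambda>tau. V (xi, tau)) has_real_derivative Vt (xi, tau)) (at tau)" if "0 < tau" "tau < L" for tau
    using d[of tau] VG[of tau] that by simp
  show "((\<lambda>tau. Vt (xi, tau)) has_real_derivative Vtt (xi, tau)) (at tau)" if "0 < tau" "tau < L" for tau
  proof -
    have t: "tau \<in> {0<..<L}" using that by auto
    have "(G has_real_derivative (A xi * (ww xi * EEr xi tau) + (ww xi * I tau - xi\<^sup>2 * F tau))) (at tau)"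
      unfolding G_def[abs_def] by (intro DERIV_add DERIV_cmult EEd_deriv I'(2) t)
    moreover have "A xi * (ww xi * EEr xi tau) + (ww xi * I tau - xi\<^sup>2 * F tau) = Vtt (xi, tau)"
      unfolding Vtt_def using V_eq[OF that, of xi] ID[OF t] by (simp add: F_def algebra_simps)
    ultimately have "(G has_real_derivative Vtt (xi, tau)) (at tau)" by simp
    then show ?thesis
      by (rule has_field_derivative_transform_within_open[where S = "{0<..<L}"]) (use t VG in auto)
  qed
qed

lemma V_tame: "tame V" by (rule tame_b[OF V_adm V_bnd])
lemma FF_tame: "tame FF" by (rule tame_b2[OF FF_adm FF_bnd])

lemma Vtt_tame: "tame Vtt"
proof -
  have w: "\<bar>ww xi\<bar> <= (1 + \<bar>xi\<bar>) ^ 4" "\<bar>xi\<^sup>2\<bar> <= (1 + \<bar>xi\<bar>) ^ 2" for xi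
  proof -
    define y where "y = \<bar>xi\<bar>"
    have y: "0 <= y" by (simp add: y_def)
    have "\<bar>ww xi\<bar> <= y ^ 4 + y ^ 2" unfolding ww_def y_def by (rule order_trans[OF abs_triangle_ineq4]) (simp add: power_abs)
    also have "\<dots> <= (1 + y) ^ 4"
      using y by (simp add: power4_eq_xxxx power2_eq_square algebra_simps)
    finally show "\<bar>ww xi\<bar> <= (1 + \<bar>xi\<bar>) ^ 4" by (simp add: y_def)
    show "\<bar>xi\<^sup>2\<bar> <= (1 + \<bar>xi\<bar>) ^ 2" by (simp add: power2_sum)
  qed
  have "tame (\<lambda>z. (case z of (xi, tau) => ww xi * V (xi, tau)) - (case z of (xi, tau) => xi\<^sup>2 * FF (xi, tau)))"
    by (intro tame_diff tame_mult[OF V_tame _ w(1)] tame_mult[OF FF_tame _ w(2)]) (auto simp: ww_def)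
  then show ?thesis by (simp add: Vtt_def case_prod_unfold)
qed

lemma Vt_tame: "tame Vt"
  by (rule tame_antiderivative[OF V_tame Vtt_tame V_ode])

lemma JJ_V_deriv:
  "0 < tau ==> tau < L ==> (JJ V i has_derivative (\<lambda>(h, k). JJ V (Suc i) (x, tau) * h + JJ Vt i (x, tau) * k)) (at (x, tau))"
  by (rule JJ_has_derivative[OF V_tame Vt_tame V_ode(1)])

lemma JJ_Vt_deriv:
  "0 < tau ==> tau < L ==> (JJ Vt i has_derivative (\<lambda>(h, k). JJ Vt (Suc i) (x, tau) * h + JJ Vtt i (x, tau) * k)) (at (x, tau))"
  by (rule JJ_has_derivative[OF Vt_tame Vtt_tame V_ode(2)])

text \<open>Two differentiations of the cosine change its sign: xi^4 becomes the fourth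
  x-derivative, and both terms carrying -xi^2 become second x-derivatives with a plus sign.\<close>

lemma JJ_Vtt:
  assumes t: "0 < tau" "tau < L"
  shows "JJ Vtt i (x, tau) = JJ V (i + 4) (x, tau) + JJ V (i + 2) (x, tau) + JJ FF (i + 2) (x, tau)"
proof -
  have c4: "cs (i + 4) \<theta> = cs i \<theta>" for \<theta>
  proof -
    have e: "i + 4 = (i + 2) + 2" by simp
    show ?thesis unfolding e cs_2 by simp
  qed
  have "JJ Vtt i (x, tau) = (\<integral>xi. V (xi, tau) * xi ^ (i + 4) * cs (i + 4) (xi * x) + V (xi, tau) * xi ^ (i + 2) * cs (i + 2) (xi * x)
      + FF (xi, tau) * xi ^ (i + 2) * cs (i + 2) (xi * x) \<partial>lborel)"
    unfolding JJ_def
    by (simp only: case_prod_conv)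
      (intro Bochner_Integration.integral_cong refl, simp only: c4 cs_2, simp add: Vtt_def ww_def power_add power2_eq_square algebra_simps)
  also have "\<dots> = JJ V (i + 4) (x, tau) + JJ V (i + 2) (x, tau) + JJ FF (i + 2) (x, tau)"
    unfolding JJ_def case_prod_conv
    using JJ_integrable[OF V_tame t] JJ_integrable[OF FF_tame t]
    by (simp only: Bochner_Integration.integral_add Bochner_Integration.integrable_add)
  finally show ?thesis .
qed

lemma JJ_FF_0: "0 < tau ==> tau < L ==> JJ FF 0 (x, tau) = (JJ V 0 (x, tau))\<^sup>2"
  unfolding FF_def by (rule JJ_conv[OF V_adm V_bnd])

text \<open>Once \<open>JJ FF j\<close> is known as an expression in u, uniqueness of the
  x-derivative identifies the next order; so derivatives of u^2 need no convolution formula of their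
  own.\<close>

lemma JJ_FF_Suc:
  assumes t: "0 < tau" "tau < L" and P: "\<And>x. JJ FF j (x, tau) = P (x, tau)"
    and d: "(P has_derivative (\<lambda>(h, k). gx * h + gt * k)) (at (x, tau))"
  shows "JJ FF (Suc j) (x, tau) = gx"
proof -
  have "((\<lambda>x. P (x, tau)) has_real_derivative JJ FF (Suc j) (x, tau)) (at x)"
    using JJ_x_deriv[OF FF_tame t, of j x] unfolding P .
  moreover have "((\<lambda>x. P (x, tau)) has_real_derivative gx) (at x)"
  proof -
    have "((\<lambda>x. (x, tau)) has_derivative (\<lambda>h. (h, 0))) (at x)" by (auto intro!: derivative_eq_intros)
    from has_derivative_compose[OF this d] show ?thesis by (simp add: has_field_derivative_def)
  qed
  ultimately show ?thesis by (rule DERIV_unique)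
qed

inductive_set PF :: "bool => (real \<times> real => real) set" for q :: bool where
  PF_V: "JJ V i \<in> PF q"
| PF_Vt: "q ==> JJ Vt i \<in> PF q"
| PF_const: "(\<lambda>z. c) \<in> PF q"
| PF_add: "f \<in> PF q ==> g \<in> PF q ==> (\<lambda>z. f z + g z) \<in> PF q"
| PF_mult: "f \<in> PF q ==> g \<in> PF q ==> (\<lambda>z. f z * g z) \<in> PF q"

lemma PF_mono: "f \<in> PF q ==> f \<in> PF True"
  by (induction rule: PF.induct) (auto intro: PF.intros)

text \<open>The equation closes the polynomials in \<open>\<partial>\<^sub>x\<^sup>i u\<close> and \<open>\<partial>\<^sub>x\<^sup>i \<partial>\<^sub>tau u\<close> under differentiation; the flag \<open>q\<close> admits the latter.\<close>

lemma PF_deriv_aux: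
  assumes H: "\<And>j. q ==> \<exists>P\<in>PF True. \<forall>z\<in>UNIV \<times> {0<..<L}. JJ FF j z = P z"
  shows "g \<in> PF q ==> \<exists>gx\<in>PF q. \<exists>gt\<in>PF True. \<forall>z\<in>UNIV \<times> {0<..<L}. (g has_derivative (\<lambda>(h, k). gx z * h + gt z * k)) (at z)"
proof (induction rule: PF.induct)
  case (PF_V i)
  show ?case
    by (intro bexI[of _ "JJ V (Suc i)"] bexI[of _ "JJ Vt i"]) (auto intro: PF.intros JJ_V_deriv)
next
  case (PF_Vt i)
  obtain P where P: "P \<in> PF True" "\<And>z. z \<in> UNIV \<times> {0<..<L} ==> JJ FF (i + 2) z = P z" using H[OF PF_Vt.hyps, of "i + 2"] by blast
  show ?case
  proof (intro bexI ballI)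
    show "JJ Vt (Suc i) \<in> PF q" by (rule PF.PF_Vt[OF PF_Vt.hyps])
    show "(\<lambda>z. (JJ V (i + 4) z + JJ V (i + 2) z) + P z) \<in> PF True" by (intro PF.PF_add PF.PF_V P)
    fix z :: "real \<times> real" assume z: "z \<in> UNIV \<times> {0<..<L}"
    obtain x tau where xt: "z = (x, tau)" by (cases z)
    then have t: "0 < tau" "tau < L" using z by auto
    show "(JJ Vt i has_derivative (\<lambda>(h, k). JJ Vt (Suc i) z * h + ((JJ V (i + 4) z + JJ V (i + 2) z) + P z) * k)) (at z)"
      using JJ_Vt_deriv[OF t, of i x] JJ_Vtt[OF t, of i x] P(2)[OF z] unfolding xt by simp
  qed
next
  case (PF_const c)
  show ?case
    by (intro bexI[of _ "\<lambda>z. 0"] ballI) (auto intro: PF.intros simp: case_prod_unfold)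
next
  case (PF_add f g)
  then obtain fx ft gx gt where *: "fx \<in> PF q" "ft \<in> PF True" "gx \<in> PF q" "gt \<in> PF True"
    and f: "\<And>z. z\<in>UNIV \<times> {0<..<L} ==> (f has_derivative (\<lambda>(h, k). fx z * h + ft z * k)) (at z)"
    and g: "\<And>z. z\<in>UNIV \<times> {0<..<L} ==> (g has_derivative (\<lambda>(h, k). gx z * h + gt z * k)) (at z)" by blast
  show ?case
  proof (intro bexI ballI)
    show "(\<lambda>z. fx z + gx z) \<in> PF q" "(\<lambda>z. ft z + gt z) \<in> PF True" using * by (auto intro: PF.intros)
    fix z :: "real \<times> real" assume z: "z \<in> UNIV \<times> {0<..<L}"
    show "((\<lambda>z. f z + g z) has_derivative (\<lambda>(h, k). (fx z + gx z) * h + (ft z + gt z) * k)) (at z)"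
      by (rule has_derivative_eq_rhs[OF has_derivative_add[OF f[OF z] g[OF z]]]) (auto simp: fun_eq_iff algebra_simps)
  qed
next
  case (PF_mult f g)
  then obtain fx ft gx gt where *: "fx \<in> PF q" "ft \<in> PF True" "gx \<in> PF q" "gt \<in> PF True"
    and f: "\<And>z. z\<in>UNIV \<times> {0<..<L} ==> (f has_derivative (\<lambda>(h, k). fx z * h + ft z * k)) (at z)"
    and g: "\<And>z. z\<in>UNIV \<times> {0<..<L} ==> (g has_derivative (\<lambda>(h, k). gx z * h + gt z * k)) (at z)" by blast
  show ?case
  proof (intro bexI ballI)
    show "(\<lambda>z. f z * gx z + fx z * g z) \<in> PF q" "(\<lambda>z. f z * gt z + ft z * g z) \<in> PF True"
      using * PF_mult.hyps PF_mono by (auto intro!: PF.intros)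
    fix z :: "real \<times> real" assume z: "z \<in> UNIV \<times> {0<..<L}"
    show "((\<lambda>z. f z * g z) has_derivative (\<lambda>(h, k). (f z * gx z + fx z * g z) * h + (f z * gt z + ft z * g z) * k)) (at z)"
      by (rule has_derivative_eq_rhs[OF has_derivative_mult[OF f[OF z] g[OF z]]]) (auto simp: fun_eq_iff algebra_simps)
  qed
qed

text \<open>Taking q = False makes the hypothesis of \<open>PF_deriv_aux\<close> vacuous. This
  breaks a circle: the time derivative of \<open>JJ Vt i\<close> contains \<open>JJ FF\<close>,
  which has to be recognised as a polynomial first, by x-derivatives alone.\<close>

lemma FF_PF: "\<exists>P\<in>PF False. \<forall>z\<in>UNIV \<times> {0<..<L}. JJ FF j z = P z"
proof (induction j)
  case 0
  have "\<forall>z\<in>UNIV \<times> {0<..<L}. JJ FF 0 z = JJ V 0 z * JJ V 0 z"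
    using JJ_FF_0 by (auto simp: power2_eq_square)
  then show ?case by (intro bexI[of _ "\<lambda>z. JJ V 0 z * JJ V 0 z"]) (auto intro: PF.intros)
next
  case (Suc j)
  then obtain P where P: "P \<in> PF False" "\<And>z. z \<in> UNIV \<times> {0<..<L} ==> JJ FF j z = P z" by blast
  obtain gx gt where g: "gx \<in> PF False"
    "\<And>z. z\<in>UNIV \<times> {0<..<L} ==> (P has_derivative (\<lambda>(h, k). gx z * h + gt z * k)) (at z)"
    using PF_deriv_aux[OF _ P(1)] by blast
  have "JJ FF (Suc j) (x, tau) = gx (x, tau)" if t: "0 < tau" "tau < L" for x tau
    by (rule JJ_FF_Suc[OF t P(2) g(2)]) (use t in auto)
  then show ?case using g(1) by (intro bexI[of _ gx]) auto
qed

lemma PF_deriv: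
  assumes "g \<in> PF True"
  shows "\<exists>gx\<in>PF True. \<exists>gt\<in>PF True. \<forall>z\<in>UNIV \<times> {0<..<L}. (g has_derivative (\<lambda>(h, k). gx z * h + gt z * k)) (at z)"
  using FF_PF PF_mono by (intro PF_deriv_aux[OF _ assms]) blast

lemma JJ_V_eq:
  assumes t: "0 < tau" "tau < L"
  shows "JJ Vtt 0 (x, tau) = JJ V 4 (x, tau) + JJ V 2 (x, tau) + (2 * (JJ V 1 (x, tau))\<^sup>2 + 2 * JJ V 0 (x, tau) * JJ V 2 (x, tau))"
proof -
  have 0: "JJ FF 0 (x, tau) = (\<lambda>z. JJ V 0 z * JJ V 0 z) (x, tau)" for x
    using JJ_FF_0[OF t] by (simp add: power2_eq_square)
  have 1: "JJ FF (Suc 0) (x, tau) = 2 * JJ V 0 (x, tau) * JJ V (Suc 0) (x, tau)" for x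
    by (rule JJ_FF_Suc[OF t 0, where gt = "2 * JJ V 0 (x, tau) * JJ Vt 0 (x, tau)"])
      (rule has_derivative_eq_rhs[OF has_derivative_mult[OF JJ_V_deriv[OF t] JJ_V_deriv[OF t]]], auto simp: fun_eq_iff algebra_simps)
  have 1: "JJ FF (Suc 0) (x, tau) = (\<lambda>z. 2 * (JJ V 0 z * JJ V (Suc 0) z)) (x, tau)" for x
    by (simp add: 1)
  have d: "((\<lambda>z. 2 * (JJ V 0 z * JJ V (Suc 0) z)) has_derivative (\<lambda>(h, k).
      (2 * (JJ V (Suc 0) (x, tau))\<^sup>2 + 2 * JJ V 0 (x, tau) * JJ V (Suc (Suc 0)) (x, tau)) * h +
      (2 * JJ Vt 0 (x, tau) * JJ V (Suc 0) (x, tau) + 2 * JJ V 0 (x, tau) * JJ Vt (Suc 0) (x, tau)) * k)) (at (x, tau))"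
    by (rule has_derivative_eq_rhs[OF has_derivative_mult_right[OF has_derivative_mult[OF JJ_V_deriv[OF t] JJ_V_deriv[OF t]]]])
      (auto simp: fun_eq_iff algebra_simps power2_eq_square)
  have "JJ FF (Suc (Suc 0)) (x, tau) = 2 * (JJ V (Suc 0) (x, tau))\<^sup>2 + 2 * JJ V 0 (x, tau) * JJ V (Suc (Suc 0)) (x, tau)"
    by (rule JJ_FF_Suc[OF t 1 d])
  then show ?thesis using JJ_Vtt[OF t, of 0 x] by (simp add: numeral_2_eq_2)
qed

end

section \<open>Spatial decay\<close>

lemma fd_iter_Suc: "(fd h ^^ Suc n) f = (fd h ^^ n) (fd h f)"
  by (simp add: funpow_Suc_right del: funpow.simps)

lemma fd_iter_Suc': "(fd h ^^ Suc n) f x = (fd h ^^ n) f (x + h) - (fd h ^^ n) f x"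
  by (simp add: fd_def)

lemma fd_iter_add: "(fd h ^^ n) (\<lambda>x. f x + g x) x = (fd h ^^ n) f x + (fd h ^^ n) g x"
  by (induction n arbitrary: x) (simp_all add: fd_iter_Suc' del: funpow.simps(2))

lemma fd_iter_shift: "(fd h ^^ n) (\<lambda>x. f (x + c)) x = (fd h ^^ n) f (x + c)"
  for x :: "'a::ab_group_add"
  by (induction n arbitrary: x) (simp_all add: fd_iter_Suc' add.commute add.left_commute del: funpow.simps(2))

lemma fd_iter_multc: "(fd h ^^ n) (\<lambda>x. f x * c) x = (fd h ^^ n) f x * c"
  for c :: "'b::ring"
  by (induction n arbitrary: x) (simp_all add: fd_iter_Suc' left_diff_distrib del: funpow.simps(2))

lemma fd_iter_integral:
  fixes f :: "real => 'b => real"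
  assumes "\<And>x. integrable M (f x)"
  shows "integrable M (\<lambda>s. (fd h ^^ n) (\<lambda>x. f x s) x)"
    "(fd h ^^ n) (\<lambda>x. \<integral>s. f x s \<partial>M) x = (\<integral>s. (fd h ^^ n) (\<lambda>x. f x s) x \<partial>M)"
proof -
  have "integrable M (\<lambda>s. (fd h ^^ n) (\<lambda>x. f x s) x) \<and>
    (fd h ^^ n) (\<lambda>x. \<integral>s. f x s \<partial>M) x = (\<integral>s. (fd h ^^ n) (\<lambda>x. f x s) x \<partial>M)"
    using assms by (induction n arbitrary: x) (simp_all add: fd_iter_Suc' del: funpow.simps(2))
  then show "integrable M (\<lambda>s. (fd h ^^ n) (\<lambda>x. f x s) x)"
    "(fd h ^^ n) (\<lambda>x. \<integral>s. f x s \<partial>M) x = (\<integral>s. (fd h ^^ n) (\<lambda>x. f x s) x \<partial>M)" by auto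
qed

lemma sum_choose_Suc:
  fixes x :: "nat => real"
  shows "(\<Sum>j\<le>n. real (n choose j) * x (Suc j)) + (\<Sum>j\<le>n. real (n choose j) * x j) = (\<Sum>j\<le>Suc n. real (Suc n choose j) * x j)"
proof -
  have "(\<Sum>j\<le>n. real (n choose j) * x j) = (\<Sum>j\<le>Suc n. real (n choose j) * x j)" by simp
  also have "\<dots> = x 0 + (\<Sum>j\<le>n. real (n choose Suc j) * x (Suc j))"
    by (subst sum.atMost_Suc_shift) simp
  finally have e: "(\<Sum>j\<le>n. real (n choose j) * x j) = x 0 + (\<Sum>j\<le>n. real (n choose Suc j) * x (Suc j))" .
  have "(\<Sum>j\<le>Suc n. real (Suc n choose j) * x j) = x 0 + (\<Sum>j\<le>n. real (Suc n choose Suc j) * x (Suc j))"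
    by (subst sum.atMost_Suc_shift) simp
  then show ?thesis by (simp add: e distrib_right sum.distrib)
qed

text \<open>Discrete Leibniz rule in which every shift is put on k. Since k is measured by bounds
  uniform in x, the shifts disappear and the differences of f are taken at x itself.\<close>

lemma fd_iter_mult_bound:
  fixes k f :: "real => real"
  assumes "\<And>j x. j <= n ==> \<bar>(fd h ^^ j) k x\<bar> <= a j"
  shows "\<bar>(fd h ^^ n) (\<lambda>x. k x * f x) x\<bar> <= (\<Sum>j\<le>n. real (n choose j) * (a j * \<bar>(fd h ^^ (n - j)) f x\<bar>))"
  using assms
proof (induction n arbitrary: k f a)
  case 0
  then show ?case using mult_right_mono[of "\<bar>k x\<bar>" "a 0" "\<bar>f x\<bar>"] 0[of 0 x] by (simp add: abs_mult)
next
  case (Suc n)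
  have e: "fd h (\<lambda>x. k x * f x) = (\<lambda>x. fd h k x * f x + k (x + h) * fd h f x)"
    by (simp add: fd_def algebra_simps)
  have 1: "\<bar>(fd h ^^ n) (\<lambda>x. fd h k x * f x) x\<bar> <= (\<Sum>j\<le>n. real (n choose j) * (a (Suc j) * \<bar>(fd h ^^ (n - j)) f x\<bar>))"
  proof (rule Suc.IH)
    fix j x assume "j <= n"
    then show "\<bar>(fd h ^^ j) (fd h k) x\<bar> <= a (Suc j)" using Suc.prems[of "Suc j" x] by (simp add: fd_iter_Suc del: funpow.simps(2))
  qed
  have 2: "\<bar>(fd h ^^ n) (\<lambda>x. k (x + h) * fd h f x) x\<bar> <= (\<Sum>j\<le>n. real (n choose j) * (a j * \<bar>(fd h ^^ (n - j)) (fd h f) x\<bar>))"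
  proof (rule Suc.IH)
    fix j x assume "j <= n"
    then show "\<bar>(fd h ^^ j) (\<lambda>x. k (x + h)) x\<bar> <= a j" unfolding fd_iter_shift using Suc.prems by simp
  qed
  have 3: "(\<Sum>j\<le>n. real (n choose j) * (a j * \<bar>(fd h ^^ (n - j)) (fd h f) x\<bar>)) = (\<Sum>j\<le>n. real (n choose j) * (a j * \<bar>(fd h ^^ (Suc n - j)) f x\<bar>))"
    by (intro sum.cong refl) (simp add: Suc_diff_le fd_iter_Suc del: funpow.simps(2))
  have "\<bar>(fd h ^^ Suc n) (\<lambda>x. k x * f x) x\<bar> <= \<bar>(fd h ^^ n) (\<lambda>x. fd h k x * f x) x\<bar> + \<bar>(fd h ^^ n) (\<lambda>x. k (x + h) * fd h f x) x\<bar>"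
    unfolding fd_iter_Suc e fd_iter_add by (rule abs_triangle_ineq)
  also have "\<dots> <= (\<Sum>j\<le>n. real (n choose j) * (a (Suc j) * \<bar>(fd h ^^ (Suc n - Suc j)) f x\<bar>)) + (\<Sum>j\<le>n. real (n choose j) * (a j * \<bar>(fd h ^^ (Suc n - j)) f x\<bar>))"
    using 1 2 unfolding 3 by simp
  also have "\<dots> = (\<Sum>j\<le>Suc n. real (Suc n choose j) * (a j * \<bar>(fd h ^^ (Suc n - j)) f x\<bar>))"
    by (rule sum_choose_Suc)
  finally show ?case .
qed

definition n1 :: "(real => real) => ennreal" where
  "n1 f = (\<integral>\<^sup>+xi. ennreal \<bar>f xi\<bar> \<partial>lborel)"

lemma fd_iter_measurable:
  fixes F :: "real \<times> 'b => real"
  assumes F: "F \<in> borel_measurable (borel \<Otimes>\<^sub>M N)"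
  shows "(\<lambda>p. (fd h ^^ n) (\<lambda>xi. F (xi, snd p)) (fst p)) \<in> borel_measurable (borel \<Otimes>\<^sub>M N)"
proof (induction n)
  case 0 then show ?case using F by simp
next
  case (Suc n)
  have "(\<lambda>p. (fst p + h, snd p)) \<in> (borel \<Otimes>\<^sub>M N) \<rightarrow>\<^sub>M (borel \<Otimes>\<^sub>M N)" by measurable
  from measurable_compose[OF this Suc]
  have "(\<lambda>p. (fd h ^^ n) (\<lambda>xi. F (xi, snd p)) (fst p + h)) \<in> borel_measurable (borel \<Otimes>\<^sub>M N)" by simp
  then show ?case using Suc unfolding fd_iter_Suc' by simp
qed

lemma fd_iter_measurable1:
  fixes f :: "real => real"
  assumes f: "f \<in> borel_measurable borel"
  shows "(fd h ^^ n) f \<in> borel_measurable borel"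
proof (induction n)
  case 0 then show ?case using f by simp
next
  case (Suc n)
  have "(\<lambda>x. x + h) \<in> borel \<rightarrow>\<^sub>M borel" by measurable
  from measurable_compose[OF this Suc]
  have "(\<lambda>x. (fd h ^^ n) f (x + h)) \<in> borel_measurable borel" .
  then show ?case using Suc unfolding fd_iter_Suc'[abs_def] by simp
qed

lemma n1_fd_le:
  assumes f: "f \<in> borel_measurable borel"
  shows "n1 ((fd h ^^ n) f) <= 2 ^ n * n1 f"
proof (induction n)
  case (Suc n)
  define g where "g = (fd h ^^ n) f"
  have [measurable]: "g \<in> borel_measurable borel" unfolding g_def by (rule fd_iter_measurable1[OF f])
  have "n1 ((fd h ^^ Suc n) f) <= (\<integral>\<^sup>+xi. ennreal \<bar>g (xi + h)\<bar> + ennreal \<bar>g xi\<bar> \<partial>lborel)"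
    unfolding n1_def fd_iter_Suc' g_def by (intro nn_integral_mono) (simp flip: ennreal_plus)
  also have "\<dots> = (\<integral>\<^sup>+xi. ennreal \<bar>g (xi + h)\<bar> \<partial>lborel) + (\<integral>\<^sup>+xi. ennreal \<bar>g xi\<bar> \<partial>lborel)"
    by (rule nn_integral_add) measurable
  also have "(\<integral>\<^sup>+xi. ennreal \<bar>g (xi + h)\<bar> \<partial>lborel) = (\<integral>\<^sup>+xi. ennreal \<bar>g xi\<bar> \<partial>lborel)"
    using nn_integral_translate[of "\<lambda>xi. ennreal \<bar>g xi\<bar>" h] by simp
  finally have "n1 ((fd h ^^ Suc n) f) <= 2 * n1 g" unfolding n1_def by (simp add: mult_2)
  also have "\<dots> <= 2 * (2 ^ n * n1 f)" using Suc unfolding g_def by (intro mult_left_mono) auto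
  finally show ?case by (simp add: mult.assoc)
qed simp

section \<open>The integral equation under differences in frequency\<close>

context boussinesq_fourier
begin

definition Phi :: "real => real => real" where "Phi tau xi = A xi * EEr xi tau"

definition XX :: "nat => real => real => ennreal" where
  "XX n h tau = n1 ((fd h ^^ n) (\<lambda>xi. V (xi, tau)))"

lemma M_nonneg: "0 <= M"
  using bndD(5)[OF V_bnd, of "L/2"] b_pos[of "L/2"] L by (simp add: zero_le_mult_iff)

text \<open>Crude, without any power of h; it serves as the finite starting point of
  \<open>gronwall_absorb\<close>.\<close>

lemma XX_apriori: "0 < tau ==> tau < L ==> XX n h tau <= ennreal (2 ^ n * M * b tau)"
proof -
  assume t: "0 < tau" "tau < L"
  have "XX n h tau <= 2 ^ n * n1 (\<lambda>xi. V (xi, tau))" unfolding XX_def by (rule n1_fd_le[OF adm_section(1)[OF V_adm]])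
  also have "\<dots> <= 2 ^ n * ennreal (M * b tau)" using bndD(4)[OF V_bnd t] unfolding n1_def by (intro mult_left_mono) auto
  also have "\<dots> = ennreal (2 ^ n * M * b tau)"
    using M_nonneg b_pos[OF t] by (simp add: ennreal_mult mult.assoc flip: ennreal_power)
  finally show ?thesis .
qed

text \<open>Convolution commutes with translations, so all differences fall on one factor and the
  other enters by its plain L1 norm. The estimate is therefore linear in the n-th
  difference.\<close>

lemma n1_fd_conv:
  assumes t: "0 < s" "s < L"
  shows "n1 ((fd h ^^ n) (\<lambda>xi. FF (xi, s))) <= XX n h s * ennreal (M * b s)"
proof -
  define f where "f xi = V (xi, s)" for xi
  have fm [measurable]: "f \<in> borel_measurable borel" unfolding f_def by (rule adm_section[OF V_adm])
  define g where "g = (fd h ^^ n) f"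
  have gm [measurable]: "g \<in> borel_measurable borel" unfolding g_def by (rule fd_iter_measurable1[OF fm])
  have int: "integrable lborel (\<lambda>l. f (xi - l) * f l)" for xi
    using conv_integrable[OF V_adm V_adm V_bnd V_bnd t] by (simp add: f_def)
  have e: "(fd h ^^ n) (\<lambda>xi. FF (xi, s)) xi = (\<integral>l. g (xi - l) * f l \<partial>lborel)" for xi
  proof -
    have "(fd h ^^ n) (\<lambda>xi. FF (xi, s)) xi = (fd h ^^ n) (\<lambda>xi. \<integral>l. f (xi - l) * f l \<partial>lborel) xi"
      by (simp add: FF_def conv_def f_def)
    also have "\<dots> = (\<integral>l. (fd h ^^ n) (\<lambda>xi. f (xi - l) * f l) xi \<partial>lborel)"
      by (rule fd_iter_integral(2)[OF int])
    also have "\<dots> = (\<integral>l. g (xi - l) * f l \<partial>lborel)"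
      unfolding fd_iter_multc g_def using fd_iter_shift[of n h f "- _" xi] by simp
    finally show ?thesis .
  qed
  have "n1 ((fd h ^^ n) (\<lambda>xi. FF (xi, s))) <= (\<integral>\<^sup>+xi. (\<integral>\<^sup>+l. ennreal \<bar>g (xi - l)\<bar> * ennreal \<bar>f l\<bar> \<partial>lborel) \<partial>lborel)"
    unfolding n1_def e
    by (intro nn_integral_mono order_trans[OF ennreal_abs_integral_le]) (simp add: abs_mult ennreal_mult)
  also have "\<dots> = (\<integral>\<^sup>+xi. ennreal \<bar>g xi\<bar> \<partial>lborel) * (\<integral>\<^sup>+xi. ennreal \<bar>f xi\<bar> \<partial>lborel)"
    by (rule nn_integral_convolution) measurable
  also have "\<dots> <= XX n h s * ennreal (M * b s)"
    using bndD(4)[OF V_bnd t] by (intro mult_mono) (auto simp: XX_def n1_def g_def f_def[abs_def])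
  finally show ?thesis .
qed

text \<open>Leibniz puts j differences on the kernel, measured in sup by \<open>a j\<close>, and n -
  j on the convolution, measured in L1. Integrating in xi first leaves a scalar integral inequality
  in time, which all decay estimates share.\<close>

lemma XX_step:
  assumes t: "0 < tau" "tau < L"
    and a: "\<And>j s xi. j <= n ==> 0 < s ==> s < L ==> \<bar>(fd h ^^ j) (\<lambda>xi. kk xi tau s) xi\<bar> <= a j s"
    and am: "\<And>j. a j \<in> borel_measurable borel"
    and g: "\<And>j s. j <= n ==> 0 < s ==> s < L ==> XX j h s <= ennreal (g j s) \<and> 0 <= g j s"
  shows "XX n h tau <= n1 ((fd h ^^ n) (Phi tau)) +
     (\<integral>\<^sup>+s. indicator {0<..<L} s * ennreal (\<Sum>j\<le>n. real (n choose j) * (a j s * (g (n - j) s * (M * b s)))) \<partial>lborel)"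
proof -
  note [measurable] = am
  have a0: "0 <= a j s" if "j <= n" "0 < s" "s < L" for j s using a[OF that, of 0] by linarith
  have FFm: "FF \<in> borel_measurable (borel \<Otimes>\<^sub>M borel)" by (rule adm_measurable[OF FF_adm])
  define d where "d m p = (fd h ^^ m) (\<lambda>xi. FF (xi, snd p)) (fst p)" for m and p :: "real \<times> real"
  have dm [measurable]: "d m \<in> borel_measurable (borel \<Otimes>\<^sub>M borel)" for m
    unfolding d_def[abs_def] by (rule fd_iter_measurable[OF FFm])
  have MM: "0 <= M * M" by simp
  have iF: "integrable lborel (\<lambda>s. kk xi tau s * FF (xi, s))" for xi
    by (rule kk_F_integrable(1)[OF FF_adm FF_bnd MM t(1) order_refl t(2)])
  have Veq: "V (xi, tau) = Phi tau xi + (\<integral>s. kk xi tau s * FF (xi, s) \<partial>lborel)" for xi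
    using V_eq[OF t, of xi] t by (simp add: Phi_def duh_def FF_def)
  have e: "(fd h ^^ n) (\<lambda>xi. V (xi, tau)) xi = (fd h ^^ n) (Phi tau) xi + (\<integral>s. (fd h ^^ n) (\<lambda>xi. kk xi tau s * FF (xi, s)) xi \<partial>lborel)" for xi
    unfolding Veq fd_iter_add fd_iter_integral(2)[OF iF] ..
  have FF0: "FF (xi, s) = 0" if "s \<notin> {0<..<L}" for xi s by (rule admD(2)[OF FF_adm that])
  have pt: "ennreal \<bar>(fd h ^^ n) (\<lambda>xi. kk xi tau s * FF (xi, s)) xi\<bar> <=
     indicator {0<..<L} s * (\<Sum>j\<le>n. ennreal (real (n choose j) * a j s) * ennreal \<bar>d (n - j) (xi, s)\<bar>)" for xi s
  proof (cases "s \<in> {0<..<L}")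
    case True
    then have s: "0 < s" "s < L" by auto
    have "\<bar>(fd h ^^ n) (\<lambda>xi. kk xi tau s * FF (xi, s)) xi\<bar> <= (\<Sum>j\<le>n. real (n choose j) * (a j s * \<bar>d (n - j) (xi, s)\<bar>))"
      using fd_iter_mult_bound[of n h "\<lambda>xi. kk xi tau s" "\<lambda>j. a j s" "\<lambda>xi. FF (xi, s)" xi] a[OF _ s] by (simp add: d_def)
    then have "ennreal \<bar>(fd h ^^ n) (\<lambda>xi. kk xi tau s * FF (xi, s)) xi\<bar> <= ennreal (\<Sum>j\<le>n. real (n choose j) * a j s * \<bar>d (n - j) (xi, s)\<bar>)"
      by (intro ennreal_leI) (simp add: mult.assoc)
    also have "\<dots> = (\<Sum>j\<le>n. ennreal (real (n choose j) * a j s * \<bar>d (n - j) (xi, s)\<bar>))"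
      using a0[OF _ s] by (intro sum_ennreal[symmetric]) auto
    also have "\<dots> = (\<Sum>j\<le>n. ennreal (real (n choose j) * a j s) * ennreal \<bar>d (n - j) (xi, s)\<bar>)"
      using a0[OF _ s] by (intro sum.cong refl ennreal_mult) auto
    finally show ?thesis using True by simp
  next
    case False
    have "(fd h ^^ n) (\<lambda>xi. 0 * (0::real)) xi = 0" unfolding fd_iter_multc by simp
    then show ?thesis using False FF0 by simp
  qed
  have "XX n h tau <= (\<integral>\<^sup>+xi. ennreal \<bar>(fd h ^^ n) (Phi tau) xi\<bar> + (\<integral>\<^sup>+s. indicator {0<..<L} s * (\<Sum>j\<le>n. ennreal (real (n choose j) * a j s) * ennreal \<bar>d (n - j) (xi, s)\<bar>) \<partial>lborel) \<partial>lborel)"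
    unfolding XX_def n1_def
  proof (intro nn_integral_mono)
    fix xi
    have "ennreal \<bar>(fd h ^^ n) (\<lambda>xi. V (xi, tau)) xi\<bar> <= ennreal \<bar>(fd h ^^ n) (Phi tau) xi\<bar> + ennreal \<bar>\<integral>s. (fd h ^^ n) (\<lambda>xi. kk xi tau s * FF (xi, s)) xi \<partial>lborel\<bar>"
      unfolding e by (simp flip: ennreal_plus)
    also have "ennreal \<bar>\<integral>s. (fd h ^^ n) (\<lambda>xi. kk xi tau s * FF (xi, s)) xi \<partial>lborel\<bar> <= (\<integral>\<^sup>+s. ennreal \<bar>(fd h ^^ n) (\<lambda>xi. kk xi tau s * FF (xi, s)) xi\<bar> \<partial>lborel)"
      by (rule ennreal_abs_integral_le)
    also have "\<dots> <= (\<integral>\<^sup>+s. indicator {0<..<L} s * (\<Sum>j\<le>n. ennreal (real (n choose j) * a j s) * ennreal \<bar>d (n - j) (xi, s)\<bar>) \<partial>lborel)"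
      by (intro nn_integral_mono pt)
    finally show "ennreal \<bar>(fd h ^^ n) (\<lambda>xi. V (xi, tau)) xi\<bar> <= ennreal \<bar>(fd h ^^ n) (Phi tau) xi\<bar> + (\<integral>\<^sup>+s. indicator {0<..<L} s * (\<Sum>j\<le>n. ennreal (real (n choose j) * a j s) * ennreal \<bar>d (n - j) (xi, s)\<bar>) \<partial>lborel)"
      by (simp add: add_left_mono)
  qed
  also have "\<dots> = n1 ((fd h ^^ n) (Phi tau)) + (\<integral>\<^sup>+xi. (\<integral>\<^sup>+s. indicator {0<..<L} s * (\<Sum>j\<le>n. ennreal (real (n choose j) * a j s) * ennreal \<bar>d (n - j) (xi, s)\<bar>) \<partial>lborel) \<partial>lborel)"
  proof -
    have "Phi tau \<in> borel_measurable borel"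
    proof -
      have "Phi tau = (\<lambda>xi. V (xi, tau) - duh (conv V V) (xi, tau))" using V_eq[OF t] by (simp add: Phi_def fun_eq_iff)
      moreover have "(\<lambda>xi. V (xi, tau)) \<in> borel_measurable borel" by (rule adm_section[OF V_adm])
      moreover have "(\<lambda>xi. duh (conv V V) (xi, tau)) \<in> borel_measurable borel"
        using adm_section(1)[OF duh_adm[OF FF_adm FF_bnd MM]] by (simp add: FF_def)
      ultimately show ?thesis by simp
    qed
    then have [measurable]: "(fd h ^^ n) (Phi tau) \<in> borel_measurable borel" by (rule fd_iter_measurable1)
    show ?thesis unfolding n1_def by (rule nn_integral_add) measurable
  qed
  also have "(\<integral>\<^sup>+xi. (\<integral>\<^sup>+s. indicator {0<..<L} s * (\<Sum>j\<le>n. ennreal (real (n choose j) * a j s) * ennreal \<bar>d (n - j) (xi, s)\<bar>) \<partial>lborel) \<partial>lborel) =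
     (\<integral>\<^sup>+s. (\<integral>\<^sup>+xi. indicator {0<..<L} s * (\<Sum>j\<le>n. ennreal (real (n choose j) * a j s) * ennreal \<bar>d (n - j) (xi, s)\<bar>) \<partial>lborel) \<partial>lborel)"
    by (rule lborel_pair.Fubini') measurable
  also have "\<dots> <= (\<integral>\<^sup>+s. indicator {0<..<L} s * ennreal (\<Sum>j\<le>n. real (n choose j) * (a j s * (g (n - j) s * (M * b s)))) \<partial>lborel)"
  proof (intro nn_integral_mono)
    fix s :: real
    show "(\<integral>\<^sup>+xi. indicator {0<..<L} s * (\<Sum>j\<le>n. ennreal (real (n choose j) * a j s) * ennreal \<bar>d (n - j) (xi, s)\<bar>) \<partial>lborel) <=
       indicator {0<..<L} s * ennreal (\<Sum>j\<le>n. real (n choose j) * (a j s * (g (n - j) s * (M * b s))))"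
    proof (cases "s \<in> {0<..<L}")
      case True
      then have s: "0 < s" "s < L" by auto
      have Mb: "0 <= M * b s" using M_nonneg b_pos[OF s] by simp
      have "(\<integral>\<^sup>+xi. indicator {0<..<L} s * (\<Sum>j\<le>n. ennreal (real (n choose j) * a j s) * ennreal \<bar>d (n - j) (xi, s)\<bar>) \<partial>lborel) =
        (\<Sum>j\<le>n. (\<integral>\<^sup>+xi. ennreal (real (n choose j) * a j s) * ennreal \<bar>d (n - j) (xi, s)\<bar> \<partial>lborel))"
        using True by (simp, subst nn_integral_sum) (auto simp: )
      also have "\<dots> = (\<Sum>j\<le>n. ennreal (real (n choose j) * a j s) * n1 ((fd h ^^ (n - j)) (\<lambda>xi. FF (xi, s))))"
        by (intro sum.cong refl) (subst nn_integral_cmult, measurable, simp add: n1_def d_def)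
      also have "\<dots> <= (\<Sum>j\<le>n. ennreal (real (n choose j) * a j s) * (ennreal (g (n - j) s) * ennreal (M * b s)))"
      proof (intro sum_mono mult_left_mono)
        fix j
        have "n1 ((fd h ^^ (n - j)) (\<lambda>xi. FF (xi, s))) <= XX (n - j) h s * ennreal (M * b s)" by (rule n1_fd_conv[OF s])
        also have "\<dots> <= ennreal (g (n - j) s) * ennreal (M * b s)" using g[OF _ s, of "n - j"] by (intro mult_right_mono) auto
        finally show "n1 ((fd h ^^ (n - j)) (\<lambda>xi. FF (xi, s))) <= ennreal (g (n - j) s) * ennreal (M * b s)" .
      qed auto
      also have "\<dots> = (\<Sum>j\<le>n. ennreal (real (n choose j) * (a j s * (g (n - j) s * (M * b s)))))"
      proof (intro sum.cong refl)
        fix j assume j: "j \<in> {..n}"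
        have "0 <= g (n - j) s" "0 <= a j s" using g[OF _ s, of "n - j"] a0[OF _ s, of j] j by auto
        then show "ennreal (real (n choose j) * a j s) * (ennreal (g (n - j) s) * ennreal (M * b s)) = ennreal (real (n choose j) * (a j s * (g (n - j) s * (M * b s))))"
          using Mb by (simp only: ennreal_mult[symmetric] mult_nonneg_nonneg of_nat_0_le_iff mult.assoc)
      qed
      also have "\<dots> = ennreal (\<Sum>j\<le>n. real (n choose j) * (a j s * (g (n - j) s * (M * b s))))"
      proof (intro sum_ennreal)
        fix j assume j: "j \<in> {..n}"
        have "0 <= g (n - j) s" "0 <= a j s" using g[OF _ s, of "n - j"] a0[OF _ s, of j] j by auto
        then show "0 <= real (n choose j) * (a j s * (g (n - j) s * (M * b s)))" using Mb by simp
      qed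
      finally show ?thesis using True by simp
    qed simp
  qed
  finally show ?thesis by (simp add: add_left_mono)
qed

end

context time_interval
begin

lemma kk_diff_ratio:
  "\<exists>C h0. 0 < C \<and> 0 < h0 \<and> (\<forall>h xi tau s. 0 < h \<and> h <= h0 \<and> 0 < tau \<and> tau < L \<and> 0 < s \<and> s < L -->
     \<bar>(fd h ^^ n) (\<lambda>xi. kk xi tau s) xi\<bar> <= C * h ^ n * (min tau s / max tau s))"
  using kk_diff[of n] by (elim ex_forward conj_forward all_forward imp_forward) simp_all

lemma kk_diff_sqrt:
  "\<exists>C h0. 0 < C \<and> 0 < h0 \<and> (\<forall>h xi tau s. 0 < h \<and> h <= h0 \<and> 0 < tau \<and> tau < L \<and> 0 < s \<and> s < L -->
     \<bar>(fd h ^^ 1) (\<lambda>xi. kk xi tau s) xi\<bar> <= C * h ^ 1 * (min tau s / sqrt (max tau s)))"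
  using kk_diff[of 1] by (elim ex_forward conj_forward all_forward imp_forward) simp_all

lemma kk_diff_min:
  "\<exists>C h0. 0 < C \<and> 0 < h0 \<and> (\<forall>h xi tau s. 0 < h \<and> h <= h0 \<and> 0 < tau \<and> tau < L \<and> 0 < s \<and> s < L -->
     \<bar>(fd h ^^ 2) (\<lambda>xi. kk xi tau s) xi\<bar> <= C * h ^ 2 * min tau s)"
  using kk_diff[of 2] by (elim ex_forward conj_forward all_forward imp_forward) simp_all

end

context blowup_weight
begin

lemma kappa_dom:
  assumes t: "0 < tau" and g: "1 - e < g" "g < 2" and c: "0 <= c"
    and f: "\<And>s. 0 < s ==> s < L ==> f s <= c * (min tau s * max tau s powr (- e) * s powr (- g))"
  shows "(\<integral>\<^sup>+s. indicator {0<..<L} s * ennreal (f s) \<partial>lborel) <= ennreal (c * ((1 / (2 - g) + 1 / (g + e - 1)) * tau powr (2 - e - g)))"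
proof -
  have "(\<integral>\<^sup>+s. indicator {0<..<L} s * ennreal (f s) \<partial>lborel) <=
    (\<integral>\<^sup>+s. ennreal c * (indicator {0<..<L} s * ennreal (min tau s * max tau s powr (- e) * s powr (- g))) \<partial>lborel)"
  proof (intro nn_integral_mono)
    fix s :: real
    show "indicator {0<..<L} s * ennreal (f s) <= ennreal c * (indicator {0<..<L} s * ennreal (min tau s * max tau s powr (- e) * s powr (- g)))"
    proof (cases "0 < s \<and> s < L")
      case True
      then have "ennreal (f s) <= ennreal (c * (min tau s * max tau s powr (- e) * s powr (- g)))"
        using f by (intro ennreal_leI) auto
      also have "\<dots> = ennreal c * ennreal (min tau s * max tau s powr (- e) * s powr (- g))"
        by (rule ennreal_mult'[OF c])
      finally show ?thesis using True by simp
    qed (auto simp: indicator_def)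
  qed
  also have "\<dots> = ennreal c * (\<integral>\<^sup>+s. indicator {0<..<L} s * ennreal (min tau s * max tau s powr (- e) * s powr (- g)) \<partial>lborel)"
    by (rule nn_integral_cmult) measurable
  also have "\<dots> <= ennreal c * ennreal ((1 / (2 - g) + 1 / (g + e - 1)) * tau powr (2 - e - g))"
    by (intro mult_left_mono kappa_integral t g) auto
  also have "\<dots> = ennreal (c * ((1 / (2 - g) + 1 / (g + e - 1)) * tau powr (2 - e - g)))"
    by (rule ennreal_mult'[OF c, symmetric])
  finally show ?thesis .
qed

lemma power_dom:
  assumes p: "-1 < p" and c: "0 <= c"
    and f: "\<And>s. 0 < s ==> s < L ==> f s <= c * s powr p"
  shows "(\<integral>\<^sup>+s. indicator {0<..<L} s * ennreal (f s) \<partial>lborel) <= ennreal (c * (L powr (p + 1) / (p + 1)))"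
proof -
  have "(\<integral>\<^sup>+s. indicator {0<..<L} s * ennreal (f s) \<partial>lborel) <=
    (\<integral>\<^sup>+s. ennreal c * (ennreal (s powr p) * indicator {0..L} s) \<partial>lborel)"
  proof (intro nn_integral_mono)
    fix s :: real
    show "indicator {0<..<L} s * ennreal (f s) <= ennreal c * (ennreal (s powr p) * indicator {0..L} s)"
    proof (cases "0 < s \<and> s < L")
      case True
      then have "ennreal (f s) <= ennreal (c * s powr p)" using f by (intro ennreal_leI) auto
      then show ?thesis using True by (simp add: ennreal_mult'[OF c])
    qed (auto simp: indicator_def)
  qed
  also have "\<dots> = ennreal c * (\<integral>\<^sup>+s. ennreal (s powr p) * indicator {0..L} s \<partial>lborel)"
    by (rule nn_integral_cmult) measurable
  also have "\<dots> = ennreal c * ennreal (L powr (p + 1) / (p + 1))"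
    using nn_integral_powr_from_0[OF p, of L] L by simp
  also have "\<dots> = ennreal (c * (L powr (p + 1) / (p + 1)))"
    by (rule ennreal_mult'[OF c, symmetric])
  finally show ?thesis .
qed

lemma max_powr: "0 < tau ==> max tau s powr (- 1) = 1 / max tau s" for tau s :: real
  using powr_neg_one[of "max tau s"] by simp

text \<open>Counterpart of \<open>Cq\<close> for the weight s^(-\<gamma>):
  \<open>kappa_integral\<close> with e = 1 and g = \<beta> + \<gamma> produces
  tau^(1-\<beta>-\<gamma>), which is at most L^(1-\<beta>) tau^(-\<gamma>).\<close>

definition Kp :: "real => real" where
  "Kp \<gamma> = Ck * Cb * ((1 / (2 - (\<beta> + \<gamma>)) + 1 / (\<beta> + \<gamma>)) * L powr (1 - \<beta>))"

lemma Kp_integral: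
  assumes t: "0 < tau" "tau < L" and \<gamma>: "0 <= \<gamma>" "\<gamma> < 1" and M: "0 <= M"
  shows "(\<integral>\<^sup>+s. indicator {0<..<L} s * ennreal (Ck * (min tau s / max tau s) * (s powr (- \<gamma>) * (M * b s))) \<partial>lborel) <= ennreal (M * Kp \<gamma> * tau powr (- \<gamma>))"
proof -
  have c0: "0 <= Ck * Cb * M" using Ck(1) Cb_pos M by simp
  have "(\<integral>\<^sup>+s. indicator {0<..<L} s * ennreal (Ck * (min tau s / max tau s) * (s powr (- \<gamma>) * (M * b s))) \<partial>lborel)
     <= ennreal (Ck * Cb * M * ((1 / (2 - (\<beta> + \<gamma>)) + 1 / ((\<beta> + \<gamma>) + 1 - 1)) * tau powr (2 - 1 - (\<beta> + \<gamma>))))"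
  proof (rule kappa_dom[OF t(1) _ _ c0])
    fix s assume s: "0 < s" "s < L"
    have "s powr (- \<gamma>) * (M * b s) <= s powr (- \<gamma>) * (M * (Cb * s powr (- \<beta>)))"
      using b_upper[OF s] M by (intro mult_left_mono) auto
    also have "\<dots> = M * Cb * s powr (- (\<beta> + \<gamma>))" by (simp add: mult_ac flip: powr_add)
    finally have "Ck * (min tau s / max tau s) * (s powr (- \<gamma>) * (M * b s)) <= Ck * (min tau s / max tau s) * (M * Cb * s powr (- (\<beta> + \<gamma>)))"
      using s t Ck(1) by (intro mult_left_mono) auto
    then show "Ck * (min tau s / max tau s) * (s powr (- \<gamma>) * (M * b s)) <= Ck * Cb * M * (min tau s * max tau s powr (- 1) * s powr (- (\<beta> + \<gamma>)))"
      unfolding max_powr[OF t(1)] by (simp add: mult_ac)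
  qed (use beta \<gamma> in auto)
  also have "\<dots> <= ennreal (M * Kp \<gamma> * tau powr (- \<gamma>))"
  proof (rule ennreal_leI)
    have "tau powr (1 - (\<beta> + \<gamma>)) = tau powr (1 - \<beta>) * tau powr (- \<gamma>)" by (simp add: diff_diff_eq flip: powr_add)
    also have "\<dots> <= L powr (1 - \<beta>) * tau powr (- \<gamma>)"
      using t beta by (intro mult_right_mono powr_mono2) auto
    finally have p: "tau powr (1 - (\<beta> + \<gamma>)) <= L powr (1 - \<beta>) * tau powr (- \<gamma>)" .
    have "Ck * Cb * M * ((1 / (2 - (\<beta> + \<gamma>)) + 1 / (\<beta> + \<gamma>)) * tau powr (1 - (\<beta> + \<gamma>))) <=
      Ck * Cb * M * ((1 / (2 - (\<beta> + \<gamma>)) + 1 / (\<beta> + \<gamma>)) * (L powr (1 - \<beta>) * tau powr (- \<gamma>)))"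
      using p beta \<gamma> c0 by (intro mult_left_mono) auto
    also have "\<dots> = M * Kp \<gamma> * tau powr (- \<gamma>)" by (simp add: Kp_def mult_ac)
    finally show "Ck * Cb * M * ((1 / (2 - (\<beta> + \<gamma>)) + 1 / ((\<beta> + \<gamma>) + 1 - 1)) * tau powr (2 - 1 - (\<beta> + \<gamma>))) <= M * Kp \<gamma> * tau powr (- \<gamma>)"
      by simp
  qed
  finally show ?thesis .
qed

end

text \<open>The first condition makes \<open>KO b\<close> at most b/2. The second makes the kernel
  with half its singularity integrable against s^(-2\<beta>): it is 1 - e < g in
  \<open>kappa_integral\<close> for e = 1/2 and g = 2 * \<beta>.\<close>

locale boussinesq_small = boussinesq_fourier +
  assumes small_q: "M * Cq <= 1/2" and beta4: "1/4 < \<beta>"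
begin

text \<open>The part of the differenced equation where no difference falls on the kernel, acting on
  a majorant G of \<open>XX n\<close>. It is the only part of top order, hence the only one that has
  to be absorbed.\<close>

definition KO :: "(real => real) => real => ennreal" where
  "KO G tau = (\<integral>\<^sup>+s. indicator {0<..<L} s * ennreal (Ck * (min tau s / max tau s) * (G s * (M * b s))) \<partial>lborel)"

lemma KO_linear:
  assumes t: "0 < tau" "tau < L" and c: "0 <= c1" "0 <= c2"
    and f [measurable]: "f \<in> borel_measurable borel" and g [measurable]: "g \<in> borel_measurable borel"
    and f0: "\<And>s. 0 < s ==> s < L ==> 0 <= f s" and g0: "\<And>s. 0 < s ==> s < L ==> 0 <= g s"
  shows "KO (\<lambda>s. c1 * f s + c2 * g s) tau = ennreal c1 * KO f tau + ennreal c2 * KO g tau"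
proof -
  have "KO (\<lambda>s. c1 * f s + c2 * g s) tau = (\<integral>\<^sup>+s. ennreal c1 * (indicator {0<..<L} s * ennreal (Ck * (min tau s / max tau s) * (f s * (M * b s)))) +
      ennreal c2 * (indicator {0<..<L} s * ennreal (Ck * (min tau s / max tau s) * (g s * (M * b s)))) \<partial>lborel)"
    unfolding KO_def
  proof (intro nn_integral_cong)
    fix s :: real
    show "indicator {0<..<L} s * ennreal (Ck * (min tau s / max tau s) * ((c1 * f s + c2 * g s) * (M * b s))) =
      ennreal c1 * (indicator {0<..<L} s * ennreal (Ck * (min tau s / max tau s) * (f s * (M * b s)))) +
      ennreal c2 * (indicator {0<..<L} s * ennreal (Ck * (min tau s / max tau s) * (g s * (M * b s))))"
    proof (cases "0 < s \<and> s < L")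
      case True
      define q where "q = Ck * (min tau s / max tau s) * (M * b s)"
      have q: "0 <= q" using True t Ck(1) M_nonneg b_pos[of s] by (simp add: q_def)
      have fg: "0 <= f s * q" "0 <= g s * q" using f0[of s] g0[of s] True q by auto
      have "Ck * (min tau s / max tau s) * ((c1 * f s + c2 * g s) * (M * b s)) = c1 * (f s * q) + c2 * (g s * q)"
        by (simp add: q_def algebra_simps)
      then have "ennreal (Ck * (min tau s / max tau s) * ((c1 * f s + c2 * g s) * (M * b s))) = ennreal c1 * ennreal (f s * q) + ennreal c2 * ennreal (g s * q)"
        using fg c by (simp only: ennreal_plus[OF mult_nonneg_nonneg mult_nonneg_nonneg] ennreal_mult)
      moreover have "f s * q = Ck * (min tau s / max tau s) * (f s * (M * b s))" "g s * q = Ck * (min tau s / max tau s) * (g s * (M * b s))"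
        by (simp_all add: q_def mult_ac)
      ultimately show ?thesis using True by simp
    qed (auto simp: indicator_def)
  qed
  also have "\<dots> = ennreal c1 * KO f tau + ennreal c2 * KO g tau"
    unfolding KO_def by (subst nn_integral_add, measurable, measurable, subst nn_integral_cmult, measurable, subst nn_integral_cmult, measurable)
  finally show ?thesis .
qed

lemma KO_b:
  assumes t: "0 < tau" "tau < L"
  shows "KO b tau <= ennreal (b tau / 2)"
proof -
  have "KO b tau = (\<integral>\<^sup>+s. ennreal M * (indicator {0<..<L} s * ennreal (Ck * (min tau s / max tau s) * (b s)\<^sup>2)) \<partial>lborel)"
    unfolding KO_def
  proof (intro nn_integral_cong)
    fix s :: real
    have "Ck * (min tau s / max tau s) * (b s * (M * b s)) = M * (Ck * (min tau s / max tau s) * (b s)\<^sup>2)"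
      by (simp add: power2_eq_square)
    then show "indicator {0<..<L} s * ennreal (Ck * (min tau s / max tau s) * (b s * (M * b s))) = ennreal M * (indicator {0<..<L} s * ennreal (Ck * (min tau s / max tau s) * (b s)\<^sup>2))"
      by (simp only: ennreal_mult'[OF M_nonneg] mult.left_commute)
  qed
  also have "\<dots> = ennreal M * (\<integral>\<^sup>+s. indicator {0<..<L} s * ennreal (Ck * (min tau s / max tau s) * (b s)\<^sup>2) \<partial>lborel)"
    by (rule nn_integral_cmult) measurable
  also have "\<dots> <= ennreal M * ennreal (Cq * b tau)" by (intro mult_left_mono kernel_weight_integral t) auto
  also have "\<dots> = ennreal (M * Cq * b tau)" by (simp add: ennreal_mult'[OF M_nonneg] mult.assoc)
  also have "\<dots> <= ennreal (b tau / 2)"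
    using mult_right_mono[OF small_q, of "b tau"] b_pos[OF t] by (intro ennreal_leI) simp
  finally show ?thesis .
qed

text \<open>A Gronwall-type absorption: smallness of \<open>M\<close> makes the bilinear term a contraction for every weight \<open>w\<close>
  with \<open>KO w <= w / 2\<close>, and the a priori bound in \<open>b\<close> is iterated away.\<close>

lemma gronwall_absorb:
  fixes Y :: "real => ennreal"
  assumes w [measurable]: "w \<in> borel_measurable borel" and w0: "\<And>s. 0 < s ==> s < L ==> 0 <= w s"
    and KOw: "\<And>tau. 0 < tau ==> tau < L ==> KO w tau <= ennreal (w tau / 2)"
    and step: "\<And>G tau. G \<in> borel_measurable borel ==> (\<And>s. 0 < s ==> s < L ==> Y s <= ennreal (G s) \<and> 0 <= G s) ==>
        0 < tau ==> tau < L ==> Y tau <= ennreal (C * w tau) + KO G tau"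
    and apriori: "\<And>s. 0 < s ==> s < L ==> Y s <= ennreal (K * b s)" and CK: "0 <= C" "0 <= K"
    and t: "0 < tau" "tau < L"
  shows "Y tau <= ennreal (2 * C * w tau)"
proof -
  have n: "Y tau <= ennreal (2 * C * w tau + K * (1/2) ^ n * b tau)" if "0 < tau" "tau < L" for n tau
    using that
  proof (induction n arbitrary: tau)
    case 0
    have "Y tau <= ennreal (K * b tau)" by (rule apriori[OF 0])
    also have "\<dots> <= ennreal (2 * C * w tau + K * (1/2) ^ 0 * b tau)" using CK w0[OF 0] by (intro ennreal_leI) simp
    finally show ?case .
  next
    case (Suc n)
    define G where "G s = (2 * C) * w s + (K * (1/2) ^ n) * b s" for s
    have Gm: "G \<in> borel_measurable borel" unfolding G_def by measurable
    have G: "Y s <= ennreal (G s) \<and> 0 <= G s" if "0 < s" "s < L" for s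
      using Suc.IH[OF that] CK w0[OF that] b_pos[OF that] by (simp add: G_def)
    have "Y tau <= ennreal (C * w tau) + KO G tau" by (rule step[OF Gm G Suc.prems])
    also have "KO G tau = ennreal (2 * C) * KO w tau + ennreal (K * (1/2) ^ n) * KO b tau"
      unfolding G_def using CK w0 b_pos by (intro KO_linear[OF Suc.prems]) (auto intro: less_imp_le)
    also have "\<dots> <= ennreal (2 * C) * ennreal (w tau / 2) + ennreal (K * (1/2) ^ n) * ennreal (b tau / 2)"
      by (intro add_mono mult_left_mono KOw KO_b Suc.prems) auto
    also have "\<dots> = ennreal (C * w tau + K * (1/2) ^ Suc n * b tau)"
    proof -
      have a: "0 <= 2 * C" "0 <= K * (1/2) ^ n" "0 <= w tau / 2" "0 <= b tau / 2"
        using CK w0[OF Suc.prems] b_pos[OF Suc.prems] by auto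
      have "ennreal (2 * C) * ennreal (w tau / 2) + ennreal (K * (1/2) ^ n) * ennreal (b tau / 2) = ennreal (2 * C * (w tau / 2) + K * (1/2) ^ n * (b tau / 2))"
        using a by (simp only: ennreal_mult[symmetric] ennreal_plus[symmetric] mult_nonneg_nonneg)
      then show ?thesis by (simp add: mult_ac)
    qed
    also have "ennreal (C * w tau) + ennreal (C * w tau + K * (1/2) ^ Suc n * b tau) = ennreal (2 * C * w tau + K * (1/2) ^ Suc n * b tau)"
    proof -
      have a: "0 <= C * w tau" "0 <= K * (1/2) ^ Suc n * b tau"
        using CK w0[OF Suc.prems] b_pos[OF Suc.prems] by auto
      then have "ennreal (C * w tau) + ennreal (C * w tau + K * (1/2) ^ Suc n * b tau) = ennreal (C * w tau + (C * w tau + K * (1/2) ^ Suc n * b tau))"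
        by (intro ennreal_plus[symmetric] add_nonneg_nonneg)
      then show ?thesis by (simp add: mult_ac)
    qed
    finally show ?case by (simp add: add_left_mono)
  qed
  have "(\<lambda>n. 2 * C * w tau + K * (1/2) ^ n * b tau) \<longlonglongrightarrow> 2 * C * w tau + K * 0 * b tau"
    by (intro tendsto_intros LIMSEQ_power_zero) simp
  then have "(\<lambda>n. ennreal (2 * C * w tau + K * (1/2) ^ n * b tau)) \<longlonglongrightarrow> ennreal (2 * C * w tau)"
    using tendsto_ennrealI by fastforce
  then show ?thesis using n[OF t] by (intro LIMSEQ_le_const) auto
qed

text \<open>\<open>XX_step\<close> with the Leibniz term j = 0 split off as \<open>KO G\<close>; the
  sum over j >= 1 involves only lower differences of V and is known data.\<close>

lemma XX_step2:
  assumes t: "0 < tau" "tau < L"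
    and a: "\<And>j s xi. 1 <= j ==> j <= n ==> 0 < s ==> s < L ==> \<bar>(fd h ^^ j) (\<lambda>xi. kk xi tau s) xi\<bar> <= a j s"
    and am [measurable]: "\<And>j. a j \<in> borel_measurable borel"
    and g: "\<And>j s. j < n ==> 0 < s ==> s < L ==> XX j h s <= ennreal (g j s) \<and> 0 <= g j s"
    and gm [measurable]: "\<And>j. g j \<in> borel_measurable borel"
    and G: "\<And>s. 0 < s ==> s < L ==> XX n h s <= ennreal (G s) \<and> 0 <= G s" and Gm [measurable]: "G \<in> borel_measurable borel"
  shows "XX n h tau <= (n1 ((fd h ^^ n) (Phi tau)) +
     (\<integral>\<^sup>+s. indicator {0<..<L} s * ennreal (\<Sum>j=1..n. real (n choose j) * (a j s * (g (n - j) s * (M * b s)))) \<partial>lborel)) + KO G tau"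
proof -
  define a' where "a' j s = (if j = 0 then Ck * (min tau s / max tau s) else a j s)" for j s
  define g' where "g' m s = (if m = n then G s else g m s)" for m s
  have am': "a' j \<in> borel_measurable borel" for j unfolding a'_def by (cases "j = 0") auto
  have a'b: "\<bar>(fd h ^^ j) (\<lambda>xi. kk xi tau s) xi\<bar> <= a' j s" if "j <= n" "0 < s" "s < L" for j s xi
    using a[of j s xi] Ck(3)[OF t that(2,3), of xi] that by (cases "j = 0") (auto simp: a'_def)
  have g'b: "XX j h s <= ennreal (g' j s) \<and> 0 <= g' j s" if "j <= n" "0 < s" "s < L" for j s
    using g[of j s] G[of s] that by (cases "j = n") (auto simp: g'_def)
  define T where "T s = (\<Sum>j=1..n. real (n choose j) * (a j s * (g (n - j) s * (M * b s))))" for s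
  have Tm [measurable]: "T \<in> borel_measurable borel" unfolding T_def by measurable
  have T0: "0 <= T s" if s: "0 < s" "s < L" for s
    unfolding T_def
  proof (intro sum_nonneg)
    fix j assume j: "j \<in> {1..n}"
    have "0 <= a j s" using a[of j s 0] j s by force
    moreover have "0 <= g (n - j) s" using g[of "n - j" s] j s by auto
    ultimately show "0 <= real (n choose j) * (a j s * (g (n - j) s * (M * b s)))" using M_nonneg b_pos[OF s] by simp
  qed
  have sp: "(\<Sum>j\<le>n. real (n choose j) * (a' j s * (g' (n - j) s * (M * b s)))) = Ck * (min tau s / max tau s) * (G s * (M * b s)) + T s" for s
  proof -
    have "{..n} = insert 0 {1..n}" by auto
    then have "(\<Sum>j\<le>n. real (n choose j) * (a' j s * (g' (n - j) s * (M * b s)))) = a' 0 s * (g' n s * (M * b s)) + (\<Sum>j=1..n. real (n choose j) * (a' j s * (g' (n - j) s * (M * b s))))"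
      by simp
    also have "(\<Sum>j=1..n. real (n choose j) * (a' j s * (g' (n - j) s * (M * b s)))) = T s"
      unfolding T_def by (intro sum.cong refl) (auto simp: a'_def g'_def)
    finally show ?thesis by (simp add: a'_def g'_def)
  qed
  have "XX n h tau <= n1 ((fd h ^^ n) (Phi tau)) +
     (\<integral>\<^sup>+s. indicator {0<..<L} s * ennreal (\<Sum>j\<le>n. real (n choose j) * (a' j s * (g' (n - j) s * (M * b s)))) \<partial>lborel)"
    by (rule XX_step[OF t a'b am' g'b])
  also have "(\<integral>\<^sup>+s. indicator {0<..<L} s * ennreal (\<Sum>j\<le>n. real (n choose j) * (a' j s * (g' (n - j) s * (M * b s)))) \<partial>lborel) =
     (\<integral>\<^sup>+s. indicator {0<..<L} s * ennreal (T s) + indicator {0<..<L} s * ennreal (Ck * (min tau s / max tau s) * (G s * (M * b s))) \<partial>lborel)"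
  proof (intro nn_integral_cong)
    fix s :: real
    show "indicator {0<..<L} s * ennreal (\<Sum>j\<le>n. real (n choose j) * (a' j s * (g' (n - j) s * (M * b s)))) =
      indicator {0<..<L} s * ennreal (T s) + indicator {0<..<L} s * ennreal (Ck * (min tau s / max tau s) * (G s * (M * b s)))"
    proof (cases "0 < s \<and> s < L")
      case True
      have "0 <= Ck * (min tau s / max tau s) * (G s * (M * b s))"
        using True t Ck(1) M_nonneg b_pos[of s] G[of s] by simp
      then show ?thesis using True T0[of s] unfolding sp by (simp add: add.commute)
    qed (auto simp: indicator_def)
  qed
  also have "\<dots> = (\<integral>\<^sup>+s. indicator {0<..<L} s * ennreal (T s) \<partial>lborel) + KO G tau"
    unfolding KO_def by (rule nn_integral_add) measurable
  finally show ?thesis unfolding T_def by (simp add: add.assoc)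
qed

text \<open>Induction on n: the terms with j >= 1 use earlier bounds, the top-order term is
  absorbed. The bound may blow up like b as tau tends to 0; it serves the Schwartz decay on compact
  time intervals, not the uniform decay.\<close>

lemma difference_bounds:
  assumes P: "\<And>n. \<exists>C h0. 0 <= C \<and> 0 < h0 \<and> (\<forall>h tau. 0 < h \<and> h <= h0 \<and> 0 < tau \<and> tau < L -->
     n1 ((fd h ^^ n) (Phi tau)) <= ennreal (C * h ^ n * b tau))"
  shows "\<exists>C h0. 0 <= C \<and> 0 < h0 \<and> (\<forall>h tau. 0 < h \<and> h <= h0 \<and> 0 < tau \<and> tau < L --> XX n h tau <= ennreal (C * h ^ n * b tau))"
proof (induction n rule: less_induct)
  case (less n)
  have "\<forall>m. \<exists>C h0. m < n --> 0 <= C \<and> 0 < h0 \<and> (\<forall>h tau. 0 < h \<and> h <= h0 \<and> 0 < tau \<and> tau < L --> XX m h tau <= ennreal (C * h ^ m * b tau))"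
    using less by blast
  from choice[OF this] obtain cX where "\<forall>m. \<exists>h0. m < n --> 0 <= cX m \<and> 0 < h0 \<and> (\<forall>h tau. 0 < h \<and> h <= h0 \<and> 0 < tau \<and> tau < L --> XX m h tau <= ennreal (cX m * h ^ m * b tau))" ..
  from choice[OF this] obtain hX where X0: "\<forall>m. m < n --> 0 <= cX m \<and> 0 < hX m \<and> (\<forall>h tau. 0 < h \<and> h <= hX m \<and> 0 < tau \<and> tau < L --> XX m h tau <= ennreal (cX m * h ^ m * b tau))" ..
  note X1 = X0[THEN spec, THEN mp]
  have X_1: "0 <= cX m" if "m < n" for m using X1[OF that] by (rule conjunct1)
  have X_2: "0 < hX m" if "m < n" for m using X1[OF that, THEN conjunct2] by (rule conjunct1)
  have X_3: "XX m h tau <= ennreal (cX m * h ^ m * b tau)" if m: "m < n" and h: "0 < h" "h <= hX m" "0 < tau" "tau < L" for m h tau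
    by (rule X1[OF m, THEN conjunct2, THEN conjunct2, THEN spec, THEN spec, THEN mp]) (use h in simp)
  have "\<forall>j. \<exists>C h0. 0 < C \<and> 0 < h0 \<and> (\<forall>h xi tau s. 0 < h \<and> h <= h0 \<and> 0 < tau \<and> tau < L \<and> 0 < s \<and> s < L -->
     \<bar>(fd h ^^ j) (\<lambda>xi. kk xi tau s) xi\<bar> <= C * h ^ j * (min tau s / max tau s))"
    by (rule allI, rule kk_diff_ratio)
  from choice[OF this] obtain cK where "\<forall>j. \<exists>h0. 0 < cK j \<and> 0 < h0 \<and> (\<forall>h xi tau s. 0 < h \<and> h <= h0 \<and> 0 < tau \<and> tau < L \<and> 0 < s \<and> s < L -->
     \<bar>(fd h ^^ j) (\<lambda>xi. kk xi tau s) xi\<bar> <= cK j * h ^ j * (min tau s / max tau s))" ..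
  from choice[OF this] obtain hK where K0: "\<forall>j. 0 < cK j \<and> 0 < hK j \<and> (\<forall>h xi tau s. 0 < h \<and> h <= hK j \<and> 0 < tau \<and> tau < L \<and> 0 < s \<and> s < L -->
     \<bar>(fd h ^^ j) (\<lambda>xi. kk xi tau s) xi\<bar> <= cK j * h ^ j * (min tau s / max tau s))" ..
  note K1 = K0[THEN spec]
  have K_1: "0 < cK j" for j using K1[of j] by (rule conjunct1)
  have K_2: "0 < hK j" for j using K1[of j, THEN conjunct2] by (rule conjunct1)
  have K_3: "\<bar>(fd h ^^ j) (\<lambda>xi. kk xi tau s) xi\<bar> <= cK j * h ^ j * (min tau s / max tau s)"
    if h: "0 < h" "h <= hK j" "0 < tau" "tau < L" "0 < s" "s < L" for j h xi tau s
    by (rule K1[THEN conjunct2, THEN conjunct2, THEN spec, THEN spec, THEN spec, THEN spec, THEN mp]) (use h in simp)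
  obtain cP hP where Pn: "0 <= cP" "0 < hP" "\<And>h tau. 0 < h ==> h <= hP ==> 0 < tau ==> tau < L ==>
     n1 ((fd h ^^ n) (Phi tau)) <= ennreal (cP * h ^ n * b tau)"
    using P[of n] by blast
  define h0 where "h0 = Min ({hP} \<union> hK ` {..n} \<union> hX ` {..<n})"
  have "h0 \<in> {hP} \<union> hK ` {..n} \<union> hX ` {..<n}" unfolding h0_def by (intro Min_in) auto
  then have h0_1: "0 < h0" using Pn(2) K_2 X_2 by auto
  have h0_2: "h0 <= hP" unfolding h0_def by (rule Min_le) auto
  have h0_3: "h0 <= hK j" if "j <= n" for j unfolding h0_def by (rule Min_le) (use that in auto)
  have h0_4: "h0 <= hX j" if "j < n" for j unfolding h0_def by (rule Min_le) (use that in auto)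
  note h0 = h0_1 h0_2 h0_3 h0_4
  \<comment> \<open>Total Leibniz coefficient of the lower-order terms, divided by \<open>Ck\<close>
    so that they become a multiple of the integrand of
    \<open>kernel_weight_integral\<close>.\<close>
  define Q where "Q = (\<Sum>j=1..n. real (n choose j) * (cK j * (cX (n - j) * M))) / Ck"
  have Q0: "0 <= Q" unfolding Q_def using Ck(1) K_1 X_1 M_nonneg
    by (intro divide_nonneg_nonneg sum_nonneg mult_nonneg_nonneg) (auto intro: less_imp_le)
  define C where "C = cP + Q * Cq"
  have C0: "0 <= C" using Pn Q0 Cq_pos by (simp add: C_def)
  have "XX n h tau <= ennreal (2 * (C * h ^ n) * b tau)" if h: "0 < h" "h <= h0" and t: "0 < tau" "tau < L" for h tau
  proof (rule gronwall_absorb[OF b_meas _ KO_b, where K = "2 ^ n * M" and Y = "XX n h"])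
    show "0 <= C * h ^ n" "0 <= 2 ^ n * M" using C0 h M_nonneg by auto
    show "0 < tau" "tau < L" using t by auto
    show "0 < s ==> s < L ==> 0 <= b s" for s using b_pos by (auto intro: less_imp_le)
    show "0 < s ==> s < L ==> XX n h s <= ennreal (2 ^ n * M * b s)" for s by (rule XX_apriori)
    fix G tau assume Gm: "G \<in> borel_measurable borel"
      and G: "\<And>s. 0 < s ==> s < L ==> XX n h s <= ennreal (G s) \<and> 0 <= G s" and t: "0 < tau" "tau < L"
    define a where "a j s = cK j * h ^ j * (min tau s / max tau s)" for j s
    define g where "g m s = cX m * h ^ m * b s" for m s
    have "XX n h tau <= (n1 ((fd h ^^ n) (Phi tau)) +
       (\<integral>\<^sup>+s. indicator {0<..<L} s * ennreal (\<Sum>j=1..n. real (n choose j) * (a j s * (g (n - j) s * (M * b s)))) \<partial>lborel)) + KO G tau"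
    proof (rule XX_step2[OF t _ _ _ _ G Gm])
      fix j s xi assume "1 <= j" "j <= n" "0 < s" "s < L"
      then show "\<bar>(fd h ^^ j) (\<lambda>xi. kk xi tau s) xi\<bar> <= a j s" unfolding a_def using h h0(3)[of j] t by (intro K_3) auto
    next
      show "a j \<in> borel_measurable borel" for j unfolding a_def by measurable
      show "g j \<in> borel_measurable borel" for j unfolding g_def by measurable
      fix j s assume j: "j < n" "0 < s" "s < L"
      have "XX j h s <= ennreal (g j s)" unfolding g_def using X_3[OF j(1) h(1) _ j(2,3)] h h0(4)[OF j(1)] by simp
      moreover have "0 <= g j s" unfolding g_def using X_1[OF j(1)] h b_pos[OF j(2,3)] by simp
      ultimately show "XX j h s <= ennreal (g j s) \<and> 0 <= g j s" ..
    qed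
    also have "n1 ((fd h ^^ n) (Phi tau)) <= ennreal (cP * h ^ n * b tau)" using Pn(3)[OF h(1) _ t] h h0(2) by simp
    also have "(\<integral>\<^sup>+s. indicator {0<..<L} s * ennreal (\<Sum>j=1..n. real (n choose j) * (a j s * (g (n - j) s * (M * b s)))) \<partial>lborel) =
       (\<integral>\<^sup>+s. ennreal (Q * h ^ n) * (indicator {0<..<L} s * ennreal (Ck * (min tau s / max tau s) * (b s)\<^sup>2)) \<partial>lborel)"
    proof (intro nn_integral_cong)
      fix s
      have "(\<Sum>j=1..n. real (n choose j) * (a j s * (g (n - j) s * (M * b s)))) = (\<Sum>j=1..n. (real (n choose j) * (cK j * (cX (n - j) * M))) * (h ^ n * (min tau s / max tau s) * (b s)\<^sup>2))"
      proof (intro sum.cong refl)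
        fix j assume j: "j \<in> {1..n}"
        have "h ^ n = h ^ j * h ^ (n - j)" using j by (simp flip: power_add)
        then show "real (n choose j) * (a j s * (g (n - j) s * (M * b s))) = (real (n choose j) * (cK j * (cX (n - j) * M))) * (h ^ n * (min tau s / max tau s) * (b s)\<^sup>2)"
          by (simp add: a_def g_def power2_eq_square)
      qed
      also have "\<dots> = (Q * h ^ n) * (Ck * (min tau s / max tau s) * (b s)\<^sup>2)"
        unfolding Q_def sum_distrib_right[symmetric] using Ck(1) by simp
      finally have e: "(\<Sum>j=1..n. real (n choose j) * (a j s * (g (n - j) s * (M * b s)))) = (Q * h ^ n) * (Ck * (min tau s / max tau s) * (b s)\<^sup>2)" .
      have "0 <= Q * h ^ n" using Q0 h by simp
      then show "indicator {0<..<L} s * ennreal (\<Sum>j=1..n. real (n choose j) * (a j s * (g (n - j) s * (M * b s)))) = ennreal (Q * h ^ n) * (indicator {0<..<L} s * ennreal (Ck * (min tau s / max tau s) * (b s)\<^sup>2))"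
        unfolding e by (simp only: ennreal_mult' mult.left_commute)
    qed
    also have "\<dots> = ennreal (Q * h ^ n) * (\<integral>\<^sup>+s. indicator {0<..<L} s * ennreal (Ck * (min tau s / max tau s) * (b s)\<^sup>2) \<partial>lborel)"
      by (rule nn_integral_cmult) measurable
    also have "\<dots> <= ennreal (Q * h ^ n) * ennreal (Cq * b tau)" by (intro mult_left_mono kernel_weight_integral t) auto
    also have "\<dots> = ennreal (Q * Cq * h ^ n * b tau)" using Q0 h Cq_pos b_pos[OF t] by (subst ennreal_mult[symmetric]) (auto simp: mult_ac)
    also have "ennreal (cP * h ^ n * b tau) + ennreal (Q * Cq * h ^ n * b tau) = ennreal (C * h ^ n * b tau)"
      using Pn(1) Q0 h Cq_pos b_pos[OF t] by (simp add: C_def distrib_right flip: ennreal_plus)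
    finally show "XX n h tau <= ennreal (C * h ^ n * b tau) + KO G tau" by (simp add: add_right_mono add_left_mono)
  qed
  then show ?case using C0 h0(1) by (intro exI[of _ "2 * C"] exI[of _ h0]) (auto simp: mult.assoc simp del: distrib_left_numeral)
qed

lemma KO_pow:
  assumes "0 < tau" "tau < L" and "0 <= \<gamma>" "\<gamma> < 1" and small: "M * Kp \<gamma> <= 1/2"
  shows "KO (\<lambda>s. s powr (- \<gamma>)) tau <= ennreal (tau powr (- \<gamma>) / 2)"
proof -
  have "KO (\<lambda>s. s powr (- \<gamma>)) tau <= ennreal (M * Kp \<gamma> * tau powr (- \<gamma>))"
    unfolding KO_def by (rule Kp_integral[OF assms(1-4) M_nonneg])
  also have "\<dots> <= ennreal (tau powr (- \<gamma>) / 2)"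
    using mult_right_mono[OF small, of "tau powr (- \<gamma>)"] by (intro ennreal_leI) simp
  finally show ?thesis .
qed

lemma b_sq_le: "0 < s ==> s < L ==> (M * b s) * (M * b s) <= M\<^sup>2 * Cb\<^sup>2 * s powr (- (2 * \<beta>))"
proof -
  assume s: "0 < s" "s < L"
  have "b s * b s <= (Cb * s powr (- \<beta>)) * (Cb * s powr (- \<beta>))"
    using b_upper[OF s] b_pos[OF s] by (intro mult_mono) auto
  also have "\<dots> = Cb\<^sup>2 * s powr (- (2 * \<beta>))" by (simp add: power2_eq_square flip: powr_add)
  finally have "M\<^sup>2 * (b s * b s) <= M\<^sup>2 * (Cb\<^sup>2 * s powr (- (2 * \<beta>)))" by (intro mult_left_mono) auto
  then show ?thesis by (simp add: power2_eq_square mult_ac)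
qed

text \<open>The kernel with half its singularity turns the source b^2 into tau^(3/2-2\<beta>), which
  is at most a constant times tau^(-\<gamma>) by the third condition on \<gamma>. With \<gamma> = 0
  the bound is uniform up to tau = 0.\<close>

lemma first_difference_bound:
  assumes g: "0 <= \<gamma>" "\<gamma> < 1" "0 <= 3/2 - 2 * \<beta> + \<gamma>" and small: "M * Kp \<gamma> <= 1/2"
    and C: "0 <= C" and h1: "0 < h1"
    and P: "\<And>h tau. 0 < h ==> h <= h1 ==> 0 < tau ==> tau < L ==> n1 ((fd h ^^ 1) (Phi tau)) <= ennreal (C * h * tau powr (- \<gamma>))"
  shows "\<exists>C h0. 0 <= C \<and> 0 < h0 \<and> (\<forall>h tau. 0 < h \<and> h <= h0 \<and> 0 < tau \<and> tau < L --> XX 1 h tau <= ennreal (C * h * tau powr (- \<gamma>)))"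
proof -
  obtain cK hK where K: "0 < cK" "0 < hK" and K0: "\<forall>h xi tau s. 0 < h \<and> h <= hK \<and> 0 < tau \<and> tau < L \<and> 0 < s \<and> s < L -->
     \<bar>(fd h ^^ 1) (\<lambda>xi. kk xi tau s) xi\<bar> <= cK * h ^ 1 * (min tau s / sqrt (max tau s))"
    using kk_diff_sqrt by - (elim exE conjE, rule that)
  define K1 where "K1 = 1 / (2 - 2 * \<beta>) + 1 / (2 * \<beta> + 1/2 - 1)"
  have K1: "0 <= K1" using beta beta4 by (simp add: K1_def)
  define Q where "Q = cK * (M\<^sup>2 * Cb\<^sup>2) * (K1 * L powr (3/2 - 2 * \<beta> + \<gamma>))"
  have Q: "0 <= Q" using K K1 by (simp add: Q_def)
  have "XX 1 h tau <= ennreal (2 * ((C + Q) * h) * tau powr (- \<gamma>))" if h: "0 < h" "h <= min h1 hK" and t: "0 < tau" "tau < L" for h tau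
  proof (rule gronwall_absorb[where K = "2 ^ 1 * M" and Y = "XX 1 h" and w = "\<lambda>s. s powr (- \<gamma>)"])
    show "0 <= (C + Q) * h" using C Q h by simp
    show "0 <= 2 ^ 1 * M" using M_nonneg by simp
    show "0 < s ==> s < L ==> XX 1 h s <= ennreal (2 ^ 1 * M * b s)" for s by (rule XX_apriori)
    show "0 < tau ==> tau < L ==> KO (\<lambda>s. s powr (- \<gamma>)) tau <= ennreal (tau powr (- \<gamma>) / 2)" for tau
      by (rule KO_pow[OF _ _ g(1,2) small])
    show "0 < tau" "tau < L" using t by auto
    fix G tau assume Gm: "G \<in> borel_measurable borel"
      and G: "\<And>s. 0 < s ==> s < L ==> XX 1 h s <= ennreal (G s) \<and> 0 <= G s" and t: "0 < tau" "tau < L"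
    define a where "a j s = cK * h * (min tau s / sqrt (max tau s))" for j :: nat and s
    define g where "g m s = M * b s" for m :: nat and s
    have "XX 1 h tau <= (n1 ((fd h ^^ 1) (Phi tau)) +
       (\<integral>\<^sup>+s. indicator {0<..<L} s * ennreal (\<Sum>j=1..1. real (1 choose j) * (a j s * (g (1 - j) s * (M * b s)))) \<partial>lborel)) + KO G tau"
    proof (rule XX_step2[OF t _ _ _ _ G Gm])
      fix j :: nat and s xi assume a: "1 <= j" "j <= 1" "0 < s" "s < L"
      have "\<bar>(fd h ^^ 1) (\<lambda>xi. kk xi tau s) xi\<bar> <= cK * h ^ 1 * (min tau s / sqrt (max tau s))"
        by (rule K0[THEN spec, THEN spec, THEN spec, THEN spec, THEN mp]) (use h t a in simp)
      moreover have "j = 1" using a by simp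
      ultimately show "\<bar>(fd h ^^ j) (\<lambda>xi. kk xi tau s) xi\<bar> <= a j s" by (simp add: a_def)
    next
      show "a j \<in> borel_measurable borel" for j unfolding a_def by measurable
      show "g j \<in> borel_measurable borel" for j unfolding g_def by measurable
      fix j :: nat and s assume j: "j < 1" "0 < s" "s < L"
      then show "XX j h s <= ennreal (g j s) \<and> 0 <= g j s"
        using XX_apriori[OF j(2,3), of 0 h] M_nonneg b_pos[OF j(2,3)] by (simp add: g_def)
    qed
    also have "n1 ((fd h ^^ 1) (Phi tau)) <= ennreal (C * h * tau powr (- \<gamma>))" using P[OF h(1) _ t] h by simp
    also have "(\<integral>\<^sup>+s. indicator {0<..<L} s * ennreal (\<Sum>j=1..1. real (1 choose j) * (a j s * (g (1 - j) s * (M * b s)))) \<partial>lborel)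
       <= ennreal (cK * h * (M\<^sup>2 * Cb\<^sup>2) * ((1 / (2 - 2 * \<beta>) + 1 / (2 * \<beta> + 1/2 - 1)) * tau powr (2 - 1/2 - 2 * \<beta>)))"
    proof (rule kappa_dom[OF t(1)])
      fix s assume s: "0 < s" "s < L"
      have m: "1 / sqrt (max tau s) = max tau s powr (- (1/2))"
        using t by (simp add: powr_minus_divide powr_half_sqrt)
      have "(\<Sum>j=1..1. real (1 choose j) * (a j s * (g (1 - j) s * (M * b s)))) = cK * h * (min tau s * (1 / sqrt (max tau s))) * ((M * b s) * (M * b s))"
        by (simp add: a_def g_def)
      also have "\<dots> <= cK * h * (min tau s * (1 / sqrt (max tau s))) * (M\<^sup>2 * Cb\<^sup>2 * s powr (- (2 * \<beta>)))"
        using K h t s by (intro mult_left_mono b_sq_le) auto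
      finally show "(\<Sum>j=1..1. real (1 choose j) * (a j s * (g (1 - j) s * (M * b s)))) <= cK * h * (M\<^sup>2 * Cb\<^sup>2) * (min tau s * max tau s powr (- (1/2)) * s powr (- (2 * \<beta>)))"
        unfolding m by (simp only: mult_ac)
    qed (use beta beta4 K h in auto)
    also have "\<dots> <= ennreal (Q * h * tau powr (- \<gamma>))"
    proof (rule ennreal_leI)
      have "tau powr (2 - 1/2 - 2 * \<beta>) = tau powr (3/2 - 2 * \<beta> + \<gamma>) * tau powr (- \<gamma>)" by (simp flip: powr_add)
      also have "\<dots> <= L powr (3/2 - 2 * \<beta> + \<gamma>) * tau powr (- \<gamma>)" using t g by (intro mult_right_mono powr_mono2) auto
      finally have "cK * h * (M\<^sup>2 * Cb\<^sup>2) * (K1 * tau powr (2 - 1/2 - 2 * \<beta>)) <= cK * h * (M\<^sup>2 * Cb\<^sup>2) * (K1 * (L powr (3/2 - 2 * \<beta> + \<gamma>) * tau powr (- \<gamma>)))"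
        using K K1 h by (intro mult_left_mono) auto
      then show "cK * h * (M\<^sup>2 * Cb\<^sup>2) * ((1 / (2 - 2 * \<beta>) + 1 / (2 * \<beta> + 1/2 - 1)) * tau powr (2 - 1/2 - 2 * \<beta>)) <= Q * h * tau powr (- \<gamma>)"
        unfolding K1_def[symmetric] Q_def by (simp only: mult_ac)
    qed
    also have "ennreal (C * h * tau powr (- \<gamma>)) + ennreal (Q * h * tau powr (- \<gamma>)) = ennreal ((C + Q) * h * tau powr (- \<gamma>))"
      using C Q h by (simp add: distrib_right flip: ennreal_plus)
    finally show "XX 1 h tau <= ennreal ((C + Q) * h * tau powr (- \<gamma>)) + KO G tau" by (simp add: add_right_mono add_left_mono)
  qed auto
  then show ?thesis using C Q h1 K by (rule_tac exI[of _ "2 * (C + Q)"], rule_tac exI[of _ "min h1 hK"]) (auto simp: mult.assoc simp del: distrib_left_numeral)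
qed

text \<open>Two lower-order terms occur: one difference each on kernel and V, and both on the
  kernel. Their sources behave like s^(1/2-\<gamma>-\<beta>) and s^(1-2\<beta>), both integrable at
  0, so no negative power of tau remains.\<close>

lemma second_difference_bound:
  assumes g: "0 <= \<gamma>" "\<gamma> + \<beta> < 3/2" and small: "M * Kp 0 <= 1/2"
    and C: "0 <= C" and C1: "0 <= C1" and h1: "0 < h1"
    and P: "\<And>h tau. 0 < h ==> h <= h1 ==> 0 < tau ==> tau < L ==> n1 ((fd h ^^ 2) (Phi tau)) <= ennreal (C * h\<^sup>2)"
    and X1: "\<And>h tau. 0 < h ==> h <= h1 ==> 0 < tau ==> tau < L ==> XX 1 h tau <= ennreal (C1 * h * tau powr (- \<gamma>))"
  shows "\<exists>C h0. 0 <= C \<and> 0 < h0 \<and> (\<forall>h tau. 0 < h \<and> h <= h0 \<and> 0 < tau \<and> tau < L --> XX 2 h tau <= ennreal (C * h\<^sup>2))"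
proof -
  obtain cK hK where K: "0 < cK" "0 < hK" and K0: "\<forall>h xi tau s. 0 < h \<and> h <= hK \<and> 0 < tau \<and> tau < L \<and> 0 < s \<and> s < L -->
     \<bar>(fd h ^^ 1) (\<lambda>xi. kk xi tau s) xi\<bar> <= cK * h ^ 1 * (min tau s / sqrt (max tau s))"
    using kk_diff_sqrt by - (elim exE conjE, rule that)
  obtain cm hm where Km: "0 < cm" "0 < hm" and Km0: "\<forall>h xi tau s. 0 < h \<and> h <= hm \<and> 0 < tau \<and> tau < L \<and> 0 < s \<and> s < L -->
     \<bar>(fd h ^^ 2) (\<lambda>xi. kk xi tau s) xi\<bar> <= cm * h ^ 2 * min tau s"
    using kk_diff_min by - (elim exE conjE, rule that)
  define p1 where "p1 = 1/2 - \<gamma> - \<beta>"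
  define p2 where "p2 = 1 - 2 * \<beta>"
  \<comment> \<open>The worse of the two exponents; since s < L, both powers are bounded by a
    constant times s^q.\<close>
  define q where "q = min p1 p2"
  have q: "-1 < q" using g beta by (simp add: q_def p1_def p2_def)
  define c1 where "c1 = 2 * cK * C1 * M * Cb * L powr (p1 - q)"
  define c2 where "c2 = cm * M\<^sup>2 * Cb\<^sup>2 * L powr (p2 - q)"
  have c: "0 <= c1" "0 <= c2" using K Km C1 M_nonneg Cb_pos by (auto simp: c1_def c2_def)
  define Q where "Q = (c1 + c2) * (L powr (q + 1) / (q + 1))"
  have Q: "0 <= Q" using c q by (simp add: Q_def)
  \<comment> \<open>The weight is the constant 1, written as a power with exponent 0 so that
    \<open>KO_pow\<close> applies.\<close>
  have "XX 2 h tau <= ennreal (2 * ((C + Q) * h\<^sup>2) * tau powr (- 0))" if h: "0 < h" "h <= min h1 (min hK hm)" and t: "0 < tau" "tau < L" for h tau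
  proof (rule gronwall_absorb[where K = "2 ^ 2 * M" and Y = "XX 2 h" and w = "\<lambda>s. s powr (- 0)"])
    show "0 <= (C + Q) * h\<^sup>2" using C Q h by simp
    show "0 <= 2 ^ 2 * M" using M_nonneg by simp
    show "0 < s ==> s < L ==> XX 2 h s <= ennreal (2 ^ 2 * M * b s)" for s by (rule XX_apriori)
    show "0 < tau ==> tau < L ==> KO (\<lambda>s. s powr (- 0)) tau <= ennreal (tau powr (- 0) / 2)" for tau
      by (rule KO_pow[OF _ _ _ _ small]) auto
    show "0 < tau" "tau < L" using t by auto
    fix G tau assume Gm: "G \<in> borel_measurable borel"
      and G: "\<And>s. 0 < s ==> s < L ==> XX 2 h s <= ennreal (G s) \<and> 0 <= G s" and t: "0 < tau" "tau < L"
    define a where "a j s = (if j = 1 then cK * h * sqrt s else cm * h\<^sup>2 * s)" for j :: nat and s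
    define g where "g m s = (if m = 0 then M * b s else C1 * h * s powr (- \<gamma>))" for m :: nat and s
    have "XX 2 h tau <= (n1 ((fd h ^^ 2) (Phi tau)) +
       (\<integral>\<^sup>+s. indicator {0<..<L} s * ennreal (\<Sum>j=1..2. real (2 choose j) * (a j s * (g (2 - j) s * (M * b s)))) \<partial>lborel)) + KO G tau"
    proof (rule XX_step2[OF t _ _ _ _ G Gm])
      fix j :: nat and s xi assume a: "1 <= j" "j <= 2" "0 < s" "s < L"
      have "\<bar>(fd h ^^ 1) (\<lambda>xi. kk xi tau s) xi\<bar> <= cK * h ^ 1 * (min tau s / sqrt (max tau s))"
        by (rule K0[THEN spec, THEN spec, THEN spec, THEN spec, THEN mp]) (use h t a in simp)
      also have "\<dots> <= cK * h ^ 1 * sqrt s"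
      proof (intro mult_left_mono)
        \<comment> \<open>The minimum is at most the geometric mean of s and the maximum, since it
          is at most either of them.\<close>
        have "min tau s <= sqrt s * sqrt (max tau s)"
          using t a by (cases "tau <= s") (auto simp: max_def min_def real_le_rsqrt power2_eq_square simp flip: real_sqrt_mult intro!: real_le_rsqrt mult_left_mono)
        then show "min tau s / sqrt (max tau s) <= sqrt s" using t by (simp add: pos_divide_le_eq)
      qed (use K h in auto)
      finally have e1: "\<bar>(fd h ^^ 1) (\<lambda>xi. kk xi tau s) xi\<bar> <= cK * h * sqrt s" by simp
      have "\<bar>(fd h ^^ 2) (\<lambda>xi. kk xi tau s) xi\<bar> <= cm * h ^ 2 * min tau s"
        by (rule Km0[THEN spec, THEN spec, THEN spec, THEN spec, THEN mp]) (use h t a in simp)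
      also have "\<dots> <= cm * h\<^sup>2 * s" using Km h by (intro mult_left_mono) auto
      finally have e2: "\<bar>(fd h ^^ 2) (\<lambda>xi. kk xi tau s) xi\<bar> <= cm * h\<^sup>2 * s" .
      have "j = 1 \<or> j = 2" using a by auto
      then show "\<bar>(fd h ^^ j) (\<lambda>xi. kk xi tau s) xi\<bar> <= a j s" using e1 e2 by (auto simp: a_def)
    next
      show "a j \<in> borel_measurable borel" for j unfolding a_def by measurable
      show "g j \<in> borel_measurable borel" for j unfolding g_def by measurable
      fix j :: nat and s assume j: "j < 2" "0 < s" "s < L"
      have "j = 0 \<or> j = 1" using j by auto
      then show "XX j h s <= ennreal (g j s) \<and> 0 <= g j s"
      proof
        assume "j = 0" then show ?thesis
          using XX_apriori[OF j(2,3), of 0 h] M_nonneg b_pos[OF j(2,3)] by (simp add: g_def)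
      next
        assume "j = 1" then show ?thesis using X1[OF h(1) _ j(2,3)] h C1 by (simp add: g_def)
      qed
    qed
    also have "n1 ((fd h ^^ 2) (Phi tau)) <= ennreal (C * h\<^sup>2)" using P[OF h(1) _ t] h by simp
    also have "(\<integral>\<^sup>+s. indicator {0<..<L} s * ennreal (\<Sum>j=1..2. real (2 choose j) * (a j s * (g (2 - j) s * (M * b s)))) \<partial>lborel)
       <= ennreal ((c1 + c2) * h\<^sup>2 * (L powr (q + 1) / (q + 1)))"
    proof (rule power_dom[OF q])
      fix s assume s: "0 < s" "s < L"
      have p: "s powr r <= L powr (r - q) * s powr q" if "q <= r" for r
      proof -
        have "s powr r = s powr (r - q) * s powr q" by (simp flip: powr_add)
        also have "\<dots> <= L powr (r - q) * s powr q" using s that by (intro mult_right_mono powr_mono2) auto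
        finally show ?thesis .
      qed
      have "{1..2::nat} = {1,2}" by auto
      then have "(\<Sum>j=1..2. real (2 choose j) * (a j s * (g (2 - j) s * (M * b s)))) = 2 * cK * h\<^sup>2 * C1 * M * (sqrt s * s powr (- \<gamma>)) * b s + cm * h\<^sup>2 * s * ((M * b s) * (M * b s))"
        by (simp add: a_def g_def power2_eq_square)
      also have "\<dots> <= 2 * cK * h\<^sup>2 * C1 * M * (sqrt s * s powr (- \<gamma>)) * (Cb * s powr (- \<beta>)) + cm * h\<^sup>2 * s * (M\<^sup>2 * Cb\<^sup>2 * s powr (- (2 * \<beta>)))"
        using K Km h C1 M_nonneg s by (intro add_mono mult_left_mono b_upper b_sq_le) auto
      also have "sqrt s = s powr (1/2)" using s by (simp add: powr_half_sqrt)
      also have "2 * cK * h\<^sup>2 * C1 * M * (s powr (1/2) * s powr (- \<gamma>)) * (Cb * s powr (- \<beta>)) = 2 * cK * C1 * M * Cb * h\<^sup>2 * s powr p1"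
        by (simp add: p1_def powr_diff powr_minus_divide)
      also have "cm * h\<^sup>2 * s * (M\<^sup>2 * Cb\<^sup>2 * s powr (- (2 * \<beta>))) = cm * M\<^sup>2 * Cb\<^sup>2 * h\<^sup>2 * s powr p2"
        using s by (simp add: p2_def powr_diff powr_minus_divide)
      also have "2 * cK * C1 * M * Cb * h\<^sup>2 * s powr p1 + cm * M\<^sup>2 * Cb\<^sup>2 * h\<^sup>2 * s powr p2 <=
        2 * cK * C1 * M * Cb * h\<^sup>2 * (L powr (p1 - q) * s powr q) + cm * M\<^sup>2 * Cb\<^sup>2 * h\<^sup>2 * (L powr (p2 - q) * s powr q)"
        using K Km C1 M_nonneg Cb_pos by (intro add_mono mult_left_mono p) (auto simp: q_def)
      also have "\<dots> = (c1 + c2) * h\<^sup>2 * s powr q" by (simp add: c1_def c2_def algebra_simps)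
      finally show "(\<Sum>j=1..2. real (2 choose j) * (a j s * (g (2 - j) s * (M * b s)))) <= (c1 + c2) * h\<^sup>2 * s powr q" .
    qed (use c in auto)
    also have "\<dots> = ennreal (Q * h\<^sup>2)" by (simp add: Q_def mult_ac)
    also have "ennreal (C * h\<^sup>2) + ennreal (Q * h\<^sup>2) = ennreal ((C + Q) * h\<^sup>2 * tau powr (- 0))"
      using C Q t by (simp add: distrib_right flip: ennreal_plus)
    finally show "XX 2 h tau <= ennreal ((C + Q) * h\<^sup>2 * tau powr (- 0)) + KO G tau" by (simp add: add_right_mono add_left_mono)
  qed auto
  then show ?thesis using C Q h1 K Km by (rule_tac exI[of _ "2 * (C + Q)"], rule_tac exI[of _ "min h1 (min hK hm)"]) (auto simp: mult.assoc simp del: distrib_left_numeral)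
qed

end

text \<open>A difference in frequency multiplies the transform by exp(-i h x) - 1. Dividing by h^N
  and letting h tend to 0 produces |x|^N, so bounds on differences of order h^N do the work of N
  derivatives.\<close>

lemma fourier_decay:
  fixes f :: "real => real"
  assumes f: "integrable lborel f" and h0: "0 < h0" and K: "0 <= K"
    and d: "\<And>h. 0 < h ==> h <= h0 ==> n1 ((fd h ^^ N) f) <= ennreal (K * h ^ N)"
  shows "\<bar>x\<bar> ^ N * \<bar>\<integral>xi. f xi * cos (xi * x) \<partial>lborel\<bar> <= K"
proof -
  define F :: "(real => real) => complex" where "F g = (\<integral>xi. of_real (g xi) * cis (xi * x) \<partial>lborel)" for g
  have cm: "(\<lambda>xi. cis (xi * x)) \<in> borel_measurable borel"
    by (intro borel_measurable_continuous_onI continuous_intros)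
  have int: "integrable lborel (\<lambda>xi. complex_of_real (g xi) * cis (xi * x))" if "integrable lborel g" for g
  proof (rule Bochner_Integration.integrable_bound[OF that])
    have [measurable]: "g \<in> borel_measurable borel" using borel_measurable_integrable[OF that] by simp
    note cm [measurable]
    show "(\<lambda>xi. complex_of_real (g xi) * cis (xi * x)) \<in> borel_measurable lborel" by measurable
    show "AE xi in lborel. norm (complex_of_real (g xi) * cis (xi * x)) <= norm (g xi)" by (simp add: norm_mult)
  qed
  have fdi: "integrable lborel (fd h g) \<and> F (fd h g) = (cis (- (h * x)) - 1) * F g" if g: "integrable lborel g" for g h
  proof
    have gh: "integrable lborel (\<lambda>xi. g (xi + h))" using lborel_integrable_real_affine[OF g, of 1 h] by (simp add: add.commute)
    show "integrable lborel (fd h g)" unfolding fd_def using g gh by (intro Bochner_Integration.integrable_diff)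
    have "F g = (\<integral>xi. of_real (g (xi + h)) * cis ((xi + h) * x) \<partial>lborel)"
      unfolding F_def by (subst lborel_integral_real_affine[where c = 1 and t = h]) (auto simp: add.commute)
    also have "\<dots> = (\<integral>xi. cis (h * x) * (of_real (g (xi + h)) * cis (xi * x)) \<partial>lborel)"
    proof (intro Bochner_Integration.integral_cong refl)
      fix xi
      have c: "cis ((xi + h) * x) = cis (h * x) * cis (xi * x)" by (simp add: cis_mult algebra_simps)
      show "of_real (g (xi + h)) * cis ((xi + h) * x) = cis (h * x) * (of_real (g (xi + h)) * cis (xi * x))"
        unfolding c by (simp only: mult.left_commute)
    qed
    also have "\<dots> = cis (h * x) * (\<integral>xi. of_real (g (xi + h)) * cis (xi * x) \<partial>lborel)" by simp
    finally have s: "cis (- (h * x)) * F g = (\<integral>xi. of_real (g (xi + h)) * cis (xi * x) \<partial>lborel)"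
      by (simp add: cis_mult mult.assoc[symmetric])
    have "F (fd h g) = (\<integral>xi. of_real (g (xi + h)) * cis (xi * x) - of_real (g xi) * cis (xi * x) \<partial>lborel)"
      unfolding F_def fd_def by (simp add: left_diff_distrib)
    also have "\<dots> = cis (- (h * x)) * F g - F g"
      unfolding s unfolding F_def by (rule Bochner_Integration.integral_diff[OF int[OF gh] int[OF g]])
    finally show "F (fd h g) = (cis (- (h * x)) - 1) * F g" by (simp add: left_diff_distrib)
  qed
  have fdn: "integrable lborel ((fd h ^^ n) g) \<and> F ((fd h ^^ n) g) = (cis (- (h * x)) - 1) ^ n * F g" if g: "integrable lborel g" for g h n
  proof (induction n)
    case (Suc n)
    then show ?case using fdi[of "(fd h ^^ n) g" h] by simp
  qed (use g in simp)
  have b: "\<bar>sin (h * x) / h\<bar> ^ N * norm (F f) <= K" if h: "0 < h" "h <= h0" for h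
  proof -
    \<comment> \<open>The imaginary part alone suffices, as sin(h x)/h already tends to x.\<close>
    have "\<bar>sin (h * x)\<bar> = \<bar>Im (cis (- (h * x)) - 1)\<bar>" by simp
    also have "\<dots> <= norm (cis (- (h * x)) - 1)" by (rule abs_Im_le_cmod)
    finally have "\<bar>sin (h * x)\<bar> ^ N * norm (F f) <= norm (cis (- (h * x)) - 1) ^ N * norm (F f)"
      by (intro mult_right_mono power_mono) auto
    also have "\<dots> = norm (F ((fd h ^^ N) f))" using fdn[OF f] by (simp add: norm_mult norm_power)
    also have "\<dots> <= K * h ^ N"
    proof -
      have "ennreal (norm (F ((fd h ^^ N) f))) <= (\<integral>\<^sup>+xi. ennreal (norm (complex_of_real ((fd h ^^ N) f xi) * cis (xi * x))) \<partial>lborel)"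
        unfolding F_def by (rule integral_norm_bound_ennreal) (use fdn[OF f] int in blast)
      also have "\<dots> = n1 ((fd h ^^ N) f)" by (simp add: n1_def norm_mult)
      also have "\<dots> <= ennreal (K * h ^ N)" by (rule d[OF h])
      finally show ?thesis using K h by (simp add: ennreal_le_iff)
    qed
    finally have "\<bar>sin (h * x)\<bar> ^ N * norm (F f) / h ^ N <= K" using h by (simp add: pos_divide_le_eq)
    then show ?thesis using h by (simp add: power_divide)
  qed
  have "((\<lambda>h. sin (h * x)) has_real_derivative x) (at 0)" by (auto intro!: derivative_eq_intros)
  then have "((\<lambda>h. sin (h * x) / h) \<longlongrightarrow> x) (at 0)" by (simp add: DERIV_def)
  then have "((\<lambda>h. sin (h * x) / h) \<longlongrightarrow> x) (at_right 0)" by (rule filterlim_mono) (auto simp: at_within_le_at)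
  then have "((\<lambda>h. \<bar>sin (h * x) / h\<bar> ^ N * norm (F f)) \<longlongrightarrow> \<bar>x\<bar> ^ N * norm (F f)) (at_right 0)"
    by (intro tendsto_intros)
  moreover have "eventually (\<lambda>h. \<bar>sin (h * x) / h\<bar> ^ N * norm (F f) <= K) (at_right 0)"
    using b h0 by (auto simp: eventually_at_right_field intro!: exI[of _ h0])
  ultimately have "\<bar>x\<bar> ^ N * norm (F f) <= K" by (rule tendsto_upperbound) simp
  moreover have "(\<integral>xi. f xi * cos (xi * x) \<partial>lborel) = Re (F f)"
    unfolding F_def using integral_Re[OF int[OF f]] by simp
  moreover have "\<bar>Re (F f)\<bar> <= norm (F f)" by (rule abs_Re_le_cmod)
  ultimately show ?thesis by (smt (verit) mult_left_mono zero_le_power abs_ge_zero)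
qed

text \<open>Landau's inequality \<open>|f'(x)| <= (|f(x+\<theta>)| + |f(x)|)/\<theta> + \<theta> sup |f''|\<close> with \<open>\<theta> = (1+|x|)\<^sup>-\<^sup>N\<close>.\<close>

lemma decay_deriv:
  fixes f f' f'' :: "real => real"
  assumes d1: "\<And>x. (f has_real_derivative f' x) (at x)" and d2: "\<And>x. (f' has_real_derivative f'' x) (at x)"
    and B: "\<And>x. \<bar>f'' x\<bar> <= B" and K: "\<And>x. (1 + \<bar>x\<bar>) ^ (2 * N) * \<bar>f x\<bar> <= K"
  shows "(1 + \<bar>x\<bar>) ^ N * \<bar>f' x\<bar> <= (2 ^ (2 * N) + 1) * K + B"
proof -
  define w where "w = (1 + \<bar>x\<bar>) ^ N"
  have w: "1 <= w" by (simp add: w_def one_le_power)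
  have w2: "w\<^sup>2 = (1 + \<bar>x\<bar>) ^ (2 * N)" unfolding w_def by (simp only: power_mult[symmetric] mult.commute)
  define \<theta> where "\<theta> = 1 / w"
  have th: "0 < \<theta>" "\<theta> <= 1" "w * \<theta> = 1" using w by (auto simp: \<theta>_def)
  obtain y where y: "x < y" "y < x + \<theta>" "f (x + \<theta>) - f x = (x + \<theta> - x) * f' y"
    using MVT2[of x "x + \<theta>" f f'] d1 th by auto
  obtain z where z: "f' y - f' x = (y - x) * f'' z"
    using MVT2[of x y f' f''] d2 y by auto
  have "\<bar>f' y - f' x\<bar> <= \<theta> * B"
    unfolding z abs_mult using y th B[of z] by (intro mult_mono) auto
  moreover have "\<bar>f' y\<bar> = w * \<bar>f (x + \<theta>) - f x\<bar>"
    using y(3) th by (simp add: abs_mult)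
  ultimately have "\<bar>f' x\<bar> <= w * (\<bar>f (x + \<theta>)\<bar> + \<bar>f x\<bar>) + \<theta> * B"
    using w mult_left_mono[of "\<bar>f (x + \<theta>) - f x\<bar>" "\<bar>f (x + \<theta>)\<bar> + \<bar>f x\<bar>" w] by linarith
  then have "w * \<bar>f' x\<bar> <= w * (w * (\<bar>f (x + \<theta>)\<bar> + \<bar>f x\<bar>) + \<theta> * B)" using w by (intro mult_left_mono) auto
  also have "\<dots> = w\<^sup>2 * \<bar>f (x + \<theta>)\<bar> + w\<^sup>2 * \<bar>f x\<bar> + B"
  proof -
    have "w * (w * (\<bar>f (x + \<theta>)\<bar> + \<bar>f x\<bar>) + \<theta> * B) = w\<^sup>2 * \<bar>f (x + \<theta>)\<bar> + w\<^sup>2 * \<bar>f x\<bar> + (w * \<theta>) * B"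
      by (simp add: power2_eq_square algebra_simps)
    then show ?thesis unfolding th(3) by simp
  qed
  also have "w\<^sup>2 * \<bar>f (x + \<theta>)\<bar> <= 2 ^ (2 * N) * K"
  proof -
    have "1 + \<bar>x\<bar> <= 2 * (1 + \<bar>x + \<theta>\<bar>)"
    proof -
      have "\<bar>x\<bar> <= \<bar>x + \<theta>\<bar> + \<theta>" using th by arith
      moreover have "u <= v + \<theta> ==> 0 <= v ==> 1 + u <= 2 * (1 + v)" for u v :: real using th(2) by simp
      ultimately show ?thesis by simp
    qed
    then have "(1 + \<bar>x\<bar>) ^ (2 * N) <= (2 * (1 + \<bar>x + \<theta>\<bar>)) ^ (2 * N)" by (intro power_mono) auto
    then have "w\<^sup>2 * \<bar>f (x + \<theta>)\<bar> <= (2 ^ (2 * N) * (1 + \<bar>x + \<theta>\<bar>) ^ (2 * N)) * \<bar>f (x + \<theta>)\<bar>"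
      by (intro mult_right_mono) (auto simp: w2 power_mult_distrib simp del: distrib_left_numeral)
    also have "\<dots> <= 2 ^ (2 * N) * K" using K[of "x + \<theta>"] by simp
    finally show ?thesis .
  qed
  also have "w\<^sup>2 * \<bar>f x\<bar> <= K" using K[of x] by (simp add: w2)
  finally show ?thesis by (simp add: w_def distrib_right)
qed

context boussinesq_small
begin

lemma V_integrable: "0 < tau ==> tau < L ==> integrable lborel (\<lambda>xi. V (xi, tau))"
  using JJ_integrable[OF V_tame, of tau 0 0 0] by (simp add: cs_0)

lemma JJ_V_decay:
  assumes t: "0 < tau" "tau < L" and h0: "0 < h0" and K: "0 <= K"
    and d: "\<And>h. 0 < h ==> h <= h0 ==> XX N h tau <= ennreal (K * h ^ N)"
  shows "\<bar>x\<bar> ^ N * \<bar>JJ V 0 (x, tau)\<bar> <= K"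
  using fourier_decay[OF V_integrable[OF t] h0 K, of N x] d by (simp add: JJ_def cs_0 XX_def)

text \<open>|xi|^i is at most i!/a^i times exp(a|xi|), a single term of the exponential series; the
  weighted L1 norm of V absorbs it.\<close>

lemma JJ_V_bound:
  assumes a: "0 < a" "a <= c" "c < L"
  shows "\<exists>B. \<forall>tau x. a <= tau \<and> tau <= c --> \<bar>JJ V i (x, tau)\<bar> <= B"
proof -
  obtain K where K: "K > 0" "\<And>s. a <= s ==> s < L ==> b s <= K" using b_local_bound[OF a(1)] by blast
  define q where "q = fact i / a ^ i"
  have q: "0 <= q" using a by (simp add: q_def)
  have "\<bar>JJ V i (x, tau)\<bar> <= q * (M * K)" if t: "a <= tau" "tau <= c" for tau x
  proof -
    have t0: "0 < tau" "tau < L" using t a by auto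
    note [measurable] = adm_section(1)[OF V_adm]
    have "ennreal (norm (JJ V i (x, tau))) <= (\<integral>\<^sup>+xi. ennreal (norm (V (xi, tau) * xi ^ i * cs i (xi * x))) \<partial>lborel)"
      unfolding JJ_def using integral_norm_bound_ennreal[OF JJ_integrable[OF V_tame t0]] by simp
    also have "\<dots> <= (\<integral>\<^sup>+xi. ennreal q * ennreal (\<bar>V (xi, tau)\<bar> * exp (tau * \<bar>xi\<bar>)) \<partial>lborel)"
    proof (intro nn_integral_mono)
      fix xi :: real
      have "(a * \<bar>xi\<bar>) ^ i / fact i <= exp (a * \<bar>xi\<bar>)"
      proof -
        have "(\<lambda>n. (a * \<bar>xi\<bar>) ^ n / fact n) sums exp (a * \<bar>xi\<bar>)"
          using exp_converges[of "a * \<bar>xi\<bar>"] by (simp add: divide_inverse_commute)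
        then have "(\<Sum>n\<in>{i}. (a * \<bar>xi\<bar>) ^ n / fact n) <= (\<Sum>n. (a * \<bar>xi\<bar>) ^ n / fact n) \<and> (\<Sum>n. (a * \<bar>xi\<bar>) ^ n / fact n) = exp (a * \<bar>xi\<bar>)"
          using a by (intro conjI sum_le_suminf sums_unique[symmetric]) (auto simp: sums_iff)
        then show ?thesis by simp
      qed
      then have "\<bar>xi\<bar> ^ i <= q * exp (a * \<bar>xi\<bar>)" using a by (simp add: q_def power_mult_distrib field_simps)
      also have "\<dots> <= q * exp (tau * \<bar>xi\<bar>)" using t q by (intro mult_left_mono) (auto intro!: mult_right_mono)
      finally have p: "\<bar>xi\<bar> ^ i <= q * exp (tau * \<bar>xi\<bar>)" .
      have "norm (V (xi, tau) * xi ^ i * cs i (xi * x)) <= \<bar>V (xi, tau)\<bar> * (q * exp (tau * \<bar>xi\<bar>)) * 1"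
        unfolding real_norm_def abs_mult power_abs by (intro mult_mono p abs_cs_le) (use q in auto)
      then have "ennreal (norm (V (xi, tau) * xi ^ i * cs i (xi * x))) <= ennreal (q * (\<bar>V (xi, tau)\<bar> * exp (tau * \<bar>xi\<bar>)))"
        by (intro ennreal_leI) (simp add: mult_ac)
      also have "\<dots> = ennreal q * ennreal (\<bar>V (xi, tau)\<bar> * exp (tau * \<bar>xi\<bar>))" by (rule ennreal_mult'[OF q])
      finally show "ennreal (norm (V (xi, tau) * xi ^ i * cs i (xi * x))) <= ennreal q * ennreal (\<bar>V (xi, tau)\<bar> * exp (tau * \<bar>xi\<bar>))" .
    qed
    also have "\<dots> = ennreal q * (\<integral>\<^sup>+xi. ennreal (\<bar>V (xi, tau)\<bar> * exp (tau * \<bar>xi\<bar>)) \<partial>lborel)" by (rule nn_integral_cmult) measurable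
    also have "\<dots> <= ennreal q * ennreal (M * b tau)" by (intro mult_left_mono bndD(3)[OF V_bnd t0]) auto
    also have "\<dots> = ennreal (q * (M * b tau))" by (rule ennreal_mult'[OF q, symmetric])
    also have "\<dots> <= ennreal (q * (M * K))" using q M_nonneg K t t0 by (intro ennreal_leI mult_left_mono) auto
    finally show ?thesis using q M_nonneg K by (simp add: ennreal_le_iff)
  qed
  then show ?thesis by blast
qed

lemma JJ_V_x_deriv: "0 < tau ==> tau < L ==> ((\<lambda>x. JJ V i (x, tau)) has_real_derivative JJ V (Suc i) (x, tau)) (at x)"
  by (rule JJ_x_deriv[OF V_tame])

text \<open>Only u itself is treated by frequency differences. Decay of order 2N for the i-th
  derivative and boundedness of the (i+2)-nd give decay of order N for the (i+1)-st, by
  \<open>decay_deriv\<close>; hence N is arbitrary in the induction.\<close>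

lemma JJ_V_schwartz:
  assumes P: "\<And>n. \<exists>C h0. 0 <= C \<and> 0 < h0 \<and> (\<forall>h tau. 0 < h \<and> h <= h0 \<and> 0 < tau \<and> tau < L -->
     n1 ((fd h ^^ n) (Phi tau)) <= ennreal (C * h ^ n * b tau))"
    and a: "0 < a" "a <= c" "c < L"
  shows "\<exists>K. \<forall>tau x. a <= tau \<and> tau <= c --> (1 + \<bar>x\<bar>) ^ N * \<bar>JJ V i (x, tau)\<bar> <= K"
proof (induction i arbitrary: N)
  case 0
  obtain K where K: "K > 0" "\<And>s. a <= s ==> s < L ==> b s <= K" using b_local_bound[OF a(1)] by blast
  obtain B where B: "\<And>tau x. a <= tau ==> tau <= c ==> \<bar>JJ V 0 (x, tau)\<bar> <= B" using JJ_V_bound[OF a, of 0] by blast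
  obtain C h0 where C: "0 <= C" "0 < h0" "\<forall>h tau. 0 < h \<and> h <= h0 \<and> 0 < tau \<and> tau < L --> XX N h tau <= ennreal (C * h ^ N * b tau)"
    using difference_bounds[OF P, of N] by - (elim exE conjE, rule that)
  have "(1 + \<bar>x\<bar>) ^ N * \<bar>JJ V 0 (x, tau)\<bar> <= 2 ^ N * (B + C * K)" if t: "a <= tau" "tau <= c" for tau x
  proof -
    have t0: "0 < tau" "tau < L" using t a by auto
    have "\<bar>x\<bar> ^ N * \<bar>JJ V 0 (x, tau)\<bar> <= C * b tau"
    proof (rule JJ_V_decay[OF t0 C(2)])
      show "0 <= C * b tau" using C b_pos[OF t0] by simp
      fix h :: real assume "0 < h" "h <= h0"
      then show "XX N h tau <= ennreal (C * b tau * h ^ N)" using C(3)[THEN spec, THEN spec, THEN mp, of h tau] t0 by (simp add: mult_ac)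
    qed
    also have "\<dots> <= C * K" using C K t t0 by (intro mult_left_mono) auto
    finally have 1: "\<bar>x\<bar> ^ N * \<bar>JJ V 0 (x, tau)\<bar> <= C * K" .
    have "(1 + \<bar>x\<bar>) ^ N <= (2 * max 1 \<bar>x\<bar>) ^ N" by (intro power_mono) auto
    also have "\<dots> = 2 ^ N * max 1 \<bar>x\<bar> ^ N" by (simp add: power_mult_distrib)
    also have "max 1 \<bar>x\<bar> ^ N <= 1 + \<bar>x\<bar> ^ N" by (cases "\<bar>x\<bar> <= 1") (auto simp: max_def)
    finally have "(1 + \<bar>x\<bar>) ^ N * \<bar>JJ V 0 (x, tau)\<bar> <= 2 ^ N * (1 + \<bar>x\<bar> ^ N) * \<bar>JJ V 0 (x, tau)\<bar>"
      by (intro mult_right_mono) auto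
    also have "\<dots> = 2 ^ N * (\<bar>JJ V 0 (x, tau)\<bar> + \<bar>x\<bar> ^ N * \<bar>JJ V 0 (x, tau)\<bar>)" by (simp add: algebra_simps)
    also have "\<dots> <= 2 ^ N * (B + C * K)" using 1 B[OF t] by (intro mult_left_mono add_mono) auto
    finally show ?thesis .
  qed
  then show ?case by blast
next
  case (Suc i)
  obtain B where B: "\<And>tau x. a <= tau ==> tau <= c ==> \<bar>JJ V (Suc (Suc i)) (x, tau)\<bar> <= B" using JJ_V_bound[OF a, of "Suc (Suc i)"] by blast
  obtain K where K: "\<And>tau x. a <= tau ==> tau <= c ==> (1 + \<bar>x\<bar>) ^ (2 * N) * \<bar>JJ V i (x, tau)\<bar> <= K" using Suc[of "2 * N"] by blast
  have "(1 + \<bar>x\<bar>) ^ N * \<bar>JJ V (Suc i) (x, tau)\<bar> <= (2 ^ (2 * N) + 1) * K + B" if t: "a <= tau" "tau <= c" for tau x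
  proof (rule decay_deriv[where f = "\<lambda>x. JJ V i (x, tau)" and f'' = "\<lambda>x. JJ V (Suc (Suc i)) (x, tau)"])
    show "((\<lambda>x. JJ V i (x, tau)) has_real_derivative JJ V (Suc i) (x, tau)) (at x)"
         "((\<lambda>x. JJ V (Suc i) (x, tau)) has_real_derivative JJ V (Suc (Suc i)) (x, tau)) (at x)" for x
      using t a by (auto intro!: JJ_V_x_deriv)
  qed (use B K t in auto)
  then show ?case by blast
qed

end

section \<open>The profile\<close>

lemma sqrt_power_powr: "0 < x ==> sqrt x ^ n = x powr (real n / 2)"
  by (simp add: powr_half_sqrt[symmetric] powr_power)

text \<open>A Lorentzian of width 1/sqrt a, normalised to integral at most pi for every a, with
  maximum sqrt a; domination by it yields sup and L1 bounds at once.\<close>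

definition qq :: "real => real => real" where "qq a xi = sqrt a / (1 + a * xi\<^sup>2)"

lemma qq_nonneg: "0 <= a ==> 0 <= qq a xi" by (simp add: qq_def)

lemma qq_le: "0 <= a ==> qq a xi <= sqrt a"
proof -
  assume "0 <= a"
  then have "1 + a * xi\<^sup>2 >= 1" by simp
  then have "sqrt a / (1 + a * xi\<^sup>2) <= sqrt a / 1" using \<open>0 <= a\<close> by (intro divide_left_mono) (auto intro: add_pos_nonneg)
  then show ?thesis by (simp add: qq_def)
qed

lemma qq_measurable [measurable]: "(\<lambda>z. qq (f z) (g z)) \<in> borel_measurable N"
  if [measurable]: "f \<in> borel_measurable N" "g \<in> borel_measurable N"
  unfolding qq_def by measurable

lemma qq_integral:
  assumes a: "0 < a"
  shows "(\<integral>\<^sup>+xi. ennreal (qq a xi) \<partial>lborel) <= ennreal pi"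
proof -
  have "(\<integral>\<^sup>+x. ennreal (1 / (1 + x\<^sup>2)) \<partial>lborel) = ennreal \<bar>sqrt a\<bar> * (\<integral>\<^sup>+x. ennreal (1 / (1 + (0 + sqrt a * x)\<^sup>2)) \<partial>lborel)"
    by (rule nn_integral_real_affine) (use a in auto)
  also have "\<dots> = (\<integral>\<^sup>+x. ennreal \<bar>sqrt a\<bar> * ennreal (1 / (1 + (0 + sqrt a * x)\<^sup>2)) \<partial>lborel)"
    by (rule nn_integral_cmult[symmetric]) measurable
  also have "\<dots> = (\<integral>\<^sup>+xi. ennreal (qq a xi) \<partial>lborel)"
    using a by (intro nn_integral_cong) (simp add: qq_def power_mult_distrib flip: ennreal_mult)
  finally show ?thesis using nn_integral_inverse_square by simp
qed

text \<open>In the variable z = sqrt a |xi| this is (1+z)^2 <= 2(1+z^2) and (1+z^2)^2 exp(-z^2) <=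
  4, whence 8. The factor in R converts 1 + |xi| into powers of a^(-1/2) for bounded a.\<close>

lemma gauss_qq:
  fixes a R xi :: real
  assumes a: "0 < a" "a <= R" and m: "m <= 2"
  shows "(1 + \<bar>xi\<bar>) ^ m * exp (- (xi\<^sup>2 * a)) <= 8 * (1 + sqrt R)\<^sup>2 / sqrt a ^ (m + 1) * qq a xi"
proof -
  define s where "s = sqrt a"
  have s: "0 < s" "a = s\<^sup>2" using a by (auto simp: s_def)
  define z where "z = s * \<bar>xi\<bar>"
  have z: "0 <= z" "z\<^sup>2 = xi\<^sup>2 * a" using s by (auto simp: z_def power_mult_distrib)
  define r where "r = sqrt R"
  have r: "0 <= r" "s <= r" using a by (auto simp: r_def s_def)
  have "s * (1 + \<bar>xi\<bar>) <= (1 + r) * (1 + z)"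
  proof -
    have "(1 + r) * (1 + z) = 1 + r + z + r * z" by (simp add: algebra_simps)
    moreover have "0 <= r * z" using r z by simp
    moreover have "s * (1 + \<bar>xi\<bar>) = s + z" by (simp add: z_def algebra_simps)
    ultimately show ?thesis using r z by linarith
  qed
  then have "(s * (1 + \<bar>xi\<bar>)) ^ m <= ((1 + r) * (1 + z)) ^ m" using s by (intro power_mono) auto
  also have "\<dots> <= ((1 + r) * (1 + z))\<^sup>2"
  proof (rule power_increasing[OF m])
    have "1 * 1 <= (1 + r) * (1 + z)" using r z by (intro mult_mono) auto
    then show "1 <= (1 + r) * (1 + z)" by simp
  qed
  also have "\<dots> = (1 + r)\<^sup>2 * (1 + z)\<^sup>2" by (simp add: power_mult_distrib)
  also have "(1 + z)\<^sup>2 <= 2 * (1 + z\<^sup>2)" using zero_le_power2[of "z - 1"] by (simp add: power2_eq_square algebra_simps)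
  finally have 1: "(s * (1 + \<bar>xi\<bar>)) ^ m <= (1 + r)\<^sup>2 * (2 * (1 + z\<^sup>2))" by (simp add: mult_left_mono)
  have 2: "(1 + z\<^sup>2) * (1 + z\<^sup>2) * exp (- z\<^sup>2) <= 4"
  proof -
    have "1 + z\<^sup>2 / 2 <= exp (z\<^sup>2 / 2)" by (rule exp_ge_add_one_self)
    then have "(1 + z\<^sup>2 / 2)\<^sup>2 <= (exp (z\<^sup>2 / 2))\<^sup>2" by (intro power_mono) auto
    also have "\<dots> = exp (z\<^sup>2)" by (simp add: power2_eq_square flip: exp_add)
    finally have "4 * (1 + z\<^sup>2 / 2)\<^sup>2 <= 4 * exp (z\<^sup>2)" by simp
    moreover have "(1 + z\<^sup>2) * (1 + z\<^sup>2) <= 4 * (1 + z\<^sup>2 / 2)\<^sup>2"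
    proof -
      have "(1 + z\<^sup>2) <= 2 * (1 + z\<^sup>2 / 2)" by simp
      then have "(1 + z\<^sup>2) * (1 + z\<^sup>2) <= (2 * (1 + z\<^sup>2 / 2)) * (2 * (1 + z\<^sup>2 / 2))" by (intro mult_mono) auto
      then show ?thesis unfolding power2_eq_square[of "1 + z\<^sup>2 / 2"] by (simp only: mult_ac)
    qed
    ultimately have "(1 + z\<^sup>2) * (1 + z\<^sup>2) <= 4 * exp (z\<^sup>2)" by simp
    then have "(1 + z\<^sup>2) * (1 + z\<^sup>2) * exp (- z\<^sup>2) <= 4 * exp (z\<^sup>2) * exp (- z\<^sup>2)" by (intro mult_right_mono) auto
    then show ?thesis by (simp add: mult.assoc flip: exp_add)
  qed
  have "(1 + \<bar>xi\<bar>) ^ m * exp (- z\<^sup>2) * (s ^ m * (1 + z\<^sup>2)) = (s * (1 + \<bar>xi\<bar>)) ^ m * ((1 + z\<^sup>2) * exp (- z\<^sup>2))"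
    by (simp add: power_mult_distrib mult_ac)
  also have "\<dots> <= ((1 + r)\<^sup>2 * (2 * (1 + z\<^sup>2))) * ((1 + z\<^sup>2) * exp (- z\<^sup>2))"
    using 1 by (intro mult_right_mono) auto
  also have "\<dots> = 2 * (1 + r)\<^sup>2 * ((1 + z\<^sup>2) * (1 + z\<^sup>2) * exp (- z\<^sup>2))" by (simp only: mult_ac)
  also have "\<dots> <= 2 * (1 + r)\<^sup>2 * 4" using 2 by (intro mult_left_mono) auto
  finally have "(1 + \<bar>xi\<bar>) ^ m * exp (- z\<^sup>2) * (s ^ m * (1 + z\<^sup>2)) <= 8 * (1 + r)\<^sup>2" by simp
  then have "(1 + \<bar>xi\<bar>) ^ m * exp (- z\<^sup>2) <= 8 * (1 + r)\<^sup>2 / (s ^ m * (1 + z\<^sup>2))"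
    using s z by (subst pos_le_divide_eq) (auto intro!: mult_pos_pos add_pos_nonneg)
  also have "\<dots> = 8 * (1 + sqrt R)\<^sup>2 / sqrt a ^ (m + 1) * qq a xi"
    using s unfolding qq_def s_def[symmetric] r_def[symmetric] by (simp add: z mult.commute)
  finally show ?thesis by (simp add: z)
qed

text \<open>The logarithmic factor enters as an abstract slowly varying function l of the small
  variable: at least 1, nonincreasing, and subject to Potter's inequality \<open>l_potter\<close>,
  which is the only quantitative trace of its slow variation.\<close>

locale profile =
  fixes \<delta> c :: real and l :: "real => real"
  assumes delta: "0 < \<delta>" "\<delta> < 1" and c: "0 < c" "c <= 1"
    and l_meas [measurable]: "l \<in> borel_measurable borel"
    and l_ge: "\<And>y. 0 < y ==> y <= c ==> 1 <= l y"
    and l_mono: "\<And>y tau. 0 < y ==> y <= tau ==> tau <= c ==> l tau <= l y"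
    and l_potter: "\<And>e. 0 < e ==> \<exists>K>0. \<forall>y tau. 0 < y \<and> y <= tau \<and> tau <= c --> l y <= K * (tau / y) powr e * l tau"
begin

definition rho :: "real => real" where "rho y = y powr (1/2 - \<delta>) * l y * indicator {0<..c} y"

lemma rho_measurable [measurable]: "rho \<in> borel_measurable borel"
  unfolding rho_def[abs_def] by measurable

lemma rho_nonneg: "0 <= rho y"
  using l_ge[of y] by (auto simp: rho_def indicator_def)

lemma l_powr:
  assumes "0 < e"
  shows "\<exists>K>0. \<forall>y. 0 < y \<and> y <= c --> l y <= K * y powr (- e)"
proof -
  obtain K where K: "K > 0" "\<And>y tau. 0 < y ==> y <= tau ==> tau <= c ==> l y <= K * (tau / y) powr e * l tau"
    using l_potter[OF assms] by blast
  have lc: "1 <= l c" using l_ge[of c] c by simp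
  show ?thesis
  proof (intro exI[of _ "K * l c"] conjI allI impI)
    show "0 < K * l c" using K lc by simp
    fix y assume y: "0 < y \<and> y <= c"
    have "l y <= K * (c / y) powr e * l c" using K(2)[of y c] y by simp
    also have "(c / y) powr e <= (1 / y) powr e" using y c assms by (intro powr_mono2 divide_right_mono) auto
    also have "(1 / y) powr e = y powr (- e)" using y by (simp add: powr_minus_divide powr_divide)
    finally show "l y <= K * l c * y powr (- e)" using K lc by (simp add: mult_ac)
  qed
qed

lemma rho_powr_integral:
  assumes q: "\<delta> - 3/2 < q"
  shows "\<exists>C\<ge>0. (\<integral>\<^sup>+y. ennreal (rho y * y powr q) \<partial>lborel) <= ennreal C"
proof -
  \<comment> \<open>Half of the available room in the exponent is given to l through
    \<open>l_powr\<close>; the other half keeps p > -1.\<close>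
  define e where "e = (q - (\<delta> - 3/2)) / 2"
  have e: "0 < e" using q by (simp add: e_def)
  obtain K where K: "K > 0" "\<And>y. 0 < y ==> y <= c ==> l y <= K * y powr (- e)" using l_powr[OF e] by blast
  define p where "p = 1/2 - \<delta> - e + q"
  have p: "-1 < p" using q by (simp add: p_def e_def field_simps)
  have "(\<integral>\<^sup>+y. ennreal (rho y * y powr q) \<partial>lborel) <= (\<integral>\<^sup>+y. ennreal K * (ennreal (y powr p) * indicator {0..c} y) \<partial>lborel)"
  proof (intro nn_integral_mono)
    fix y :: real
    show "ennreal (rho y * y powr q) <= ennreal K * (ennreal (y powr p) * indicator {0..c} y)"
    proof (cases "0 < y \<and> y <= c")
      case True
      have "rho y * y powr q <= y powr (1/2 - \<delta>) * (K * y powr (- e)) * y powr q"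
        using True K(2)[of y] by (auto simp: rho_def intro!: mult_right_mono mult_left_mono)
      also have "\<dots> = K * y powr p"
      proof -
        have "y powr p = y powr (1/2 - \<delta>) * y powr (- e) * y powr q" unfolding p_def by (simp flip: powr_add)
        then show ?thesis by (simp add: mult_ac)
      qed
      finally have "ennreal (rho y * y powr q) <= ennreal (K * y powr p)" by (rule ennreal_leI)
      then show ?thesis using True K by (simp add: ennreal_mult)
    qed (auto simp: rho_def)
  qed
  also have "\<dots> = ennreal K * (\<integral>\<^sup>+y. ennreal (y powr p) * indicator {0..c} y \<partial>lborel)"
    by (rule nn_integral_cmult) measurable
  also have "\<dots> = ennreal K * ennreal (c powr (p + 1) / (p + 1))" using c by (subst nn_integral_powr_from_0[OF p]) auto
  also have "\<dots> = ennreal (K * (c powr (p + 1) / (p + 1)))" using K by (intro ennreal_mult'[symmetric]) simp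
  finally show ?thesis using K p by (intro exI[of _ "K * (c powr (p + 1) / (p + 1))"]) auto
qed

text \<open>The L1 size of the linear solution up to constants, since xi^2 exp(-xi^2 (y+tau))
  integrates to order (y+tau)^(-3/2).\<close>

definition I0 :: "real => ennreal" where "I0 tau = (\<integral>\<^sup>+y. ennreal (rho y / sqrt (y + tau) ^ 3) \<partial>lborel)"

lemma I0_mono: "0 < s ==> s <= t ==> I0 t <= I0 s"
  unfolding I0_def
proof (intro nn_integral_mono ennreal_leI)
  fix y :: real assume s: "0 < s" "s <= t"
  show "rho y / sqrt (y + t) ^ 3 <= rho y / sqrt (y + s) ^ 3"
  proof (cases "0 < y")
    case True
    then show ?thesis using s rho_nonneg[of y] by (intro divide_left_mono power_mono mult_pos_pos) auto
  qed (auto simp: rho_def)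
qed

text \<open>Split at y = tau. Below, Potter with exponent 1/2 replaces l y and leaves tau^(-1)
  y^(-\<delta>), integrable at 0 as \<delta> < 1; above, monotonicity of l leaves y^(-1-\<delta>),
  integrable at infinity as \<delta> > 0.\<close>

lemma I0_upper: "\<exists>C>0. \<forall>tau. 0 < tau \<and> tau <= c --> I0 tau <= ennreal (C * (tau powr (- \<delta>) * l tau))"
proof -
  obtain K where K: "K > 0" "\<And>y tau. 0 < y ==> y <= tau ==> tau <= c ==> l y <= K * (tau / y) powr (1/2) * l tau"
    using l_potter[of "1/2"] by auto
  have "I0 tau <= ennreal ((K / (1 - \<delta>) + 1 / \<delta>) * (tau powr (- \<delta>) * l tau))" if t: "0 < tau" "tau <= c" for tau
  proof -
    have lt: "1 <= l tau" using l_ge t by simp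
    have "I0 tau <= (\<integral>\<^sup>+y. ennreal (K * l tau * tau powr (-1)) * (ennreal (y powr (- \<delta>)) * indicator {0..tau} y) +
       ennreal (l tau) * (ennreal (y powr (- 1 - \<delta>)) * indicator {tau..} y) \<partial>lborel)"
      unfolding I0_def
    proof (intro nn_integral_mono)
      fix y :: real
      show "ennreal (rho y / sqrt (y + tau) ^ 3) <= ennreal (K * l tau * tau powr (-1)) * (ennreal (y powr (- \<delta>)) * indicator {0..tau} y) +
       ennreal (l tau) * (ennreal (y powr (- 1 - \<delta>)) * indicator {tau..} y)"
      proof (cases "0 < y \<and> y <= c")
        case y: True
        then have r: "rho y = y powr (1/2 - \<delta>) * l y" by (simp add: rho_def)
        show ?thesis
        proof (cases "y < tau")
          case True
          have "rho y / sqrt (y + tau) ^ 3 <= rho y / sqrt tau ^ 3"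
            using y t rho_nonneg[of y] by (intro divide_left_mono power_mono mult_pos_pos) auto
          also have "\<dots> <= y powr (1/2 - \<delta>) * (K * (tau / y) powr (1/2) * l tau) / sqrt tau ^ 3"
            unfolding r using K(2)[of y tau] y t True by (intro divide_right_mono mult_left_mono) auto
          also have "\<dots> = K * l tau * (tau powr (1/2) / tau powr (3/2)) * (y powr (1/2 - \<delta>) / y powr (1/2))"
            using y t by (simp add: sqrt_power_powr powr_divide mult_ac)
          also have "\<dots> = K * l tau * tau powr (-1) * y powr (- \<delta>)" by (simp flip: powr_diff)
          finally have "ennreal (rho y / sqrt (y + tau) ^ 3) <= ennreal (K * l tau * tau powr (-1) * y powr (- \<delta>))" by (rule ennreal_leI)
          also have "\<dots> = ennreal (K * l tau * tau powr (-1)) * ennreal (y powr (- \<delta>))" by (rule ennreal_mult'') simp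
          finally show ?thesis using True y by simp
        next
          case False
          have "rho y / sqrt (y + tau) ^ 3 <= rho y / sqrt y ^ 3"
            using y t rho_nonneg[of y] by (intro divide_left_mono power_mono mult_pos_pos) auto
          also have "\<dots> <= y powr (1/2 - \<delta>) * l tau / sqrt y ^ 3"
            unfolding r using l_mono[of tau y] y t False by (intro divide_right_mono mult_left_mono) auto
          also have "\<dots> = l tau * (y powr (1/2 - \<delta>) / y powr (3/2))" using y by (simp add: sqrt_power_powr)
          also have "\<dots> = l tau * y powr (- 1 - \<delta>)" by (simp flip: powr_diff)
          finally have "ennreal (rho y / sqrt (y + tau) ^ 3) <= ennreal (l tau * y powr (- 1 - \<delta>))" by (rule ennreal_leI)
          also have "\<dots> = ennreal (l tau) * ennreal (y powr (- 1 - \<delta>))" by (rule ennreal_mult'') simp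
          finally show ?thesis using False by (simp add: add_increasing)
        qed
      qed (auto simp: rho_def)
    qed
    also have "\<dots> = ennreal (K * l tau * tau powr (-1)) * (\<integral>\<^sup>+y. ennreal (y powr (- \<delta>)) * indicator {0..tau} y \<partial>lborel) +
       ennreal (l tau) * (\<integral>\<^sup>+y. ennreal (y powr (- 1 - \<delta>)) * indicator {tau..} y \<partial>lborel)"
      by (subst nn_integral_add, measurable, subst nn_integral_cmult, measurable, subst nn_integral_cmult, measurable)
    also have "\<dots> = ennreal (K * l tau * tau powr (-1)) * ennreal (tau powr (- \<delta> + 1) / (- \<delta> + 1)) +
       ennreal (l tau) * ennreal (- (tau powr (- 1 - \<delta> + 1)) / (- 1 - \<delta> + 1))"
      using t delta by (subst nn_integral_powr_from_0, simp, simp, subst nn_integral_powr_to_inf) auto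
    also have "\<dots> = ennreal (K * l tau * tau powr (-1) * (tau powr (- \<delta> + 1) / (- \<delta> + 1)) + l tau * (- (tau powr (- 1 - \<delta> + 1)) / (- 1 - \<delta> + 1)))"
    proof -
      have a: "0 <= K * l tau * tau powr (-1)" "0 <= tau powr (- \<delta> + 1) / (- \<delta> + 1)" "0 <= l tau" "0 <= - (tau powr (- 1 - \<delta> + 1)) / (- 1 - \<delta> + 1)"
        using K lt delta by auto
      then show ?thesis by (simp only: ennreal_mult ennreal_plus mult_nonneg_nonneg)
    qed
    also have "K * l tau * tau powr (-1) * (tau powr (- \<delta> + 1) / (- \<delta> + 1)) + l tau * (- (tau powr (- 1 - \<delta> + 1)) / (- 1 - \<delta> + 1)) = (K / (1 - \<delta>) + 1 / \<delta>) * (tau powr (- \<delta>) * l tau)"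
    proof -
      have "tau powr (-1) * tau powr (- \<delta> + 1) = tau powr (- \<delta>)" by (simp only: powr_add[symmetric]) simp
      then have "K * l tau * tau powr (-1) * (tau powr (- \<delta> + 1) / (- \<delta> + 1)) = K / (1 - \<delta>) * (tau powr (- \<delta>) * l tau)"
      proof -
        have g: "K * l' * u * (x / (- \<delta> + 1)) = K / (1 - \<delta>) * ((u * x) * l')" for u x l' :: real by simp
        show ?thesis unfolding g \<open>tau powr (-1) * tau powr (- \<delta> + 1) = tau powr (- \<delta>)\<close> ..
      qed
      moreover have "l tau * (- (tau powr (- 1 - \<delta> + 1)) / (- 1 - \<delta> + 1)) = 1 / \<delta> * (tau powr (- \<delta>) * l tau)" by simp
      ultimately show ?thesis by (simp only: distrib_right)
    qed
    finally show ?thesis .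
  qed
  then show ?thesis using K delta by (intro exI[of _ "K / (1 - \<delta>) + 1 / \<delta>"]) (auto intro: add_pos_pos)
qed

text \<open>On tau/2 <= y <= tau one has rho y >= tau^(1/2-\<delta>) l(tau) / 2 and (y+tau)^(3/2) <=
  8 tau^(3/2), whence 1/16; the interval has length tau/2, whence 1/32.\<close>

lemma I0_lower:
  assumes t: "0 < tau" "tau <= c"
  shows "ennreal (1/32 * (tau powr (- \<delta>) * l tau)) <= I0 tau"
proof -
  have lt: "1 <= l tau" using l_ge t by simp
  have "ennreal (1/32 * (tau powr (- \<delta>) * l tau)) = ennreal (1/16 * tau powr (-1 - \<delta>) * l tau) * ennreal (tau - tau / 2)"
  proof -
    have "tau powr (-1 - \<delta>) * tau = tau powr (- \<delta>)" using t by (simp add: powr_diff powr_minus_divide)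
    then have "1/32 * (tau powr (- \<delta>) * l tau) = 1/16 * tau powr (-1 - \<delta>) * l tau * (tau - tau / 2)" by (simp add: algebra_simps)
    then show ?thesis using lt t by (subst ennreal_mult[symmetric]) auto
  qed
  also have "ennreal (tau - tau / 2) = (\<integral>\<^sup>+y. indicator {tau / 2..tau} y \<partial>lborel)" using t by simp
  also have "ennreal (1/16 * tau powr (-1 - \<delta>) * l tau) * \<dots> = (\<integral>\<^sup>+y. ennreal (1/16 * tau powr (-1 - \<delta>) * l tau) * indicator {tau / 2..tau} y \<partial>lborel)"
    by (rule nn_integral_cmult[symmetric]) measurable
  also have "\<dots> <= I0 tau" unfolding I0_def
  proof (intro nn_integral_mono)
    fix y :: real
    show "ennreal (1/16 * tau powr (-1 - \<delta>) * l tau) * indicator {tau / 2..tau} y <= ennreal (rho y / sqrt (y + tau) ^ 3)"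
    proof (cases "tau / 2 <= y \<and> y <= tau")
      case True
      then have y: "0 < y" "y <= c" using t by auto
      have p: "tau powr (1/2 - \<delta>) / 2 <= y powr (1/2 - \<delta>)"
      proof (cases "\<delta> <= 1/2")
        case d: True
        have "(2::real) powr (1/2 - \<delta>) <= 2 powr 1" using delta by (intro powr_mono) auto
        then have "tau powr (1/2 - \<delta>) / 2 <= tau powr (1/2 - \<delta>) / 2 powr (1/2 - \<delta>)" by (intro divide_left_mono) auto
        also have "\<dots> = (tau / 2) powr (1/2 - \<delta>)" using t by (simp add: powr_divide)
        also have "\<dots> <= y powr (1/2 - \<delta>)" using True d t by (intro powr_mono2) auto
        finally show ?thesis .
      next
        case d: False
        have "tau powr (1/2 - \<delta>) <= y powr (1/2 - \<delta>)" using True d y by (intro powr_mono2') auto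
        then show ?thesis using powr_ge_zero[of tau "1/2 - \<delta>"] by linarith
      qed
      have "sqrt (y + tau) <= sqrt (4 * tau)" using True t by simp
      also have "\<dots> = 2 * sqrt tau" by (simp add: real_sqrt_mult)
      finally have "sqrt (y + tau) ^ 3 <= (2 * sqrt tau) ^ 3" using y t by (intro power_mono) auto
      then have s: "sqrt (y + tau) ^ 3 <= 8 * tau powr (3/2)" using t by (simp add: power_mult_distrib sqrt_power_powr)
      have "1/16 * tau powr (-1 - \<delta>) * l tau = (tau powr (1/2 - \<delta>) / 2) * l tau / (8 * tau powr (3/2))"
      proof -
        have "tau powr (-1 - \<delta>) = tau powr (1/2 - \<delta>) / tau powr (3/2)" by (simp flip: powr_diff)
        then show ?thesis by simp
      qed
      also have "\<dots> <= (y powr (1/2 - \<delta>) * l y) / (8 * tau powr (3/2))"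
        using p lt l_mono[of y tau] y True t by (intro divide_right_mono mult_mono) auto
      also have "\<dots> <= (y powr (1/2 - \<delta>) * l y) / sqrt (y + tau) ^ 3"
        using s y t l_ge[of y] by (intro divide_left_mono mult_pos_pos mult_nonneg_nonneg) auto
      also have "y powr (1/2 - \<delta>) * l y = rho y" using y by (simp add: rho_def)
      finally show ?thesis using True by (simp add: ennreal_leI)
    qed auto
  qed
  finally show ?thesis .
qed

text \<open>Serves as the weight b in place of tau^(-\<delta>) l(tau), to which it is comparable for
  tau <= c: it stays positive and nonincreasing on the whole half line, whereas l is controlled only
  up to c.\<close>

definition bb :: "real => real" where "bb tau = enn2real (I0 tau)"

lemma ennreal_bb: "0 < tau ==> ennreal (bb tau) = I0 tau"
proof -
  assume t: "0 < tau"
  obtain C where C: "\<And>tau. 0 < tau \<and> tau <= c ==> I0 tau <= ennreal (C * (tau powr (- \<delta>) * l tau))" using I0_upper by blast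
  have "I0 tau <= I0 (min tau c)" using t c by (intro I0_mono) auto
  also have "\<dots> <= ennreal (C * (min tau c powr (- \<delta>) * l (min tau c)))" using t c by (intro C) auto
  also have "\<dots> < top" by simp
  finally show ?thesis unfolding bb_def by (simp add: ennreal_enn2real_if)
qed

lemma bb_measurable [measurable]: "bb \<in> borel_measurable borel"
  unfolding bb_def[abs_def] I0_def[abs_def] by measurable

lemma bb_mono: "0 < s ==> s <= t ==> bb t <= bb s"
  using I0_mono[of s t] ennreal_bb[of s] ennreal_bb[of t] by (simp add: bb_def ennreal_le_iff2 del: ennreal_enn2real_if) (metis bb_def enn2real_nonneg ennreal_le_iff)

lemma bb_upper: "\<exists>C>0. \<forall>tau. 0 < tau \<and> tau <= c --> bb tau <= C * (tau powr (- \<delta>) * l tau)"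
proof -
  obtain C where C: "C > 0" "\<And>tau. 0 < tau \<and> tau <= c ==> I0 tau <= ennreal (C * (tau powr (- \<delta>) * l tau))" using I0_upper by blast
  have "bb tau <= C * (tau powr (- \<delta>) * l tau)" if t: "0 < tau" "tau <= c" for tau
  proof -
    have "0 <= C * (tau powr (- \<delta>) * l tau)" using C(1) l_ge[OF t] by simp
    then show ?thesis using C(2)[of tau] t ennreal_bb[OF t(1)] by (metis ennreal_le_iff)
  qed
  then show ?thesis using C by blast
qed

lemma bb_lower: "0 < tau ==> tau <= c ==> 1/32 * (tau powr (- \<delta>) * l tau) <= bb tau"
  using I0_lower[of tau] ennreal_bb[of tau] by (metis bb_def enn2real_nonneg ennreal_le_iff)

lemma bb_pos: "0 < tau ==> 0 < bb tau"
proof -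
  assume t: "0 < tau"
  have "0 < I0 tau"
  proof (rule ccontr)
    assume "\<not> 0 < I0 tau"
    then have "I0 tau = 0" by simp
    then have "AE y in lborel. ennreal (rho y / sqrt (y + tau) ^ 3) = 0"
      unfolding I0_def by (subst (asm) nn_integral_0_iff_AE) measurable
    then have "AE y in lborel. y \<notin> {0<..c}"
    proof (rule AE_mp, intro AE_I2 impI notI)
      fix y assume "ennreal (rho y / sqrt (y + tau) ^ 3) = 0" and y: "y \<in> {0<..c}"
      moreover have "0 < rho y" using y l_ge[of y] by (auto simp: rho_def)
      moreover have "0 < sqrt (y + tau) ^ 3" using y t by auto
      ultimately show False by (metis divide_pos_pos ennreal_eq_0_iff not_less)
    qed
    moreover have "{y. \<not> y \<notin> {0<..c}} = {0<..c}" by auto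
    ultimately have "emeasure lborel {0<..c} = 0" using AE_iff_measurable[of "{0<..c}" lborel "\<lambda>y. y \<notin> {0<..c}"] by simp
    then show False using c by simp
  qed
  then show ?thesis using ennreal_bb[OF t] by (metis ennreal_0 ennreal_less_zero_iff)
qed

lemma blowup_weight_bb:
  assumes L: "c <= L" and be: "\<delta> < \<beta>" "\<beta> < 1" "2 * \<beta> - 1 <= \<delta>"
  shows "\<exists>c0 Cb. blowup_weight L bb \<beta> c0 Cb"
proof -
  have L0: "0 < L" using L c by simp
  obtain C where C: "C > 0" "\<And>tau. 0 < tau \<and> tau <= c ==> bb tau <= C * (tau powr (- \<delta>) * l tau)" using bb_upper by blast
  obtain K where K: "K > 0" "\<And>y. 0 < y \<and> y <= c ==> l y <= K * y powr (- (\<beta> - \<delta>))" using l_powr[of "\<beta> - \<delta>"] be by auto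
  \<comment> \<open>One summand for s <= c, where l costs the power \<beta> - \<delta>, and one for
    s > c, where \<open>bb\<close> is at most \<open>bb c\<close>. Likewise D bounds s^(1-2\<beta>)
    for s > c whatever the sign of the exponent, and c0 serves both ranges.\<close>
  define Cb where "Cb = C * K + bb c * L powr \<beta>"
  define D where "D = c powr (1 - 2 * \<beta>) + L powr (1 - 2 * \<beta>)"
  have D: "0 < D" using c by (simp add: D_def add_pos_nonneg)
  define c0 where "c0 = min (1/32) (bb L / D)"
  have c0: "0 < c0" using D bb_pos[OF L0] by (simp add: c0_def)
  have c0': "c0 <= 1/32" unfolding c0_def by (rule min.cobounded1)
  have bc: "0 < bb c" using bb_pos c by simp
  have up: "bb s <= Cb * s powr (- \<beta>)" if s: "0 < s" "s < L" for s
  proof (cases "s <= c")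
    case True
    have "bb s <= C * (s powr (- \<delta>) * l s)" using C(2)[of s] s True by simp
    also have "\<dots> <= C * (s powr (- \<delta>) * (K * s powr (- (\<beta> - \<delta>))))" using C(1) K(2)[of s] s True by (intro mult_left_mono) auto
    also have "\<dots> = C * K * s powr (- \<beta>)"
    proof -
      have "s powr (- \<beta>) = s powr (- \<delta>) * s powr (- (\<beta> - \<delta>))" by (simp flip: powr_add)
      then show ?thesis by simp
    qed
    also have "\<dots> <= Cb * s powr (- \<beta>)" using bc by (intro mult_right_mono) (auto simp: Cb_def)
    finally show ?thesis .
  next
    case False
    have "bb s <= bb c * 1" using bb_mono[of c s] c False by simp
    also have "1 = L powr \<beta> * L powr (- \<beta>)" using L0 by (simp flip: powr_add)
    also have "bb c * \<dots> <= bb c * (L powr \<beta> * s powr (- \<beta>))"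
      using bc s be delta by (intro mult_left_mono powr_mono2') auto
    also have "\<dots> <= Cb * s powr (- \<beta>)" using C K by (simp add: Cb_def distrib_right)
    finally show ?thesis .
  qed
  have low: "c0 * s powr (1 - 2 * \<beta>) <= bb s" if s: "0 < s" "s < L" for s
  proof (cases "s <= c")
    case True
    have "c0 * s powr (1 - 2 * \<beta>) <= 1/32 * s powr (- \<delta>)"
      using s True c be c0' by (intro mult_mono powr_mono') auto
    also have "\<dots> <= 1/32 * (s powr (- \<delta>) * l s)" using l_ge[of s] s True by (simp add: mult_left_mono[of 1 "l s" "s powr (- \<delta>)", simplified])
    also have "\<dots> <= bb s" using bb_lower[of s] s True by simp
    finally show ?thesis .
  next
    case False
    have "s powr (1 - 2 * \<beta>) <= D"
    proof (cases "0 <= 1 - 2 * \<beta>")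
      case True
      then have "s powr (1 - 2 * \<beta>) <= L powr (1 - 2 * \<beta>)" using s by (intro powr_mono2) auto
      then show ?thesis by (simp add: D_def add_increasing)
    next
      case neg: False
      then have "s powr (1 - 2 * \<beta>) <= c powr (1 - 2 * \<beta>)" using s c False by (intro powr_mono2') auto
      then show ?thesis by (simp add: D_def add_increasing2)
    qed
    then have "c0 * s powr (1 - 2 * \<beta>) <= bb L / D * D" using c0 D bb_pos[OF L0] by (intro mult_mono) (auto simp: c0_def)
    also have "\<dots> = bb L" using D by simp
    also have "\<dots> <= bb s" using bb_mono s by simp
    finally show ?thesis .
  qed
  have "blowup_weight L bb \<beta> c0 Cb"
    by unfold_locales (use L0 be delta c0 up low in auto)
  then show ?thesis by blast
qed

end

context time_interval
begin

lemma pro_diff: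
  "\<exists>C h0. 0 < C \<and> 0 < h0 \<and> (\<forall>h xi y t. 0 < h \<and> h <= h0 \<and> 0 <= y \<and> y <= 1 \<and> 0 <= t \<and> t <= L -->
     \<bar>(fd h ^^ n) (pro y t) xi\<bar> <= C * (h / (1 + \<bar>xi\<bar>)) ^ n * ((1 + xi\<^sup>2) * exp (- (xi\<^sup>2 * (y + t) / 2))))"
  using kernel_profile_diff[of n] by (elim ex_forward conj_forward) simp_all

text \<open>For |xi| >= 1 the symbol is nonnegative, so every term is a cosh and positive: the
  numerator is at least exp(q (2L - t))/2 and the denominator at most 3 exp(2 q L), with q <=
  xi^2.\<close>

lemma EEr_ge:
  assumes hxi: "1 <= \<bar>xi\<bar>" and t: "0 <= t" "t <= L"
  shows "exp (- (xi\<^sup>2 * t)) / 6 <= EEr xi t"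
proof -
  have xi2: "1 <= xi\<^sup>2" using power_mono[OF hxi, of 2] by simp
  have w0: "0 <= xi ^ 4 - xi\<^sup>2" using power_increasing[of 2 4 "\<bar>xi\<bar>"] hxi by simp
  define q where "q = sqrt (xi ^ 4 - xi\<^sup>2)"
  have q0: "0 <= q" using w0 by (simp add: q_def)
  have q: "q <= xi\<^sup>2" unfolding q_def by (rule real_le_lsqrt) (auto simp flip: power_mult)
  have C: "CCr xi s = cosh (q * s)" for s
  proof -
    have "CC (of_real (xi ^ 4 - xi\<^sup>2)) s = of_real (cosh (q * s))"
      unfolding q_def using w0 by (simp add: CC_cosh csqrt_of_real_nonneg cosh_of_real_complex del: of_real_diff flip: of_real_mult)
    then show ?thesis by (simp add: CCr_def wz_of_real)
  qed
  have c1: "exp (q * s) / 2 <= cosh (q * s)" "cosh (q * s) <= exp (q * s)" if "0 <= s" for s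
  proof -
    have "exp (- (q * s)) <= exp (q * s)" using that q0 by simp
    then show "exp (q * s) / 2 <= cosh (q * s)" "cosh (q * s) <= exp (q * s)" by (simp_all add: cosh_field_def)
  qed
  have d: "DDr xi <= 3 * exp (q * (2 * L))"
  proof -
    have "1 <= exp (q * (2 * L))" using q0 L by simp
    then show ?thesis unfolding DDr_def C using c1(2)[of "2 * L"] L by linarith
  qed
  have "exp (- (xi\<^sup>2 * t)) / 6 <= exp (- (q * t)) / 6" using q t by (simp add: mult_right_mono)
  also have "exp (- (q * t)) / 6 = (exp (q * (2 * L - t)) / 2) / (3 * exp (q * (2 * L)))"
  proof -
    have "q * (2 * L - t) = - (q * t) + q * (2 * L)" by (simp add: algebra_simps)
    then have "exp (q * (2 * L - t)) = exp (- (q * t)) * exp (q * (2 * L))" by (simp only: exp_add)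
    then show ?thesis by simp
  qed
  also have "\<dots> <= (exp (q * (2 * L - t)) / 2) / DDr xi"
    using d DDr_pos[of xi] by (intro divide_left_mono) auto
  also have "\<dots> <= (CCr xi (2 * L - t) + 2 * CCr xi t) / DDr xi"
  proof (rule divide_right_mono)
    show "exp (q * (2 * L - t)) / 2 <= CCr xi (2 * L - t) + 2 * CCr xi t"
      unfolding C using c1(1)[of "2 * L - t"] t L cosh_real_ge_1[of "q * t"] by linarith
  qed (use DDr_pos[of xi] in simp)
  also have "\<dots> = EEr xi t" by (simp add: EEr_eq)
  finally show ?thesis .
qed

text \<open>For |xi| <= 1 the propagator oscillates and may change sign; a bound by a constant is
  enough, as these frequencies carry only bounded mass.\<close>

lemma EEr_abs_le:
  assumes hxi: "\<bar>xi\<bar> <= 1"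
  shows "\<bar>EEr xi t\<bar> <= 3"
proof -
  have w0: "xi ^ 4 - xi\<^sup>2 <= 0" using power_decreasing[of 2 4 "\<bar>xi\<bar>"] hxi by simp
  have C: "\<bar>CCr xi s\<bar> <= 1" for s
  proof -
    define q where "q = sqrt (- (xi ^ 4 - xi\<^sup>2))"
    have "CC (of_real (xi ^ 4 - xi\<^sup>2)) s = cosh (\<i> * of_real (q * s))"
      unfolding q_def using w0 by (simp add: CC_cosh csqrt_of_real_nonpos mult.assoc del: of_real_diff)
    then have "CC (of_real (xi ^ 4 - xi\<^sup>2)) s = of_real (cos (q * s))" unfolding cosh_i_real .
    then show ?thesis by (simp add: CCr_def wz_of_real)
  qed
  have "\<bar>EEr xi t\<bar> = \<bar>CCr xi (2 * L - t) + 2 * CCr xi t\<bar> / DDr xi" using DDr_pos[of xi] by (simp add: EEr_eq)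
  also have "\<dots> <= 3 / 1" using C[of "2 * L - t"] C[of t] DDr_pos[of xi] by (intro frac_le) auto
  finally show ?thesis by simp
qed

end

text \<open>Restriction to 1/(2 sqrt a) <= xi <= 1/sqrt a, where the exponential is at least
  exp(-1).\<close>

lemma gauss_lower:
  assumes a: "0 < a"
  shows "ennreal (exp (- 1) / 8 / sqrt a ^ 3) <= (\<integral>\<^sup>+xi. ennreal (xi\<^sup>2 * exp (- (xi\<^sup>2 * a))) \<partial>lborel)"
proof -
  define s where "s = sqrt a"
  have s: "0 < s" "a = s\<^sup>2" using a by (auto simp: s_def)
  have "ennreal (exp (- 1) / 8 / s ^ 3) = ennreal (1 / (4 * s\<^sup>2) * exp (- 1)) * ennreal (1 / s - 1 / (2 * s))"
    using s by (subst ennreal_mult[symmetric]) (auto simp: field_simps power2_eq_square power3_eq_cube)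
  also have "ennreal (1 / s - 1 / (2 * s)) = (\<integral>\<^sup>+xi. indicator {1 / (2 * s)..1 / s} xi \<partial>lborel)"
    using s by (simp add: frac_le)
  also have "ennreal (1 / (4 * s\<^sup>2) * exp (- 1)) * \<dots> = (\<integral>\<^sup>+xi. ennreal (1 / (4 * s\<^sup>2) * exp (- 1)) * indicator {1 / (2 * s)..1 / s} xi \<partial>lborel)"
    by (rule nn_integral_cmult[symmetric]) measurable
  also have "\<dots> <= (\<integral>\<^sup>+xi. ennreal (xi\<^sup>2 * exp (- (xi\<^sup>2 * a))) \<partial>lborel)"
  proof (intro nn_integral_mono)
    fix xi :: real
    show "ennreal (1 / (4 * s\<^sup>2) * exp (- 1)) * indicator {1 / (2 * s)..1 / s} xi <= ennreal (xi\<^sup>2 * exp (- (xi\<^sup>2 * a)))"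
    proof (cases "1 / (2 * s) <= xi \<and> xi <= 1 / s")
      case True
      have p: "0 < 1 / (2 * s)" using s by simp
      have x0: "0 < xi" using True p by linarith
      have 1: "(1 / (2 * s))\<^sup>2 <= xi\<^sup>2" using True p by (intro power_mono) auto
      have "xi\<^sup>2 <= (1 / s)\<^sup>2" using True x0 by (intro power_mono) auto
      then have 2: "xi\<^sup>2 * a <= 1" using s by (simp add: power_divide pos_le_divide_eq)
      have "1 / (4 * s\<^sup>2) * exp (- 1) <= xi\<^sup>2 * exp (- (xi\<^sup>2 * a))"
        using 1 2 by (intro mult_mono) (auto simp: power_divide power_mult_distrib)
      then show ?thesis using True by (simp add: ennreal_leI)
    qed auto
  qed
  finally show ?thesis by (simp add: s_def)
qed

section \<open>The linear solution generated by the profile\<close>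

locale profile_interval = profile + time_interval +
  assumes cL: "c <= L"
begin

lemma rho_integrable: "integrable lborel rho"
proof -
  obtain C where C: "C >= 0" "(\<integral>\<^sup>+y. ennreal (rho y * y powr 0) \<partial>lborel) <= ennreal C"
    using rho_powr_integral[of 0] delta by auto
  have "(\<integral>\<^sup>+y. ennreal (norm (rho y)) \<partial>lborel) = (\<integral>\<^sup>+y. ennreal (rho y * y powr 0) \<partial>lborel)"
    using rho_nonneg by (intro nn_integral_cong) (auto simp: rho_def)
  also have "\<dots> < \<infinity>" using C(2) le_less_trans ennreal_less_top by (metis infinity_ennreal_def)
  finally show ?thesis by (intro integrableI_bounded) auto
qed

definition R0 :: real where "R0 = (\<integral>y. rho y \<partial>lborel)"

lemma R0_nonneg: "0 <= R0" unfolding R0_def using rho_nonneg by simp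

definition A1 :: "real => real" where "A1 xi = xi\<^sup>2 * (\<integral>y. rho y * exp (- (y * xi\<^sup>2)) \<partial>lborel)"

lemma rho_exp_le: "0 <= u ==> rho y * exp (- (y * u)) <= rho y"
proof (cases "0 < y")
  case True
  then show "0 <= u ==> rho y * exp (- (y * u)) <= rho y" by (intro mult_left_le rho_nonneg) simp
qed (simp add: rho_def)

lemma rho_exp_integrable: "integrable lborel (\<lambda>y. rho y * exp (- (y * xi\<^sup>2)))"
  by (rule Bochner_Integration.integrable_bound[OF rho_integrable]) (use rho_exp_le rho_nonneg in auto)

lemma A1_nonneg: "0 <= A1 xi" unfolding A1_def using rho_nonneg by simp

lemma A1_le: "A1 xi <= xi\<^sup>2 * R0"
  unfolding A1_def R0_def by (intro mult_left_mono integral_mono rho_exp_integrable rho_integrable rho_exp_le) auto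

lemma A1_cont: "continuous_on UNIV A1"
proof -
  have "continuous_on UNIV (\<lambda>xi::real. (\<integral>y. rho y * exp (- (y * xi\<^sup>2)) \<partial>lborel))"
    unfolding continuous_on_eq_continuous_at[OF open_UNIV] continuous_at_sequentially o_def
  proof (intro ballI allI impI)
    fix x :: real and u :: "nat => real" assume u: "u \<longlonglongrightarrow> x"
    show "(\<lambda>n. \<integral>y. rho y * exp (- (y * (u n)\<^sup>2)) \<partial>lborel) \<longlonglongrightarrow> (\<integral>y. rho y * exp (- (y * x\<^sup>2)) \<partial>lborel)"
    proof (rule integral_dominated_convergence[where w = rho])
      show "AE y in lborel. (\<lambda>n. rho y * exp (- (y * (u n)\<^sup>2))) \<longlonglongrightarrow> rho y * exp (- (y * x\<^sup>2))"
        by (intro AE_I2 tendsto_intros u)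
      show "AE y in lborel. norm (rho y * exp (- (y * (u n)\<^sup>2))) <= rho y" for n
        using rho_exp_le rho_nonneg by (auto simp: abs_mult)
    qed (use rho_integrable in auto)
  qed
  then show ?thesis unfolding A1_def[abs_def] by (intro continuous_intros)
qed

lemma A1_measurable [measurable]: "A1 \<in> borel_measurable borel"
  using A1_cont by (rule borel_measurable_continuous_onI)

lemma pro_rho_integrable: "integrable lborel (\<lambda>y. pro y t xi * rho y)"
proof (rule Bochner_Integration.integrable_cong[THEN iffD1, OF refl])
  show "integrable lborel (\<lambda>y. (xi\<^sup>2 * EEr xi t) * (rho y * exp (- (y * xi\<^sup>2))))"
    by (rule integrable_mult_right[OF rho_exp_integrable])
qed (simp add: pro_def mult_ac)

lemma A1_EEr: "A1 xi * EEr xi t = (\<integral>y. pro y t xi * rho y \<partial>lborel)"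
proof -
  have "(\<integral>y. pro y t xi * rho y \<partial>lborel) = (\<integral>y. (xi\<^sup>2 * EEr xi t) * (rho y * exp (- (y * xi\<^sup>2))) \<partial>lborel)"
    by (intro Bochner_Integration.integral_cong refl) (simp add: pro_def mult_ac)
  also have "\<dots> = (xi\<^sup>2 * EEr xi t) * (\<integral>y. rho y * exp (- (y * xi\<^sup>2)) \<partial>lborel)"
    by simp
  finally show ?thesis by (simp add: A1_def)
qed

text \<open>Here m counts the powers of |xi| left after n differences, each of which removes one
  from 1 + xi^2. On a Gaussian of width (y+tau)^(-1/2) a power of |xi| costs (y+tau)^(-1/2), so m =
  2 - n lowers the singular exponent from 3/2 to 1 and to 1/2.\<close>

lemma A1_EEr_diff:
  assumes m: "m <= 2" "2 <= n + m"
  shows "\<exists>C h0. 0 < C \<and> 0 < h0 \<and> (\<forall>h xi tau. 0 < h \<and> h <= h0 \<and> 0 < tau \<and> tau < L -->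
     ennreal (\<bar>(fd h ^^ n) (\<lambda>xi. A1 xi * EEr xi tau) xi\<bar> * exp (tau * \<bar>xi\<bar>)) <=
     (\<integral>\<^sup>+y. ennreal (C * h ^ n) * (ennreal (rho y / sqrt (y + tau) ^ (m + 1)) * ennreal (qq ((y + tau) / 4) xi)) \<partial>lborel))"
proof -
  obtain C h0 where C: "0 < C" "0 < h0" and p: "\<forall>h xi y t. 0 < h \<and> h <= h0 \<and> 0 <= y \<and> y <= 1 \<and> 0 <= t \<and> t <= L -->
     \<bar>(fd h ^^ n) (pro y t) xi\<bar> <= C * (h / (1 + \<bar>xi\<bar>)) ^ n * ((1 + xi\<^sup>2) * exp (- (xi\<^sup>2 * (y + t) / 2)))"
    using pro_diff[of n] by - (elim exE conjE, rule that)
  define R where "R = (1 + L) / 4"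
  define D where "D = C * exp L * (8 * (1 + sqrt R)\<^sup>2 * 2 ^ (m + 1))"
  have "0 < 1 + sqrt R" using L by (simp add: R_def add_pos_nonneg)
  then have D: "0 < D" using C by (simp add: D_def)
  have "ennreal (\<bar>(fd h ^^ n) (\<lambda>xi. A1 xi * EEr xi tau) xi\<bar> * exp (tau * \<bar>xi\<bar>)) <=
     (\<integral>\<^sup>+y. ennreal (D * h ^ n) * (ennreal (rho y / sqrt (y + tau) ^ (m + 1)) * ennreal (qq ((y + tau) / 4) xi)) \<partial>lborel)"
    if h: "0 < h" "h <= h0" and t: "0 < tau" "tau < L" for h xi tau
  proof -
    have Dh: "0 <= D * h ^ n" using D h by simp
    have e: "(fd h ^^ n) (\<lambda>xi. A1 xi * EEr xi tau) xi = (\<integral>y. (fd h ^^ n) (pro y tau) xi * rho y \<partial>lborel)"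
      unfolding A1_EEr using fd_iter_integral(2)[where f = "\<lambda>xi y. pro y tau xi * rho y" and n = n and h = h and x = xi, OF pro_rho_integrable] by (simp add: fd_iter_multc)
    have i: "integrable lborel (\<lambda>y. (fd h ^^ n) (pro y tau) xi * rho y)"
      using fd_iter_integral(1)[where f = "\<lambda>xi y. pro y tau xi * rho y" and n = n and h = h and x = xi, OF pro_rho_integrable] by (simp add: fd_iter_multc)
    have [measurable]: "(\<lambda>y. (fd h ^^ n) (pro y tau) xi * rho y) \<in> borel_measurable borel" using borel_measurable_integrable[OF i] by simp
    have "ennreal (\<bar>(fd h ^^ n) (\<lambda>xi. A1 xi * EEr xi tau) xi\<bar> * exp (tau * \<bar>xi\<bar>)) =
      ennreal (exp (tau * \<bar>xi\<bar>)) * ennreal \<bar>\<integral>y. (fd h ^^ n) (pro y tau) xi * rho y \<partial>lborel\<bar>"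
      unfolding e by (simp add: ennreal_mult mult.commute)
    also have "\<dots> <= ennreal (exp (tau * \<bar>xi\<bar>)) * (\<integral>\<^sup>+y. ennreal \<bar>(fd h ^^ n) (pro y tau) xi * rho y\<bar> \<partial>lborel)"
      by (intro mult_left_mono ennreal_abs_integral_le) simp
    also have "\<dots> = (\<integral>\<^sup>+y. ennreal (exp (tau * \<bar>xi\<bar>)) * ennreal \<bar>(fd h ^^ n) (pro y tau) xi * rho y\<bar> \<partial>lborel)"
      by (rule nn_integral_cmult[symmetric]) measurable
    also have "\<dots> <= (\<integral>\<^sup>+y. ennreal (D * h ^ n) * (ennreal (rho y / sqrt (y + tau) ^ (m + 1)) * ennreal (qq ((y + tau) / 4) xi)) \<partial>lborel)"
    proof (intro nn_integral_mono)
      fix y :: real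
      show "ennreal (exp (tau * \<bar>xi\<bar>)) * ennreal \<bar>(fd h ^^ n) (pro y tau) xi * rho y\<bar> <=
        ennreal (D * h ^ n) * (ennreal (rho y / sqrt (y + tau) ^ (m + 1)) * ennreal (qq ((y + tau) / 4) xi))"
      proof (cases "0 < y \<and> y <= c")
        case True
        define a where "a = (y + tau) / 4"
        have a: "0 < a" "a <= R" using True t c by (auto simp: a_def R_def)
        have sa: "sqrt (y + tau) = 2 * sqrt a"
        proof -
          have "y + tau = 4 * a" by (simp add: a_def)
          then have "sqrt (y + tau) = sqrt 4 * sqrt a" by (simp only: real_sqrt_mult)
          then show ?thesis by simp
        qed
        have "exp (tau * \<bar>xi\<bar>) * exp (- (xi\<^sup>2 * (y + tau) / 2)) <= exp L * exp (- (xi\<^sup>2 * a))"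
        proof -
          have "0 <= (\<bar>xi\<bar> / 2 - 1)\<^sup>2" by simp
          then have "\<bar>xi\<bar> <= 1 + xi\<^sup>2 / 4" by (simp add: power2_diff power_divide)
          then have "tau * \<bar>xi\<bar> <= tau * (1 + xi\<^sup>2 / 4)" using t by (intro mult_left_mono) auto
          also have "\<dots> = tau + xi\<^sup>2 * tau / 4" by (simp add: algebra_simps)
          also have "xi\<^sup>2 * (y + tau) / 2 = xi\<^sup>2 * a + xi\<^sup>2 * y / 4 + xi\<^sup>2 * tau / 4" by (simp add: a_def field_simps)
          moreover have "0 <= xi\<^sup>2 * y / 4" using True by simp
          ultimately have "tau * \<bar>xi\<bar> + - (xi\<^sup>2 * (y + tau) / 2) <= L + - (xi\<^sup>2 * a)" using t by linarith
          then show ?thesis by (simp only: exp_add[symmetric] exp_le_cancel_iff)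
        qed
        moreover have "(1 + xi\<^sup>2) / (1 + \<bar>xi\<bar>) ^ n <= (1 + \<bar>xi\<bar>) ^ m"
        proof -
          have "1 + xi\<^sup>2 <= (1 + \<bar>xi\<bar>)\<^sup>2" by (simp add: power2_sum)
          also have "\<dots> <= (1 + \<bar>xi\<bar>) ^ (n + m)" by (rule power_increasing) (use m in auto)
          finally have "1 + xi\<^sup>2 <= (1 + \<bar>xi\<bar>) ^ m * (1 + \<bar>xi\<bar>) ^ n" by (simp add: power_add mult.commute)
          then show ?thesis by (subst pos_divide_le_eq) auto
        qed
        ultimately have "(exp (tau * \<bar>xi\<bar>) * exp (- (xi\<^sup>2 * (y + tau) / 2))) * ((1 + xi\<^sup>2) / (1 + \<bar>xi\<bar>) ^ n) <= (exp L * exp (- (xi\<^sup>2 * a))) * (1 + \<bar>xi\<bar>) ^ m"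
          by (rule mult_mono) auto
        also have "\<dots> = exp L * ((1 + \<bar>xi\<bar>) ^ m * exp (- (xi\<^sup>2 * a)))" by (simp only: mult_ac)
        also have "\<dots> <= exp L * (8 * (1 + sqrt R)\<^sup>2 / sqrt a ^ (m + 1) * qq a xi)"
          by (intro mult_left_mono gauss_qq a m) auto
        finally have 1: "(exp (tau * \<bar>xi\<bar>) * exp (- (xi\<^sup>2 * (y + tau) / 2))) * ((1 + xi\<^sup>2) / (1 + \<bar>xi\<bar>) ^ n) <= exp L * (8 * (1 + sqrt R)\<^sup>2 / sqrt a ^ (m + 1) * qq a xi)" .
        have "\<bar>(fd h ^^ n) (pro y tau) xi\<bar> <= C * (h / (1 + \<bar>xi\<bar>)) ^ n * ((1 + xi\<^sup>2) * exp (- (xi\<^sup>2 * (y + tau) / 2)))"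
          by (rule p[THEN spec, THEN spec, THEN spec, THEN spec, THEN mp]) (use True h t c in auto)
        then have "exp (tau * \<bar>xi\<bar>) * \<bar>(fd h ^^ n) (pro y tau) xi\<bar> <= exp (tau * \<bar>xi\<bar>) * (C * (h / (1 + \<bar>xi\<bar>)) ^ n * ((1 + xi\<^sup>2) * exp (- (xi\<^sup>2 * (y + tau) / 2))))"
          by (intro mult_left_mono) auto
        also have "\<dots> = C * h ^ n * ((exp (tau * \<bar>xi\<bar>) * exp (- (xi\<^sup>2 * (y + tau) / 2))) * ((1 + xi\<^sup>2) / (1 + \<bar>xi\<bar>) ^ n))"
          by (simp add: power_divide)
        also have "\<dots> <= C * h ^ n * (exp L * (8 * (1 + sqrt R)\<^sup>2 / sqrt a ^ (m + 1) * qq a xi))"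
          using C h 1 by (intro mult_left_mono) auto
        also have "\<dots> = D * h ^ n * (1 / sqrt (y + tau) ^ (m + 1) * qq a xi)"
          unfolding sa D_def power_mult_distrib by simp
        finally have "exp (tau * \<bar>xi\<bar>) * \<bar>(fd h ^^ n) (pro y tau) xi\<bar> * rho y <= D * h ^ n * (1 / sqrt (y + tau) ^ (m + 1) * qq a xi) * rho y"
          using rho_nonneg by (intro mult_right_mono) auto
        then have 2: "exp (tau * \<bar>xi\<bar>) * \<bar>(fd h ^^ n) (pro y tau) xi * rho y\<bar> <= (D * h ^ n) * ((rho y / sqrt (y + tau) ^ (m + 1)) * qq a xi)"
          using rho_nonneg[of y] by (simp add: abs_mult mult_ac)
        have n: "0 <= rho y / sqrt (y + tau) ^ (m + 1)" "0 <= qq a xi" using rho_nonneg[of y] a True t qq_nonneg[of a xi] by auto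
        have "ennreal (exp (tau * \<bar>xi\<bar>)) * ennreal \<bar>(fd h ^^ n) (pro y tau) xi * rho y\<bar> = ennreal (exp (tau * \<bar>xi\<bar>) * \<bar>(fd h ^^ n) (pro y tau) xi * rho y\<bar>)"
          by (rule ennreal_mult[symmetric]) auto
        also have "\<dots> <= ennreal ((D * h ^ n) * ((rho y / sqrt (y + tau) ^ (m + 1)) * qq a xi))" by (rule ennreal_leI[OF 2])
        also have "\<dots> = ennreal (D * h ^ n) * (ennreal (rho y / sqrt (y + tau) ^ (m + 1)) * ennreal (qq a xi))"
          by (simp only: ennreal_mult[OF Dh mult_nonneg_nonneg[OF n]] ennreal_mult[OF n])
        finally show ?thesis by (simp only: a_def)
      qed (auto simp: rho_def)
    qed
    finally show ?thesis .
  qed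
  then show ?thesis using D C(2) by blast
qed

end

context profile_interval
begin

text \<open>Tonelli; the Lorentzian integrates to at most pi whatever y and tau, so only the
  integral over y is left.\<close>

lemma A1_EEr_integral:
  assumes m: "m <= 2" "2 <= n + m"
  shows "\<exists>C h0. 0 < C \<and> 0 < h0 \<and> (\<forall>h tau. 0 < h \<and> h <= h0 \<and> 0 < tau \<and> tau < L -->
     (\<integral>\<^sup>+xi. ennreal (\<bar>(fd h ^^ n) (\<lambda>xi. A1 xi * EEr xi tau) xi\<bar> * exp (tau * \<bar>xi\<bar>)) \<partial>lborel) <=
     ennreal (C * h ^ n) * (\<integral>\<^sup>+y. ennreal (rho y / sqrt (y + tau) ^ (m + 1)) \<partial>lborel))"
proof -
  obtain C h0 where C: "0 < C" "0 < h0" and d: "\<forall>h xi tau. 0 < h \<and> h <= h0 \<and> 0 < tau \<and> tau < L -->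
     ennreal (\<bar>(fd h ^^ n) (\<lambda>xi. A1 xi * EEr xi tau) xi\<bar> * exp (tau * \<bar>xi\<bar>)) <=
     (\<integral>\<^sup>+y. ennreal (C * h ^ n) * (ennreal (rho y / sqrt (y + tau) ^ (m + 1)) * ennreal (qq ((y + tau) / 4) xi)) \<partial>lborel)"
    using A1_EEr_diff[OF m] by - (elim exE conjE, rule that)
  have "(\<integral>\<^sup>+xi. ennreal (\<bar>(fd h ^^ n) (\<lambda>xi. A1 xi * EEr xi tau) xi\<bar> * exp (tau * \<bar>xi\<bar>)) \<partial>lborel) <=
     ennreal (C * pi * h ^ n) * (\<integral>\<^sup>+y. ennreal (rho y / sqrt (y + tau) ^ (m + 1)) \<partial>lborel)"
    if h: "0 < h" "h <= h0" and t: "0 < tau" "tau < L" for h tau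
  proof -
    have "(\<integral>\<^sup>+xi. ennreal (\<bar>(fd h ^^ n) (\<lambda>xi. A1 xi * EEr xi tau) xi\<bar> * exp (tau * \<bar>xi\<bar>)) \<partial>lborel) <=
      (\<integral>\<^sup>+xi. \<integral>\<^sup>+y. ennreal (C * h ^ n) * (ennreal (rho y / sqrt (y + tau) ^ (m + 1)) * ennreal (qq ((y + tau) / 4) xi)) \<partial>lborel \<partial>lborel)"
      by (intro nn_integral_mono d[THEN spec, THEN spec, THEN spec, THEN mp]) (use h t in simp)
    also have "\<dots> = (\<integral>\<^sup>+y. \<integral>\<^sup>+xi. ennreal (C * h ^ n) * (ennreal (rho y / sqrt (y + tau) ^ (m + 1)) * ennreal (qq ((y + tau) / 4) xi)) \<partial>lborel \<partial>lborel)"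
      by (rule lborel_pair.Fubini') measurable
    also have "\<dots> = (\<integral>\<^sup>+y. ennreal (C * h ^ n) * (ennreal (rho y / sqrt (y + tau) ^ (m + 1)) * (\<integral>\<^sup>+xi. ennreal (qq ((y + tau) / 4) xi) \<partial>lborel)) \<partial>lborel)"
      by (intro nn_integral_cong, subst nn_integral_cmult, measurable, subst nn_integral_cmult, measurable)
    also have "\<dots> <= (\<integral>\<^sup>+y. ennreal (C * pi * h ^ n) * ennreal (rho y / sqrt (y + tau) ^ (m + 1)) \<partial>lborel)"
    proof (intro nn_integral_mono)
      fix y :: real
      show "ennreal (C * h ^ n) * (ennreal (rho y / sqrt (y + tau) ^ (m + 1)) * (\<integral>\<^sup>+xi. ennreal (qq ((y + tau) / 4) xi) \<partial>lborel)) <=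
        ennreal (C * pi * h ^ n) * ennreal (rho y / sqrt (y + tau) ^ (m + 1))"
      proof (cases "0 < y")
        case True
        then have "ennreal (C * h ^ n) * (ennreal (rho y / sqrt (y + tau) ^ (m + 1)) * (\<integral>\<^sup>+xi. ennreal (qq ((y + tau) / 4) xi) \<partial>lborel)) <=
          ennreal (C * h ^ n) * (ennreal (rho y / sqrt (y + tau) ^ (m + 1)) * ennreal pi)"
          using t by (intro mult_left_mono qq_integral) auto
        also have "\<dots> = ennreal (C * h ^ n) * ennreal pi * ennreal (rho y / sqrt (y + tau) ^ (m + 1))" by (simp only: mult_ac)
        also have "ennreal (C * h ^ n) * ennreal pi = ennreal (C * pi * h ^ n)"
          using C h by (subst ennreal_mult[symmetric]) (auto simp: mult_ac)
        finally show ?thesis .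
      qed (simp add: rho_def)
    qed
    also have "\<dots> = ennreal (C * pi * h ^ n) * (\<integral>\<^sup>+y. ennreal (rho y / sqrt (y + tau) ^ (m + 1)) \<partial>lborel)"
      by (rule nn_integral_cmult) measurable
    finally show ?thesis .
  qed
  then show ?thesis using C pi_gt_zero by (rule_tac exI[of _ "C * pi"], rule_tac exI[of _ h0]) auto
qed

lemma A1_EEr_bound:
  "\<exists>C>0. \<forall>tau. 0 < tau \<and> tau < L --> (\<forall>xi. \<bar>A1 xi * EEr xi tau\<bar> * exp (tau * \<bar>xi\<bar>) <= C * bb tau) \<and>
     (\<integral>\<^sup>+xi. ennreal (\<bar>A1 xi * EEr xi tau\<bar> * exp (tau * \<bar>xi\<bar>)) \<partial>lborel) <= ennreal (C * bb tau)"
proof -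
  have m: "(2::nat) <= 2" "2 <= 0 + (2::nat)" by auto
  obtain C1 h1 where C1: "0 < C1" "0 < h1" and 1: "\<forall>h tau. 0 < h \<and> h <= h1 \<and> 0 < tau \<and> tau < L -->
     (\<integral>\<^sup>+xi. ennreal (\<bar>(fd h ^^ 0) (\<lambda>xi. A1 xi * EEr xi tau) xi\<bar> * exp (tau * \<bar>xi\<bar>)) \<partial>lborel) <=
     ennreal (C1 * h ^ 0) * (\<integral>\<^sup>+y. ennreal (rho y / sqrt (y + tau) ^ (2 + 1)) \<partial>lborel)"
    using A1_EEr_integral[OF m] by - (elim exE conjE, rule that)
  obtain C2 h2 where C2: "0 < C2" "0 < h2" and 2: "\<forall>h xi tau. 0 < h \<and> h <= h2 \<and> 0 < tau \<and> tau < L -->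
     ennreal (\<bar>(fd h ^^ 0) (\<lambda>xi. A1 xi * EEr xi tau) xi\<bar> * exp (tau * \<bar>xi\<bar>)) <=
     (\<integral>\<^sup>+y. ennreal (C2 * h ^ 0) * (ennreal (rho y / sqrt (y + tau) ^ (2 + 1)) * ennreal (qq ((y + tau) / 4) xi)) \<partial>lborel)"
    using A1_EEr_diff[OF m] by - (elim exE conjE, rule that)
  define R where "R = sqrt ((1 + L) / 4)"
  have R: "0 < R" using L by (simp add: R_def)
  define C where "C = C1 + C2 * R"
  have C: "0 < C" using C1 C2 R by (simp add: C_def add_pos_pos)
  have *: "(\<forall>xi. \<bar>A1 xi * EEr xi tau\<bar> * exp (tau * \<bar>xi\<bar>) <= C * bb tau) \<and>
     (\<integral>\<^sup>+xi. ennreal (\<bar>A1 xi * EEr xi tau\<bar> * exp (tau * \<bar>xi\<bar>)) \<partial>lborel) <= ennreal (C * bb tau)" if t: "0 < tau" "tau < L" for tau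
  proof (intro conjI allI)
    have b: "0 < bb tau" by (rule bb_pos[OF t(1)])
    have "(\<integral>\<^sup>+xi. ennreal (\<bar>A1 xi * EEr xi tau\<bar> * exp (tau * \<bar>xi\<bar>)) \<partial>lborel) <= ennreal C1 * I0 tau"
      using 1[THEN spec, THEN spec, THEN mp, of h1 tau] C1 t by (simp add: I0_def)
    also have "\<dots> = ennreal (C1 * bb tau)" using C1 b by (simp add: ennreal_bb[OF t(1), symmetric] ennreal_mult)
    also have "\<dots> <= ennreal (C * bb tau)" using C2 R b by (intro ennreal_leI mult_right_mono) (auto simp: C_def)
    finally show "(\<integral>\<^sup>+xi. ennreal (\<bar>A1 xi * EEr xi tau\<bar> * exp (tau * \<bar>xi\<bar>)) \<partial>lborel) <= ennreal (C * bb tau)" .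
    fix xi :: real
    have "ennreal (\<bar>A1 xi * EEr xi tau\<bar> * exp (tau * \<bar>xi\<bar>)) <= (\<integral>\<^sup>+y. ennreal C2 * (ennreal (rho y / sqrt (y + tau) ^ 3) * ennreal (qq ((y + tau) / 4) xi)) \<partial>lborel)"
      using 2[THEN spec, THEN spec, THEN spec, THEN mp, of h2 tau xi] C2 t by simp
    also have "\<dots> <= (\<integral>\<^sup>+y. ennreal (C2 * R) * ennreal (rho y / sqrt (y + tau) ^ 3) \<partial>lborel)"
    proof (intro nn_integral_mono)
      fix y :: real
      show "ennreal C2 * (ennreal (rho y / sqrt (y + tau) ^ 3) * ennreal (qq ((y + tau) / 4) xi)) <= ennreal (C2 * R) * ennreal (rho y / sqrt (y + tau) ^ 3)"
      proof (cases "0 < y \<and> y <= c")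
        case True
        have "qq ((y + tau) / 4) xi <= sqrt ((y + tau) / 4)" using True t by (intro qq_le) auto
        also have "\<dots> <= R" unfolding R_def using True t c by (intro real_sqrt_le_mono) auto
        finally have "ennreal C2 * (ennreal (rho y / sqrt (y + tau) ^ 3) * ennreal (qq ((y + tau) / 4) xi)) <= ennreal C2 * (ennreal (rho y / sqrt (y + tau) ^ 3) * ennreal R)"
          by (intro mult_left_mono ennreal_leI) auto
        also have "\<dots> = ennreal C2 * ennreal R * ennreal (rho y / sqrt (y + tau) ^ 3)" by (simp only: mult_ac)
        also have "ennreal C2 * ennreal R = ennreal (C2 * R)" using C2 R by (simp add: ennreal_mult)
        finally show ?thesis .
      qed (auto simp: rho_def)
    qed
    also have "\<dots> = ennreal (C2 * R) * I0 tau" unfolding I0_def by (rule nn_integral_cmult) measurable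
    also have "\<dots> = ennreal (C2 * R * bb tau)" using C2 R b by (simp add: ennreal_bb[OF t(1), symmetric] ennreal_mult)
    also have "\<dots> <= ennreal (C * bb tau)" using C1 b by (intro ennreal_leI mult_right_mono) (auto simp: C_def)
    finally show "\<bar>A1 xi * EEr xi tau\<bar> * exp (tau * \<bar>xi\<bar>) <= C * bb tau" using C b by (simp add: ennreal_le_iff)
  qed
  show ?thesis by (intro exI[of _ C] conjI C allI impI) (use * in blast)+
qed

lemma n1_A1_EEr:
  assumes m: "m <= 2" "2 <= n + m" and \<kappa>: "\<bar>\<kappa>\<bar> <= 1" and g: "0 <= G"
    and I: "\<And>tau. 0 < tau ==> tau < L ==> (\<integral>\<^sup>+y. ennreal (rho y / sqrt (y + tau) ^ (m + 1)) \<partial>lborel) <= ennreal (G * w tau) \<and> 0 <= w tau"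
  shows "\<exists>C h0. 0 <= C \<and> 0 < h0 \<and> (\<forall>h tau. 0 < h \<and> h <= h0 \<and> 0 < tau \<and> tau < L -->
     n1 ((fd h ^^ n) (\<lambda>xi. \<kappa> * A1 xi * EEr xi tau)) <= ennreal (C * h ^ n * w tau))"
proof -
  obtain C h0 where C: "0 < C" "0 < h0" and 1: "\<forall>h tau. 0 < h \<and> h <= h0 \<and> 0 < tau \<and> tau < L -->
     (\<integral>\<^sup>+xi. ennreal (\<bar>(fd h ^^ n) (\<lambda>xi. A1 xi * EEr xi tau) xi\<bar> * exp (tau * \<bar>xi\<bar>)) \<partial>lborel) <=
     ennreal (C * h ^ n) * (\<integral>\<^sup>+y. ennreal (rho y / sqrt (y + tau) ^ (m + 1)) \<partial>lborel)"
    using A1_EEr_integral[OF m] by - (elim exE conjE, rule that)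
  have "n1 ((fd h ^^ n) (\<lambda>xi. \<kappa> * A1 xi * EEr xi tau)) <= ennreal (C * G * h ^ n * w tau)"
    if h: "0 < h" "h <= h0" and t: "0 < tau" "tau < L" for h tau
  proof -
    have e: "(fd h ^^ n) (\<lambda>xi. \<kappa> * A1 xi * EEr xi tau) xi = (fd h ^^ n) (\<lambda>xi. A1 xi * EEr xi tau) xi * \<kappa>" for xi
      using fd_iter_multc[of n h "\<lambda>xi. A1 xi * EEr xi tau" \<kappa> xi] by (simp add: mult_ac)
    have "n1 ((fd h ^^ n) (\<lambda>xi. \<kappa> * A1 xi * EEr xi tau)) <= (\<integral>\<^sup>+xi. ennreal (\<bar>(fd h ^^ n) (\<lambda>xi. A1 xi * EEr xi tau) xi\<bar> * exp (tau * \<bar>xi\<bar>)) \<partial>lborel)"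
      unfolding n1_def e abs_mult
    proof (intro nn_integral_mono ennreal_leI mult_left_mono)
      fix xi :: real
      have "1 <= exp (tau * \<bar>xi\<bar>)" using t by simp
      then show "\<bar>\<kappa>\<bar> <= exp (tau * \<bar>xi\<bar>)" using \<kappa> by linarith
    qed simp
    also have "\<dots> <= ennreal (C * h ^ n) * (\<integral>\<^sup>+y. ennreal (rho y / sqrt (y + tau) ^ (m + 1)) \<partial>lborel)"
      by (rule 1[THEN spec, THEN spec, THEN mp]) (use h t in simp)
    also have "\<dots> <= ennreal (C * h ^ n) * ennreal (G * w tau)" using I[OF t] by (intro mult_left_mono) auto
    also have "\<dots> = ennreal (C * G * h ^ n * w tau)" using C h g I[OF t] by (subst ennreal_mult[symmetric]) (auto simp: mult_ac)
    finally show ?thesis .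
  qed
  then show ?thesis using C g by (rule_tac exI[of _ "C * G"], rule_tac exI[of _ h0]) auto
qed

lemma n1_A1_EEr_n:
  assumes \<kappa>: "\<bar>\<kappa>\<bar> <= 1"
  shows "\<exists>C h0. 0 <= C \<and> 0 < h0 \<and> (\<forall>h tau. 0 < h \<and> h <= h0 \<and> 0 < tau \<and> tau < L -->
     n1 ((fd h ^^ n) (\<lambda>xi. \<kappa> * A1 xi * EEr xi tau)) <= ennreal (C * h ^ n * bb tau))"
proof (rule n1_A1_EEr[where m = 2 and G = 1])
  fix tau assume t: "0 < tau" "tau < L"
  show "(\<integral>\<^sup>+y. ennreal (rho y / sqrt (y + tau) ^ (2 + 1)) \<partial>lborel) <= ennreal (1 * bb tau) \<and> 0 <= bb tau"
    using ennreal_bb[OF t(1)] bb_pos[OF t(1)] by (simp add: I0_def)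
qed (use \<kappa> in auto)

text \<open>With m = 1 the singular factor is (y+tau)^(-1) <= y^(\<gamma>-1) tau^(-\<gamma>), and
  rho(y) y^(\<gamma>-1) is integrable because \<gamma> > \<delta> - 1/2. So \<gamma> = 0 is
  available exactly when \<delta> < 1/2, the origin of the case distinction in the spatial
  bounds.\<close>

lemma n1_A1_EEr_1:
  assumes \<kappa>: "\<bar>\<kappa>\<bar> <= 1" and \<gamma>: "0 <= \<gamma>" "\<gamma> <= 1" "\<delta> - 1/2 < \<gamma>"
  shows "\<exists>C h0. 0 <= C \<and> 0 < h0 \<and> (\<forall>h tau. 0 < h \<and> h <= h0 \<and> 0 < tau \<and> tau < L -->
     n1 ((fd h ^^ 1) (\<lambda>xi. \<kappa> * A1 xi * EEr xi tau)) <= ennreal (C * h ^ 1 * tau powr (- \<gamma>)))"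
proof -
  obtain G where G: "G >= 0" "(\<integral>\<^sup>+y. ennreal (rho y * y powr (\<gamma> - 1)) \<partial>lborel) <= ennreal G"
    using rho_powr_integral[of "\<gamma> - 1"] \<gamma> by auto
  show ?thesis
  proof (rule n1_A1_EEr[where m = 1 and G = G])
    fix tau assume t: "0 < tau" "tau < L"
    have "(\<integral>\<^sup>+y. ennreal (rho y / sqrt (y + tau) ^ (1 + 1)) \<partial>lborel) <= (\<integral>\<^sup>+y. ennreal (rho y * y powr (\<gamma> - 1)) * ennreal (tau powr (- \<gamma>)) \<partial>lborel)"
    proof (intro nn_integral_mono)
      fix y :: real
      show "ennreal (rho y / sqrt (y + tau) ^ (1 + 1)) <= ennreal (rho y * y powr (\<gamma> - 1)) * ennreal (tau powr (- \<gamma>))"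
      proof (cases "0 < y")
        case True
        have "rho y / sqrt (y + tau) ^ (1 + 1) = rho y * ((y + tau) powr (\<gamma> - 1) * (y + tau) powr (- \<gamma>))"
        proof -
          have "(y + tau) powr (\<gamma> - 1) * (y + tau) powr (- \<gamma>) = (y + tau) powr (- 1)"
            by (simp only: powr_add[symmetric]) simp
          then show ?thesis using True t by (simp only:) (simp add: powr_neg_one)
        qed
        also have "\<dots> <= rho y * (y powr (\<gamma> - 1) * tau powr (- \<gamma>))"
          using True t \<gamma> rho_nonneg by (intro mult_left_mono mult_mono powr_mono2') auto
        finally have "ennreal (rho y / sqrt (y + tau) ^ (1 + 1)) <= ennreal (rho y * y powr (\<gamma> - 1) * tau powr (- \<gamma>))"
          by (intro ennreal_leI) (simp add: mult.assoc)
        also have "\<dots> = ennreal (rho y * y powr (\<gamma> - 1)) * ennreal (tau powr (- \<gamma>))" by (rule ennreal_mult'') simp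
        finally show ?thesis .
      qed (simp add: rho_def)
    qed
    also have "\<dots> = (\<integral>\<^sup>+y. ennreal (rho y * y powr (\<gamma> - 1)) \<partial>lborel) * ennreal (tau powr (- \<gamma>))" by (rule nn_integral_multc) measurable
    also have "\<dots> <= ennreal G * ennreal (tau powr (- \<gamma>))" using G(2) by (intro mult_right_mono) auto
    also have "\<dots> = ennreal (G * tau powr (- \<gamma>))" by (rule ennreal_mult''[symmetric]) simp
    finally show "(\<integral>\<^sup>+y. ennreal (rho y / sqrt (y + tau) ^ (1 + 1)) \<partial>lborel) <= ennreal (G * tau powr (- \<gamma>)) \<and> 0 <= tau powr (- \<gamma>)" by simp
  qed (use \<kappa> G in auto)
qed

text \<open>With m = 0 the factor is (y+tau)^(-1/2) <= y^(-1/2), against which rho is integrable for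
  every \<delta> < 1: two differences are bounded uniformly in tau.\<close>

lemma n1_A1_EEr_2:
  assumes \<kappa>: "\<bar>\<kappa>\<bar> <= 1"
  shows "\<exists>C h0. 0 <= C \<and> 0 < h0 \<and> (\<forall>h tau. 0 < h \<and> h <= h0 \<and> 0 < tau \<and> tau < L -->
     n1 ((fd h ^^ 2) (\<lambda>xi. \<kappa> * A1 xi * EEr xi tau)) <= ennreal (C * h ^ 2 * 1))"
proof -
  obtain G where G: "G >= 0" "(\<integral>\<^sup>+y. ennreal (rho y * y powr (- (1/2))) \<partial>lborel) <= ennreal G"
    using rho_powr_integral[of "- (1/2)"] delta by auto
  show ?thesis
  proof (rule n1_A1_EEr[where m = 0 and G = G])
    fix tau assume t: "0 < tau" "tau < L"
    have "(\<integral>\<^sup>+y. ennreal (rho y / sqrt (y + tau) ^ (0 + 1)) \<partial>lborel) <= (\<integral>\<^sup>+y. ennreal (rho y * y powr (- (1/2))) \<partial>lborel)"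
    proof (intro nn_integral_mono ennreal_leI)
      fix y :: real
      show "rho y / sqrt (y + tau) ^ (0 + 1) <= rho y * y powr (- (1/2))"
      proof (cases "0 < y")
        case True
        have "rho y / sqrt (y + tau) ^ (0 + 1) <= rho y / sqrt y" using True t rho_nonneg[of y] by (simp add: divide_left_mono)
        also have "\<dots> = rho y * y powr (- (1/2))" using True by (simp add: powr_minus_divide powr_half_sqrt)
        finally show ?thesis .
      qed (simp add: rho_def)
    qed
    also have "\<dots> <= ennreal (G * 1)" using G by simp
    finally show "(\<integral>\<^sup>+y. ennreal (rho y / sqrt (y + tau) ^ (0 + 1)) \<partial>lborel) <= ennreal (G * 1) \<and> 0 <= (1::real)" by simp
  qed (use \<kappa> G in auto)
qed

lemma A1_EEr_integrable:
  assumes t: "0 < tau" "tau < L" shows "integrable lborel (\<lambda>xi. A1 xi * EEr xi tau)"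
proof -
  obtain C where C: "\<forall>tau. 0 < tau \<and> tau < L --> (\<forall>xi. \<bar>A1 xi * EEr xi tau\<bar> * exp (tau * \<bar>xi\<bar>) <= C * bb tau) \<and>
     (\<integral>\<^sup>+xi. ennreal (\<bar>A1 xi * EEr xi tau\<bar> * exp (tau * \<bar>xi\<bar>)) \<partial>lborel) <= ennreal (C * bb tau)"
    using A1_EEr_bound by - (elim exE conjE, rule that)
  have "(\<integral>\<^sup>+xi. ennreal (norm (A1 xi * EEr xi tau)) \<partial>lborel) <= (\<integral>\<^sup>+xi. ennreal (\<bar>A1 xi * EEr xi tau\<bar> * exp (tau * \<bar>xi\<bar>)) \<partial>lborel)"
  proof (intro nn_integral_mono ennreal_leI)
    fix xi :: real
    show "norm (A1 xi * EEr xi tau) <= \<bar>A1 xi * EEr xi tau\<bar> * exp (tau * \<bar>xi\<bar>)"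
      using mult_left_mono[of 1 "exp (tau * \<bar>xi\<bar>)" "\<bar>A1 xi * EEr xi tau\<bar>"] t by simp
  qed
  also have "\<dots> <= ennreal (C * bb tau)" using C[THEN spec, THEN mp, of tau] t by simp
  also have "\<dots> < \<infinity>" by simp
  finally show ?thesis by (intro integrableI_bounded) auto
qed

text \<open>High frequencies contribute positively by \<open>EEr_ge\<close> and give the rate; the
  frequencies |xi| <= 1, where the sign is unknown, contribute a bounded error, harmless because
  \<open>bb\<close> is unbounded at 0.\<close>

lemma mass_lower:
  assumes t: "0 < tau" "tau < L"
  shows "exp (- 1) / 48 * bb tau - 8 * R0 <= (\<integral>xi. A1 xi * EEr xi tau \<partial>lborel)"
proof -
  \<comment> \<open>For |xi| <= 1 the product is at least -3 * R0 and G is at most R0, so adding 4 *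
    R0 gives F >= G everywhere; the correction integrates to 8 * R0.\<close>
  define F where "F xi = A1 xi * EEr xi tau + 4 * R0 * indicator {-1..1} xi" for xi
  define G where "G xi = A1 xi * exp (- (xi\<^sup>2 * tau)) / 6" for xi
  have Fi: "integrable lborel F" unfolding F_def
    by (intro Bochner_Integration.integrable_add A1_EEr_integrable t integrable_mult_right integrable_real_indicator) auto
  have GF: "G xi <= F xi" for xi
  proof (cases "\<bar>xi\<bar> <= 1")
    case True
    have x2: "xi\<^sup>2 <= 1" using True by (simp add: abs_square_le_1)
    have a: "A1 xi <= R0" using A1_le[of xi] mult_right_mono[OF x2 R0_nonneg] by simp
    have "\<bar>A1 xi * EEr xi tau\<bar> <= R0 * 3"
      unfolding abs_mult using A1_nonneg[of xi] a EEr_abs_le[OF True, of tau] R0_nonneg by (intro mult_mono) auto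
    moreover have "A1 xi * exp (- (xi\<^sup>2 * tau)) <= R0 * 1"
      using A1_nonneg[of xi] a t R0_nonneg by (intro mult_mono) auto
    moreover have "indicator {-1..1} xi = (1::real)" using True by (auto simp: indicator_def abs_le_iff)
    ultimately show ?thesis unfolding F_def G_def using R0_nonneg by simp
  next
    case False
    then have "exp (- (xi\<^sup>2 * tau)) / 6 <= EEr xi tau" using t by (intro EEr_ge) auto
    then have "A1 xi * (exp (- (xi\<^sup>2 * tau)) / 6) <= A1 xi * EEr xi tau" by (intro mult_left_mono A1_nonneg)
    moreover have "indicator {-1..1} xi = (0::real)" using False by (auto simp: indicator_def abs_le_iff)
    ultimately show ?thesis unfolding F_def G_def by simp
  qed
  have G0: "0 <= G xi" for xi unfolding G_def using A1_nonneg by simp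
  have Gm [measurable]: "G \<in> borel_measurable borel" unfolding G_def[abs_def] by measurable
  have "ennreal (exp (- 1) / 48 * bb tau) = ennreal (exp (- 1) / 8 / 6) * I0 tau"
    using bb_pos[OF t(1)] by (simp add: ennreal_bb[OF t(1), symmetric] flip: ennreal_mult)
  also have "\<dots> = (\<integral>\<^sup>+y. ennreal (exp (- 1) / 8 / 6) * ennreal (rho y / sqrt (y + tau) ^ 3) \<partial>lborel)"
    unfolding I0_def by (rule nn_integral_cmult[symmetric]) measurable
  also have "\<dots> <= (\<integral>\<^sup>+y. ennreal (rho y / 6) * (\<integral>\<^sup>+xi. ennreal (xi\<^sup>2 * exp (- (xi\<^sup>2 * (y + tau)))) \<partial>lborel) \<partial>lborel)"
  proof (intro nn_integral_mono)
    fix y :: real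
    show "ennreal (exp (- 1) / 8 / 6) * ennreal (rho y / sqrt (y + tau) ^ 3) <= ennreal (rho y / 6) * (\<integral>\<^sup>+xi. ennreal (xi\<^sup>2 * exp (- (xi\<^sup>2 * (y + tau)))) \<partial>lborel)"
    proof (cases "0 < y")
      case True
      have "ennreal (exp (- 1) / 8 / 6) * ennreal (rho y / sqrt (y + tau) ^ 3) = ennreal (rho y / 6) * ennreal (exp (- 1) / 8 / sqrt (y + tau) ^ 3)"
        using rho_nonneg[of y] True t by (simp flip: ennreal_mult)
      also have "\<dots> <= ennreal (rho y / 6) * (\<integral>\<^sup>+xi. ennreal (xi\<^sup>2 * exp (- (xi\<^sup>2 * (y + tau)))) \<partial>lborel)"
        using True t by (intro mult_left_mono gauss_lower) auto
      finally show ?thesis .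
    qed (simp add: rho_def)
  qed
  also have "\<dots> = (\<integral>\<^sup>+y. \<integral>\<^sup>+xi. ennreal (rho y / 6) * ennreal (xi\<^sup>2 * exp (- (xi\<^sup>2 * (y + tau)))) \<partial>lborel \<partial>lborel)"
    by (intro nn_integral_cong nn_integral_cmult[symmetric]) measurable
  also have "\<dots> = (\<integral>\<^sup>+xi. \<integral>\<^sup>+y. ennreal (rho y / 6) * ennreal (xi\<^sup>2 * exp (- (xi\<^sup>2 * (y + tau)))) \<partial>lborel \<partial>lborel)"
    by (rule lborel_pair.Fubini') measurable
  also have "\<dots> = (\<integral>\<^sup>+xi. ennreal (G xi) \<partial>lborel)"
  proof (intro nn_integral_cong)
    fix xi :: real
    define k where "k = xi\<^sup>2 * exp (- (xi\<^sup>2 * tau)) / 6"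
    have k: "0 <= k" by (simp add: k_def)
    have "(\<integral>\<^sup>+y. ennreal (rho y / 6) * ennreal (xi\<^sup>2 * exp (- (xi\<^sup>2 * (y + tau)))) \<partial>lborel) = (\<integral>\<^sup>+y. ennreal (k * (rho y * exp (- (y * xi\<^sup>2)))) \<partial>lborel)"
    proof (intro nn_integral_cong)
      fix y
      have "exp (- (xi\<^sup>2 * (y + tau))) = exp (- (xi\<^sup>2 * tau)) * exp (- (y * xi\<^sup>2))" by (simp add: algebra_simps flip: exp_add)
      then have "rho y / 6 * (xi\<^sup>2 * exp (- (xi\<^sup>2 * (y + tau)))) = k * (rho y * exp (- (y * xi\<^sup>2)))" by (simp add: k_def)
      then show "ennreal (rho y / 6) * ennreal (xi\<^sup>2 * exp (- (xi\<^sup>2 * (y + tau)))) = ennreal (k * (rho y * exp (- (y * xi\<^sup>2))))"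
        using rho_nonneg[of y] by (simp only: ennreal_mult[symmetric] zero_le_mult_iff zero_le_power2 exp_ge_zero divide_nonneg_nonneg zero_le_numeral simp_thms)
    qed
    also have "\<dots> = ennreal (\<integral>y. k * (rho y * exp (- (y * xi\<^sup>2))) \<partial>lborel)"
      using k rho_nonneg by (intro nn_integral_eq_integral integrable_mult_right rho_exp_integrable) auto
    also have "(\<integral>y. k * (rho y * exp (- (y * xi\<^sup>2))) \<partial>lborel) = G xi" by (simp add: k_def G_def A1_def)
    finally show "(\<integral>\<^sup>+y. ennreal (rho y / 6) * ennreal (xi\<^sup>2 * exp (- (xi\<^sup>2 * (y + tau)))) \<partial>lborel) = ennreal (G xi)" .
  qed
  also have "\<dots> <= (\<integral>\<^sup>+xi. ennreal (F xi) \<partial>lborel)" by (intro nn_integral_mono ennreal_leI GF)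
  also have "\<dots> = ennreal (\<integral>xi. F xi \<partial>lborel)"
    using order_trans[OF G0 GF] by (intro nn_integral_eq_integral Fi) auto
  finally have "exp (- 1) / 48 * bb tau <= (\<integral>xi. F xi \<partial>lborel)"
    using order_trans[OF G0 GF] by (subst (asm) ennreal_le_iff) (auto intro: Bochner_Integration.integral_nonneg)
  also have "(\<integral>xi. F xi \<partial>lborel) = (\<integral>xi. A1 xi * EEr xi tau \<partial>lborel) + 8 * R0"
    unfolding F_def by (subst Bochner_Integration.integral_add) (auto intro: A1_EEr_integrable t)
  finally show ?thesis by simp
qed

end

section \<open>Schwartz class solutions\<close>

text \<open>Arbitrarily short increments along each axis stay in the domain, at t = 0 forward in
  time; hence the derivative within the domain is unique and \<open>frechet_derivative\<close> picks
  the intended one.\<close>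

lemma dom_T_directions:
  assumes z: "z \<in> dom_T T" and i: "i \<in> Basis" and e: "0 < e"
  shows "\<exists>d. 0 < \<bar>d\<bar> \<and> \<bar>d\<bar> < e \<and> z + d *\<^sub>R i \<in> dom_T T"
proof -
  obtain x t where xt: "z = (x, t)" "0 <= t" "t < T" using z by (auto simp: dom_T_def)
  define d where "d = min (e / 2) ((T - t) / 2)"
  have d: "0 < d" "d < e" "t + d < T"
    using e xt min.cobounded1[of "e / 2" "(T - t) / 2"] min.cobounded2[of "e / 2" "(T - t) / 2"] unfolding d_def by (auto simp: field_simps)
  have "i = (1, 0) \<or> i = (0, 1)" using i by (auto simp: Basis_prod_def)
  then have "z + d *\<^sub>R i \<in> dom_T T" using d xt by (auto simp: dom_T_def)
  then show ?thesis using d by (intro exI[of _ d]) auto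
qed

lemma pd_eq:
  assumes z: "z \<in> dom_T T" and d: "(f has_derivative (\<lambda>(h, k). p * h + q * k)) (at z within dom_T T)"
  shows "pdx (dom_T T) f z = p" "pdt (dom_T T) f z = q"
proof -
  have "f differentiable (at z within dom_T T)" using d by (auto simp: differentiable_def)
  then have f: "(f has_derivative frechet_derivative f (at z within dom_T T)) (at z within dom_T T)"
    by (simp add: frechet_derivative_works)
  have "frechet_derivative f (at z within dom_T T) = (\<lambda>(h, k). p * h + q * k)"
    by (rule frechet_derivative_unique_within[OF f d]) (use dom_T_directions[OF z] in blast)
  then show "pdx (dom_T T) f z = p" "pdt (dom_T T) f z = q" by (simp_all add: pdx_def pdt_def)
qed

lemma pd_cong:
  assumes z: "z \<in> dom_T T" and d: "(f has_derivative (\<lambda>(h, k). p * h + q * k)) (at z within dom_T T)"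
    and e: "\<And>w. w \<in> dom_T T ==> g w = f w"
  shows "pdx (dom_T T) g z = p" "pdt (dom_T T) g z = q"
proof -
  have "(g has_derivative (\<lambda>(h, k). p * h + q * k)) (at z within dom_T T)"
    by (rule has_derivative_transform[OF z _ d]) (use e in auto)
  from pd_eq[OF z this] show "pdx (dom_T T) g z = p" "pdt (dom_T T) g z = q" .
qed

context boussinesq_small
begin

context
  fixes T x0 :: real
  assumes T: "0 < T" "T < L"
begin

text \<open>Because T < L, the whole domain including t = 0 lands in the open strip, where the
  solution is differentiable in the ordinary sense. Reversal changes the sign of one time
  derivative, not of two.\<close>

definition th :: "real \<times> real => real \<times> real" where "th z = (fst z - x0, T - snd z)"

lemma th_dom: "z \<in> dom_T T ==> th z \<in> UNIV \<times> {0<..<L}"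
  using T by (auto simp: dom_T_def th_def)

lemma th_deriv:
  assumes g: "(g has_derivative (\<lambda>(h, k). p * h + q * k)) (at (th z))"
  shows "((\<lambda>z. g (th z)) has_derivative (\<lambda>(h, k). p * h + (- q) * k)) (at z within S)"
proof -
  have "(th has_derivative (\<lambda>w. (fst w, - snd w))) (at z within S)"
    unfolding th_def[abs_def] by (auto intro!: derivative_eq_intros)
  from has_derivative_compose[OF this g] show ?thesis
    by (rule has_derivative_eq_rhs) (auto simp: fun_eq_iff)
qed

lemma th_V: "z \<in> dom_T T ==> ((\<lambda>z. JJ V i (th z)) has_derivative (\<lambda>(h, k). JJ V (Suc i) (th z) * h + (- JJ Vt i (th z)) * k)) (at z within S)"
  using th_dom[of z] JJ_V_deriv[of "snd (th z)" i "fst (th z)"] by (intro th_deriv) auto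

lemma th_Vt: "z \<in> dom_T T ==> ((\<lambda>z. JJ Vt i (th z)) has_derivative (\<lambda>(h, k). JJ Vt (Suc i) (th z) * h + (- JJ Vtt i (th z)) * k)) (at z within S)"
  using th_dom[of z] JJ_Vt_deriv[of "snd (th z)" i "fst (th z)"] by (intro th_deriv) auto

lemma pdx_th: "z \<in> dom_T T ==> (pdx (dom_T T) ^^ i) (\<lambda>z. JJ V 0 (th z)) z = JJ V i (th z)"
proof (induction i arbitrary: z)
  case (Suc i)
  then show ?case using pd_cong(1)[OF Suc.prems th_V[OF Suc.prems, of i], of "(pdx (dom_T T) ^^ i) (\<lambda>z. JJ V 0 (th z))"] by simp
qed simp

lemma smooth_th: "smooth_on (dom_T T) (\<lambda>z. JJ V 0 (th z))"
  unfolding smooth_on_def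
proof (intro exI conjI ballI)
  \<comment> \<open>The pull-back of the class closed under both derivatives; the sign from time
    reversal stays inside because constants belong to \<open>PF\<close>.\<close>
  define F where "F = (\<lambda>g z. g (th z)) ` PF True"
  show "(\<lambda>z. JJ V 0 (th z)) \<in> F" unfolding F_def by (intro imageI PF_V)
  fix f assume "f \<in> F"
  then obtain g where g: "g \<in> PF True" "f = (\<lambda>z. g (th z))" by (auto simp: F_def)
  obtain gx gt where gg: "gx \<in> PF True" "gt \<in> PF True"
    and d: "\<And>z. z \<in> UNIV \<times> {0<..<L} ==> (g has_derivative (\<lambda>(h, k). gx z * h + gt z * k)) (at z)"
    using PF_deriv[OF g(1)] by blast
  have D: "(f has_derivative (\<lambda>(h, k). gx (th z) * h + (- gt (th z)) * k)) (at z within dom_T T)" if "z \<in> dom_T T" for z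
    unfolding g(2) by (rule th_deriv[OF d[OF th_dom[OF that]]])
  show "continuous_on (dom_T T) f" using D by (intro has_derivative_continuous_on)
  have "(\<lambda>z. (\<lambda>z. -1) z * gt z) \<in> PF True" by (intro PF_mult PF_const gg)
  then have m: "(\<lambda>z. - gt (th z)) \<in> F" unfolding F_def by (intro image_eqI[where x = "\<lambda>z. (\<lambda>z. -1) z * gt z"]) auto
  show "\<exists>gx\<in>F. \<exists>gt\<in>F. \<forall>z\<in>dom_T T. (f has_derivative (\<lambda>(h, k). gx z * h + gt z * k)) (at z within dom_T T)"
    by (intro bexI[of _ "\<lambda>z. gx (th z)"] bexI[OF _ m] ballI D) (auto simp: F_def gg)
qed

lemma equation_th:
  assumes z: "z \<in> dom_T T"
  defines "u \<equiv> \<lambda>z. JJ V 0 (th z)"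
  shows "pdt (dom_T T) (pdt (dom_T T) u) z = pdx (dom_T T) (pdx (dom_T T) u) z
     + pdx (dom_T T) (pdx (dom_T T) (\<lambda>w. (u w)\<^sup>2)) z + (pdx (dom_T T) ^^ 4) u z"
proof -
  let ?S = "dom_T T"
  have t: "pdt ?S u w = - JJ Vt 0 (th w)" if "w \<in> ?S" for w
    unfolding u_def by (rule pd_eq(2)[OF that th_V[OF that]])
  have "((\<lambda>w. - JJ Vt 0 (th w)) has_derivative (\<lambda>(h, k). (- JJ Vt 1 (th z)) * h + JJ Vtt 0 (th z) * k)) (at z within ?S)"
    using has_derivative_minus[OF th_Vt[OF z, of 0 ?S]] by (rule has_derivative_eq_rhs) (auto simp: fun_eq_iff)
  from pd_cong(2)[OF z this t] have 1: "pdt ?S (pdt ?S u) z = JJ Vtt 0 (th z)" .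
  have 2: "pdx ?S (pdx ?S u) z = JJ V 2 (th z)" using pdx_th[OF z, of 2] unfolding u_def by (simp add: numeral_2_eq_2)
  have 3: "(pdx ?S ^^ 4) u z = JJ V 4 (th z)" unfolding u_def by (rule pdx_th[OF z])
  have sq: "pdx ?S (\<lambda>w. (u w)\<^sup>2) w = 2 * u w * JJ V 1 (th w)" if w: "w \<in> ?S" for w
  proof (rule pd_eq(1)[OF w])
    show "((\<lambda>w. (u w)\<^sup>2) has_derivative (\<lambda>(h, k). (2 * u w * JJ V 1 (th w)) * h + (- (2 * u w * JJ Vt 0 (th w))) * k)) (at w within ?S)"
      unfolding power2_eq_square u_def
      by (rule has_derivative_eq_rhs[OF has_derivative_mult[OF th_V[OF w] th_V[OF w]]]) (auto simp: fun_eq_iff algebra_simps)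
  qed
  have "((\<lambda>w. 2 * (u w * JJ V 1 (th w))) has_derivative (\<lambda>(h, k). (2 * ((JJ V 1 (th z))\<^sup>2 + u z * JJ V 2 (th z))) * h +
      (- (2 * (JJ Vt 0 (th z) * JJ V 1 (th z) + u z * JJ Vt 1 (th z)))) * k)) (at z within ?S)"
    unfolding u_def
    by (rule has_derivative_eq_rhs[OF has_derivative_mult_right[OF has_derivative_mult[OF th_V[OF z] th_V[OF z]]]])
      (auto simp: fun_eq_iff algebra_simps power2_eq_square numeral_2_eq_2)
  from pd_cong(1)[OF z this, of "pdx ?S (\<lambda>w. (u w)\<^sup>2)"]
  have 4: "pdx ?S (pdx ?S (\<lambda>w. (u w)\<^sup>2)) z = 2 * ((JJ V 1 (th z))\<^sup>2 + u z * JJ V 2 (th z))" by (simp add: sq)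
  have e: "JJ Vtt 0 (th z) = JJ V 4 (th z) + JJ V 2 (th z) + (2 * (JJ V 1 (th z))\<^sup>2 + 2 * JJ V 0 (th z) * JJ V 2 (th z))"
    using th_dom[OF z] JJ_V_eq[of "snd (th z)" "fst (th z)"] by auto
  show ?thesis unfolding 1 2 3 4 e unfolding u_def by (simp add: algebra_simps)
qed

lemma schwartz_th:
  assumes P: "\<And>n. \<exists>C h0. 0 <= C \<and> 0 < h0 \<and> (\<forall>h tau. 0 < h \<and> h <= h0 \<and> 0 < tau \<and> tau < L -->
     n1 ((fd h ^^ n) (Phi tau)) <= ennreal (C * h ^ n * b tau))"
  shows "schwartz_boussinesq_sol T (\<lambda>z. JJ V 0 (th z))"
  unfolding schwartz_boussinesq_sol_def
proof (intro conjI ballI allI impI smooth_th equation_th)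
  fix N :: nat and tau :: real assume "1 <= N" and t: "0 <= tau \<and> tau < T"
  have "\<forall>i. \<exists>K. \<forall>s x. T - tau <= s \<and> s <= T --> (1 + \<bar>x\<bar>) ^ N * \<bar>JJ V i (x, s)\<bar> <= K"
    by (intro allI JJ_V_schwartz[OF P]) (use t T in auto)
  from choice[OF this] obtain K where K: "\<And>i s x. T - tau <= s ==> s <= T ==> (1 + \<bar>x\<bar>) ^ N * \<bar>JJ V i (x, s)\<bar> <= K i" by blast
  show "\<exists>B. \<forall>x t. 0 <= t \<and> t <= tau --> (\<Sum>i=0..N. (1 + \<bar>x\<bar>) ^ N * \<bar>(pdx (dom_T T) ^^ i) (\<lambda>z. JJ V 0 (th z)) (x, t)\<bar>) <= B"
  proof (rule exI[of _ "\<Sum>i=0..N. (1 + \<bar>x0\<bar>) ^ N * K i"], intro allI impI, rule sum_mono)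
    fix x s i assume s: "0 <= s \<and> s <= tau"
    then have z: "(x, s) \<in> dom_T T" using t by (auto simp: dom_T_def)
    have "1 + \<bar>x\<bar> <= (1 + \<bar>x0\<bar>) * (1 + \<bar>x - x0\<bar>)"
    proof -
      have "\<bar>x\<bar> <= \<bar>x0\<bar> + \<bar>x - x0\<bar>" by arith
      moreover have "0 <= \<bar>x0\<bar> * \<bar>x - x0\<bar>" by simp
      moreover have "(1 + \<bar>x0\<bar>) * (1 + \<bar>x - x0\<bar>) = 1 + (\<bar>x0\<bar> + \<bar>x - x0\<bar>) + \<bar>x0\<bar> * \<bar>x - x0\<bar>" by (simp add: algebra_simps)
      ultimately show ?thesis by linarith
    qed
    then have "(1 + \<bar>x\<bar>) ^ N <= ((1 + \<bar>x0\<bar>) * (1 + \<bar>x - x0\<bar>)) ^ N" by (intro power_mono) auto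
    then have "(1 + \<bar>x\<bar>) ^ N * \<bar>JJ V i (x - x0, T - s)\<bar> <= ((1 + \<bar>x0\<bar>) * (1 + \<bar>x - x0\<bar>)) ^ N * \<bar>JJ V i (x - x0, T - s)\<bar>"
      by (intro mult_right_mono) auto
    also have "\<dots> = (1 + \<bar>x0\<bar>) ^ N * ((1 + \<bar>x - x0\<bar>) ^ N * \<bar>JJ V i (x - x0, T - s)\<bar>)" by (simp add: power_mult_distrib)
    also have "\<dots> <= (1 + \<bar>x0\<bar>) ^ N * K i" using s by (intro mult_left_mono K) auto
    finally show "(1 + \<bar>x\<bar>) ^ N * \<bar>(pdx (dom_T T) ^^ i) (\<lambda>z. JJ V 0 (th z)) (x, s)\<bar> <= (1 + \<bar>x0\<bar>) ^ N * K i"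
      unfolding pdx_th[OF z] by (simp add: th_def)
  qed
qed

end

end

section \<open>Iterated logarithms\<close>

lemma iter_log_0 [simp]: "iter_log 0 s = s" by (simp add: iter_log_def)
lemma iter_log_Suc [simp]: "iter_log (Suc r) s = ln (iter_log r s)" by (simp add: iter_log_def)

lemma iter_log_at_top: "filterlim (iter_log r) at_top at_top"
proof (induction r)
  case 0 then show ?case using filterlim_ident by (simp add: iter_log_0[abs_def])
next
  case (Suc r) then show ?case using filterlim_compose[OF ln_at_top Suc] by simp
qed

lemma iter_log_measurable [measurable]: "iter_log r \<in> borel_measurable borel"
proof (induction r)
  case (Suc r)
  then have [measurable]: "iter_log r \<in> borel_measurable borel" .
  show ?case unfolding iter_log_Suc[abs_def] by measurable
qed (simp add: iter_log_0[abs_def])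

lemma iter_log_large: "\<exists>S\<ge>1. \<forall>s k. S <= s \<and> k <= R --> 1 <= iter_log k s"
proof -
  have "eventually (\<lambda>s. \<forall>k\<in>{..R}. 1 <= iter_log k s) at_top"
    using iter_log_at_top by (intro eventually_ball_finite) (auto simp: filterlim_at_top)
  then obtain S where "\<forall>s\<ge>S. \<forall>k\<in>{..R}. 1 <= iter_log k s" by (auto simp: eventually_at_top_linorder)
  then show ?thesis by (intro exI[of _ "max 1 S"]) auto
qed

lemma iter_log_mono:
  assumes "\<And>k. k <= r ==> 1 <= iter_log k s" and "s <= s'"
  shows "iter_log r s <= iter_log r s'"
  using assms(1)
proof (induction r)
  case (Suc r)
  have "iter_log r s <= iter_log r s'" using Suc by simp
  moreover have "1 <= iter_log r s" using Suc.prems[of r] by simp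
  ultimately show ?case by simp
qed (use assms(2) in simp)

text \<open>Slow variation of iterated logarithms: ln((1 + ln q) X) <= ln q + ln X, and as the next
  logarithm is at least 1, the added ln q becomes a factor 1 + ln q. The identity (r = 0) is
  excluded, since it scales by q.\<close>

lemma iter_log_scale:
  assumes "\<And>k. k <= r ==> 1 <= iter_log k s" and la: "1 <= q" and "0 < r"
  shows "iter_log r (q * s) <= (1 + ln q) * iter_log r s"
  using assms(3,1)
proof (induction r)
  case (Suc r)
  have s: "1 <= s" using Suc.prems(2)[of 0] by simp
  have l: "0 <= ln q" using la by simp
  have i: "1 <= iter_log r s" "1 <= iter_log (Suc r) s" using Suc.prems(2)[of r] Suc.prems(2)[of "Suc r"] by auto
  have up: "x + iter_log (Suc r) s <= (1 + ln q) * iter_log (Suc r) s" if "x <= ln q" for x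
    using mult_left_mono[OF i(2) l] that by (simp add: algebra_simps)
  show ?case
  proof (cases "r = 0")
    case True
    have "ln (q * s) = ln q + ln s" using la s by (simp add: ln_mult)
    then show ?thesis using up[of "ln q"] True by simp
  next
    case False
    then have "iter_log r (q * s) <= (1 + ln q) * iter_log r s" using Suc by simp
    moreover have "iter_log r s <= iter_log r (q * s)"
      using Suc.prems(2) la s by (intro iter_log_mono) auto
    ultimately have "ln (iter_log r (q * s)) <= ln ((1 + ln q) * iter_log r s)" using i by simp
    also have "\<dots> = ln (1 + ln q) + iter_log (Suc r) s" using i l by (simp add: ln_mult)
    also have "\<dots> <= (1 + ln q) * iter_log (Suc r) s" using ln_add_one_self_le_self[OF l] by (intro up)
    finally show ?thesis by simp
  qed
qed simp

definition logs :: "nat => (nat => nat) => (nat => real) => real => real" where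
  "logs p r a y = (\<Prod>j=1..p. iter_log (r j) (1 / y) powr a j)"

lemma one_plus_ln_powr:
  fixes A e :: real
  assumes A: "0 <= A" and e: "0 < e"
  shows "\<exists>K>0. \<forall>q\<ge>1. (1 + ln q) powr A <= K * q powr e"
proof -
  \<comment> \<open>ln q <= q^\<eta> / \<eta> raised to the power A costs q^(\<eta> A), and \<eta> A
    <= e also when A = 0.\<close>
  define \<eta> where "\<eta> = e / (A + 1)"
  have n: "0 < \<eta>" "\<eta> * A <= e" using A e by (auto simp: \<eta>_def field_simps)
  have "(1 + ln q) powr A <= (1 + 1 / \<eta>) powr A * q powr e" if l: "1 <= q" for q :: real
  proof -
    have "1 <= q powr \<eta>" using l n by (simp add: ge_one_powr_ge_zero)
    moreover have "ln q <= q powr \<eta> / \<eta>" by (rule ln_powr_bound[OF l n(1)])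
    ultimately have "1 + ln q <= (1 + 1 / \<eta>) * q powr \<eta>" by (simp add: distrib_right)
    then have "(1 + ln q) powr A <= ((1 + 1 / \<eta>) * q powr \<eta>) powr A" using l A by (intro powr_mono2) auto
    also have "\<dots> = (1 + 1 / \<eta>) powr A * q powr (\<eta> * A)" using n by (simp add: powr_mult powr_powr)
    also have "\<dots> <= (1 + 1 / \<eta>) powr A * q powr e" using l n by (intro mult_left_mono powr_mono) auto
    finally show ?thesis .
  qed
  moreover have "0 < (1 + 1 / \<eta>) powr A" using add_pos_pos[of 1 "1 / \<eta>"] n by simp
  ultimately show ?thesis by blast
qed

lemma logs_profile:
  assumes d: "0 < \<delta>" "\<delta> < 1" and r: "\<forall>j\<in>{1..p}. r j > 0" and a: "\<forall>j\<in>{1..p}. a j >= 0"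
  shows "\<exists>c. profile \<delta> c (logs p r a)"
proof -
  \<comment> \<open>A common upper bound for all orders r j, available also for p = 0.\<close>
  define R where "R = (\<Sum>j=1..p. r j)"
  have R: "r j <= R" if "j \<in> {1..p}" for j unfolding R_def using that by (intro member_le_sum) auto
  obtain S where S: "1 <= S" "\<And>s k. S <= s ==> k <= R ==> 1 <= iter_log k s" using iter_log_large[of R] by blast
  \<comment> \<open>For y <= c the point 1/y lies beyond S, where all iterated logarithms up to
    order R are at least 1.\<close>
  define c where "c = 1 / S"
  have c: "0 < c" "c <= 1" using S by (auto simp: c_def)
  have inv: "S <= 1 / y" if "0 < y" "y <= c" for y using that S by (auto simp: c_def field_simps)
  have i: "1 <= iter_log k (1 / y)" if "0 < y" "y <= c" "j \<in> {1..p}" "k <= r j" for y k j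
    using S(2)[OF inv[OF that(1,2)]] R[OF that(3)] that(4) by auto
  have "profile \<delta> c (logs p r a)"
  proof
    show "0 < \<delta>" "\<delta> < 1" "0 < c" "c <= 1" by fact+
    show "logs p r a \<in> borel_measurable borel" unfolding logs_def[abs_def] by measurable
    fix y assume y: "0 < y" "y <= c"
    show "1 <= logs p r a y" unfolding logs_def
      using i[OF y] a by (intro prod_ge_1 ge_one_powr_ge_zero) auto
  next
    fix y tau assume y: "0 < y" "y <= tau" "tau <= c"
    show "logs p r a tau <= logs p r a y" unfolding logs_def
    proof (intro prod_mono conjI powr_mono2)
      fix j assume j: "j \<in> {1..p}"
      show "0 <= a j" using a j by simp
      show "0 <= iter_log (r j) (1 / tau)" using i[of tau j "r j"] y j by simp
      show "iter_log (r j) (1 / tau) <= iter_log (r j) (1 / y)"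
        using i[of tau j] y j by (intro iter_log_mono) (auto intro: divide_left_mono)
    qed simp
  next
    fix e :: real assume e: "0 < e"
    define A where "A = (\<Sum>j=1..p. a j)"
    have "0 <= A" unfolding A_def using a by (intro sum_nonneg) auto
    from one_plus_ln_powr[OF this e] obtain K where K: "K > 0" "\<And>q. 1 <= q ==> (1 + ln q) powr A <= K * q powr e" by blast
    have "logs p r a y <= K * (tau / y) powr e * logs p r a tau" if y: "0 < y" "y <= tau" "tau <= c" for y tau
    proof -
      have l: "1 <= tau / y" using y by simp
      have n: "0 <= ln (tau / y)" using l by (rule ln_ge_zero)
      have "logs p r a y <= (\<Prod>j=1..p. (1 + ln (tau / y)) powr a j * iter_log (r j) (1 / tau) powr a j)"
        unfolding logs_def
      proof (intro prod_mono conjI)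
        fix j assume j: "j \<in> {1..p}"
        have "iter_log (r j) (tau / y * (1 / tau)) <= (1 + ln (tau / y)) * iter_log (r j) (1 / tau)"
          using i[of tau j] y j r l by (intro iter_log_scale) auto
        moreover have "tau / y * (1 / tau) = 1 / y" using y by simp
        ultimately have "iter_log (r j) (1 / y) powr a j <= ((1 + ln (tau / y)) * iter_log (r j) (1 / tau)) powr a j"
          using i[of y j "r j"] y j a by (intro powr_mono2) auto
        also have "\<dots> = (1 + ln (tau / y)) powr a j * iter_log (r j) (1 / tau) powr a j"
          using i[of tau j "r j"] y j n by (intro powr_mult)
        finally show "iter_log (r j) (1 / y) powr a j <= (1 + ln (tau / y)) powr a j * iter_log (r j) (1 / tau) powr a j" .
      qed simp
      also have "\<dots> = (1 + ln (tau / y)) powr A * logs p r a tau"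
        using n by (simp add: prod.distrib logs_def A_def powr_sum)
      also have "\<dots> <= K * (tau / y) powr e * logs p r a tau"
        using K(2)[OF l] by (intro mult_right_mono) (auto simp: logs_def intro: prod_nonneg)
      finally show ?thesis .
    qed
    then show "\<exists>K>0. \<forall>y tau. 0 < y \<and> y <= tau \<and> tau <= c --> logs p r a y <= K * (tau / y) powr e * logs p r a tau" using K(1) by blast
  qed
  then show ?thesis by blast
qed

context boussinesq_small
begin

text \<open>The second difference gives the decay 1/x^2 uniformly in tau; its proof passes through
  the first difference, which may be singular like tau^(-\<gamma>). When \<gamma> = 0 the first
  difference itself yields the decay 1/|x|.\<close>

lemma spatial_decay:
  assumes g: "0 <= \<gamma>" "\<gamma> < 1" "0 <= 3/2 - 2 * \<beta> + \<gamma>" "\<gamma> + \<beta> < 3/2"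
    and small: "M * Kp \<gamma> <= 1/2" "M * Kp 0 <= 1/2"
    and P1: "\<exists>C h0. 0 <= C \<and> 0 < h0 \<and> (\<forall>h tau. 0 < h \<and> h <= h0 \<and> 0 < tau \<and> tau < L --> n1 ((fd h ^^ 1) (Phi tau)) <= ennreal (C * h ^ 1 * tau powr (- \<gamma>)))"
    and P2: "\<exists>C h0. 0 <= C \<and> 0 < h0 \<and> (\<forall>h tau. 0 < h \<and> h <= h0 \<and> 0 < tau \<and> tau < L --> n1 ((fd h ^^ 2) (Phi tau)) <= ennreal (C * h ^ 2 * 1))"
  shows "\<exists>K\<ge>0. \<forall>x tau. 0 < tau \<and> tau < L --> x\<^sup>2 * \<bar>JJ V 0 (x, tau)\<bar> <= K \<and> (\<gamma> = 0 --> \<bar>x\<bar> * \<bar>JJ V 0 (x, tau)\<bar> <= K)"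
proof -
  obtain C1 h1 where C1: "0 <= C1" "0 < h1" and p1: "\<forall>h tau. 0 < h \<and> h <= h1 \<and> 0 < tau \<and> tau < L --> n1 ((fd h ^^ 1) (Phi tau)) <= ennreal (C1 * h ^ 1 * tau powr (- \<gamma>))"
    using P1 by - (elim exE conjE, rule that)
  obtain C2 h2 where C2: "0 <= C2" "0 < h2" and p2: "\<forall>h tau. 0 < h \<and> h <= h2 \<and> 0 < tau \<and> tau < L --> n1 ((fd h ^^ 2) (Phi tau)) <= ennreal (C2 * h ^ 2 * 1)"
    using P2 by - (elim exE conjE, rule that)
  have "\<exists>C h0. 0 <= C \<and> 0 < h0 \<and> (\<forall>h tau. 0 < h \<and> h <= h0 \<and> 0 < tau \<and> tau < L --> XX 1 h tau <= ennreal (C * h * tau powr (- \<gamma>)))"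
  proof (rule first_difference_bound[OF g(1-3) small(1) C1])
    fix h tau assume "0 < h" "h <= h1" "0 < tau" "tau < L"
    then show "n1 ((fd h ^^ 1) (Phi tau)) <= ennreal (C1 * h * tau powr (- \<gamma>))" using p1[THEN spec, THEN spec, THEN mp, of h tau] by simp
  qed
  then obtain C3 h3 where C3: "0 <= C3" "0 < h3" and x1: "\<forall>h tau. 0 < h \<and> h <= h3 \<and> 0 < tau \<and> tau < L --> XX 1 h tau <= ennreal (C3 * h * tau powr (- \<gamma>))"
    by - (elim exE conjE, rule that)
  have h: "0 < min h2 h3" using C2 C3 by simp
  have "\<exists>C h0. 0 <= C \<and> 0 < h0 \<and> (\<forall>h tau. 0 < h \<and> h <= h0 \<and> 0 < tau \<and> tau < L --> XX 2 h tau <= ennreal (C * h\<^sup>2))"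
  proof (rule second_difference_bound[OF g(1,4) small(2) C2(1) C3(1) h])
    fix h tau assume "0 < h" "h <= min h2 h3" "0 < tau" "tau < L"
    then show "n1 ((fd h ^^ 2) (Phi tau)) <= ennreal (C2 * h\<^sup>2)" "XX 1 h tau <= ennreal (C3 * h * tau powr (- \<gamma>))"
      using p2[THEN spec, THEN spec, THEN mp, of h tau] x1[THEN spec, THEN spec, THEN mp, of h tau] by auto
  qed
  then obtain C4 h4 where C4: "0 <= C4" "0 < h4" and x2: "\<forall>h tau. 0 < h \<and> h <= h4 \<and> 0 < tau \<and> tau < L --> XX 2 h tau <= ennreal (C4 * h\<^sup>2)"
    by - (elim exE conjE, rule that)
  have "x\<^sup>2 * \<bar>JJ V 0 (x, tau)\<bar> <= max C3 C4" if t: "0 < tau" "tau < L" for x tau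
    using JJ_V_decay[OF t C4(2) C4(1), of 2 x] x2 t by force
  moreover have "\<bar>x\<bar> * \<bar>JJ V 0 (x, tau)\<bar> <= max C3 C4" if t: "0 < tau" "tau < L" and "\<gamma> = 0" for x tau
  proof -
    have "\<bar>x\<bar> ^ 1 * \<bar>JJ V 0 (x, tau)\<bar> <= C3"
    proof (rule JJ_V_decay[OF t C3(2) C3(1)])
      fix h :: real assume "0 < h" "h <= h3"
      then show "XX 1 h tau <= ennreal (C3 * h ^ 1)" using x1[THEN spec, THEN spec, THEN mp, of h tau] t that(3) by simp
    qed
    then show ?thesis by simp
  qed
  ultimately show ?thesis using C3(1) by (intro exI[of _ "max C3 C4"]) auto
qed

end

section \<open>The blow-up solution\<close>

context profile_interval
begin

lemma blowup_solution:
  assumes T: "0 < T" "T < L" and sg: "\<bar>sg\<bar> = (1::real)"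
  shows "\<exists>u. schwartz_boussinesq_sol T u \<and>
    (\<exists>tau1 k1 k2. 0 < tau1 \<and> 0 < k1 \<and> 0 < k2 \<and> (\<forall>tau. 0 < tau \<and> tau <= tau1 -->
       k1 * (tau powr (- \<delta>) * l tau) <= sg * u (x0, T - tau) \<and> sg * u (x0, T - tau) <= k2 * (tau powr (- \<delta>) * l tau))) \<and>
    (\<exists>K\<ge>0. \<forall>x t. 0 <= t \<and> t < T --> (x - x0)\<^sup>2 * \<bar>u (x, t)\<bar> <= K \<and> (\<delta> < 1/2 --> \<bar>x - x0\<bar> * \<bar>u (x, t)\<bar> <= K))"
proof -
  \<comment> \<open>Strictly above \<delta>, to leave room for logarithms. In the second case 2 *
    \<beta> - 1 equals \<delta>, the limit allowed by the contraction; in the first \<beta> stays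
    below 1/2, so that \<gamma> = 0 is compatible with the difference estimates.\<close>
  define \<beta> where "\<beta> = (if \<delta> < 1/2 then (\<delta> + 1/2) / 2 else (1 + \<delta>) / 2)"
  have be: "\<delta> < \<beta>" "\<beta> < 1" "2 * \<beta> - 1 <= \<delta>" "1/4 < \<beta>" using delta by (auto simp: \<beta>_def field_simps)
  \<comment> \<open>For \<gamma> = \<beta>/2 the conditions become 3/2 (1 - \<beta>) >= 0, 3/2
    \<beta> < 3/2 and \<delta> - 1/2 < (1 + \<delta>)/4, all consequences of \<delta> < 1.\<close>
  define \<gamma> where "\<gamma> = (if \<delta> < 1/2 then 0 else \<beta> / 2)"
  have ga: "0 <= \<gamma>" "\<gamma> < 1" "0 <= 3/2 - 2 * \<beta> + \<gamma>" "\<gamma> + \<beta> < 3/2" "\<gamma> <= 1" "\<delta> - 1/2 < \<gamma>"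
    using delta be by (auto simp: \<gamma>_def \<beta>_def field_simps)
  obtain c0 Cb where "blowup_weight L bb \<beta> c0 Cb" using blowup_weight_bb[OF cL be(1-3)] by blast
  then interpret W: blowup_weight L bb \<beta> c0 Cb .
  obtain C where C: "0 < C" and A: "\<forall>tau. 0 < tau \<and> tau < L --> (\<forall>xi. \<bar>A1 xi * EEr xi tau\<bar> * exp (tau * \<bar>xi\<bar>) <= C * bb tau) \<and>
     (\<integral>\<^sup>+xi. ennreal (\<bar>A1 xi * EEr xi tau\<bar> * exp (tau * \<bar>xi\<bar>)) \<partial>lborel) <= ennreal (C * bb tau)"
    using A1_EEr_bound by - (elim exE conjE, rule that)
  \<comment> \<open>\<epsilon> = 1/D meets all smallness demands at once: the fixed point with data
    of size \<epsilon> C, the absorption conditions M Kp <= 1/2 for M = 2 \<epsilon> C, and M^2 Cq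
    <= \<epsilon> q for q = exp(-1)/96, where 384 = 4 * 96.\<close>
  define D where "D = 1 + 8 * C * W.Cq + 4 * C * \<bar>W.Kp 0\<bar> + 4 * C * \<bar>W.Kp \<gamma>\<bar> + 384 * exp 1 * C\<^sup>2 * W.Cq"
  define \<epsilon> where "\<epsilon> = 1 / D"
  have D0: "0 <= 8 * C * W.Cq" "0 <= 4 * C * \<bar>W.Kp 0\<bar>" "0 <= 4 * C * \<bar>W.Kp \<gamma>\<bar>" "0 <= 384 * exp 1 * C\<^sup>2 * W.Cq"
    using C W.Cq_pos by auto
  have D: "1 <= D" unfolding D_def using D0 by linarith
  have e0: "0 < \<epsilon>" "\<epsilon> <= 1" using D by (auto simp: \<epsilon>_def)
  have eps: "\<epsilon> * X <= 1" if "X <= D" for X using that D by (simp add: \<epsilon>_def)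
  have e1: "\<epsilon> * (8 * C * W.Cq) <= 1" "\<epsilon> * (4 * C * \<bar>W.Kp 0\<bar>) <= 1" "\<epsilon> * (4 * C * \<bar>W.Kp \<gamma>\<bar>) <= 1" "\<epsilon> * (384 * exp 1 * C\<^sup>2 * W.Cq) <= 1"
    by (rule eps, unfold D_def, use D0 in linarith)+
  define M where "M = 2 * (\<epsilon> * C)"
  have M0: "0 < M" using e0 C by (simp add: M_def)
  have Mq: "M * W.Cq <= 1/2" using e1(1) by (simp add: M_def)
  have MK: "M * W.Kp g <= 1/2" if "\<epsilon> * (4 * C * \<bar>W.Kp g\<bar>) <= 1" for g
  proof -
    have "M * W.Kp g <= M * \<bar>W.Kp g\<bar>" using M0 by (intro mult_left_mono) auto
    also have "\<dots> <= 1/2" using that by (simp add: M_def)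
    finally show ?thesis .
  qed
  define \<kappa> where "\<kappa> = sg * \<epsilon>"
  have ka: "\<bar>\<kappa>\<bar> = \<epsilon>" "\<bar>\<kappa>\<bar> <= 1" "sg * \<kappa> = \<epsilon>" using sg e0 by (auto simp: \<kappa>_def abs_mult abs_if split: if_splits)
  define \<Phi> where "\<Phi> p = (if snd p \<in> {0<..<L} then \<kappa> * A1 (fst p) * EEr (fst p) (snd p) else 0)" for p :: "real \<times> real"
  have Pa: "W.adm \<Phi>" unfolding W.adm_def
  proof (intro conjI allI impI)
    have "continuous_on (UNIV \<times> {0<..<L}) (\<lambda>p::real \<times> real. \<kappa> * A1 (fst p) * EEr (fst p) (snd p))"
      by (intro continuous_intros continuous_on_compose2[OF A1_cont]) auto
    then show "continuous_on (UNIV \<times> {0<..<L}) \<Phi>" by (rule continuous_on_eq) (auto simp: \<Phi>_def)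
    show "\<Phi> (xi, s) = 0" if "s \<notin> {0<..<L}" for xi s using that by (auto simp: \<Phi>_def)
    show "\<Phi> (- xi, s) = \<Phi> (xi, s)" for xi s by (simp add: \<Phi>_def A1_def EEr_even)
  qed
  have Pb: "W.bnd \<Phi> (\<lambda>s. (\<epsilon> * C) * bb s)" unfolding W.bnd_def
  proof (intro ballI conjI allI)
    fix s assume "s \<in> {0<..<L}"
    then have s: "0 < s" "s < L" by auto
    have e: "\<bar>\<Phi> (xi, s)\<bar> * exp (s * \<bar>xi\<bar>) = \<epsilon> * (\<bar>A1 xi * EEr xi s\<bar> * exp (s * \<bar>xi\<bar>))" for xi
      using s ka(1) by (simp add: \<Phi>_def abs_mult)
    note As = A[THEN spec, THEN mp, of s]
    show "\<bar>\<Phi> (xi, s)\<bar> * exp (s * \<bar>xi\<bar>) <= (\<epsilon> * C) * bb s" for xi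
      unfolding e mult.assoc[of \<epsilon>] using As s e0 by (intro mult_left_mono) auto
    have "(\<integral>\<^sup>+xi. ennreal (\<bar>\<Phi> (xi, s)\<bar> * exp (s * \<bar>xi\<bar>)) \<partial>lborel) = (\<integral>\<^sup>+xi. ennreal \<epsilon> * ennreal (\<bar>A1 xi * EEr xi s\<bar> * exp (s * \<bar>xi\<bar>)) \<partial>lborel)"
      unfolding e using e0 by (intro nn_integral_cong ennreal_mult') simp
    also have "\<dots> = ennreal \<epsilon> * (\<integral>\<^sup>+xi. ennreal (\<bar>A1 xi * EEr xi s\<bar> * exp (s * \<bar>xi\<bar>)) \<partial>lborel)"
      by (rule nn_integral_cmult) measurable
    also have "\<dots> <= ennreal \<epsilon> * ennreal (C * bb s)" using As s by (intro mult_left_mono) auto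
    also have "\<dots> = ennreal ((\<epsilon> * C) * bb s)" using e0 by (simp add: ennreal_mult' mult.assoc)
    finally show "(\<integral>\<^sup>+xi. ennreal (\<bar>\<Phi> (xi, s)\<bar> * exp (s * \<bar>xi\<bar>)) \<partial>lborel) <= ennreal ((\<epsilon> * C) * bb s)" .
  qed
  have "\<exists>V. W.adm V \<and> W.bnd V (\<lambda>s. 2 * (\<epsilon> * C) * bb s) \<and> (\<forall>xi s. 0 < s \<and> s < L --> V (xi, s) = \<Phi> (xi, s) + W.duh (W.conv V V) (xi, s))"
    using e0 C e1(1) by (intro W.fixed_point[OF Pa Pb]) (auto simp: mult_ac)
  then obtain V where V: "W.adm V" "W.bnd V (\<lambda>s. 2 * (\<epsilon> * C) * bb s)" and Ve: "\<forall>xi s. 0 < s \<and> s < L --> V (xi, s) = \<Phi> (xi, s) + W.duh (W.conv V V) (xi, s)"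
    by - (elim exE conjE, rule that)
  note V = V[folded M_def]
  interpret S: boussinesq_small L bb \<beta> c0 Cb V "\<lambda>xi. \<kappa> * A1 xi" M
  proof
    show "V (xi, s) = \<kappa> * A1 xi * EEr xi s + W.duh (W.conv V V) (xi, s)" if "0 < s" "s < L" for xi s
      using Ve[THEN spec, THEN spec, THEN mp, of s xi] that by (simp add: \<Phi>_def)
  qed (fact V Mq be(4))+
  have Phi: "S.Phi tau = (\<lambda>xi. \<kappa> * A1 xi * EEr xi tau)" for tau by (rule ext) (simp add: S.Phi_def)
  have sol: "schwartz_boussinesq_sol T (\<lambda>z. JJ V 0 (S.th T x0 z))"
    by (rule S.schwartz_th[OF T]) (unfold Phi, rule n1_A1_EEr_n[OF ka(2)])
  have dec: "\<exists>K\<ge>0. \<forall>x tau. 0 < tau \<and> tau < L --> x\<^sup>2 * \<bar>JJ V 0 (x, tau)\<bar> <= K \<and> (\<gamma> = 0 --> \<bar>x\<bar> * \<bar>JJ V 0 (x, tau)\<bar> <= K)"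
    by (rule S.spatial_decay[OF ga(1-4) MK[OF e1(3)] MK[OF e1(2)]])
      (unfold Phi, rule n1_A1_EEr_1[OF ka(2) ga(1,5,6)], rule n1_A1_EEr_2[OF ka(2)])
  obtain K where K: "0 <= K" and Kd: "\<forall>x tau. 0 < tau \<and> tau < L --> x\<^sup>2 * \<bar>JJ V 0 (x, tau)\<bar> <= K \<and> (\<gamma> = 0 --> \<bar>x\<bar> * \<bar>JJ V 0 (x, tau)\<bar> <= K)"
    using dec by - (elim exE conjE, rule that)
  obtain Cu where Cu: "Cu > 0" "\<And>tau. 0 < tau \<and> tau <= c ==> bb tau <= Cu * (tau powr (- \<delta>) * l tau)" using bb_upper by blast
  \<comment> \<open>Half of the constant exp(-1)/48 of \<open>mass_lower\<close>; the other half is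
    spent on the nonlinear term.\<close>
  define q where "q = (exp (- 1) :: real) / 96"
  have q: "0 < q" by (simp add: q_def)
  have main: "\<epsilon> * (q * bb tau - 8 * R0) <= sg * JJ V 0 (0, tau) \<and> sg * JJ V 0 (0, tau) <= M * bb tau" if t: "0 < tau" "tau < L" for tau
  proof
    have b: "0 < bb tau" by (rule bb_pos[OF t(1)])
    have J: "JJ V 0 (0, tau) = (\<integral>xi. V (xi, tau) \<partial>lborel)" by (simp add: JJ_def cs_0)
    have Vi: "integrable lborel (\<lambda>xi. V (xi, tau))" by (rule S.V_integrable[OF t])
    have Ai: "integrable lborel (\<lambda>xi. \<kappa> * (A1 xi * EEr xi tau))" by (intro integrable_mult_right A1_EEr_integrable t)
    have "ennreal \<bar>JJ V 0 (0, tau)\<bar> <= (\<integral>\<^sup>+xi. ennreal \<bar>V (xi, tau)\<bar> \<partial>lborel)" unfolding J by (rule ennreal_abs_integral_le)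
    also have "\<dots> <= ennreal (M * bb tau)" by (rule W.bndD(4)[OF V(2) t])
    finally have "\<bar>JJ V 0 (0, tau)\<bar> <= M * bb tau" using M0 b by (simp add: ennreal_le_iff)
    then show "sg * JJ V 0 (0, tau) <= M * bb tau" using sg abs_ge_self[of "sg * JJ V 0 (0, tau)"] by (simp add: abs_mult)
    have db: "W.bnd (W.duh (W.conv V V)) (\<lambda>s. M * M * W.Cq * bb s)"
      using M0 by (intro W.duh_bnd[OF S.FF_adm[unfolded S.FF_def] S.FF_bnd[unfolded S.FF_def]]) simp
    have "JJ V 0 (0, tau) - \<kappa> * (\<integral>xi. A1 xi * EEr xi tau \<partial>lborel) = (\<integral>xi. V (xi, tau) \<partial>lborel) - (\<integral>xi. \<kappa> * (A1 xi * EEr xi tau) \<partial>lborel)"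
      unfolding J by simp
    also have "\<dots> = (\<integral>xi. V (xi, tau) - \<kappa> * (A1 xi * EEr xi tau) \<partial>lborel)" by (rule Bochner_Integration.integral_diff[OF Vi Ai, symmetric])
    also have "\<dots> = (\<integral>xi. W.duh (W.conv V V) (xi, tau) \<partial>lborel)" using S.V_eq[OF t] by simp
    finally have d: "JJ V 0 (0, tau) - \<kappa> * (\<integral>xi. A1 xi * EEr xi tau \<partial>lborel) = (\<integral>xi. W.duh (W.conv V V) (xi, tau) \<partial>lborel)" .
    have "ennreal \<bar>JJ V 0 (0, tau) - \<kappa> * (\<integral>xi. A1 xi * EEr xi tau \<partial>lborel)\<bar> <= (\<integral>\<^sup>+xi. ennreal \<bar>W.duh (W.conv V V) (xi, tau)\<bar> \<partial>lborel)"
      unfolding d by (rule ennreal_abs_integral_le)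
    also have "\<dots> <= ennreal (M * M * W.Cq * bb tau)" by (rule W.bndD(4)[OF db t])
    finally have "\<bar>JJ V 0 (0, tau) - \<kappa> * (\<integral>xi. A1 xi * EEr xi tau \<partial>lborel)\<bar> <= M * M * W.Cq * bb tau" using M0 b W.Cq_pos by (simp add: ennreal_le_iff)
    also have "\<dots> <= \<epsilon> * q * bb tau"
    proof (intro mult_right_mono)
      have "exp (- 1) * (\<epsilon> * (384 * exp 1 * C\<^sup>2 * W.Cq)) <= exp (- 1) * (1::real)" using e1(4) by (intro mult_left_mono) auto
      moreover have "exp (- 1) * (\<epsilon> * (384 * exp 1 * C\<^sup>2 * W.Cq)) = 384 * (exp (- 1) * exp 1) * (\<epsilon> * (C\<^sup>2 * W.Cq))" by (simp only: mult_ac)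
      moreover have "exp (- 1) * exp 1 = (1::real)" by (simp flip: exp_add)
      ultimately have "4 * (\<epsilon> * (C\<^sup>2 * W.Cq)) <= q" by (simp add: q_def)
      then have "\<epsilon> * (4 * (\<epsilon> * (C\<^sup>2 * W.Cq))) <= \<epsilon> * q" using e0 by (intro mult_left_mono) auto
      then show "M * M * W.Cq <= \<epsilon> * q" by (simp add: M_def power2_eq_square mult_ac)
    qed (use b in auto)
    finally have 1: "\<bar>sg * (JJ V 0 (0, tau) - \<kappa> * (\<integral>xi. A1 xi * EEr xi tau \<partial>lborel))\<bar> <= \<epsilon> * q * bb tau" using sg by (simp add: abs_mult)
    have "sg * (JJ V 0 (0, tau) - \<kappa> * (\<integral>xi. A1 xi * EEr xi tau \<partial>lborel)) = sg * JJ V 0 (0, tau) - (sg * \<kappa>) * (\<integral>xi. A1 xi * EEr xi tau \<partial>lborel)"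
      by (simp add: algebra_simps)
    with 1 have 2: "\<epsilon> * (\<integral>xi. A1 xi * EEr xi tau \<partial>lborel) - \<epsilon> * q * bb tau <= sg * JJ V 0 (0, tau)" unfolding ka(3) by linarith
    have "\<epsilon> * (2 * q * bb tau - 8 * R0) <= \<epsilon> * (\<integral>xi. A1 xi * EEr xi tau \<partial>lborel)"
      using mass_lower[OF t] e0 by (intro mult_left_mono) (auto simp: q_def)
    then show "\<epsilon> * (q * bb tau - 8 * R0) <= sg * JJ V 0 (0, tau)" using 2 by (simp add: algebra_simps)
  qed
  \<comment> \<open>Once tau^(-\<delta>) l(tau) exceeds N, the low-frequency error 8 * R0 is at most
    q/64 of it, half of the lower bound q/32 obtained from \<open>bb_lower\<close>; tau1 is the time
    from which on this holds.\<close>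
  define N where "N = 512 * R0 / q + 1"
  have N: "1 <= N" using R0_nonneg q by (simp add: N_def)
  define tau1 where "tau1 = min c (N powr (- (1 / \<delta>)))"
  have t1: "0 < tau1" "tau1 <= c" using N c by (auto simp: tau1_def)
  have asy: "\<epsilon> * q / 64 * (tau powr (- \<delta>) * l tau) <= sg * JJ V 0 (0, tau) \<and> sg * JJ V 0 (0, tau) <= M * Cu * (tau powr (- \<delta>) * l tau)"
    if t: "0 < tau" "tau <= tau1" "tau < L" for tau
  proof
    have tc: "tau <= c" using t t1 by simp
    have "N = (N powr (- (1 / \<delta>))) powr (- \<delta>)" using delta N by (simp add: powr_powr)
    also have "\<dots> <= tau powr (- \<delta>)" using t delta by (intro powr_mono2') (auto simp: tau1_def)
    also have "tau powr (- \<delta>) * 1 <= tau powr (- \<delta>) * l tau" using l_ge[of tau] t tc by (intro mult_left_mono) auto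
    finally have B: "N <= tau powr (- \<delta>) * l tau" by simp
    have "512 * R0 / q <= tau powr (- \<delta>) * l tau" using B by (simp add: N_def)
    then have "512 * R0 <= tau powr (- \<delta>) * l tau * q" using q by (simp only: pos_divide_le_eq)
    moreover have "q * (1/32 * (tau powr (- \<delta>) * l tau)) <= q * bb tau" using bb_lower[OF t(1) tc] q by (intro mult_left_mono) auto
    ultimately have "q / 64 * (tau powr (- \<delta>) * l tau) <= q * bb tau - 8 * R0" by (simp add: field_simps)
    then have "\<epsilon> * (q / 64 * (tau powr (- \<delta>) * l tau)) <= \<epsilon> * (q * bb tau - 8 * R0)" using e0 by (intro mult_left_mono) auto
    also have "\<dots> <= sg * JJ V 0 (0, tau)" using main[OF t(1,3)] by simp
    finally show "\<epsilon> * q / 64 * (tau powr (- \<delta>) * l tau) <= sg * JJ V 0 (0, tau)" by simp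
    have "sg * JJ V 0 (0, tau) <= M * bb tau" using main[OF t(1,3)] by simp
    also have "\<dots> <= M * (Cu * (tau powr (- \<delta>) * l tau))" using Cu(2)[of tau] t tc M0 by (intro mult_left_mono) auto
    finally show "sg * JJ V 0 (0, tau) <= M * Cu * (tau powr (- \<delta>) * l tau)" by (simp add: mult.assoc)
  qed
  show ?thesis
  proof (intro exI[of _ "\<lambda>z. JJ V 0 (S.th T x0 z)"] conjI sol)
    show "\<exists>tau1 k1 k2. 0 < tau1 \<and> 0 < k1 \<and> 0 < k2 \<and> (\<forall>tau. 0 < tau \<and> tau <= tau1 -->
       k1 * (tau powr (- \<delta>) * l tau) <= sg * JJ V 0 (S.th T x0 (x0, T - tau)) \<and> sg * JJ V 0 (S.th T x0 (x0, T - tau)) <= k2 * (tau powr (- \<delta>) * l tau))"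
    proof (rule exI[of _ "min tau1 T"], rule exI[of _ "\<epsilon> * q / 64"], rule exI[of _ "M * Cu"], intro conjI allI impI)
      fix tau assume "0 < tau \<and> tau <= min tau1 T"
      then show "\<epsilon> * q / 64 * (tau powr (- \<delta>) * l tau) <= sg * JJ V 0 (S.th T x0 (x0, T - tau))" "sg * JJ V 0 (S.th T x0 (x0, T - tau)) <= M * Cu * (tau powr (- \<delta>) * l tau)"
        using asy[of tau] T by (auto simp: S.th_def[OF T])
    qed (use t1 T e0 q M0 Cu in auto)
    show "\<exists>K\<ge>0. \<forall>x t. 0 <= t \<and> t < T --> (x - x0)\<^sup>2 * \<bar>JJ V 0 (S.th T x0 (x, t))\<bar> <= K \<and> (\<delta> < 1/2 --> \<bar>x - x0\<bar> * \<bar>JJ V 0 (S.th T x0 (x, t))\<bar> <= K)"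
    proof (intro exI[of _ K] conjI K allI impI)
      fix x t assume t: "0 <= t \<and> t < T"
      note Kx = Kd[THEN spec, THEN spec, THEN mp, of "T - t" "x - x0"]
      show "(x - x0)\<^sup>2 * \<bar>JJ V 0 (S.th T x0 (x, t))\<bar> <= K" using Kx t T by (simp add: S.th_def[OF T])
      show "\<bar>x - x0\<bar> * \<bar>JJ V 0 (S.th T x0 (x, t))\<bar> <= K" if "\<delta> < 1/2" using Kx t T that by (simp add: S.th_def[OF T] \<gamma>_def)
    qed
  qed
qed

end

theorem theorem2p1:
  fixes p :: nat and r :: "nat \<Rightarrow> nat" and a :: "nat \<Rightarrow> real" and \<sigma> :: nat
    and T x0 \<delta> :: real
  assumes "\<forall>j\<in>{1..p}. r j > 0"
    and "\<forall>i\<in>{1..p}. \<forall>j\<in>{1..p}. i < j \<longrightarrow> r i < r j"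
    and "\<forall>j\<in>{1..p}. a j \<ge> 0"
    and "\<sigma> \<in> {0, 1}"
    and "T > 0"
    and "0 < \<delta>" and "\<delta> < 1"
  shows "\<exists>u. schwartz_boussinesq_sol T u \<and>
     asymp_eq_at (\<lambda>t. u (x0, t)) (\<lambda>t. LOG (1 / (T - t)) p r a \<sigma> / (T - t) powr \<delta>) T \<and>
     (\<exists>C>0. \<forall>x t. x \<noteq> x0 \<and> 0 \<le> t \<and> t < T \<longrightarrow>
        \<bar>u (x, t)\<bar> \<le> C * (1 + x\<^sup>2) / (x - x0)\<^sup>2) \<and>
     (\<delta> < 1/2 \<longrightarrow> (\<exists>C>0. \<forall>x t. x \<noteq> x0 \<and> 0 \<le> t \<and> t < T \<longrightarrow>
        \<bar>u (x, t)\<bar> \<le> C * (1 + \<bar>x\<bar>) / \<bar>x - x0\<bar>))"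
proof -
  obtain c where "profile \<delta> c (logs p r a)" using logs_profile[OF assms(6,7,1,3)] by blast
  then interpret P: profile \<delta> c "logs p r a" .
  \<comment> \<open>The end point only has to exceed T and to be at least c; c <= 1 makes T + 1
    suitable.\<close>
  interpret I: profile_interval \<delta> c "logs p r a" "T + 1"
    by unfold_locales (use assms(5) P.c in auto)
  define sg where "sg = (-1::real) ^ \<sigma>"
  have sg: "\<bar>sg\<bar> = 1" "sg * sg = 1" using assms(4) by (auto simp: sg_def)
  have T1: "T < T + 1" by simp
  obtain u K \<tau>1 k1 k2 where u: "schwartz_boussinesq_sol T u" and k: "0 < \<tau>1" "0 < k1" "0 < k2"
    and asy: "\<forall>\<tau>. 0 < \<tau> \<and> \<tau> \<le> \<tau>1 \<longrightarrow> k1 * (\<tau> powr (- \<delta>) * logs p r a \<tau>) \<le> sg * u (x0, T - \<tau>) \<and> sg * u (x0, T - \<tau>) \<le> k2 * (\<tau> powr (- \<delta>) * logs p r a \<tau>)"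
    and K: "0 \<le> K" and d: "\<forall>x t. 0 \<le> t \<and> t < T \<longrightarrow> (x - x0)\<^sup>2 * \<bar>u (x, t)\<bar> \<le> K \<and> (\<delta> < 1/2 \<longrightarrow> \<bar>x - x0\<bar> * \<bar>u (x, t)\<bar> \<le> K)"
    using I.blowup_solution[OF assms(5) T1 sg(1), of x0] by - (elim exE conjE, rule that)
  have gt: "LOG (1 / (T - t)) p r a \<sigma> / (T - t) powr \<delta> = sg * ((T - t) powr (- \<delta>) * logs p r a (T - t))" for t
    by (simp add: LOG_def logs_def sg_def powr_minus_divide)
  have "asymp_eq_at (\<lambda>t. u (x0, t)) (\<lambda>t. LOG (1 / (T - t)) p r a \<sigma> / (T - t) powr \<delta>) T"
    unfolding asymp_eq_at_def gt
  \<comment> \<open>T/2 keeps the initial time positive. For \<sigma> = 1 the comparison function is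
    negative, so the two constants exchange their roles.\<close>
  proof (rule exI[of _ "T - min \<tau>1 (T / 2)"], rule exI[of _ "if \<sigma> = 0 then k1 else k2"], rule exI[of _ "if \<sigma> = 0 then k2 else k1"], intro conjI allI impI)
    fix t assume t: "T - min \<tau>1 (T / 2) \<le> t \<and> t < T"
    then have "0 < T - t \<and> T - t \<le> \<tau>1" by auto
    note A = asy[THEN spec, THEN mp, OF this]
    have "\<sigma> = 0 \<or> \<sigma> = 1" using assms(4) by auto
    then show "(if \<sigma> = 0 then k1 else k2) * (sg * ((T - t) powr (- \<delta>) * logs p r a (T - t))) \<le> u (x0, t)"
      "u (x0, t) \<le> (if \<sigma> = 0 then k2 else k1) * (sg * ((T - t) powr (- \<delta>) * logs p r a (T - t)))"
      using A by (auto simp: sg_def)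
  qed (use k assms(5) in \<open>auto simp: min_def\<close>)
  moreover have "\<exists>C>0. \<forall>x t. x \<noteq> x0 \<and> 0 \<le> t \<and> t < T \<longrightarrow> \<bar>u (x, t)\<bar> \<le> C * (1 + x\<^sup>2) / (x - x0)\<^sup>2"
  \<comment> \<open>K may be 0, while the constant must be positive.\<close>
  proof (intro exI[of _ "K + 1"] conjI allI impI)
    fix x t assume x: "x \<noteq> x0 \<and> 0 \<le> t \<and> t < T"
    have "(x - x0)\<^sup>2 * \<bar>u (x, t)\<bar> \<le> K" using d[THEN spec, THEN spec, THEN mp, of t x] x by simp
    also have "\<dots> \<le> (K + 1) * (1 + x\<^sup>2)" using K mult_mono[of K "K + 1" 1 "1 + x\<^sup>2"] by simp
    finally show "\<bar>u (x, t)\<bar> \<le> (K + 1) * (1 + x\<^sup>2) / (x - x0)\<^sup>2" using x by (subst pos_le_divide_eq) (auto simp: mult.commute)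
  qed (use K in simp)
  moreover have "\<exists>C>0. \<forall>x t. x \<noteq> x0 \<and> 0 \<le> t \<and> t < T \<longrightarrow> \<bar>u (x, t)\<bar> \<le> C * (1 + \<bar>x\<bar>) / \<bar>x - x0\<bar>" if de: "\<delta> < 1/2"
  proof (intro exI[of _ "K + 1"] conjI allI impI)
    fix x t assume x: "x \<noteq> x0 \<and> 0 \<le> t \<and> t < T"
    have "\<bar>x - x0\<bar> * \<bar>u (x, t)\<bar> \<le> K" using d[THEN spec, THEN spec, THEN mp, of t x] x de by simp
    also have "\<dots> \<le> (K + 1) * (1 + \<bar>x\<bar>)" using K mult_mono[of K "K + 1" 1 "1 + \<bar>x\<bar>"] by simp
    finally show "\<bar>u (x, t)\<bar> \<le> (K + 1) * (1 + \<bar>x\<bar>) / \<bar>x - x0\<bar>" using x by (subst pos_le_divide_eq) (auto simp: mult.commute)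
  qed (use K in simp)
  ultimately show ?thesis using u by blast
qed

end
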